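(* Let $n\ge2$, let $D$ be a domain in $\overline{\mathbb R^n}=\mathbb R^n\cup\{\infty\}$, let $\Phi:[0,\infty]\to[0,\infty]$ be a non-decreasing convex function, and let $p\in(0,n-1]$. Put $\Phi_p(t)=\Phi(t^p)$, $H_p(t)=\log\Phi_p(t)$. Then each of the following conditions (i)–(vi) implies that the class $S^{\Phi}_{M,\Delta}$ is equicontinuous and normal for all $M\in(0,\infty)$ and $\Delta\in(0,1)$: (i) $\int_{\delta}^{\infty}H_p'(t)\,\frac{dt}{t}=\infty$ for some $\delta>0$; (ii) $\int_{\delta}^{\infty}\frac{dH_p(t)}{t}=\infty$ for some $\delta>0$; (iii) $\int_{\delta}^{\infty}H_p(t)\,\frac{dt}{t^2}=\infty$ for some $\delta>0$; (iv) $\int_{0}^{\Delta_0}H_p\!\left(\frac1t\right)dt=\infty$ for some $\Delta_0>0$; (v) $\int_{\delta_*}^{\infty}\frac{d\eta}{H_p^{-1}(\eta)}=\infty$ for some $\delta_*>H_p(+0)$; (vi) $\int_{\delta_*}^{\infty}\frac{d\tau}{\tau\,\Phi_p^{-1}(\tau)}=\infty$ for some $\delta_*>\Phi(+0)$.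
   Context: Notation: $dm$ is Lebesgue measure. $\overline{\mathbb R^n}$ carries the spherical (chordal) metric $h(x,y)=\frac{|x-y|}{\sqrt{1+|x|^2}\sqrt{1+|y|^2}}$ for $x,y\neq\infty$, $h(x,\infty)=\frac1{\sqrt{1+|x|^2}}$; for a set $E$, $h(E)=\sup_{x_1,x_2\in E}h(x_1,x_2)$. $\Phi$ is convex on $[0,\infty]$ if $\Phi(\lambda t_1+(1-\lambda)t_2)\le\lambda\Phi(t_1)+(1-\lambda)\Phi(t_2)$ for all $t_1,t_2\in[0,\infty]$, $\lambda\in[0,1]$. Conventions for (i)–(vi): for a non-decreasing function $F$ on $[0,\infty]$, $F^{-1}(\tau)=\inf\{t\in[0,\infty]:F(t)\ge\tau\}$ with $\inf\emptyset=\infty$; $F(+0)=\lim_{t\to0+}F(t)$; $1/\infty=0$, $1/0=\infty$. All right-hand sides mean $+\infty$. The integral in (ii) is a Lebesgue–Stieltjes integral, the others are Lebesgue integrals ($H_p'$ is the a.e. derivative). The integrals in (i) and (ii) are set equal to $\infty$ if $\Phi_p(t)=\infty$ for all $t\ge T$ with some $T\in[0,\infty)$. With $t_0=\sup\{t:\Phi_p(t)=0\}$ ($t_0=0$ if $\Phi_p(0)>0$), it is required in (i)–(iii) that $\delta>t_0$ and in (iv) that $\Delta_0<1/t_0$. Inner dilatation: at a point $x$ of differentiability of $f$, with $J(x,f)=\det f'(x)$ and $l(f'(x))=\inf_{v\ne0}|f'(x)v|/|v|$, set $K_I(x,f)=|J(x,f)|/l(f'(x))^n$ if $J(x,f)\ne0$,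 $K_I(x,f)=1$ if $f'(x)=0$, and $K_I(x,f)=\infty$ at all remaining points. Class $S^{\Phi}_{M,\Delta}$: all homeomorphisms (onto their image) $f:D\to\overline{\mathbb R^n}$ of the Sobolev class $W^{1,n}_{loc}$ with $K_I(\cdot,f)$ locally integrable, such that $h(\overline{\mathbb R^n}\setminus f(D))\ge\Delta$ and $$\int_D\Phi(K_I(x,f))\,\frac{dm(x)}{(1+|x|^2)^n}\le M.$$ (Where $\infty\in D$ or $f$ takes the value $\infty$, the local conditions are understood after composing with the inversion $x\mapsto x/|x|^2$.) A family $\mathfrak F$ of mappings $D\to\overline{\mathbb R^n}$ is equicontinuous if at every $x_0\in D$: for every $\varepsilon>0$ there is a neighbourhood $U$ of $x_0$ in $D$ with $h(f(x),f(x_0))<\varepsilon$ for all $x\in U$, $f\in\mathfrak F$. A family of continuous mappings is normal if every sequence in it has a subsequence converging, uniformly (w.r.t. $h$) on each compact subset of $D$, to a continuous mapping $D\to\overline{\mathbb R^n}$. *)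

theory Defs
  imports "HOL-Analysis.Analysis"
begin

section \<open>The one-point compactification with the chordal metric\<close>

datatype 'a cpt = Fin (the_fin: 'a) | Infty

fun chordal :: "'a::real_inner cpt \<Rightarrow> 'a cpt \<Rightarrow> real" where
  "chordal (Fin x) (Fin y) =
     norm (x - y) / (sqrt (1 + (norm x)\<^sup>2) * sqrt (1 + (norm y)\<^sup>2))"
| "chordal (Fin x) Infty = 1 / sqrt (1 + (norm x)\<^sup>2)"
| "chordal Infty (Fin y) = 1 / sqrt (1 + (norm y)\<^sup>2)"
| "chordal Infty Infty = 0"

text \<open>Stereographic projection onto the sphere of diameter 1 touching the origin; it turns
  \<^const>\<open>chordal\<close> into the Euclidean distance.\<close>

fun stereo :: "'a::real_inner cpt \<Rightarrow> 'a \<times> real" where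
  "stereo (Fin x) = (x /\<^sub>R (1 + (norm x)\<^sup>2), 1 - 1 / (1 + (norm x)\<^sup>2))"
| "stereo Infty = (0, 1)"

lemma one_plus_norm_pos: "0 < 1 + (norm x)\<^sup>2"
  by (simp add: add_pos_nonneg)

lemma chordal_nonneg: "0 \<le> chordal x y"
  by (cases x; cases y) auto

lemma chordal_eq_stereo: "chordal x y = dist (stereo x) (stereo y)"
proof -
  have fin: "chordal (Fin u) (Fin v) = dist (stereo (Fin u)) (stereo (Fin v))" for u v :: 'a
  proof -
    define a b where "a = 1 + (norm u)\<^sup>2" and "b = 1 + (norm v)\<^sup>2"
    have pos: "a > 0" "b > 0" unfolding a_def b_def by (rule one_plus_norm_pos)+
    have nu: "u \<bullet> u = a - 1" and nv: "v \<bullet> v = b - 1"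
      by (simp_all add: a_def b_def dot_square_norm)
    have "(norm (u /\<^sub>R a - v /\<^sub>R b))\<^sup>2
        = (u \<bullet> u) / a\<^sup>2 - 2 * (u \<bullet> v) / (a * b) + (v \<bullet> v) / b\<^sup>2"
      unfolding power2_norm_eq_inner using pos
      by (simp add: inner_diff_left inner_diff_right inner_commute divide_inverse power2_eq_square algebra_simps)
    hence "(norm (u /\<^sub>R a - v /\<^sub>R b))\<^sup>2 + (1 / b - 1 / a)\<^sup>2
        = (a + b - 2 - 2 * (u \<bullet> v)) / (a * b)"
      using pos unfolding nu nv by (simp add: field_simps power2_eq_square)
    moreover have "(norm (u - v))\<^sup>2 = a + b - 2 - 2 * (u \<bullet> v)"
      unfolding power2_norm_eq_inner
      by (simp add: inner_diff_left inner_diff_right inner_commute nu nv)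
    ultimately have "(norm (u /\<^sub>R a - v /\<^sub>R b))\<^sup>2 + (1 / b - 1 / a)\<^sup>2 = (norm (u - v))\<^sup>2 / (a * b)"
      by simp
    hence "dist (stereo (Fin u)) (stereo (Fin v)) = sqrt ((norm (u - v))\<^sup>2 / (a * b))"
      by (simp add: dist_prod_def dist_norm a_def b_def)
    thus ?thesis by (simp add: real_sqrt_divide real_sqrt_mult a_def b_def)
  qed
  have inf: "chordal (Fin u) Infty = dist (stereo (Fin u)) (stereo Infty)" for u :: 'a
  proof -
    define a where "a = 1 + (norm u)\<^sup>2"
    have pos: "a > 0" unfolding a_def by (rule one_plus_norm_pos)
    have nu: "(norm u)\<^sup>2 = a - 1" by (simp add: a_def)
    have "(norm (u /\<^sub>R a))\<^sup>2 + (1 / a)\<^sup>2 = (norm u)\<^sup>2 / a\<^sup>2 + 1 / a\<^sup>2"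
      using pos by (simp add: power_mult_distrib power_divide field_simps)
    also have "\<dots> = 1 / a" unfolding nu using pos by (simp add: field_simps power2_eq_square)
    finally have "dist (stereo (Fin u)) (stereo Infty) = sqrt (1 / a)"
      by (simp add: dist_prod_def dist_norm a_def)
    thus ?thesis by (simp add: real_sqrt_divide a_def)
  qed
  have sym: "chordal Infty (Fin u) = chordal (Fin u) Infty" for u :: 'a by simp
  show ?thesis
    by (cases x; cases y) (simp_all only: fin inf sym dist_commute chordal.simps(4) dist_self)
qed

lemma chordal_eq_0_iff: "chordal x y = 0 \<longleftrightarrow> x = y"
proof -
  have "1 + (norm u)\<^sup>2 \<noteq> 0" for u :: 'a
    using one_plus_norm_pos[of u] by linarith
  thus ?thesis by (cases x; cases y) auto
qed

instantiation cpt :: (real_inner) metric_space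
begin

definition dist_cpt :: "'a cpt \<Rightarrow> 'a cpt \<Rightarrow> real" where
  "dist_cpt = chordal"

definition uniformity_cpt :: "('a cpt \<times> 'a cpt) filter" where
  "uniformity_cpt = (INF e\<in>{0<..}. principal {(x, y). dist x y < e})"

definition open_cpt :: "'a cpt set \<Rightarrow> bool" where
  "open_cpt U \<longleftrightarrow> (\<forall>x\<in>U. \<forall>\<^sub>F (x', y) in uniformity. x' = x \<longrightarrow> y \<in> U)"

instance
proof
  fix x y z :: "'a cpt"
  show "dist x y = 0 \<longleftrightarrow> x = y"
    unfolding dist_cpt_def by (rule chordal_eq_0_iff)
  show "dist x y \<le> dist x z + dist y z"
    unfolding dist_cpt_def chordal_eq_stereo by (rule dist_triangle2)
qed (simp_all only: uniformity_cpt_def open_cpt_def)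

end

definition is_domain :: "'a::real_inner cpt set \<Rightarrow> bool" where
  "is_domain D \<longleftrightarrow> open D \<and> connected D \<and> D \<noteq> {}"

fun inversion :: "'a::real_inner cpt \<Rightarrow> 'a cpt" where
  "inversion (Fin x) = (if x = 0 then Infty else Fin (x /\<^sub>R (norm x)\<^sup>2))"
| "inversion Infty = Fin 0"

section \<open>Sobolev functions\<close>

fun Ck :: "nat \<Rightarrow> (real^'n \<Rightarrow> real) \<Rightarrow> bool" where
  "Ck 0 \<phi> \<longleftrightarrow> continuous_on UNIV \<phi>"
| "Ck (Suc k) \<phi> \<longleftrightarrow> \<phi> differentiable_on UNIV \<and>
     (\<forall>i. Ck k (\<lambda>x. frechet_derivative \<phi> (at x) (axis i 1)))"

definition test_function :: "(real^'n) set \<Rightarrow> (real^'n \<Rightarrow> real) \<Rightarrow> bool" where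
  "test_function U \<phi> \<longleftrightarrow> (\<forall>k. Ck k \<phi>) \<and>
     compact (closure {x. \<phi> x \<noteq> 0}) \<and> closure {x. \<phi> x \<noteq> 0} \<subseteq> U"

definition Lq_loc :: "(real^'n) set \<Rightarrow> nat \<Rightarrow> (real^'n \<Rightarrow> real) \<Rightarrow> bool" where
  "Lq_loc U q u \<longleftrightarrow> set_borel_measurable lebesgue U u \<and>
     (\<forall>K. compact K \<and> K \<subseteq> U \<longrightarrow> set_integrable lebesgue K (\<lambda>x. \<bar>u x\<bar> ^ q))"

definition weak_partial ::
    "(real^'n) set \<Rightarrow> 'n \<Rightarrow> (real^'n \<Rightarrow> real) \<Rightarrow> (real^'n \<Rightarrow> real) \<Rightarrow> bool" where
  "weak_partial U i u g \<longleftrightarrow> (\<forall>\<phi>. test_function U \<phi> \<longrightarrow>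
     (LINT x|lebesgue. u x * frechet_derivative \<phi> (at x) (axis i 1))
       = - (LINT x|lebesgue. g x * \<phi> x))"

definition W1_loc :: "(real^'n) set \<Rightarrow> nat \<Rightarrow> (real^'n \<Rightarrow> real^'m) \<Rightarrow> bool" where
  "W1_loc U q f \<longleftrightarrow> (\<forall>j. Lq_loc U q (\<lambda>x. f x $ j) \<and>
     (\<forall>i. \<exists>g. Lq_loc U q g \<and> weak_partial U i (\<lambda>x. f x $ j) g))"

section \<open>Inner dilatation\<close>

definition min_stretch :: "(real^'n \<Rightarrow> real^'n) \<Rightarrow> real" where
  "min_stretch A = (INF v\<in>-{0}. norm (A v) / norm v)"

definition K_I :: "(real^'n \<Rightarrow> real^'n) \<Rightarrow> real^'n \<Rightarrow> ennreal" where
  "K_I f x =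
     (let A = frechet_derivative f (at x); J = det (matrix A) in
      if f differentiable at x \<and> J \<noteq> 0 then ennreal (\<bar>J\<bar> / min_stretch A ^ CARD('n))
      else if f differentiable at x \<and> A = (\<lambda>v. 0) then 1
      else \<infinity>)"

definition L1_loc_ennreal :: "(real^'n) set \<Rightarrow> (real^'n \<Rightarrow> ennreal) \<Rightarrow> bool" where
  "L1_loc_ennreal U K \<longleftrightarrow> (\<lambda>x. K x * indicator U x) \<in> borel_measurable lebesgue \<and>
     (\<forall>C. compact C \<and> C \<subseteq> U \<longrightarrow> (\<integral>\<^sup>+x\<in>C. K x \<partial>lebesgue) < \<infinity>)"

section \<open>The class of homeomorphisms\<close>

text \<open>\<open>rep a b f\<close> is \<open>f\<close> read in coordinates, where \<open>a\<close> (source) and \<open>b\<close> (target) are the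
  identity or the inversion; \<open>rep_dom\<close> is the open set of finite points where it is meaningful.\<close>

definition rep ::
    "('a cpt \<Rightarrow> 'a cpt) \<Rightarrow> ('a cpt \<Rightarrow> 'a cpt) \<Rightarrow> ('a cpt \<Rightarrow> 'a cpt) \<Rightarrow> 'a \<Rightarrow> 'a" where
  "rep a b f x = the_fin (b (f (a (Fin x))))"

definition rep_dom ::
    "('a cpt \<Rightarrow> 'a cpt) \<Rightarrow> ('a cpt \<Rightarrow> 'a cpt) \<Rightarrow> 'a cpt set \<Rightarrow> ('a cpt \<Rightarrow> 'a cpt) \<Rightarrow> 'a set" where
  "rep_dom a b D f = {x. a (Fin x) \<in> D \<and> b (f (a (Fin x))) \<noteq> Infty}"

text \<open>The inversion is used only for a set \<open>E\<close> (the domain, or the image) containing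
  the point at infinity. For \<open>D\<close> and \<open>f ` D\<close> in the finite space the local conditions below
  are the plain Euclidean ones.\<close>

definition charts :: "'a::real_inner cpt set \<Rightarrow> ('a cpt \<Rightarrow> 'a cpt) set" where
  "charts E = (if Infty \<in> E then {id, inversion} else {id})"

text \<open>Dilatation at a finite point. The second case concerns at most one point for
  injective \<open>f\<close>.\<close>

definition K_I_cpt :: "((real^'n) cpt \<Rightarrow> (real^'n) cpt) \<Rightarrow> real^'n \<Rightarrow> ennreal" where
  "K_I_cpt f x =
     (if f (Fin x) \<noteq> Infty then K_I (rep id id f) x else K_I (rep id inversion f) x)"

definition S_class ::
    "(real^'n) cpt set \<Rightarrow> (ennreal \<Rightarrow> ennreal) \<Rightarrow> real \<Rightarrow> real \<Rightarrow> ((real^'n) cpt \<Rightarrow> (real^'n) cpt) set"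
where
  "S_class D \<Phi> M \<Delta> = {f.
     (\<exists>g. homeomorphism D (f ` D) f g) \<and>
     (\<forall>a\<in>charts D. \<forall>b\<in>charts (f ` D).
        W1_loc (rep_dom a b D f) CARD('n) (rep a b f) \<and>
        L1_loc_ennreal (rep_dom a b D f) (K_I (rep a b f))) \<and>
     diameter (- f ` D) \<ge> \<Delta> \<and>
     (\<integral>\<^sup>+x\<in>{x. Fin x \<in> D}. \<Phi> (K_I_cpt f x) / ennreal ((1 + (norm x)\<^sup>2) ^ CARD('n)) \<partial>lebesgue)
       \<le> ennreal M}"

definition equicontinuous_family ::
    "'a::metric_space set \<Rightarrow> ('a \<Rightarrow> 'b::metric_space) set \<Rightarrow> bool" where
  "equicontinuous_family D F \<longleftrightarrow> (\<forall>x0\<in>D. \<forall>\<epsilon>>0. \<exists>U. open U \<and> x0 \<in> U \<and>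
     (\<forall>f\<in>F. \<forall>x\<in>U \<inter> D. dist (f x) (f x0) < \<epsilon>))"

definition normal_family ::
    "'a::metric_space set \<Rightarrow> ('a \<Rightarrow> 'b::metric_space) set \<Rightarrow> bool" where
  "normal_family D F \<longleftrightarrow> (\<forall>f\<in>F. continuous_on D f) \<and>
     (\<forall>s::nat \<Rightarrow> 'a \<Rightarrow> 'b. (\<forall>k. s k \<in> F) \<longrightarrow>
        (\<exists>r g. strict_mono r \<and> continuous_on D g \<and>
           (\<forall>K. compact K \<and> K \<subseteq> D \<longrightarrow> uniform_limit K (s \<circ> r) g sequentially)))"

section \<open>The integral conditions\<close>

definition convex_ennreal :: "(ennreal \<Rightarrow> ennreal) \<Rightarrow> bool" where
  "convex_ennreal \<Phi> \<longleftrightarrow> (\<forall>t1 t2. \<forall>l\<in>{0..1::real}.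
     \<Phi> (ennreal l * t1 + ennreal (1 - l) * t2) \<le> ennreal l * \<Phi> t1 + ennreal (1 - l) * \<Phi> t2)"

definition ennreal_pow :: "ennreal \<Rightarrow> real \<Rightarrow> ennreal" where
  "ennreal_pow t p = (if t = \<infinity> then \<infinity> else ennreal (enn2real t powr p))"

definition ennreal_log :: "ennreal \<Rightarrow> ereal" where
  "ennreal_log t = (if t = 0 then -\<infinity> else if t = \<infinity> then \<infinity> else ereal (ln (enn2real t)))"

definition Phi_p :: "(ennreal \<Rightarrow> ennreal) \<Rightarrow> real \<Rightarrow> ennreal \<Rightarrow> ennreal" where
  "Phi_p \<Phi> p t = \<Phi> (ennreal_pow t p)"

definition H_p :: "(ennreal \<Rightarrow> ennreal) \<Rightarrow> real \<Rightarrow> ennreal \<Rightarrow> ereal" where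
  "H_p \<Phi> p t = ennreal_log (Phi_p \<Phi> p t)"

text \<open>In \<^typ>\<open>ennreal\<close>, \<open>Inf {} = \<infinity>\<close> and \<open>Sup {} = 0\<close>, as required in the next two definitions.\<close>

definition gen_inverse :: "(ennreal \<Rightarrow> 'b::order) \<Rightarrow> 'b \<Rightarrow> ennreal" where
  "gen_inverse F \<tau> = Inf {t. F t \<ge> \<tau>}"

definition t_zero :: "(ennreal \<Rightarrow> ennreal) \<Rightarrow> real \<Rightarrow> ennreal" where
  "t_zero \<Phi> p = Sup {t. Phi_p \<Phi> p t = 0}"

definition right_limit_0 :: "(ennreal \<Rightarrow> 'b::t2_space) \<Rightarrow> 'b" where
  "right_limit_0 F = Lim (at_right 0) F"

definition eventually_infinite :: "(ennreal \<Rightarrow> ennreal) \<Rightarrow> bool" where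
  "eventually_infinite F \<longleftrightarrow> (\<exists>T<\<infinity>. \<forall>t\<ge>T. F t = \<infinity>)"

text \<open>The real-valued \<open>H\<^sub>p\<close>; it is used only on \<open>(t\<^sub>0, \<infinity>)\<close> when \<open>\<Phi>\<^sub>p\<close> is not eventually
  infinite, where \<open>H\<^sub>p\<close> is finite.\<close>

definition H_p_real :: "(ennreal \<Rightarrow> ennreal) \<Rightarrow> real \<Rightarrow> real \<Rightarrow> real" where
  "H_p_real \<Phi> p t = real_of_ereal (H_p \<Phi> p (ennreal t))"

definition H_p_deriv :: "(ennreal \<Rightarrow> ennreal) \<Rightarrow> real \<Rightarrow> real \<Rightarrow> real" where
  "H_p_deriv \<Phi> p t =
     (if H_p_real \<Phi> p differentiable at t then deriv (H_p_real \<Phi> p) t else 0)"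

text \<open>The Lebesgue-Stieltjes measure of \<open>H\<^sub>p\<close> on \<open>(\<delta>, \<infinity>)\<close>: \<open>H\<^sub>p\<close> is continuous and non-decreasing
  there for \<open>\<delta> > t\<^sub>0\<close>, and is extended by the constant \<open>H\<^sub>p \<delta>\<close> to the left.\<close>

definition H_p_measure :: "(ennreal \<Rightarrow> ennreal) \<Rightarrow> real \<Rightarrow> real \<Rightarrow> real measure" where
  "H_p_measure \<Phi> p \<delta> = interval_measure (\<lambda>t. H_p_real \<Phi> p (max \<delta> t))"

text \<open>The Lebesgue integral of an extended-real function exists and equals \<open>+\<infinity>\<close>.\<close>

definition integral_eq_PInf :: "'a measure \<Rightarrow> 'a set \<Rightarrow> ('a \<Rightarrow> ereal) \<Rightarrow> bool" where
  "integral_eq_PInf N A f \<longleftrightarrow>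
     (\<integral>\<^sup>+x\<in>A. e2ennreal (f x) \<partial>N) = \<infinity> \<and> (\<integral>\<^sup>+x\<in>A. e2ennreal (- f x) \<partial>N) < \<infinity>"

definition cond_i :: "(ennreal \<Rightarrow> ennreal) \<Rightarrow> real \<Rightarrow> bool" where
  "cond_i \<Phi> p \<longleftrightarrow> (\<exists>\<delta>>0. ennreal \<delta> > t_zero \<Phi> p \<and>
     (eventually_infinite (Phi_p \<Phi> p) \<or>
      (\<integral>\<^sup>+t\<in>{\<delta><..}. ennreal (H_p_deriv \<Phi> p t / t) \<partial>lebesgue) = \<infinity>))"

definition cond_ii :: "(ennreal \<Rightarrow> ennreal) \<Rightarrow> real \<Rightarrow> bool" where
  "cond_ii \<Phi> p \<longleftrightarrow> (\<exists>\<delta>>0. ennreal \<delta> > t_zero \<Phi> p \<and>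
     (eventually_infinite (Phi_p \<Phi> p) \<or>
      (\<integral>\<^sup>+t\<in>{\<delta><..}. ennreal (1 / t) \<partial>H_p_measure \<Phi> p \<delta>) = \<infinity>))"

definition cond_iii :: "(ennreal \<Rightarrow> ennreal) \<Rightarrow> real \<Rightarrow> bool" where
  "cond_iii \<Phi> p \<longleftrightarrow> (\<exists>\<delta>>0. ennreal \<delta> > t_zero \<Phi> p \<and>
     integral_eq_PInf lebesgue {\<delta><..} (\<lambda>t. H_p \<Phi> p (ennreal t) / ereal (t\<^sup>2)))"

definition cond_iv :: "(ennreal \<Rightarrow> ennreal) \<Rightarrow> real \<Rightarrow> bool" where
  "cond_iv \<Phi> p \<longleftrightarrow> (\<exists>\<Delta>\<^sub>0>0. ennreal \<Delta>\<^sub>0 < 1 / t_zero \<Phi> p \<and>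
     integral_eq_PInf lebesgue {0<..<\<Delta>\<^sub>0} (\<lambda>t. H_p \<Phi> p (ennreal (1 / t))))"

definition cond_v :: "(ennreal \<Rightarrow> ennreal) \<Rightarrow> real \<Rightarrow> bool" where
  "cond_v \<Phi> p \<longleftrightarrow> (\<exists>\<delta>::real. ereal \<delta> > right_limit_0 (H_p \<Phi> p) \<and>
     (\<integral>\<^sup>+\<eta>\<in>{\<delta><..}. 1 / gen_inverse (H_p \<Phi> p) (ereal \<eta>) \<partial>lebesgue) = \<infinity>)"

definition cond_vi :: "(ennreal \<Rightarrow> ennreal) \<Rightarrow> real \<Rightarrow> bool" where
  "cond_vi \<Phi> p \<longleftrightarrow> (\<exists>\<delta>\<ge>0. ennreal \<delta> > right_limit_0 \<Phi> \<and>
     (\<integral>\<^sup>+\<tau>\<in>{\<delta><..}. 1 / (ennreal \<tau> * gen_inverse (Phi_p \<Phi> p) (ennreal \<tau>)) \<partial>lebesgue) = \<infinity>)"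

end

theory Submission
  imports Defs "HOL-Complex_Analysis.Great_Picard"
begin

text \<open>
  Suppose that some \<open>f\<close> in the class oscillates by at least \<open>\<epsilon>\<close> on a small neighbourhood of \<open>x\<^sub>0\<close>.
  The image of that neighbourhood is a continuum of diameter at least \<open>\<epsilon>\<close>, so it meets every sphere of
  radius \<open>t \<le> s\<close> about one of its points; by Jordan-Brouwer separation the complement of the image of a large ball
  also meets every such sphere about a point omitted by \<open>f\<close>. If \<open>z\<close> and \<open>w\<close> are points found in this way and \<open>q\<close>
  runs through a unit cube of a fixed hyperplane, then the broken line \<open>z q w\<close> meets the image of
  each cube surface \<open>|x - x\<^sub>0|\<^sub>\<infinity> = r\<close> of the surrounding ring. Central projection of \<open>f\<close> from \<open>z\<close> or \<open>w\<close> to the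
  hyperplane, completed by the coordinate \<open>\<plusminus>(x\<^sub>i - x\<^sub>0\<^sub>i)\<close>, therefore maps the shells of the ring onto sets whose
  measure is at least their thickness.

  This map has Jacobian at most \<open>C |f - z|\<^bsup>1-n\<^esup> |J| / l\<close>, and it preserves null sets: on almost
  all coordinate hyperplanes the Sobolev exponent \<open>n\<close> exceeds the dimension \<open>n - 1\<close>, so a Morrey estimate is available there.
  Young's inequality splits the weighted Jacobian into \<open>\<lambda>\<^sup>n K\<^sub>I |f - z|\<^bsup>-1/2\<^esup>\<close> and a term that is integrable in the image;
  averaging over many \<open>z\<close> at equally spaced distances removes the singular factor. The result is
  \<open>\<Sum>\<^sub>j \<lambda>\<^sub>j |A\<^sub>j| \<le> C (\<Sum>\<^sub>j \<lambda>\<^sub>j\<^sup>n \<integral> K\<^sub>I + 1)\<close> over dyadic shells. Each of the six conditions yields numbers \<open>L\<^sub>j \<in> [0,1]\<close>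
  with divergent sum and \<open>L\<^sub>j\<^bsup>n-1\<^esup> K \<le> 4 (1 + 2\<^bsup>-nj\<^esup> \<Phi>(K))\<close>, and the choice \<open>\<lambda>\<^sub>j\<close> proportional to \<open>L\<^sub>j\<close> over the size of the shell
  bounds \<open>\<Sum> L\<^sub>j\<close> over the dyadic shells between the neighbourhood and a fixed one,
  independently of \<open>f\<close>. Normality follows by the Arzela-Ascoli argument.
\<close>

section \<open>Change of variables without a well-ordered index type\<close>

text \<open>Cubes are used because the radius \<open>infnorm (x - x0)\<close> is, up to sign, one of
  the coordinates of x - x0; its level sets lie in coordinate hyperplanes, where slices of a
  \<open>W1_loc\<close> map can be estimated.

  Hoelder's inequality with exponents n and n/(n-1) would produce the kernel |y - z|^(-n), which
  just fails to be integrable. Moving half a power of the distance gives the exponent -n +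
  1/(2(n-1)) and costs |f - z|^(-1/2) beside K_I. The distance from the image of the ring to one
  centre has no lower bound uniform in f. Along N equally spaced distances, however, the mean of
  this factor is bounded in terms of the length scale alone, however large N must be for the given
  f.

  The exponent n - 1 of L_j meets the restriction p \<le> n - 1 in \<open>dilatation_bound\<close>.
  The factor 2^(-nj) there is compensated by the volume of the j-th shell together with the weight
  (1 + |x|^2)^(-n), both near a finite point and near infinity.

  The sum of the L_j finally occurs on both sides. On the right it carries the n-th power of the
  scale of the lambda_j, on the left the first power, so a small scale absorbs it because n \<ge>
  2.\<close>

typedef ('a::finite) wo = "UNIV :: 'a set" morphisms un_wo mk_wo by auto

lemma bij_mk_wo: "bij mk_wo"
  by (metis bijI' un_wo_inverse mk_wo_inverse UNIV_I)

instance wo :: (finite) finite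
proof
  have "(UNIV :: 'a wo set) = range mk_wo" by (rule bij_is_surj[OF bij_mk_wo, symmetric])
  thus "finite (UNIV :: 'a wo set)" by (metis finite finite_imageI)
qed

definition wo_rank :: "'a::finite => nat" where
  "wo_rank = (SOME f. inj f)"

lemma inj_wo_rank: "inj (wo_rank :: 'a::finite => nat)"
proof -
  have "\<exists>f :: 'a => nat. inj f"
    using finite_imp_inj_to_nat_seg[of "UNIV :: 'a set"] by auto
  thus ?thesis unfolding wo_rank_def by (rule someI_ex)
qed

instantiation wo :: (finite) wellorder
begin
definition less_eq_wo :: "'a wo => 'a wo => bool" where
  "less_eq_wo x y \<longleftrightarrow> wo_rank (un_wo x) \<le> wo_rank (un_wo y)"
definition less_wo :: "'a wo => 'a wo => bool" where
  "less_wo x y \<longleftrightarrow> wo_rank (un_wo x) < wo_rank (un_wo y)"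
instance
proof
  fix x y z :: "'a wo"
  show "x \<le> y ==> y \<le> x ==> x = y"
    unfolding less_eq_wo_def using injD[OF inj_wo_rank, of "un_wo x" "un_wo y"]
    by (simp add: un_wo_inject)
next
  fix P :: "'a wo => bool" and a
  assume *: "\<And>x. (\<And>y. y < x ==> P y) ==> P x"
  show "P a"
    by (induction a rule: measure_induct_rule[where f = "\<lambda>x. wo_rank (un_wo x)"])
       (rule *, simp add: less_wo_def)
qed (auto simp: less_eq_wo_def less_wo_def)
end

definition to_wo :: "real^'n => real^('n wo)" where
  "to_wo x = (\<chi> i. x $ un_wo i)"
definition of_wo :: "real^('n wo) => real^'n" where
  "of_wo x = (\<chi> i. x $ mk_wo i)"

lemma of_to_wo [simp]: "of_wo (to_wo x) = x"
  by (simp add: of_wo_def to_wo_def vec_eq_iff mk_wo_inverse)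

lemma to_of_wo [simp]: "to_wo (of_wo x) = x"
  by (simp add: of_wo_def to_wo_def vec_eq_iff un_wo_inverse)

lemma linear_to_wo: "linear to_wo"
  by (rule linearI) (simp_all add: to_wo_def vec_eq_iff)

lemma linear_of_wo: "linear of_wo"
  by (rule linearI) (simp_all add: of_wo_def vec_eq_iff)

lemma CARD_wo: "CARD('n::finite wo) = CARD('n)"
  by (rule bij_betw_same_card[OF bij_mk_wo, symmetric])

section \<open>Relabelling coordinates preserves measure and determinants\<close>

lemma emeasure_lborel_wo_box:
  fixes l u :: "real^'n"
  assumes "\<And>b. b \<in> Basis ==> l \<bullet> b \<le> u \<bullet> b"
  shows "emeasure (distr lborel borel (of_wo :: real^('n wo) => real^'n)) (box l u) = (\<Prod>b\<in>Basis. (u - l) \<bullet> b)"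
proof -
  have meas: "(of_wo :: real^('n wo) => real^'n) \<in> borel_measurable borel"
    by (intro borel_measurable_continuous_onI linear_continuous_on)
      (rule linear_of_wo[unfolded linear_conv_bounded_linear])
  have eq: "of_wo -` box l u = box (to_wo l) (to_wo u)"
  proof -
    have "(\<forall>i. l $ i < x $ mk_wo i \<and> x $ mk_wo i < u $ i)
      \<longleftrightarrow> (\<forall>i. l $ un_wo i < x $ i \<and> x $ i < u $ un_wo i)" for x :: "real^('n wo)"
      by (metis un_wo_inverse mk_wo_inverse UNIV_I)
    thus ?thesis by (auto simp: mem_box_cart of_wo_def to_wo_def)
  qed
  have le: "l $ i \<le> u $ i" for i using assms[of "axis i 1"] by (simp add: cart_eq_inner_axis axis_in_Basis_iff)
  have "emeasure (distr lborel borel of_wo) (box l u) = emeasure lborel (box (to_wo l) (to_wo u))"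
    using meas by (simp add: emeasure_distr eq)
  also have "... = (\<Prod>b\<in>Basis. (to_wo u - to_wo l) \<bullet> b)"
    by (rule emeasure_lborel_box) (auto simp: Basis_vec_def cart_eq_inner_axis[symmetric] to_wo_def le)
  also have "(\<Prod>b\<in>Basis. (to_wo u - to_wo l) \<bullet> b) = (\<Prod>i\<in>UNIV. (to_wo u - to_wo l) $ i)"
    by (rule prod.reindex_bij_witness[where i = "\<lambda>i. axis i 1" and j = "\<lambda>b. THE i. b = axis i (1::real)"])
       (auto simp: Basis_vec_def axis_eq_axis cart_eq_inner_axis)
  also have "... = (\<Prod>i\<in>UNIV. (u - l) $ i)"
    by (rule prod.reindex_bij_witness[where i = mk_wo and j = un_wo])
       (auto simp: to_wo_def mk_wo_inverse un_wo_inverse)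
  also have "... = (\<Prod>b\<in>Basis. (u - l) \<bullet> b)"
    by (rule prod.reindex_bij_witness[where j = "\<lambda>i. axis i 1" and i = "\<lambda>b. THE i. b = axis i (1::real)"])
       (auto simp: Basis_vec_def axis_eq_axis cart_eq_inner_axis)
  finally show ?thesis .
qed

lemma distr_of_wo: "distr lborel borel (of_wo :: real^('n wo) => real^'n) = lborel"
  by (rule lborel_eqI[symmetric]) (use emeasure_lborel_wo_box in auto)

text \<open>Conjugation with \<open>mk_wo\<close> is a bijection between the permutations of the two
  index types. It keeps the sign and, after relabelling the rows, each product in the Leibniz
  formula.\<close>

lemma det_wo:
  fixes A :: "real^'n^'n"
  shows "det (\<chi> i j. A $ un_wo i $ un_wo j) = det A"
proof -
  have inj: "inj_on (mk_wo :: 'n => _) UNIV" by (rule bij_is_inj[OF bij_mk_wo])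
  have bb: "bij_betw (mk_wo :: 'n => _) UNIV UNIV" by (rule bij_mk_wo)
  let ?c = "map_permutation (UNIV :: 'n set) mk_wo"
  have c: "?c p = mk_wo \<circ> p \<circ> un_wo" for p :: "'n => 'n"
  proof -
    have "inv_into UNIV (mk_wo :: 'n => _) = un_wo"
      by (rule inv_equality) (simp_all add: mk_wo_inverse un_wo_inverse)
    thus ?thesis using bb by (simp add: map_permutation_def restrict_id_def bij_betw_def fun_eq_iff)
  qed
  have "det A = (\<Sum>q | q permutes (UNIV :: 'n wo set).
      of_int (sign q) * (\<Prod>i\<in>UNIV. (\<chi> i j. A $ un_wo i $ un_wo j) $ i $ q i))"
    unfolding det_def
  proof (rule sum.reindex_bij_witness[where j = ?c and i = "\<lambda>q. un_wo \<circ> q \<circ> mk_wo"])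
    fix p :: "'n => 'n" assume p: "p \<in> {p. p permutes UNIV}"
    show "un_wo \<circ> ?c p \<circ> mk_wo = p" by (simp add: c fun_eq_iff mk_wo_inverse)
    show "?c p \<in> {q. q permutes UNIV}"
      using map_permutation_permutes[OF bb] p by blast
    have "sign (?c p) = sign p" by (rule sign_map_permutation) (use p inj in auto)
    moreover have "(\<Prod>i\<in>UNIV. (\<chi> i j. A $ un_wo i $ un_wo j) $ i $ ?c p i) = (\<Prod>i\<in>UNIV. A $ i $ p i)"
      by (rule prod.reindex_bij_witness[where i = mk_wo and j = un_wo])
         (auto simp: mk_wo_inverse un_wo_inverse c)
    ultimately show "of_int (sign (?c p)) * (\<Prod>i\<in>UNIV. (\<chi> i j. A $ un_wo i $ un_wo j) $ i $ ?c p i)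
        = of_int (sign p) * (\<Prod>i\<in>UNIV. A $ i $ p i)" by simp
  next
    fix q :: "'n wo => 'n wo" assume q: "q \<in> {q. q permutes UNIV}"
    show "?c (un_wo \<circ> q \<circ> mk_wo) = q" by (simp add: c fun_eq_iff un_wo_inverse)
    show "un_wo \<circ> q \<circ> mk_wo \<in> {p. p permutes UNIV}"
    proof -
      have "bij q" using q by (simp add: permutes_bij)
      moreover have "bij (un_wo :: 'n wo => 'n)" by (metis bijI' un_wo_inverse mk_wo_inverse UNIV_I)
      ultimately have "bij (un_wo \<circ> q \<circ> mk_wo)" by (intro bij_comp bij_mk_wo)
      thus ?thesis using bij_imp_permutes[of _ UNIV] by auto
    qed
  qed
  thus ?thesis by (simp add: det_def)
qed

lemma det_matrix_wo:
  fixes f :: "real^'n => real^'n"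
  assumes "linear f"
  shows "det (matrix (to_wo \<circ> f \<circ> of_wo)) = det (matrix f)"
proof -
  have ax: "of_wo (axis j (1::real)) = axis (un_wo j) 1" for j :: "'n wo"
    by (auto simp: of_wo_def axis_def vec_eq_iff mk_wo_inverse un_wo_inverse)
  have "matrix (to_wo \<circ> f \<circ> of_wo) = (\<chi> i j. matrix f $ un_wo i $ un_wo j)"
    by (simp add: matrix_def to_wo_def ax)
  thus ?thesis by (simp add: det_wo)
qed

lemma lebesgue_distr_of_wo:
  "distr lebesgue lebesgue (of_wo :: real^('n wo) => real^'n) = lebesgue"
  and measurable_of_wo_lebesgue: "(of_wo :: real^('n wo) => real^'n) \<in> lebesgue \<rightarrow>\<^sub>M lebesgue"
proof -
  have m: "(of_wo :: real^('n wo) => real^'n) \<in> lborel \<rightarrow>\<^sub>M borel"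
    by (simp, intro borel_measurable_continuous_onI linear_continuous_on)
      (rule linear_of_wo[unfolded linear_conv_bounded_linear])
  have eq: "distr lebesgue lborel (of_wo :: real^('n wo) => real^'n) = lborel"
    using m distr_of_wo by (subst distr_completion) (auto cong: distr_cong)
  have m': "(of_wo :: real^('n wo) => real^'n) \<in> lebesgue \<rightarrow>\<^sub>M lborel"
    using m by (intro measurable_completion) simp
  show m2: "(of_wo :: real^('n wo) => real^'n) \<in> lebesgue \<rightarrow>\<^sub>M lebesgue"
    using m' eq by (intro completion.measurable_completion2) auto
  show "distr lebesgue lebesgue (of_wo :: real^('n wo) => real^'n) = lebesgue"
    using completion.completion_distr_eq[OF m'] eq by simp
qed

lemma negligible_of_wo_image:
  "negligible N ==> negligible ((of_wo :: real^('n wo) => real^'n) ` N)"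
  and lebesgue_of_wo_image: "S \<in> sets lebesgue ==> (of_wo :: real^('n wo) => real^'n) ` S \<in> sets lebesgue"
  and emeasure_of_wo_image: "S \<in> sets lebesgue ==> emeasure lebesgue ((of_wo :: real^('n wo) => real^'n) ` S) = emeasure lebesgue S"
proof -
  have vim: "(of_wo :: real^('n wo) => real^'n) -` (of_wo ` S) = S" for S
  proof -
    have "inj (of_wo :: real^('n wo) => real^'n)" by (metis injI to_of_wo)
    thus ?thesis by (simp add: inj_vimage_image_eq)
  qed
  show img: "(of_wo :: real^('n wo) => real^'n) ` S \<in> sets lebesgue" if "S \<in> sets lebesgue" for S
    by (rule differentiable_image_in_sets_lebesgue[OF that])
       (auto simp: CARD_wo intro!: linear_imp_differentiable_on linear_of_wo)
  show em: "emeasure lebesgue ((of_wo :: real^('n wo) => real^'n) ` S) = emeasure lebesgue S"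
    if "S \<in> sets lebesgue" for S
    using emeasure_distr[OF measurable_of_wo_lebesgue img[OF that]]
    by (simp add: lebesgue_distr_of_wo vim)
  show "negligible ((of_wo :: real^('n wo) => real^'n) ` N)" if "negligible N"
    using that img[of N] em[of N] by (auto simp: negligible_iff_null_sets null_sets_def)
qed

lemma nn_integral_of_wo:
  assumes "(f :: real^'n => ennreal) \<in> borel_measurable lebesgue"
  shows "(\<integral>\<^sup>+x. f (of_wo x) \<partial>lebesgue) = (\<integral>\<^sup>+x. f x \<partial>lebesgue)"
  using nn_integral_distr[OF measurable_of_wo_lebesgue, of f] assms by (simp add: lebesgue_distr_of_wo)

text \<open>The change-of-variables theorems of the library carry a well-order on the index type, which
  is why they are moved here along a well-ordered copy of an arbitrary finite index type.\<close>

lemma has_derivative_wo: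
  fixes f :: "real^'n => real^'n"
  assumes "(f has_derivative f') (at (of_wo x) within S)"
  shows "((to_wo \<circ> f \<circ> of_wo) has_derivative (to_wo \<circ> f' \<circ> of_wo)) (at x within (of_wo -` S))"
proof -
  have 1: "(of_wo has_derivative of_wo) (at x within (of_wo -` S))"
    by (rule linear_imp_has_derivative[OF linear_of_wo])
  have "(f has_derivative f') (at (of_wo x) within of_wo ` (of_wo -` S))"
    using assms by (rule has_derivative_subset) auto
  from diff_chain_within[OF 1 this]
  have 2: "((f \<circ> of_wo) has_derivative (f' \<circ> of_wo)) (at x within (of_wo -` S))" .
  have "(to_wo has_derivative to_wo) (at ((f \<circ> of_wo) x) within (f \<circ> of_wo) ` (of_wo -` S))"
    by (rule linear_imp_has_derivative[OF linear_to_wo])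
  from diff_chain_within[OF 2 this] show ?thesis by (simp add: comp_def)
qed

lemma vimage_of_wo: "of_wo -` S = to_wo ` S"
  by (force simp: image_iff)

lemma borel_measurable_det_derivative:
  fixes f :: "real^'n => real^'n"
  assumes "S \<in> sets lebesgue" "\<And>x. x \<in> S ==> (f has_derivative f' x) (at x within S)"
  shows "(\<lambda>x. det (matrix (f' x)) * indicator S x) \<in> borel_measurable lebesgue"
proof -
  have 1: "(of_wo -` S :: (real^('n wo)) set) \<in> sets lebesgue"
    using measurable_sets[OF measurable_of_wo_lebesgue assms(1)] by simp
  have "(\<lambda>x. det (matrix (to_wo \<circ> f' (of_wo x) \<circ> of_wo))) \<in> borel_measurable (lebesgue_on (of_wo -` S :: (real^('n wo)) set))"
    by (rule borel_measurable_det_Jacobian[OF 1, where f = "to_wo \<circ> f \<circ> of_wo"])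
       (rule has_derivative_wo, use assms in auto)
  hence "(\<lambda>x. det (matrix (f' (of_wo x)))) \<in> borel_measurable (lebesgue_on (of_wo -` S :: (real^('n wo)) set))"
    by (rule measurable_cong[THEN iffD1, rotated])
       (auto intro!: det_matrix_wo bounded_linear.linear has_derivative_bounded_linear[OF assms(2)])
  hence 2: "(\<lambda>x. det (matrix (f' (of_wo x))) * indicator S (of_wo x)) \<in> borel_measurable (lebesgue :: (real^('n wo)) measure)"
    using 1 by (subst (asm) borel_measurable_restrict_space_iff) (auto simp: indicator_def mult.commute if_distrib vimage_def cong: if_cong)
  have "(to_wo :: real^'n => _) \<in> lebesgue \<rightarrow>\<^sub>M lebesgue"
  proof (rule measurableI)
    fix A :: "(real^('n wo)) set" assume "A \<in> sets lebesgue"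
    moreover have "to_wo -` A = of_wo ` A" by (force simp: image_iff)
    ultimately show "to_wo -` A \<inter> space lebesgue \<in> sets (lebesgue :: (real^'n) measure)"
      using lebesgue_of_wo_image by simp
  qed auto
  from measurable_compose[OF this 2] show ?thesis by simp
qed

section \<open>Area inequalities over an arbitrary finite index type\<close>

lemma has_integral_set_of_nn_integral:
  fixes f :: "'a::euclidean_space => real"
  assumes nn: "\<And>x. x \<in> S ==> 0 \<le> f x"
    and m: "(\<lambda>x. f x * indicator S x) \<in> borel_measurable lebesgue"
    and fin: "(\<integral>\<^sup>+x. ennreal (f x * indicator S x) \<partial>lebesgue) = ennreal r" "0 \<le> r"
  shows "(f has_integral r) S"
proof -
  have "((\<lambda>x. f x * indicator S x) has_integral r) UNIV"
    using has_integral_iff_nn_integral_lebesgue[of "\<lambda>x. f x * indicator S x" r] assms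
    by (auto simp: indicator_def)
  hence "((\<lambda>x. if x \<in> S then f x else 0) has_integral r) UNIV"
    by (rule has_integral_eq[rotated]) auto
  thus ?thesis by (simp add: has_integral_restrict_UNIV)
qed

text \<open>Overlaps can only make the image smaller, so the upper bound holds for maps that are not
  injective; \<open>ray_map\<close> is of this kind.\<close>

lemma emeasure_differentiable_image_le:
  fixes f :: "real^'n => real^'n"
  assumes S: "S \<in> sets lebesgue" and der: "\<And>x. x \<in> S ==> (f has_derivative f' x) (at x within S)"
  shows "f ` S \<in> sets lebesgue"
    and "emeasure lebesgue (f ` S) \<le> (\<integral>\<^sup>+x\<in>S. ennreal \<bar>det (matrix (f' x))\<bar> \<partial>lebesgue)"
proof -
  show img: "f ` S \<in> sets lebesgue"
    by (rule differentiable_image_in_sets_lebesgue[OF S])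
       (use der in \<open>auto simp: differentiable_on_def differentiable_def\<close>)
  define d where "d x = \<bar>det (matrix (f' x))\<bar> * indicator S x" for x
  have d_meas: "d \<in> borel_measurable lebesgue"
  proof -
    have "(\<lambda>x. \<bar>det (matrix (f' x)) * indicator S x\<bar>) \<in> borel_measurable lebesgue"
      using borel_measurable_det_derivative[OF S der] by simp
    thus ?thesis by (simp add: d_def[abs_def] abs_mult indicator_def if_distrib cong: if_cong)
  qed
  have Id: "(\<integral>\<^sup>+x\<in>S. ennreal \<bar>det (matrix (f' x))\<bar> \<partial>lebesgue) = (\<integral>\<^sup>+x. ennreal (d x) \<partial>lebesgue)"
    by (intro nn_integral_cong) (auto simp: d_def indicator_def)
  show "emeasure lebesgue (f ` S) \<le> (\<integral>\<^sup>+x\<in>S. ennreal \<bar>det (matrix (f' x))\<bar> \<partial>lebesgue)"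
  \<comment> \<open>The transported theorem speaks of integrable Jacobians; for an infinite integral
    the bound is trivial.\<close>
  proof (cases "(\<integral>\<^sup>+x. ennreal (d x) \<partial>lebesgue) = \<infinity>")
    case True thus ?thesis using Id by simp
  next
    case False
    then obtain r where r: "(\<integral>\<^sup>+x. ennreal (d x) \<partial>lebesgue) = ennreal r" "0 \<le> r"
      by (metis ennreal_cases infinity_ennreal_def)
    define S' where "S' = (of_wo -` S :: (real^('n wo)) set)"
    define g where "g = to_wo \<circ> f \<circ> (of_wo :: real^('n wo) => real^'n)"
    define g' where "g' x = to_wo \<circ> f' (of_wo x) \<circ> (of_wo :: real^('n wo) => real^'n)" for x
    have S': "S' \<in> sets lebesgue"
      using measurable_sets[OF measurable_of_wo_lebesgue S] by (simp add: S'_def)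
    have der': "(g has_derivative g' x) (at x within S')" if "x \<in> S'" for x
      unfolding g_def g'_def S'_def using that by (intro has_derivative_wo der) (simp add: S'_def)
    have det': "\<bar>det (matrix (g' x))\<bar> * indicator S' x = d (of_wo x)" for x
    proof (cases "x \<in> S'")
      case True
        hence "linear (f' (of_wo x))"
        by (auto simp: S'_def intro!: bounded_linear.linear has_derivative_bounded_linear[OF der])
      thus ?thesis using True by (simp add: g'_def det_matrix_wo d_def S'_def)
    qed (simp add: d_def S'_def)
    have "((\<lambda>x. \<bar>det (matrix (g' x))\<bar>) has_integral r) S'"
    proof (rule has_integral_set_of_nn_integral)
      show "(\<lambda>x. \<bar>det (matrix (g' x))\<bar> * indicator S' x) \<in> borel_measurable lebesgue"
        unfolding det' using measurable_compose[OF measurable_of_wo_lebesgue d_meas] .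
      show "(\<integral>\<^sup>+x. ennreal (\<bar>det (matrix (g' x))\<bar> * indicator S' x) \<partial>lebesgue) = ennreal r"
        unfolding det' using nn_integral_of_wo[of "\<lambda>x. ennreal (d x)"] d_meas r by simp
    qed (use r in auto)
    hence int: "(\<lambda>x. \<bar>det (matrix (g' x))\<bar>) integrable_on S'" "integral S' (\<lambda>x. \<bar>det (matrix (g' x))\<bar>) = r"
      by (auto simp: has_integral_iff)
    have lm: "g ` S' \<in> lmeasurable" by (rule measurable_differentiable_image[OF S' der' int(1)])
    have le: "measure lebesgue (g ` S') \<le> r"
      using measure_differentiable_image[OF S' der' int(1)] int(2) by simp
    have "of_wo ` (g ` S') = f ` S"
      by (auto simp: g_def S'_def vimage_of_wo image_image)
    hence "emeasure lebesgue (f ` S) = emeasure lebesgue (g ` S')"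
      using emeasure_of_wo_image[of "g ` S'"] lm by (metis fmeasurableD)
    also have "... = ennreal (measure lebesgue (g ` S'))"
      using lm by (simp add: emeasure_eq_measure2)
    also have "... \<le> ennreal r" using le by (rule ennreal_leI)
    finally show ?thesis using Id r by simp
  qed
qed

text \<open>Applied later to the embedding on its points of differentiability, with a truncated
  Riesz kernel as \<open>V\<close>. It is an inequality because the image of \<open>S\<close> is
  only part of the space. The finite integral of \<open>V\<close> over the whole space gives
  integrability on the image, and the change of variables is read from there back to
  \<open>S\<close>.\<close>

lemma nn_integral_injective_change_of_variables_le:
  fixes f :: "real^'n => real^'n" and V :: "real^'n => real"
  assumes S: "S \<in> sets lebesgue" and der: "\<And>x. x \<in> S ==> (f has_derivative f' x) (at x within S)"
    and inj: "inj_on f S" and V: "V \<in> borel_measurable borel" "\<And>y. 0 \<le> V y"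
    and fin: "(\<integral>\<^sup>+y. ennreal (V y) \<partial>lborel) < \<infinity>"
  shows "(\<integral>\<^sup>+x\<in>S. ennreal (V (f x) * \<bar>det (matrix (f' x))\<bar>) \<partial>lebesgue) \<le> (\<integral>\<^sup>+y. ennreal (V y) \<partial>lborel)"
proof -
  define S' where "S' = (of_wo -` S :: (real^('n wo)) set)"
  define g where "g = to_wo \<circ> f \<circ> (of_wo :: real^('n wo) => real^'n)"
  define g' where "g' x = to_wo \<circ> f' (of_wo x) \<circ> (of_wo :: real^('n wo) => real^'n)" for x
  define V' where "V' x = V (of_wo x)" for x :: "real^('n wo)"
  have S': "S' \<in> sets lebesgue"
    using measurable_sets[OF measurable_of_wo_lebesgue S] by (simp add: S'_def)
  have der': "(g has_derivative g' x) (at x within S')" if "x \<in> S'" for x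
    unfolding g_def g'_def S'_def using that by (intro has_derivative_wo der) (simp add: S'_def)
  have inj': "inj_on g S'"
  proof (rule inj_onI)
    fix x y assume xy: "x \<in> S'" "y \<in> S'" "g x = g y"
    have "f (of_wo x) = f (of_wo y)" using arg_cong[OF xy(3), of of_wo] by (simp add: g_def)
    hence "of_wo x = of_wo y" using xy(1,2) inj_onD[OF inj] by (simp add: S'_def)
    from arg_cong[OF this, of to_wo] show "x = y" by simp
  qed
  have Vl: "V \<in> borel_measurable lebesgue" using V(1) by (intro measurable_completion) simp
  have Vm: "V' \<in> borel_measurable lebesgue"
    unfolding V'_def using measurable_compose[OF measurable_of_wo_lebesgue Vl] .
  have IV: "(\<integral>\<^sup>+x. ennreal (V' x) \<partial>lebesgue) = (\<integral>\<^sup>+y. ennreal (V y) \<partial>lborel)"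
  proof -
    have "(\<integral>\<^sup>+x. ennreal (V' x) \<partial>lebesgue) = (\<integral>\<^sup>+y. ennreal (V y) \<partial>lebesgue)"
      unfolding V'_def using nn_integral_of_wo[of "\<lambda>x. ennreal (V x)"] Vl by simp
    thus ?thesis by (simp add: nn_integral_completion)
  qed
  obtain r where r: "(\<integral>\<^sup>+y. ennreal (V y) \<partial>lborel) = ennreal r" "0 \<le> r"
    using fin by (cases "\<integral>\<^sup>+y. ennreal (V y) \<partial>lborel" rule: ennreal_cases) auto
  have hi: "(V' has_integral r) UNIV"
    using has_integral_iff_nn_integral_lebesgue[of V' r] Vm IV r V(2) by (simp add: V'_def)
  have ai: "V' absolutely_integrable_on UNIV"
    by (rule nonnegative_absolutely_integrable_1) (use hi V(2) in \<open>auto simp: has_integral_iff V'_def\<close>)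
  have gS: "g ` S' \<in> sets lebesgue" by (rule emeasure_differentiable_image_le(1)[OF S' der'])
  have ai2: "V' absolutely_integrable_on (g ` S')"
    by (rule set_integrable_subset[OF ai]) (use gS in auto)
  \<comment> \<open>The change of variables is stated for vector values, so \<open>V'\<close> is
    read as a map into \<open>real^1\<close>.\<close>
  hence aiv: "(\<lambda>x. vec (V' x) :: real^1) absolutely_integrable_on (g ` S')"
    by (simp add: absolutely_integrable_on_1_iff)
  have main: "(\<lambda>x. \<bar>det (matrix (g' x))\<bar> *\<^sub>R (vec (V' (g x)) :: real^1)) absolutely_integrable_on S' \<and>
      integral S' (\<lambda>x. \<bar>det (matrix (g' x))\<bar> *\<^sub>R (vec (V' (g x)) :: real^1)) = integral (g ` S') (\<lambda>x. vec (V' x))"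
    by (rule iffD2[OF has_absolute_integral_change_of_variables[OF S' der' inj']]) (use aiv in auto)
  have ai3: "(\<lambda>x. \<bar>det (matrix (g' x))\<bar> * V' (g x)) absolutely_integrable_on S'"
    using main by (auto simp: absolutely_integrable_on_1_iff)
  have "integral S' (\<lambda>x. \<bar>det (matrix (g' x))\<bar> * V' (g x)) = integral (g ` S') V'"
  proof -
    have "integral S' (\<lambda>x. \<bar>det (matrix (g' x))\<bar> *\<^sub>R (vec (V' (g x)) :: real^1))
        = vec (integral S' (\<lambda>x. \<bar>det (matrix (g' x))\<bar> * V' (g x)))"
      by (subst integral_on_1_eq) simp
    moreover have "integral (g ` S') (\<lambda>x. vec (V' x) :: real^1) = vec (integral (g ` S') V')"
      by (subst integral_on_1_eq) simp
    ultimately have "vec (integral S' (\<lambda>x. \<bar>det (matrix (g' x))\<bar> * V' (g x))) = (vec (integral (g ` S') V') :: real^1)"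
      using main by simp
    from arg_cong[OF this, of "\<lambda>v. v $ 1"] show ?thesis by simp
  qed
  also have "... \<le> integral UNIV V'"
    by (rule integral_subset_le) (use ai ai2 V(2) in \<open>auto simp: absolutely_integrable_on_def V'_def\<close>)
  also have "... = r" using hi by (simp add: has_integral_iff)
  finally have le: "integral S' (\<lambda>x. \<bar>det (matrix (g' x))\<bar> * V' (g x)) \<le> r" .
  have hi3: "((\<lambda>x. \<bar>det (matrix (g' x))\<bar> * V' (g x)) has_integral integral S' (\<lambda>x. \<bar>det (matrix (g' x))\<bar> * V' (g x))) S'"
    using ai3 by (simp add: absolutely_integrable_on_def integrable_integral)
  define e where "e x = V (f x) * \<bar>det (matrix (f' x))\<bar> * indicator S x" for x
  have e': "\<bar>det (matrix (g' x))\<bar> * V' (g x) * indicator S' x = e (of_wo x)" for x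
  proof (cases "x \<in> S'")
    case True
    hence "linear (f' (of_wo x))"
      by (auto simp: S'_def intro!: bounded_linear.linear has_derivative_bounded_linear[OF der])
    thus ?thesis using True by (simp add: g'_def det_matrix_wo e_def S'_def V'_def g_def)
  qed (simp add: e_def S'_def)
  have "(\<integral>\<^sup>+x. ennreal (e (of_wo x)) \<partial>(lebesgue :: (real^('n wo)) measure))
      = (\<integral>\<^sup>+x. ennreal (\<bar>det (matrix (g' x))\<bar> * V' (g x)) * indicator S' x \<partial>lborel)"
    unfolding e'[symmetric] nn_integral_completion
    by (intro nn_integral_cong) (auto simp: indicator_def)
  also have "... = ennreal (integral S' (\<lambda>x. \<bar>det (matrix (g' x))\<bar> * V' (g x)))"
    by (rule nn_integral_has_integral_lebesgue'[OF _ hi3]) (simp add: V'_def V(2))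
  also have "... \<le> ennreal r" using le by (rule ennreal_leI)
  finally have fin1: "(\<integral>\<^sup>+x. ennreal (e (of_wo x)) \<partial>(lebesgue :: (real^('n wo)) measure)) \<le> ennreal r" .
  have em': "(\<lambda>x. e (of_wo x)) \<in> borel_measurable (lebesgue :: (real^('n wo)) measure)"
  proof -
    have "(\<lambda>x. indicator S' x *\<^sub>R (\<bar>det (matrix (g' x))\<bar> * V' (g x))) \<in> borel_measurable lebesgue"
      using ai3 unfolding set_integrable_def by (rule borel_measurable_integrable)
    thus ?thesis unfolding e'[symmetric] by (simp add: mult.commute)
  qed
  have "(to_wo :: real^'n => _) \<in> lebesgue \<rightarrow>\<^sub>M lebesgue"
  proof (rule measurableI)
    fix A :: "(real^('n wo)) set" assume "A \<in> sets lebesgue"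
    moreover have "to_wo -` A = of_wo ` A" by (force simp: image_iff)
    ultimately show "to_wo -` A \<inter> space lebesgue \<in> sets (lebesgue :: (real^'n) measure)"
      using lebesgue_of_wo_image by simp
  qed auto
  from measurable_compose[OF this em'] have em: "e \<in> borel_measurable lebesgue" by simp
  have "(\<integral>\<^sup>+x. ennreal (e x) \<partial>lebesgue) = (\<integral>\<^sup>+x. ennreal (e (of_wo x)) \<partial>(lebesgue :: (real^('n wo)) measure))"
    using nn_integral_of_wo[of "\<lambda>x. ennreal (e x)"] em by simp
  also note fin1
  also have "(\<integral>\<^sup>+x. ennreal (e x) \<partial>lebesgue) = (\<integral>\<^sup>+x\<in>S. ennreal (V (f x) * \<bar>det (matrix (f' x))\<bar>) \<partial>lebesgue)"
    by (intro nn_integral_cong) (auto simp: e_def indicator_def)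
  finally show ?thesis using r by simp
qed

section \<open>Mollification\<close>

text \<open>The denominators make the family closed under differentiation up to linear combinations:
  differentiating \<open>bump m\<close> only produces \<open>bump (m + 2)\<close> and
  \<open>bump (m + 1)\<close>. Smoothness then follows by induction without estimating higher
  derivatives.\<close>

definition bump :: "nat => real => real" where
  "bump m t = (if t > 0 then exp (- 1 / t) / t ^ m else 0)"

lemma bump_nonneg: "0 \<le> bump m t"
  by (simp add: bump_def)

text \<open>One term, of order m + 2, of the exponential series at 1/t. The two spare powers of t
  give a vanishing derivative at the origin.\<close>

lemma bump_le_square: "bump m t \<le> fact (m + 2) * t\<^sup>2"
proof (cases "t > 0")
  case True
  have "(1 / t) ^ (m + 2) / fact (m + 2) \<le> exp (1 / t)"
  proof -
    have "summable (\<lambda>n. (1 / t) ^ n /\<^sub>R fact n)" by (rule summable_exp_generic)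
    hence "(\<Sum>n\<in>{m + 2}. (1 / t) ^ n /\<^sub>R fact n) \<le> (\<Sum>n. (1 / t) ^ n /\<^sub>R fact n)"
      using True by (intro sum_le_suminf) auto
    thus ?thesis by (simp add: exp_def divide_inverse mult.commute)
  qed
  hence "(1 / t) ^ (m + 2) \<le> exp (1 / t) * fact (m + 2)"
    by (subst (asm) pos_divide_le_eq) (rule fact_gt_zero)
  hence "1 \<le> exp (1 / t) * fact (m + 2) * t ^ (m + 2)"
    using True by (simp add: power_one_over pos_divide_le_eq del: fact_Suc fact_numeral power_Suc power_add)
  hence "exp (- 1 / t) \<le> exp (- 1 / t) * (exp (1 / t) * fact (m + 2) * t ^ (m + 2))"
    using mult_left_mono[of 1 _ "exp (- 1 / t)"] by simp
  also have "... = fact (m + 2) * t ^ (m + 2)" by (simp add: exp_minus)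
  finally have "exp (- 1 / t) \<le> (fact (m + 2) * t\<^sup>2) * t ^ m" by (simp only: power_add mult_ac)
  thus ?thesis using True by (simp add: bump_def pos_divide_le_eq del: fact_Suc fact_numeral)
qed (simp add: bump_def)

lemma DERIV_bump: "(bump m has_real_derivative (bump (m + 2) t - m * bump (m + 1) t)) (at t)"
proof -
  consider "t > 0" | "t < 0" | "t = 0" by linarith
  thus ?thesis
  proof cases
    case 1
    have eq: "\<forall>\<^sub>F s in nhds t. bump m s = exp (- 1 / s) / s ^ m"
      using eventually_nhds_in_open[of "{0<..}" t] 1
      by (auto elim!: eventually_mono simp: bump_def)
    have "((\<lambda>s. exp (- 1 / s) / s ^ m) has_real_derivative (bump (m + 2) t - m * bump (m + 1) t)) (at t)"
    proof (cases m)
      case 0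
      thus ?thesis using 1
        by (auto intro!: derivative_eq_intros simp: bump_def field_simps power2_eq_square)
    next
      case (Suc k)
      have "t ^ k = t * t ^ (k - Suc 0)" if "k \<noteq> 0" using that by (cases k) auto
      thus ?thesis using 1 unfolding Suc
        by (cases "k = 0") (auto intro!: derivative_eq_intros simp: bump_def field_simps power2_eq_square)
    qed
    thus ?thesis using DERIV_cong_ev[OF refl eq refl] by simp
  next
    case 2
    have eq: "\<forall>\<^sub>F s in nhds t. bump m s = 0"
      using eventually_nhds_in_open[of "{..<0}" t] 2
      by (auto elim!: eventually_mono simp: bump_def)
    show ?thesis using DERIV_cong_ev[OF refl eq refl, of 0] 2 by (simp add: bump_def[abs_def])
  next
    case 3
    \<comment> \<open>Both bumps on the right are 0 at the origin, so the claim is that the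
      difference quotient tends to 0; this is the quadratic bound.\<close>
    have "((\<lambda>h. bump m h / h) \<longlongrightarrow> 0) (at 0)"
    proof (rule Lim_null_comparison)
      show "\<forall>\<^sub>F h in at 0. norm (bump m h / h) \<le> fact (m + 2) * \<bar>h\<bar>"
      proof (intro always_eventually allI)
        fix h :: real
        show "norm (bump m h / h) \<le> fact (m + 2) * \<bar>h\<bar>"
        proof (cases "h = 0")
          case False
          have "\<bar>bump m h\<bar> \<le> (fact (m + 2) * \<bar>h\<bar>) * \<bar>h\<bar>"
            using bump_le_square[of m h] bump_nonneg[of m h]
            by (simp add: power2_eq_square mult.assoc abs_mult_self_eq del: fact_Suc fact_numeral)
          thus ?thesis using False by (simp add: pos_divide_le_eq del: fact_Suc fact_numeral)
        qed simp
      qed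
      show "((\<lambda>h. fact (m + 2) * \<bar>h\<bar>) \<longlongrightarrow> 0) (at (0::real))"
        by (auto intro!: tendsto_eq_intros)
    qed
    thus ?thesis using 3 by (simp add: DERIV_def bump_def)
  qed
qed

lemma continuous_bump [continuous_intros]:
  "continuous_on S f ==> continuous_on S (\<lambda>x. bump m (f x))"
  by (rule continuous_on_compose2[of UNIV "bump m" S f])
     (auto intro!: DERIV_continuous_on DERIV_bump)

text \<open>An algebra of functions that contains the shifted bumps and is closed under partial
  derivatives. This is the induction hypothesis that \<open>Ck\<close> asks for, since
  \<open>Ck\<close> iterates partial derivatives.\<close>

inductive bumpy :: "real^'n => real => (real^'n => real) => bool" for x0 e where
  bumpy_bump: "bumpy x0 e (\<lambda>y. bump m (e - (x0 - y) \<bullet> (x0 - y)))"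
| bumpy_const: "bumpy x0 e (\<lambda>y. c)"
| bumpy_coord: "bumpy x0 e (\<lambda>y. y $ i)"
| bumpy_add: "bumpy x0 e f ==> bumpy x0 e g ==> bumpy x0 e (\<lambda>y. f y + g y)"
| bumpy_mult: "bumpy x0 e f ==> bumpy x0 e g ==> bumpy x0 e (\<lambda>y. f y * g y)"

lemma bumpy_has_derivative:
  fixes f :: "real^'n => real"
  assumes "bumpy x0 e f"
  shows "\<exists>f'. (\<forall>y. (f has_derivative f' y) (at y)) \<and> (\<forall>i. bumpy x0 e (\<lambda>y. f' y (axis i 1)))"
  using assms
proof induction
  case (bumpy_bump m)
  define b where "b y = bump (m + 2) (e - (x0 - y) \<bullet> (x0 - y)) - m * bump (m + 1) (e - (x0 - y) \<bullet> (x0 - y))" for y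
  have q: "((\<lambda>y. e - (x0 - y) \<bullet> (x0 - y)) has_derivative (\<lambda>h. 2 * ((x0 - y) \<bullet> h))) (at y)" for y
    by (auto intro!: derivative_eq_intros simp: inner_commute)
  have "((\<lambda>y. bump m (e - (x0 - y) \<bullet> (x0 - y))) has_derivative (\<lambda>h. b y * (2 * ((x0 - y) \<bullet> h)))) (at y)" for y
    using DERIV_compose_FDERIV[OF DERIV_bump q] by (simp add: b_def mult.commute)
  moreover have "bumpy x0 e (\<lambda>y. b y * (2 * ((x0 - y) \<bullet> axis i 1)))" for i
  proof -
    have eq: "(\<lambda>y. b y * (2 * ((x0 - y) \<bullet> axis i 1))) = (\<lambda>y. (bump (m + 2) (e - (x0 - y) \<bullet> (x0 - y)) + (- real m) * bump (m + 1) (e - (x0 - y) \<bullet> (x0 - y))) * (2 * x0 $ i + (-2) * (y $ i)))"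
      by (simp add: b_def fun_eq_iff inner_axis algebra_simps)
    show ?thesis unfolding eq by (intro bumpy.intros)
  qed
  ultimately show ?case by (intro exI[of _ "\<lambda>y h. b y * (2 * ((x0 - y) \<bullet> h))"]) blast
next
  case (bumpy_const c)
  show ?case by (rule exI[of _ "\<lambda>y h. 0"]) (auto intro: bumpy.intros)
next
  case (bumpy_coord i)
  have "bumpy x0 e (\<lambda>y. axis j 1 $ i)" for j :: 'n by (rule bumpy.bumpy_const)
  thus ?case
    by (intro exI[of _ "\<lambda>y h. h $ i"]) (auto intro!: bounded_linear_imp_has_derivative bounded_linear_vec_nth)
next
  case (bumpy_add f g)
  then obtain f' g' where "\<forall>y. (f has_derivative f' y) (at y)" "\<forall>y. (g has_derivative g' y) (at y)"
     "\<forall>i. bumpy x0 e (\<lambda>y. f' y (axis i 1))" "\<forall>i. bumpy x0 e (\<lambda>y. g' y (axis i 1))" by blast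
  thus ?case by (intro exI[of _ "\<lambda>y h. f' y h + g' y h"]) (auto intro!: has_derivative_add bumpy.intros)
next
  case (bumpy_mult f g)
  then obtain f' g' where "\<forall>y. (f has_derivative f' y) (at y)" "\<forall>y. (g has_derivative g' y) (at y)"
     "\<forall>i. bumpy x0 e (\<lambda>y. f' y (axis i 1))" "\<forall>i. bumpy x0 e (\<lambda>y. g' y (axis i 1))" by blast
  thus ?case using bumpy_mult
    by (intro exI[of _ "\<lambda>y h. f y * g' y h + f' y h * g y"]) (auto intro!: has_derivative_mult bumpy.intros)
qed

lemma bumpy_Ck: "bumpy x0 e f ==> Ck k f"
proof (induction k arbitrary: f)
  case 0
  obtain f' where "\<forall>y. (f has_derivative f' y) (at y)" using bumpy_has_derivative[OF 0] by blast
  thus ?case by (auto intro!: continuous_at_imp_continuous_on dest: has_derivative_continuous)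
next
  case (Suc k)
  obtain f' where f': "\<forall>y. (f has_derivative f' y) (at y)" "\<forall>i. bumpy x0 e (\<lambda>y. f' y (axis i 1))"
    using bumpy_has_derivative[OF Suc.prems] by blast
  have "frechet_derivative f (at y) = f' y" for y
    using f'(1) by (metis frechet_derivative_at)
  thus ?case using f' Suc.IH by (auto simp: differentiable_on_def differentiable_def)
qed

text \<open>Not normalised: averages are divided by \<open>mollifier_mass\<close> where they occur.
  The square of the norm keeps the function smooth at the origin.\<close>

definition mollifier :: "real => real^'n => real" where
  "mollifier \<epsilon> w = bump 0 (\<epsilon>\<^sup>2 - w \<bullet> w)"

lemma mollifier_nonneg: "0 \<le> mollifier \<epsilon> w"
  by (simp add: mollifier_def bump_nonneg)

lemma mollifier_outside: "\<epsilon> \<ge> 0 ==> norm w \<ge> \<epsilon> ==> mollifier \<epsilon> w = 0"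
proof -
  assume "\<epsilon> \<ge> 0" "norm w \<ge> \<epsilon>"
  hence "\<epsilon>\<^sup>2 \<le> (norm w)\<^sup>2" by (intro power_mono)
  thus ?thesis by (simp add: mollifier_def bump_def dot_square_norm)
qed

lemma mollifier_pos: "norm w < \<epsilon> ==> mollifier \<epsilon> w > 0"
  using power_strict_mono[of "norm w" \<epsilon> 2] by (simp add: mollifier_def bump_def dot_square_norm)

lemma mollifier_le_1: "mollifier \<epsilon> w \<le> 1"
  by (simp add: mollifier_def bump_def)

lemma continuous_mollifier [continuous_intros]:
  "continuous_on S f ==> continuous_on S (\<lambda>x. mollifier \<epsilon> (f x))"
  unfolding mollifier_def by (intro continuous_intros)

lemma measurable_mollifier [measurable]: "mollifier \<epsilon> \<in> borel_measurable borel"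
  by (intro borel_measurable_continuous_onI continuous_intros)

text \<open>The radial factor of the gradient; the i-th partial derivative of the mollifier at w is
  this factor times \<open>w $ i\<close>.\<close>

definition dmollifier :: "real => real^'n => real" where
  "dmollifier \<epsilon> w = - 2 * bump 2 (\<epsilon>\<^sup>2 - w \<bullet> w)"

lemma mollifier_has_derivative:
  "(mollifier \<epsilon> has_derivative (\<lambda>h. dmollifier \<epsilon> w * (w \<bullet> h))) (at w)"
proof -
  have q: "((\<lambda>w. \<epsilon>\<^sup>2 - w \<bullet> w) has_derivative (\<lambda>h. - 2 * (w \<bullet> h))) (at w)"
    by (auto intro!: derivative_eq_intros simp: inner_commute)
  show ?thesis
    using DERIV_compose_FDERIV[OF DERIV_bump[of 0] q]
    by (simp add: mollifier_def[abs_def] dmollifier_def mult_ac numeral_2_eq_2)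
qed

lemma dmollifier_outside: "\<epsilon> \<ge> 0 ==> norm w \<ge> \<epsilon> ==> dmollifier \<epsilon> w = 0"
proof -
  assume "\<epsilon> \<ge> 0" "norm w \<ge> \<epsilon>"
  hence "\<epsilon>\<^sup>2 \<le> (norm w)\<^sup>2" by (intro power_mono)
  thus ?thesis by (simp add: dmollifier_def bump_def dot_square_norm)
qed

lemma continuous_dmollifier [continuous_intros]:
  "continuous_on S f ==> continuous_on S (\<lambda>x. dmollifier \<epsilon> (f x))"
  unfolding dmollifier_def by (intro continuous_intros)

section \<open>Mollified functions and their partial derivatives\<close>

lemma test_function_mollifier:
  fixes x :: "real^'n"
  assumes "\<epsilon> > 0" "cball x \<epsilon> \<subseteq> U"
  shows "test_function U (\<lambda>y. mollifier \<epsilon> (x - y))"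
proof -
  have sub: "{y. mollifier \<epsilon> (x - y) \<noteq> 0} \<subseteq> cball x \<epsilon>"
    using mollifier_outside[of \<epsilon>] assms(1) by (force simp: dist_norm)
  hence cl: "closure {y. mollifier \<epsilon> (x - y) \<noteq> 0} \<subseteq> cball x \<epsilon>"
    by (simp add: closure_minimal)
  have "Ck k (\<lambda>y. mollifier \<epsilon> (x - y))" for k
    unfolding mollifier_def by (intro bumpy_Ck[of x "\<epsilon>\<^sup>2"] bumpy.intros)
  thus ?thesis using cl assms(2) unfolding test_function_def
    by (meson bounded_cball bounded_subset closed_closure compact_eq_bounded_closed order_trans)
qed

lemma frechet_derivative_mollifier_shift:
  "frechet_derivative (\<lambda>y. mollifier \<epsilon> (x - y)) (at y) (axis i 1) = - (dmollifier \<epsilon> (x - y) * (x - y) $ i)"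
proof -
  have "((\<lambda>y. mollifier \<epsilon> (x - y)) has_derivative (\<lambda>h. dmollifier \<epsilon> (x - y) * ((x - y) \<bullet> (- h)))) (at y)"
    by (rule has_derivative_compose[of "\<lambda>y. x - y" "\<lambda>h. - h" y UNIV "mollifier \<epsilon>", OF _ mollifier_has_derivative])
       (auto intro!: derivative_eq_intros)
  from frechet_derivative_at[OF this, THEN fun_cong, of "axis i 1"] show ?thesis
    by (simp add: inner_axis algebra_simps)
qed

text \<open>The integral runs over a fixed box, so the Leibniz rule applies at every x and the
  result is differentiable on the whole space, as the slice estimate below assumes. It is an average
  of u only at points whose ball lies in the box.\<close>

lemma mollify_has_derivative:
  fixes u :: "real^'n => real"
  assumes cont: "continuous_on (cbox a b) u"
  shows "((\<lambda>x. integral (cbox a b) (\<lambda>t. u t * mollifier \<epsilon> (x - t))) has_derivative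
     (\<lambda>h. \<Sum>i\<in>UNIV. h $ i * integral (cbox a b) (\<lambda>t. u t * (dmollifier \<epsilon> (x - t) * (x - t) $ i)))) (at x)"
proof -
  define F where "F x t = (u t * dmollifier \<epsilon> (x - t)) *\<^sub>R blinfun_inner_right (x - t)" for x t :: "real^'n"
  have cF: "continuous_on (UNIV \<times> cbox a b) (\<lambda>(x, t). F x t)"
  proof -
    have "continuous_on (UNIV \<times> cbox a b) (\<lambda>z. u (snd z))"
      by (rule continuous_on_compose2[OF cont]) (auto intro!: continuous_intros)
    moreover have "continuous_on (UNIV \<times> cbox a b) (\<lambda>z. blinfun_inner_right (fst z - snd z))"
      by (intro bounded_linear.continuous_on[OF bounded_linear_blinfun_inner_right] continuous_intros)
    ultimately show ?thesis unfolding F_def case_prod_beta by (intro continuous_intros)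
  qed
  have cFx: "continuous_on (cbox a b) (F x)" for x
  proof -
    have "continuous_on (cbox a b) (\<lambda>t. case (x, t) of (x, t) => F x t)"
      by (rule continuous_on_compose2[OF cF, of "cbox a b" "Pair x"]) (auto intro!: continuous_intros)
    thus ?thesis by simp
  qed
  have "((\<lambda>x. integral (cbox a b) (\<lambda>t. u t * mollifier \<epsilon> (x - t))) has_derivative integral (cbox a b) (F x)) (at x within UNIV)"
  proof (rule leibniz_rule[OF _ _ cF])
    fix x t :: "real^'n"
    have "((\<lambda>x. mollifier \<epsilon> (x - t)) has_derivative (\<lambda>h. dmollifier \<epsilon> (x - t) * ((x - t) \<bullet> h))) (at x)"
      by (rule has_derivative_compose[of "\<lambda>x. x - t" "\<lambda>h. h" x UNIV "mollifier \<epsilon>", OF _ mollifier_has_derivative])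
         (auto intro!: derivative_eq_intros)
    moreover have "blinfun_apply (F x t) = (\<lambda>h. u t * (dmollifier \<epsilon> (x - t) * ((x - t) \<bullet> h)))"
      by (simp add: F_def scaleR_blinfun.rep_eq fun_eq_iff)
    ultimately show "((\<lambda>x. u t * mollifier \<epsilon> (x - t)) has_derivative blinfun_apply (F x t)) (at x within UNIV)"
      using has_derivative_mult_right[of _ _ "at x" "u t"] by simp
  next
    fix x show "(\<lambda>t. u t * mollifier \<epsilon> (x - t)) integrable_on cbox a b"
      by (intro integrable_continuous continuous_intros cont)
  qed auto
  moreover have "blinfun_apply (integral (cbox a b) (F x)) h
     = (\<Sum>i\<in>UNIV. h $ i * integral (cbox a b) (\<lambda>t. u t * (dmollifier \<epsilon> (x - t) * (x - t) $ i)))" for h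
  proof -
    have h: "(\<Sum>i\<in>UNIV. h $ i *\<^sub>R axis i 1) = h"
      using basis_expansion[of h] by (simp add: scalar_mult_eq_scaleR)
    have "blinfun_apply (integral (cbox a b) (F x)) (\<Sum>i\<in>UNIV. h $ i *\<^sub>R axis i 1) = (\<Sum>i\<in>UNIV. h $ i * blinfun_apply (integral (cbox a b) (F x)) (axis i 1))"
      by (simp add: blinfun.sum_right blinfun.scaleR_right)
    hence "blinfun_apply (integral (cbox a b) (F x)) h = (\<Sum>i\<in>UNIV. h $ i * blinfun_apply (integral (cbox a b) (F x)) (axis i 1))"
      by (simp only: h)
    moreover have "blinfun_apply (integral (cbox a b) (F x)) (axis i 1) = integral (cbox a b) (\<lambda>t. u t * (dmollifier \<epsilon> (x - t) * (x - t) $ i))" for i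
      by (subst blinfun_apply_integral) (auto intro!: integrable_continuous cFx integral_cong simp: F_def scaleR_blinfun.rep_eq inner_axis)
    ultimately show ?thesis by simp
  qed
  ultimately show ?thesis by (elim has_derivative_eq_rhs) (auto simp: fun_eq_iff)
qed

lemma mollify_derivative_continuous:
  fixes u :: "real^'n => real"
  assumes cont: "continuous_on (cbox a b) u"
  shows "continuous_on UNIV (\<lambda>x. integral (cbox a b) (\<lambda>t. u t * (dmollifier \<epsilon> (x - t) * (x - t) $ i)))"
proof (rule integral_continuous_on_param)
  have "continuous_on (UNIV \<times> cbox a b) (\<lambda>z. u (snd z))"
    by (rule continuous_on_compose2[OF cont]) (auto intro!: continuous_intros)
  thus "continuous_on (UNIV \<times> cbox a b) (\<lambda>(x, t). u t * (dmollifier \<epsilon> (x - t) * (x - t) $ i))"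
    unfolding case_prod_beta by (intro continuous_intros)
qed

text \<open>The shifted mollifier is a test function because its ball lies in U. Differentiating it
  in y instead of x changes the sign, and this cancels the sign in the definition of the weak
  derivative.\<close>

lemma mollify_derivative_eq:
  fixes u :: "real^'n => real"
  assumes cont: "continuous_on (cbox a b) u" and sub: "cbox a b \<subseteq> U"
    and wp: "weak_partial U i u g" and e: "\<epsilon> > 0" and x: "cball x \<epsilon> \<subseteq> cbox a b"
  shows "integral (cbox a b) (\<lambda>t. u t * (dmollifier \<epsilon> (x - t) * (x - t) $ i)) = (LINT y|lebesgue. g y * mollifier \<epsilon> (x - y))"
proof -
  let ?f = "\<lambda>t. u t * (dmollifier \<epsilon> (x - t) * (x - t) $ i)"
  have "(LINT y|lebesgue. u y * frechet_derivative (\<lambda>y. mollifier \<epsilon> (x - y)) (at y) (axis i 1)) = - (LINT y|lebesgue. g y * mollifier \<epsilon> (x - y))"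
    using wp test_function_mollifier[OF e, of x U] x sub unfolding weak_partial_def by blast
  hence 1: "(LINT y|lebesgue. ?f y) = (LINT y|lebesgue. g y * mollifier \<epsilon> (x - y))"
    unfolding frechet_derivative_mollifier_shift by simp
  have out: "?f t = 0" if "t \<notin> cbox a b" for t
  proof -
    have "norm (x - t) \<ge> \<epsilon>" using that x by (force simp: dist_norm)
    thus ?thesis using dmollifier_outside[of \<epsilon> "x - t"] e by simp
  qed
  have "continuous_on (cbox a b) ?f" by (intro continuous_intros cont)
  hence ai: "?f absolutely_integrable_on cbox a b" by (rule absolutely_integrable_continuous)
  have "(LINT y|lebesgue. ?f y) = (LINT y:cbox a b|lebesgue. ?f y)"
    unfolding set_lebesgue_integral_def
    by (rule Bochner_Integration.integral_cong) (use out in \<open>auto simp: indicator_def\<close>)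
  also have "... = integral (cbox a b) ?f" by (rule set_lebesgue_integral_eq_integral(2)[OF ai])
  finally show ?thesis using 1 by simp
qed

section \<open>Coordinate slices\<close>

definition upd :: "'n => real => real^'n => real^'n" where
  "upd i r y = (\<chi> j. if j = i then r else y $ j)"

lemma upd_nth [simp]: "upd i r y $ j = (if j = i then r else y $ j)"
  by (simp add: upd_def)

lemma continuous_on_upd [continuous_intros]:
  "continuous_on S f ==> continuous_on S g ==> continuous_on S (\<lambda>x. upd i (f x) (g x))"
proof -
  assume "continuous_on S f" "continuous_on S g"
  hence "continuous_on S (\<lambda>x. if j = i then f x else g x $ j)" for j
    by (cases "j = i") (auto intro!: continuous_intros)
  thus ?thesis unfolding upd_def by (rule continuous_on_vec_lambda)
qed

lemma measurable_upd [measurable]: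
  "(\<lambda>(r, y). upd i r y) \<in> borel_measurable (borel \<Otimes>\<^sub>M borel)"
  unfolding borel_prod
  by (intro borel_measurable_continuous_onI) (auto simp: case_prod_beta intro!: continuous_intros)

lemma prod_Basis_cart: "(\<Prod>b\<in>Basis. (x :: real^'n) \<bullet> b) = (\<Prod>i\<in>UNIV. x $ i)"
  by (rule prod.reindex_bij_witness[where j = "\<lambda>b. THE i. b = axis i (1::real)" and i = "\<lambda>i. axis i 1"])
     (auto simp: Basis_vec_def axis_eq_axis cart_eq_inner_axis)

lemma Basis_cart_le_iff: "(\<forall>b\<in>Basis. (l :: real^'n) \<bullet> b \<le> u \<bullet> b) \<longleftrightarrow> (\<forall>i. l $ i \<le> u $ i)"
  by (auto simp: Basis_vec_def cart_eq_inner_axis)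

lemma measurable_vec_nth' [measurable]: "(\<lambda>y :: real^'n. y $ i) \<in> borel_measurable borel"
  by (intro borel_measurable_continuous_onI continuous_intros)

lemma emeasure_lborel_box_cart:
  "(\<And>i. l $ i \<le> u $ i) ==> emeasure lborel (box l (u :: real^'n)) = ennreal (\<Prod>i\<in>UNIV. (u - l) $ i)"
  using emeasure_lborel_box[of l u] Basis_cart_le_iff[of l u] by (simp only: prod_Basis_cart) blast

lemma emeasure_lborel_cbox_cart:
  "(\<And>i. l $ i \<le> u $ i) ==> emeasure lborel (cbox l (u :: real^'n)) = ennreal (\<Prod>i\<in>UNIV. (u - l) $ i)"
  using emeasure_lborel_cbox[of l u] Basis_cart_le_iff[of l u] by (simp only: prod_Basis_cart) blast

text \<open>Tonelli in one coordinate, with a dummy copy of that coordinate so that no space of lower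
  dimension is needed.\<close>

lemma nn_integral_upd:
  fixes \<phi> :: "real^'n => ennreal"
  assumes \<phi>[measurable]: "\<phi> \<in> borel_measurable borel" and cd: "c < d"
  shows "(\<integral>\<^sup>+r. (\<integral>\<^sup>+y. \<phi> (upd i r y) * indicator {y. c < y $ i \<and> y $ i < d} y \<partial>lborel) \<partial>lborel)
      = ennreal (d - c) * (\<integral>\<^sup>+y. \<phi> y \<partial>lborel)"
proof -
  \<comment> \<open>The density makes the dummy coordinate a uniform probability variable on (c, d).
    On a box, the integral over that coordinate is d - c, which the density divides out, so the
    push-forward is Lebesgue measure.\<close>
  define w where "w = (\<lambda>(r :: real, y :: real^'n). ennreal (1 / (d - c)) * indicator {y. c < y $ i \<and> y $ i < d} y)"
  have [measurable]: "w \<in> borel_measurable (lborel \<Otimes>\<^sub>M lborel)" unfolding w_def by measurable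
  have [measurable]: "(\<lambda>(r, y). upd i r y) \<in> lborel \<Otimes>\<^sub>M lborel \<rightarrow>\<^sub>M (borel :: (real^'n) measure)"
    by measurable
  define M where "M = distr (density (lborel \<Otimes>\<^sub>M lborel) w) borel (\<lambda>(r, y). upd i r y)"
  have "lborel = M"
  proof (rule lborel_eqI)
    fix l u :: "real^'n" assume "\<And>b. b \<in> Basis ==> l \<bullet> b \<le> u \<bullet> b"
    hence le: "l $ j \<le> u $ j" for j using Basis_cart_le_iff[of l u] by blast
    have "emeasure M (box l u) = (\<integral>\<^sup>+z. indicator (box l u) (case z of (r, y) => upd i r y) * w z \<partial>(lborel \<Otimes>\<^sub>M lborel))"
    proof -
      have "(\<lambda>(r, y). upd i r y) -` box l u \<inter> space (lborel \<Otimes>\<^sub>M lborel) \<in> sets (lborel \<Otimes>\<^sub>M (lborel :: (real^'n) measure))"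
        by (rule measurable_sets[of _ _ borel]) auto
      thus ?thesis unfolding M_def
        by (subst emeasure_distr, simp, simp, subst emeasure_density)
           (auto intro!: nn_integral_cong simp: indicator_def space_pair_measure)
    qed
    also have "... = (\<integral>\<^sup>+z. ennreal (1 / (d - c)) * indicator ({l $ i <..< u $ i} \<times> box (upd i c l) (upd i d u)) z \<partial>(lborel \<Otimes>\<^sub>M lborel))"
    proof (rule nn_integral_cong)
      fix z :: "real \<times> (real^'n)"
      obtain r y where z: "z = (r, y)" by force
      have "(upd i r y \<in> box l u \<and> c < y $ i \<and> y $ i < d) \<longleftrightarrow> (r \<in> {l $ i <..< u $ i} \<and> y \<in> box (upd i c l) (upd i d u))"
        by (auto simp: mem_box_cart split: if_splits)
      thus "indicator (box l u) (case z of (r, y) => upd i r y) * w z = ennreal (1 / (d - c)) * indicator ({l $ i <..< u $ i} \<times> box (upd i c l) (upd i d u)) z"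
        by (auto simp: w_def z indicator_def)
    qed
    also have "... = ennreal (1 / (d - c)) * (emeasure lborel {l $ i <..< u $ i} * emeasure lborel (box (upd i c l) (upd i d u)))"
      by (subst nn_integral_cmult_indicator) (auto simp: lborel.emeasure_pair_measure_Times)
    also have "emeasure lborel (box (upd i c l) (upd i d u)) = ennreal (\<Prod>j\<in>UNIV. (upd i d u - upd i c l) $ j)"
      by (rule emeasure_lborel_box_cart) (use le cd in auto)
    also have "(\<Prod>j\<in>UNIV. (upd i d u - upd i c l) $ j) = (d - c) * (\<Prod>j\<in>UNIV - {i}. (u - l) $ j)"
      by (subst prod.remove[of UNIV i]) auto
    also have "ennreal (1 / (d - c)) * (emeasure lborel {l $ i <..< u $ i} * ennreal ((d - c) * (\<Prod>j\<in>UNIV - {i}. (u - l) $ j)))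
        = ennreal ((u - l) $ i * (\<Prod>j\<in>UNIV - {i}. (u - l) $ j))"
      using le cd by (simp add: ennreal_mult[symmetric] prod_nonneg)
    also have "(u - l) $ i * (\<Prod>j\<in>UNIV - {i}. (u - l) $ j) = (\<Prod>j\<in>UNIV. (u - l) $ j)"
      by (rule prod.remove[symmetric]) auto
    finally show "emeasure M (box l u) = ennreal (\<Prod>b\<in>Basis. (u - l) \<bullet> b)"
      by (simp only: prod_Basis_cart)
  qed (simp add: M_def)
  hence "(\<integral>\<^sup>+y. \<phi> y \<partial>lborel) = (\<integral>\<^sup>+y. \<phi> y \<partial>M)" by simp
  also have "... = (\<integral>\<^sup>+z. \<phi> (case z of (r, y) => upd i r y) \<partial>(density (lborel \<Otimes>\<^sub>M lborel) w))"
    unfolding M_def by (subst nn_integral_distr) auto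
  also have "... = (\<integral>\<^sup>+z. w z * \<phi> (case z of (r, y) => upd i r y) \<partial>(lborel \<Otimes>\<^sub>M lborel))"
    by (rule nn_integral_density) auto
  also have "... = (\<integral>\<^sup>+r. (\<integral>\<^sup>+y. w (r, y) * \<phi> (upd i r y) \<partial>lborel) \<partial>lborel)"
    by (subst lborel.nn_integral_fst[symmetric]) auto
  also have "... = (\<integral>\<^sup>+r. ennreal (1 / (d - c)) * (\<integral>\<^sup>+y. \<phi> (upd i r y) * indicator {y. c < y $ i \<and> y $ i < d} y \<partial>lborel) \<partial>lborel)"
  proof (rule nn_integral_cong)
    fix r :: real
    have [measurable]: "(\<lambda>y. upd i r y) \<in> borel_measurable (borel :: (real^'n) measure)"
      by (intro borel_measurable_continuous_onI continuous_intros)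
    show "(\<integral>\<^sup>+y. w (r, y) * \<phi> (upd i r y) \<partial>lborel) = ennreal (1 / (d - c)) * (\<integral>\<^sup>+y. \<phi> (upd i r y) * indicator {y. c < y $ i \<and> y $ i < d} y \<partial>lborel)"
      by (subst nn_integral_cmult[symmetric]) (auto simp: w_def mult_ac intro!: nn_integral_cong)
  qed
  also have "... = ennreal (1 / (d - c)) * (\<integral>\<^sup>+r. (\<integral>\<^sup>+y. \<phi> (upd i r y) * indicator {y. c < y $ i \<and> y $ i < d} y \<partial>lborel) \<partial>lborel)"
  proof (rule nn_integral_cmult)
    have "(\<lambda>(r, y). \<phi> (upd i r y) * indicator {y. c < y $ i \<and> y $ i < d} y) \<in> borel_measurable (lborel \<Otimes>\<^sub>M lborel)"
      by measurable
    from lborel.borel_measurable_nn_integral_fst[OF this]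
    show "(\<lambda>r. \<integral>\<^sup>+y. \<phi> (upd i r y) * indicator {y. c < y $ i \<and> y $ i < d} y \<partial>lborel) \<in> borel_measurable lborel" by simp
  qed
  finally have "(\<integral>\<^sup>+y. \<phi> y \<partial>lborel) = ennreal (1 / (d - c)) * (\<integral>\<^sup>+r. (\<integral>\<^sup>+y. \<phi> (upd i r y) * indicator {y. c < y $ i \<and> y $ i < d} y \<partial>lborel) \<partial>lborel)" .
  hence "ennreal (d - c) * (\<integral>\<^sup>+y. \<phi> y \<partial>lborel) = (ennreal (d - c) * ennreal (1 / (d - c))) * (\<integral>\<^sup>+r. (\<integral>\<^sup>+y. \<phi> (upd i r y) * indicator {y. c < y $ i \<and> y $ i < d} y \<partial>lborel) \<partial>lborel)"
    by (simp add: mult.assoc)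
  also have "ennreal (d - c) * ennreal (1 / (d - c)) = 1" using cd by (simp add: ennreal_mult[symmetric])
  finally show ?thesis by simp
qed

text \<open>Takes the place of Hoelder's inequality between exponents 1 and m + 1. After integration
  a suitable \<open>k\<close> recovers it up to a constant, and all terms stay linear in the
  integrated power.\<close>

lemma le_inverse_plus_power:
  fixes x k :: real
  assumes "x \<ge> 0" "k > 0"
  shows "x \<le> 1 / k + k ^ m * x ^ Suc m"
proof (cases "x \<le> 1 / k")
  case True
  thus ?thesis using assms by (simp add: add_increasing2)
next
  case False
  hence "k * x \<ge> 1" using assms by (simp add: field_simps)
  hence "x * 1 \<le> x * (k * x) ^ m" using assms by (intro mult_left_mono one_le_power) auto
  also have "... = k ^ m * x ^ Suc m" by (simp add: power_mult_distrib)
  finally show ?thesis using assms by (simp add: add_increasing)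
qed

text \<open>A Morrey estimate on the slice \<open>x\<^sub>i = r\<close>: the path \<open>x + \<tau>\<^sup>n (y - x)\<close> is parametrised so that
  the powers of \<open>\<tau>\<close> cancel after the substitution in \<open>y\<close>.\<close>

context
  fixes a :: "real^'n" and s \<beta> r :: real and i :: 'n and m :: nat
    and u :: "real^'n => real" and D :: "'n => real^'n => real"
  assumes s: "s > 0" and \<beta>: "\<beta> > 0" and m: "CARD('n) = Suc m"
    and der: "\<And>x. (u has_derivative (\<lambda>h. \<Sum>j\<in>UNIV. h $ j * D j x)) (at x)"
    and cont: "\<And>j. continuous_on UNIV (D j)"
    and bnd: "(\<integral>\<^sup>+y. ennreal ((\<Sum>j\<in>UNIV. \<bar>D j (upd i r y)\<bar>) ^ Suc m) * indicator (box a (a + vec s)) y \<partial>lborel) \<le> ennreal ((\<beta> * s) ^ Suc m)"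
begin

private definition "D' y = (\<Sum>j\<in>UNIV. \<bar>D j (upd i r y)\<bar>)"

private lemma cont_D': "continuous_on S f ==> continuous_on S (\<lambda>x. D' (f x))"
  unfolding D'_def
  by (intro continuous_intros continuous_on_compose2[OF cont]) auto

private lemma D'_nonneg: "0 \<le> D' y" by (simp add: D'_def sum_nonneg)

private lemma meas_D' [measurable]: "D' \<in> borel_measurable borel"
  by (intro borel_measurable_continuous_onI cont_D' continuous_intros)

text \<open>Contracts the slice coordinates towards x by the factor \<open>\<tau> ^ Suc m\<close>
  and leaves the dummy coordinate alone, so \<open>upd i r (T x \<tau> y)\<close> runs through the
  path from x to \<open>upd i r y\<close>.\<close>

private definition "T x (\<tau> :: real) y = (\<chi> j. if j = i then y $ j else x $ j + \<tau> ^ Suc m * (y $ j - x $ j))"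

private lemma cont_T: "continuous_on (S :: 'z::metric_space set) f ==> continuous_on S g ==> continuous_on S (\<lambda>z. T x (f z) (g z))"
proof -
  assume "continuous_on S f" "continuous_on S g"
  hence "continuous_on S (\<lambda>z. if j = i then g z $ j else x $ j + f z ^ Suc m * (g z $ j - x $ j))" for j
    by (cases "j = i") (auto intro!: continuous_intros simp del: power_Suc)
  thus ?thesis unfolding T_def by (rule continuous_on_vec_lambda)
qed

text \<open>The fundamental theorem of calculus along the path. Each coordinate moves with speed at
  most (m+1) \<tau>^m s, and coordinate i stays equal to r.\<close>

private lemma slice_path:
  assumes x: "x \<in> cbox a (a + vec s)" "x $ i = r" and y: "y \<in> box a (a + vec s)"
  shows "ennreal \<bar>u (upd i r y) - u x\<bar>
    \<le> (\<integral>\<^sup>+\<tau>. ennreal (Suc m * \<tau> ^ m * s * D' (T x \<tau> y)) * indicator {0..1} \<tau> \<partial>lborel)"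
proof -
  define \<gamma> where "\<gamma> \<tau> = x + \<tau> ^ Suc m *\<^sub>R (upd i r y - x)" for \<tau>
  have \<gamma>_eq: "\<gamma> \<tau> = upd i r (T x \<tau> y)" for \<tau>
    using x by (auto simp: \<gamma>_def vec_eq_iff T_def)
  define g where "g \<tau> = (\<Sum>j\<in>UNIV. (real (Suc m) * \<tau> ^ m * (upd i r y - x) $ j) * D j (\<gamma> \<tau>))" for \<tau>
  have d\<gamma>: "(\<gamma> has_derivative (\<lambda>h. (h * (real (Suc m) * \<tau> ^ m)) *\<^sub>R (upd i r y - x))) (at \<tau>)" for \<tau>
  proof -
    have "((\<lambda>\<tau>. \<tau> ^ Suc m) has_derivative (\<lambda>h. h * (real (Suc m) * \<tau> ^ m))) (at \<tau>)"
      using DERIV_pow[of "Suc m" \<tau>] by (simp add: has_field_derivative_def mult_commute_abs)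
    from has_derivative_scaleR_left[OF this, of "upd i r y - x"]
    show ?thesis unfolding \<gamma>_def using has_derivative_add[OF has_derivative_const[of x "at \<tau>"]] by fastforce
  qed
  have "((\<lambda>\<tau>. u (\<gamma> \<tau>)) has_derivative (\<lambda>h. \<Sum>j\<in>UNIV. ((h * (real (Suc m) * \<tau> ^ m)) *\<^sub>R (upd i r y - x)) $ j * D j (\<gamma> \<tau>))) (at \<tau>)" for \<tau>
    by (rule has_derivative_compose[OF d\<gamma> der])
  hence vd: "((\<lambda>\<tau>. u (\<gamma> \<tau>)) has_vector_derivative g \<tau>) (at \<tau> within {0..1})" for \<tau>
    unfolding has_vector_derivative_def g_def
    by (rule has_derivative_eq_rhs[OF has_derivative_at_withinI])
       (auto simp: fun_eq_iff sum_distrib_left mult_ac)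
  have I: "(g has_integral (u (\<gamma> 1) - u (\<gamma> 0))) {0..1}"
    by (rule fundamental_theorem_of_calculus) (auto intro: vd)
  define G where "G \<tau> = real (Suc m) * \<tau> ^ m * s * D' (T x \<tau> y)" for \<tau>
  have le: "norm (g \<tau>) \<le> G \<tau>" if "\<tau> \<in> {0..1}" for \<tau>
  proof -
    have "norm (g \<tau>) \<le> (\<Sum>j\<in>UNIV. (real (Suc m) * \<tau> ^ m * s) * \<bar>D j (\<gamma> \<tau>)\<bar>)"
      unfolding g_def
    proof (rule sum_norm_le)
      fix j
      have "\<bar>(upd i r y - x) $ j\<bar> \<le> s"
        using x y s by (auto simp: mem_box_cart abs_le_iff) (smt (verit, best))+
      thus "norm ((real (Suc m) * \<tau> ^ m * (upd i r y - x) $ j) * D j (\<gamma> \<tau>)) \<le> (real (Suc m) * \<tau> ^ m * s) * \<bar>D j (\<gamma> \<tau>)\<bar>"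
        using that by (simp add: abs_mult mult_left_mono mult_right_mono)
    qed
    also have "... = G \<tau>" by (simp add: G_def D'_def \<gamma>_eq sum_distrib_left)
    finally show ?thesis .
  qed
  have cG: "continuous_on {0..1} G"
    unfolding G_def by (intro continuous_intros cont_D' cont_T)
  hence iG: "G integrable_on {0..1}" by (rule integrable_continuous_interval)
  have Gnn: "0 \<le> G \<tau>" if "\<tau> \<in> {0..1}" for \<tau>
    using that s D'_nonneg by (simp add: G_def)
  have "\<bar>u (upd i r y) - u x\<bar> = norm (integral {0..1} g)"
    using I by (simp add: has_integral_iff \<gamma>_def)
  also have "... \<le> integral {0..1} G"
    by (rule integral_norm_bound_integral) (use I iG le in \<open>auto simp: has_integral_iff\<close>)
  finally have "ennreal \<bar>u (upd i r y) - u x\<bar> \<le> ennreal (integral {0..1} G)" by (rule ennreal_leI)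
  also have "... = (\<integral>\<^sup>+\<tau>. ennreal (G \<tau>) * indicator {0..1} \<tau> \<partial>lborel)"
    by (rule nn_integral_has_integral_lebesgue'[symmetric]) (use Gnn iG in \<open>auto simp: integrable_integral\<close>)
  finally show ?thesis by (simp add: G_def)
qed

text \<open>The substitution y -> T x \<tau> y scales m coordinates by \<tau>^(m+1), whence the
  factor \<tau>^((m+1)m). The image remains in the box by convexity, so the energy bound of the
  slice applies to it.\<close>

private lemma slice_scale:
  assumes x: "x \<in> cbox a (a + vec s)" and \<tau>: "0 < \<tau>" "\<tau> \<le> 1"
  shows "(\<integral>\<^sup>+y. ennreal (D' (T x \<tau> y) ^ Suc m) * indicator (box a (a + vec s)) y \<partial>lborel)
     \<le> ennreal (1 / \<tau> ^ (Suc m * m)) * ennreal ((\<beta> * s) ^ Suc m)"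
proof -
  define B where "B = box a (a + vec s)"
  define c where "c b = (if b = axis i (1::real) then 1 else \<tau> ^ Suc m)" for b :: "real^'n"
  define t where "t = (\<chi> j. if j = i then 0 else x $ j - \<tau> ^ Suc m * x $ j)"
  define \<phi> where "\<phi> y = ennreal (D' y ^ Suc m) * indicator B y" for y
  have [measurable]: "\<phi> \<in> borel_measurable borel" unfolding \<phi>_def B_def by measurable
  have Teq: "t + (\<Sum>b\<in>Basis. (c b * (y \<bullet> b)) *\<^sub>R b) = T x \<tau> y" for y
  proof -
    have "(\<Sum>b\<in>Basis. (c b * (y \<bullet> b)) *\<^sub>R b) $ j = (if j = i then y $ j else \<tau> ^ Suc m * y $ j)" for j
    proof -
      have "(\<Sum>b\<in>Basis. (c b * (y \<bullet> b)) *\<^sub>R b) \<bullet> axis j 1 = c (axis j 1) * (y \<bullet> axis j 1)"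
        by (subst inner_sum_left_Basis) (auto simp: axis_in_Basis_iff)
      thus ?thesis by (simp add: cart_eq_inner_axis[symmetric] c_def axis_eq_axis)
    qed
    thus ?thesis by (auto simp: vec_eq_iff T_def t_def algebra_simps)
  qed
  have pc: "(\<Prod>b\<in>Basis. \<bar>c b\<bar>) = \<tau> ^ (Suc m * m)"
  proof -
    have "(\<Prod>b\<in>(Basis :: (real^'n) set). \<bar>c b\<bar>) = \<bar>c (axis i 1)\<bar> * (\<Prod>b\<in>Basis - {axis i 1}. \<bar>c b\<bar>)"
      by (rule prod.remove) (auto simp: axis_in_Basis_iff)
    also have "(\<Prod>b\<in>Basis - {axis i (1::real)}. \<bar>c b\<bar>) = (\<Prod>b\<in>Basis - {axis i (1::real)}. \<tau> ^ Suc m)"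
      using \<tau> by (intro prod.cong) (auto simp: c_def)
    also have "... = (\<tau> ^ Suc m) ^ m"
      using m by (simp add: card_Diff_singleton axis_in_Basis_iff)
    finally show ?thesis by (simp add: c_def power_mult del: power_Suc mult_Suc)
  qed
  have TB: "T x \<tau> y \<in> B" if "y \<in> B" for y
  proof -
    have p: "0 < \<tau> ^ Suc m" "\<tau> ^ Suc m \<le> 1" using \<tau> by (auto simp: power_le_one simp del: power_Suc)
    have "a $ j < x $ j + \<tau> ^ Suc m * (y $ j - x $ j) \<and> x $ j + \<tau> ^ Suc m * (y $ j - x $ j) < a $ j + s" for j
    proof -
      define q where "q = \<tau> ^ Suc m"
      have h: "a $ j \<le> x $ j" "x $ j \<le> a $ j + s" "a $ j < y $ j" "y $ j < a $ j + s" "0 < q" "q \<le> 1"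
        using x that p by (auto simp: B_def mem_box_cart q_def)
      have "0 \<le> (1 - q) * (x $ j - a $ j)" "0 < q * (y $ j - a $ j)"
        "0 \<le> (1 - q) * (a $ j + s - x $ j)" "0 < q * (a $ j + s - y $ j)"
        using h by (auto intro!: mult_nonneg_nonneg mult_pos_pos)
      thus ?thesis unfolding q_def[symmetric] by (auto simp: algebra_simps)
    qed
    thus ?thesis using that by (auto simp: B_def mem_box_cart T_def)
  qed
  have [measurable]: "T x \<tau> \<in> borel_measurable borel"
    by (intro borel_measurable_continuous_onI cont_T continuous_intros)
  have "(\<integral>\<^sup>+y. \<phi> y \<partial>lborel) = (\<integral>\<^sup>+y. \<phi> y \<partial>(density (distr lborel borel (\<lambda>y. t + (\<Sum>b\<in>Basis. (c b * (y \<bullet> b)) *\<^sub>R b))) (\<lambda>_. (\<Prod>b\<in>Basis. \<bar>c b\<bar>))))"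
    by (subst lborel_affine_euclidean[symmetric]) (use \<tau> in \<open>auto simp: c_def\<close>)
  also have "... = ennreal (\<tau> ^ (Suc m * m)) * (\<integral>\<^sup>+y. \<phi> (T x \<tau> y) \<partial>lborel)"
    unfolding Teq pc by (simp add: nn_integral_density nn_integral_cmult nn_integral_distr)
  finally have eq: "(\<integral>\<^sup>+y. \<phi> y \<partial>lborel) = ennreal (\<tau> ^ (Suc m * m)) * (\<integral>\<^sup>+y. \<phi> (T x \<tau> y) \<partial>lborel)" .
  have "(\<integral>\<^sup>+y. ennreal (D' (T x \<tau> y) ^ Suc m) * indicator B y \<partial>lborel) \<le> (\<integral>\<^sup>+y. \<phi> (T x \<tau> y) \<partial>lborel)"
    by (rule nn_integral_mono) (use TB in \<open>auto simp: \<phi>_def indicator_def\<close>)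
  also have "... = ennreal (1 / \<tau> ^ (Suc m * m)) * (\<integral>\<^sup>+y. \<phi> y \<partial>lborel)"
  proof -
    have "ennreal (1 / \<tau> ^ (Suc m * m)) * ennreal (\<tau> ^ (Suc m * m)) = 1"
      using \<tau> by (simp add: ennreal_mult[symmetric])
    thus ?thesis unfolding eq mult.assoc[symmetric] by simp
  qed
  also have "... \<le> ennreal (1 / \<tau> ^ (Suc m * m)) * ennreal ((\<beta> * s) ^ Suc m)"
    using bnd by (intro mult_left_mono) (auto simp: \<phi>_def B_def D'_def)
  finally show ?thesis by (simp add: B_def)
qed

text \<open>Tonelli exchanges the integral along the paths with the integral over their endpoints.
  For fixed \<tau> the inner integral has a bound that no longer depends on \<tau>, so the outer one
  is trivial.\<close>

private lemma slice_mean: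
  assumes x: "x \<in> cbox a (a + vec s)" "x $ i = r"
  shows "(\<integral>\<^sup>+y. ennreal \<bar>u (upd i r y) - u x\<bar> * indicator (box a (a + vec s)) y \<partial>lborel)
     \<le> ennreal (2 * Suc m * s * \<beta> * s ^ Suc m)"
proof -
  define B where "B = box a (a + vec s)"
  have eB: "emeasure lborel B = ennreal (s ^ Suc m)"
    using s m by (simp add: B_def emeasure_lborel_box_cart)
  have [measurable]: "(\<lambda>(\<tau>, y). T x \<tau> y) \<in> borel_measurable (borel \<Otimes>\<^sub>M borel)"
    unfolding borel_prod
    by (intro borel_measurable_continuous_onI) (auto simp: case_prod_beta intro!: continuous_intros cont_T)
  have [measurable]: "B \<in> sets borel" by (simp add: B_def)
  have "(\<integral>\<^sup>+y. ennreal \<bar>u (upd i r y) - u x\<bar> * indicator B y \<partial>lborel)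
     \<le> (\<integral>\<^sup>+y. (\<integral>\<^sup>+\<tau>. ennreal (Suc m * \<tau> ^ m * s * D' (T x \<tau> y)) * indicator {0..1} \<tau> * indicator B y \<partial>lborel) \<partial>lborel)"
  proof (rule nn_integral_mono)
    fix y
    show "ennreal \<bar>u (upd i r y) - u x\<bar> * indicator B y \<le> (\<integral>\<^sup>+\<tau>. ennreal (Suc m * \<tau> ^ m * s * D' (T x \<tau> y)) * indicator {0..1} \<tau> * indicator B y \<partial>lborel)"
      using slice_path[OF x, of y] by (cases "y \<in> B") (auto simp: B_def)
  qed
  also have "... = (\<integral>\<^sup>+\<tau>. (\<integral>\<^sup>+y. ennreal (Suc m * \<tau> ^ m * s * D' (T x \<tau> y)) * indicator {0..1} \<tau> * indicator B y \<partial>lborel) \<partial>lborel)"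
    by (rule lborel_pair.Fubini') measurable
  also have "... \<le> (\<integral>\<^sup>+\<tau>. ennreal (2 * Suc m * s * \<beta> * s ^ Suc m) * indicator {0..1::real} \<tau> \<partial>lborel)"
  proof (rule nn_integral_mono_AE)
    have "AE \<tau> in lborel. \<tau> \<noteq> (0::real)" by (rule AE_lborel_singleton)
    thus "AE \<tau> in lborel. (\<integral>\<^sup>+y. ennreal (Suc m * \<tau> ^ m * s * D' (T x \<tau> y)) * indicator {0..1} \<tau> * indicator B y \<partial>lborel)
         \<le> ennreal (2 * Suc m * s * \<beta> * s ^ Suc m) * indicator {0..1} \<tau>"
    proof eventually_elim
      case (elim \<tau>)
      show ?case
      proof (cases "\<tau> \<in> {0..1}")
        case True
        hence \<tau>: "0 < \<tau>" "\<tau> \<le> 1" using elim by auto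
        \<comment> \<open>This value makes both terms of \<open>le_inverse_plus_power\<close>, once
          integrated, equal to \<beta> s^(m+1) / \<tau>^m. The speed factor \<tau>^m of the path
          cancels the denominator.\<close>
        define k where "k = \<tau> ^ m / \<beta>"
        have k: "k > 0" using \<tau> \<beta> by (simp add: k_def)
        have [measurable]: "T x \<tau> \<in> borel_measurable borel"
          by (intro borel_measurable_continuous_onI cont_T continuous_intros)
        have "(\<integral>\<^sup>+y. ennreal (D' (T x \<tau> y)) * indicator B y \<partial>lborel)
            \<le> (\<integral>\<^sup>+y. (ennreal (1 / k) * indicator B y + ennreal (k ^ m) * (ennreal (D' (T x \<tau> y) ^ Suc m) * indicator B y)) \<partial>lborel)"
        proof (rule nn_integral_mono)
          fix y
          have "ennreal (D' (T x \<tau> y)) \<le> ennreal (1 / k + k ^ m * D' (T x \<tau> y) ^ Suc m)"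
            by (intro ennreal_leI le_inverse_plus_power D'_nonneg k)
          also have "... = ennreal (1 / k) + ennreal (k ^ m) * ennreal (D' (T x \<tau> y) ^ Suc m)"
            using k D'_nonneg by (simp add: ennreal_plus ennreal_mult)
          finally show "ennreal (D' (T x \<tau> y)) * indicator B y \<le> ennreal (1 / k) * indicator B y + ennreal (k ^ m) * (ennreal (D' (T x \<tau> y) ^ Suc m) * indicator B y)"
            by (auto simp: indicator_def)
        qed
        also have "... = ennreal (1 / k) * ennreal (s ^ Suc m) + ennreal (k ^ m) * (\<integral>\<^sup>+y. ennreal (D' (T x \<tau> y) ^ Suc m) * indicator B y \<partial>lborel)"
          by (simp add: nn_integral_add nn_integral_cmult eB del: power_Suc)
        also have "... \<le> ennreal (1 / k) * ennreal (s ^ Suc m) + ennreal (k ^ m) * (ennreal (1 / \<tau> ^ (Suc m * m)) * ennreal ((\<beta> * s) ^ Suc m))"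
          using slice_scale[OF x(1) \<tau>] by (intro add_left_mono mult_left_mono) (auto simp: B_def)
        also have "... = ennreal (1 / k * s ^ Suc m + k ^ m * (1 / \<tau> ^ (Suc m * m) * (\<beta> * s) ^ Suc m))"
          using k \<tau> s \<beta> by (simp add: ennreal_plus[symmetric] ennreal_mult[symmetric] del: ennreal_plus power_Suc)
        also have "1 / k * s ^ Suc m + k ^ m * (1 / \<tau> ^ (Suc m * m) * (\<beta> * s) ^ Suc m) = 2 * \<beta> * s ^ Suc m / \<tau> ^ m"
        proof -
          have "\<tau> ^ (Suc m * m) = \<tau> ^ m * (\<tau> ^ m) ^ m" by (simp add: power_add power_mult)
          hence "k ^ m * (1 / \<tau> ^ (Suc m * m) * (\<beta> * s) ^ Suc m) = \<beta> * s ^ Suc m / \<tau> ^ m"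
            using \<tau> \<beta> by (simp add: k_def power_divide power_mult_distrib field_simps)
          thus ?thesis using \<tau> \<beta> by (simp add: k_def field_simps)
        qed
        finally have le: "(\<integral>\<^sup>+y. ennreal (D' (T x \<tau> y)) * indicator B y \<partial>lborel) \<le> ennreal (2 * \<beta> * s ^ Suc m / \<tau> ^ m)" .
        have "(\<integral>\<^sup>+y. ennreal (Suc m * \<tau> ^ m * s * D' (T x \<tau> y)) * indicator {0..1} \<tau> * indicator B y \<partial>lborel)
            = (\<integral>\<^sup>+y. ennreal (Suc m * \<tau> ^ m * s) * (ennreal (D' (T x \<tau> y)) * indicator B y) \<partial>lborel)"
          using True s by (intro nn_integral_cong) (auto simp: ennreal_mult D'_nonneg mult_ac indicator_def)
        also have "... = ennreal (Suc m * \<tau> ^ m * s) * (\<integral>\<^sup>+y. ennreal (D' (T x \<tau> y)) * indicator B y \<partial>lborel)"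
          by (rule nn_integral_cmult) measurable
        also have "... \<le> ennreal (Suc m * \<tau> ^ m * s) * ennreal (2 * \<beta> * s ^ Suc m / \<tau> ^ m)"
          using le by (intro mult_left_mono) auto
        also have "... = ennreal (2 * Suc m * s * \<beta> * s ^ Suc m)"
          using \<tau> s \<beta> by (simp add: ennreal_mult[symmetric] del: power_Suc)
        finally show ?thesis using True by simp
      qed auto
    qed
  qed
  also have "... = ennreal (2 * Suc m * s * \<beta> * s ^ Suc m)" by (simp add: nn_integral_cmult_indicator)
  finally show ?thesis by (simp add: B_def)
qed

text \<open>Both points are compared with u on the whole slice. Integration over the box, dummy
  coordinate included, produces its volume s^(m+1), which is then divided out.\<close>

lemma slice_oscillation:
  assumes x: "x \<in> cbox a (a + vec s)" "x $ i = r" and x': "x' \<in> cbox a (a + vec s)" "x' $ i = r"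
  shows "\<bar>u x - u x'\<bar> \<le> 4 * Suc m * s * \<beta>"
proof -
  define B where "B = box a (a + vec s)"
  have eB: "emeasure lborel B = ennreal (s ^ Suc m)"
    using s m by (simp add: B_def emeasure_lborel_box_cart)
  have [measurable]: "B \<in> sets borel" by (simp add: B_def)
  have cu: "continuous_on UNIV u"
    using der by (auto intro!: continuous_at_imp_continuous_on dest: has_derivative_continuous)
  have [measurable]: "(\<lambda>y. u (upd i r y)) \<in> borel_measurable borel"
    by (intro borel_measurable_continuous_onI continuous_on_compose2[OF cu] continuous_intros) auto
  have "ennreal \<bar>u x - u x'\<bar> * ennreal (s ^ Suc m) = (\<integral>\<^sup>+y. ennreal \<bar>u x - u x'\<bar> * indicator B y \<partial>lborel)"
    by (simp add: nn_integral_cmult_indicator eB del: power_Suc)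
  also have "... \<le> (\<integral>\<^sup>+y. (ennreal \<bar>u (upd i r y) - u x\<bar> * indicator B y + ennreal \<bar>u (upd i r y) - u x'\<bar> * indicator B y) \<partial>lborel)"
    by (rule nn_integral_mono) (auto simp: indicator_def ennreal_plus[symmetric] simp del: ennreal_plus intro!: ennreal_leI)
  also have "... = (\<integral>\<^sup>+y. ennreal \<bar>u (upd i r y) - u x\<bar> * indicator B y \<partial>lborel) + (\<integral>\<^sup>+y. ennreal \<bar>u (upd i r y) - u x'\<bar> * indicator B y \<partial>lborel)"
    by (rule nn_integral_add) measurable
  also have "... \<le> ennreal (2 * Suc m * s * \<beta> * s ^ Suc m) + ennreal (2 * Suc m * s * \<beta> * s ^ Suc m)"
    unfolding B_def by (intro add_mono slice_mean x x')
  also have "... = ennreal ((4 * Suc m * s * \<beta>) * s ^ Suc m)"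
    using s \<beta> by (simp add: ennreal_plus[symmetric] del: ennreal_plus power_Suc)
  finally have "\<bar>u x - u x'\<bar> * s ^ Suc m \<le> (4 * Suc m * s * \<beta>) * s ^ Suc m"
    using s \<beta> by (simp add: ennreal_mult[symmetric] del: power_Suc)
  thus ?thesis using s by (simp del: power_Suc)
qed

end

text \<open>The type argument carries the dimension, which the type of \<open>\<epsilon>\<close>
  does not determine.\<close>

definition mollifier_mass :: "'n::finite itself => real => real" where
  "mollifier_mass _ \<epsilon> = enn2real (\<integral>\<^sup>+w. ennreal (mollifier \<epsilon> (w :: real^'n)) \<partial>lborel)"

lemma mollifier_sym: "mollifier \<epsilon> (x - y) = mollifier \<epsilon> (y - x)"
  by (simp add: mollifier_def dot_square_norm norm_minus_commute)

context
  fixes \<epsilon> :: real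
  assumes \<epsilon>: "\<epsilon> > 0"
begin

lemma mollifier_mass_pos: "mollifier_mass TYPE('n::finite) \<epsilon> > 0"
  and mollifier_mass_eq: "(\<integral>\<^sup>+w. ennreal (mollifier \<epsilon> (w :: real^'n)) \<partial>lborel) = ennreal (mollifier_mass TYPE('n) \<epsilon>)"
proof -
  have "(\<integral>\<^sup>+w. ennreal (mollifier \<epsilon> (w :: real^'n)) \<partial>lborel) \<le> (\<integral>\<^sup>+w. indicator (cball 0 \<epsilon>) (w :: real^'n) \<partial>lborel)"
    using mollifier_le_1[of \<epsilon>] \<epsilon>
    by (intro nn_integral_mono) (auto simp: indicator_def mollifier_outside)
  also have "... < \<infinity>" using emeasure_bounded_finite[of "cball (0 :: real^'n) \<epsilon>"] by simp
  finally have fin: "(\<integral>\<^sup>+w. ennreal (mollifier \<epsilon> (w :: real^'n)) \<partial>lborel) < \<infinity>" .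
  have "(\<integral>\<^sup>+w. ennreal (mollifier \<epsilon> (w :: real^'n)) \<partial>lborel) \<noteq> 0"
  proof
    assume "(\<integral>\<^sup>+w. ennreal (mollifier \<epsilon> (w :: real^'n)) \<partial>lborel) = 0"
    hence "AE w in lborel. mollifier \<epsilon> (w :: real^'n) \<le> 0"
      by (subst (asm) nn_integral_0_iff_AE) (auto simp: ennreal_eq_0_iff)
    hence "AE w in lborel. w \<notin> ball (0 :: real^'n) \<epsilon>"
      by eventually_elim (use mollifier_pos[of _ \<epsilon>] in \<open>force simp: not_less\<close>)
    hence "emeasure lborel (ball (0 :: real^'n) \<epsilon>) = 0"
      by (subst (asm) AE_iff_measurable[OF _ refl]) (auto simp: ball_def)
    hence "ball (0 :: real^'n) \<epsilon> \<in> null_sets lebesgue" by (intro null_sets_completionI) auto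
    hence "negligible (ball (0 :: real^'n) \<epsilon>)" by (simp add: negligible_iff_null_sets)
    thus False using open_not_negligible[OF open_ball, of "0 :: real^'n" \<epsilon>] \<epsilon> by simp
  qed
  thus "mollifier_mass TYPE('n::finite) \<epsilon> > 0" using fin
    by (simp add: mollifier_mass_def enn2real_positive_iff zero_less_iff_neq_zero)
  show "(\<integral>\<^sup>+w. ennreal (mollifier \<epsilon> (w :: real^'n)) \<partial>lborel) = ennreal (mollifier_mass TYPE('n) \<epsilon>)"
    using fin by (simp add: mollifier_mass_def)
qed

lemma nn_integral_mollifier:
  "(\<integral>\<^sup>+y. ennreal (mollifier \<epsilon> (x - y)) \<partial>lborel) = ennreal (mollifier_mass TYPE('n) \<epsilon>)" for x :: "real^'n"
proof -
  have "(\<integral>\<^sup>+y. ennreal (mollifier \<epsilon> (x - y)) \<partial>lborel) = (\<integral>\<^sup>+y. ennreal (mollifier \<epsilon> (- x + y)) \<partial>lborel)"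
    by (intro nn_integral_cong) (simp add: mollifier_sym)
  also have "... = (\<integral>\<^sup>+w. ennreal (mollifier \<epsilon> w) \<partial>(distr lborel borel ((+) (- x))))"
    by (subst nn_integral_distr) auto
  finally show ?thesis by (simp add: lborel_distr_plus mollifier_mass_eq)
qed

text \<open>Jensen's inequality for the power m + 1 with the extra constant 2^(m+1), the price of
  deriving it from \<open>le_inverse_plus_power\<close>. The averaged \<open>g\<close> is only
  Lebesgue measurable; \<open>g'\<close> is a Borel version of it, and the two agree where the
  mollifier does not vanish.\<close>

lemma mollified_power_le:
  fixes g g' :: "real^'n => real" and x :: "real^'n"
  assumes g'[measurable]: "g' \<in> borel_measurable borel" and ae: "AE y in lebesgue. y \<in> U \<longrightarrow> g y = g' y"
    and x: "cball x \<epsilon> \<subseteq> U"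
  shows "ennreal (\<bar>(LINT y|lebesgue. g y * mollifier \<epsilon> (x - y)) / mollifier_mass TYPE('n) \<epsilon>\<bar> ^ Suc m)
    \<le> ennreal (2 ^ Suc m / mollifier_mass TYPE('n) \<epsilon>) * (\<integral>\<^sup>+y. ennreal (\<bar>g' y\<bar> ^ Suc m) * ennreal (mollifier \<epsilon> (x - y)) \<partial>lborel)"
proof -
  define c where "c = mollifier_mass TYPE('n) \<epsilon>"
  have c: "c > 0" unfolding c_def by (rule mollifier_mass_pos)
  define d where "d = (LINT y|lebesgue. g y * mollifier \<epsilon> (x - y))"
  define P where "P = (\<integral>\<^sup>+y. ennreal (\<bar>g' y\<bar> ^ Suc m) * ennreal (mollifier \<epsilon> (x - y)) \<partial>lborel)"
  have d_le: "ennreal \<bar>d\<bar> \<le> (\<integral>\<^sup>+y. ennreal (\<bar>g' y\<bar> * mollifier \<epsilon> (x - y)) \<partial>lborel)"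
  proof (cases "integrable lebesgue (\<lambda>y. g y * mollifier \<epsilon> (x - y))")
    case True
    have "ennreal \<bar>d\<bar> \<le> (\<integral>\<^sup>+y. ennreal (norm (g y * mollifier \<epsilon> (x - y))) \<partial>lebesgue)"
      using integral_norm_bound_ennreal[OF True] by (simp add: d_def)
    also have "... = (\<integral>\<^sup>+y. ennreal (\<bar>g' y\<bar> * mollifier \<epsilon> (x - y)) \<partial>lebesgue)"
    proof (rule nn_integral_cong_AE, use ae in eventually_elim)
      case (elim y)
      show ?case
      proof (cases "y \<in> U")
        case False
        hence "norm (x - y) \<ge> \<epsilon>" using x by (force simp: dist_norm)
        thus ?thesis using \<epsilon> by (simp add: mollifier_outside)
      qed (use elim in \<open>simp add: abs_mult mollifier_nonneg\<close>)
    qed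
    finally show ?thesis by (simp add: nn_integral_completion)
  \<comment> \<open>If the product is not integrable, the Bochner integral \<open>d\<close> is 0 by
    convention.\<close>
  qed (simp add: d_def not_integrable_integral_eq)
  show ?thesis
  proof (cases "P = \<infinity>")
    case True
    thus ?thesis unfolding P_def[symmetric] using c by (simp add: ennreal_mult_top c_def)
  next
    case False
    then obtain B where B: "P = ennreal B" "B \<ge> 0" by (cases P rule: ennreal_cases) auto
    have key: "\<bar>d\<bar> / c \<le> 1 / k + k ^ m * (B / c)" if k: "k > 0" for k
    proof -
      have "ennreal \<bar>d\<bar> \<le> (\<integral>\<^sup>+y. (ennreal (1 / k) * ennreal (mollifier \<epsilon> (x - y)) + ennreal (k ^ m) * (ennreal (\<bar>g' y\<bar> ^ Suc m) * ennreal (mollifier \<epsilon> (x - y)))) \<partial>lborel)"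
      proof (rule order_trans[OF d_le nn_integral_mono])
        fix y
        have "\<bar>g' y\<bar> * mollifier \<epsilon> (x - y) \<le> (1 / k + k ^ m * \<bar>g' y\<bar> ^ Suc m) * mollifier \<epsilon> (x - y)"
          by (intro mult_right_mono le_inverse_plus_power k mollifier_nonneg) auto
        hence "ennreal (\<bar>g' y\<bar> * mollifier \<epsilon> (x - y)) \<le> ennreal ((1 / k + k ^ m * \<bar>g' y\<bar> ^ Suc m) * mollifier \<epsilon> (x - y))"
          by (rule ennreal_leI)
        also have "... = ennreal (1 / k) * ennreal (mollifier \<epsilon> (x - y)) + ennreal (k ^ m) * (ennreal (\<bar>g' y\<bar> ^ Suc m) * ennreal (mollifier \<epsilon> (x - y)))"
          using k mollifier_nonneg[of \<epsilon> "x - y"]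
          by (simp add: ennreal_plus[symmetric] ennreal_mult[symmetric] algebra_simps del: ennreal_plus power_Suc)
        finally show "ennreal (\<bar>g' y\<bar> * mollifier \<epsilon> (x - y)) \<le> ennreal (1 / k) * ennreal (mollifier \<epsilon> (x - y)) + ennreal (k ^ m) * (ennreal (\<bar>g' y\<bar> ^ Suc m) * ennreal (mollifier \<epsilon> (x - y)))" .
      qed
      also have "... = ennreal (1 / k) * ennreal c + ennreal (k ^ m) * ennreal B"
        unfolding B(1)[symmetric] P_def by (simp add: nn_integral_add nn_integral_cmult nn_integral_mollifier c_def del: power_Suc)
      also have "... = ennreal (c / k + k ^ m * B)"
        using k c B by (simp add: ennreal_plus[symmetric] ennreal_mult[symmetric] del: ennreal_plus)
      finally have "\<bar>d\<bar> \<le> c / k + k ^ m * B" using k c B by (subst (asm) ennreal_le_iff) auto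
      hence "\<bar>d\<bar> / c \<le> (c / k + k ^ m * B) / c" using c by (intro divide_right_mono) auto
      thus ?thesis using c by (simp add: add_divide_distrib)
    qed
    have "(\<bar>d\<bar> / c) ^ Suc m \<le> 2 ^ Suc m * (B / c)"
    proof (cases "d = 0")
      case True thus ?thesis using B c by simp
    next
      case False
      define a where "a = \<bar>d\<bar> / c"
      have a: "a > 0" using False c by (simp add: a_def)
      \<comment> \<open>The choice \<open>k = 2 / a\<close> turns the first term into
        \<open>a / 2\<close>, which is absorbed on the left.\<close>
      have "a \<le> 1 / (2 / a) + (2 / a) ^ m * (B / c)"
        unfolding a_def by (rule key) (use a in \<open>simp add: a_def[symmetric]\<close>)
      also have "1 / (2 / a) = a / 2" by simp
      finally have "a / 2 \<le> (2 / a) ^ m * (B / c)" by linarith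
      hence "(a / 2) * (a / 2) ^ m \<le> ((2 / a) ^ m * (B / c)) * (a / 2) ^ m" using a by (intro mult_right_mono) auto
      also have "... = B / c * ((2 / a) * (a / 2)) ^ m" by (simp only: power_mult_distrib mult_ac)
      also have "(2 / a) * (a / 2) = 1" using a by simp
      finally have "(a / 2) ^ Suc m \<le> B / c" by simp
      thus ?thesis unfolding a_def[symmetric] by (simp add: power_divide field_simps)
    qed
    hence "ennreal (\<bar>d / c\<bar> ^ Suc m) \<le> ennreal (2 ^ Suc m / c * B)"
      using c by (intro ennreal_leI) (simp add: abs_divide)
    also have "... = ennreal (2 ^ Suc m / c) * P"
      unfolding B(1) using B(2) c by (intro ennreal_mult) auto
    finally show ?thesis by (simp add: P_def c_def d_def)
  qed
qed

lemma nn_integral_mollified_power_le: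
  fixes h :: "real^'n => ennreal"
  assumes [measurable]: "h \<in> borel_measurable borel" "A \<in> sets borel" "A' \<in> sets borel"
    and A': "\<And>x y. x \<in> A ==> dist x y \<le> \<epsilon> ==> y \<in> A'"
  shows "(\<integral>\<^sup>+x. (\<integral>\<^sup>+y. h y * ennreal (mollifier \<epsilon> (x - y)) \<partial>lborel) * indicator A x \<partial>lborel)
    \<le> ennreal (mollifier_mass TYPE('n) \<epsilon>) * (\<integral>\<^sup>+y. h y * indicator A' y \<partial>lborel)"
proof -
  have [measurable]: "(\<lambda>(x, y). mollifier \<epsilon> (x - y)) \<in> borel_measurable (borel \<Otimes>\<^sub>M (borel :: (real^'n) measure))"
    unfolding borel_prod
    by (intro borel_measurable_continuous_onI) (auto simp: case_prod_beta intro!: continuous_intros)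
  have "(\<integral>\<^sup>+x. (\<integral>\<^sup>+y. h y * ennreal (mollifier \<epsilon> (x - y)) \<partial>lborel) * indicator A x \<partial>lborel)
      = (\<integral>\<^sup>+x. (\<integral>\<^sup>+y. h y * ennreal (mollifier \<epsilon> (x - y)) * indicator A x \<partial>lborel) \<partial>lborel)"
    by (intro nn_integral_cong nn_integral_multc[symmetric]) measurable
  also have "... = (\<integral>\<^sup>+y. (\<integral>\<^sup>+x. h y * ennreal (mollifier \<epsilon> (x - y)) * indicator A x \<partial>lborel) \<partial>lborel)"
    by (rule lborel_pair.Fubini') measurable
  also have "... \<le> (\<integral>\<^sup>+y. ennreal (mollifier_mass TYPE('n) \<epsilon>) * (h y * indicator A' y) \<partial>lborel)"
  proof (rule nn_integral_mono)
    fix y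
    have "(\<integral>\<^sup>+x. h y * ennreal (mollifier \<epsilon> (x - y)) * indicator A x \<partial>lborel)
        \<le> (\<integral>\<^sup>+x. (h y * indicator A' y) * ennreal (mollifier \<epsilon> (y - x)) \<partial>lborel)"
    proof (rule nn_integral_mono)
      fix x
      show "h y * ennreal (mollifier \<epsilon> (x - y)) * indicator A x \<le> (h y * indicator A' y) * ennreal (mollifier \<epsilon> (y - x))"
      proof (cases "x \<in> A \<and> y \<notin> A'")
        case True
        hence "norm (x - y) \<ge> \<epsilon>" using A'[of x y] by (force simp: dist_norm)
        thus ?thesis using \<epsilon> by (simp add: mollifier_outside)
      qed (auto simp: indicator_def mollifier_sym)
    qed
    also have "... = (h y * indicator A' y) * ennreal (mollifier_mass TYPE('n) \<epsilon>)"
      by (simp add: nn_integral_cmult nn_integral_mollifier)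
    finally show "(\<integral>\<^sup>+x. h y * ennreal (mollifier \<epsilon> (x - y)) * indicator A x \<partial>lborel)
        \<le> ennreal (mollifier_mass TYPE('n) \<epsilon>) * (h y * indicator A' y)" by (simp add: mult.commute)
  qed
  also have "... = ennreal (mollifier_mass TYPE('n) \<epsilon>) * (\<integral>\<^sup>+y. h y * indicator A' y \<partial>lborel)"
    by (rule nn_integral_cmult) measurable
  finally show ?thesis .
qed

end

section \<open>Oscillation of a Sobolev function on coordinate slices\<close>

lemma sum_power_le:
  fixes f :: "'i::finite => real"
  assumes "\<And>i. 0 \<le> f i"
  shows "(\<Sum>i\<in>UNIV. f i) ^ k \<le> real CARD('i) ^ k * (\<Sum>i\<in>UNIV. f i ^ k)"
proof -
  define M where "M = Max (range f)"
  have "M \<in> range f" unfolding M_def by (rule Max_in) auto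
  then obtain j where j: "M = f j" by auto
  have "(\<Sum>i\<in>UNIV. f i) \<le> real CARD('i) * M"
    using sum_bounded_above[of UNIV f M] by (simp add: M_def)
  hence "(\<Sum>i\<in>UNIV. f i) ^ k \<le> (real CARD('i) * M) ^ k"
    using assms by (intro power_mono sum_nonneg) auto
  also have "... = real CARD('i) ^ k * f j ^ k" by (simp add: power_mult_distrib j)
  also have "f j ^ k \<le> (\<Sum>i\<in>UNIV. f i ^ k)"
    using assms by (intro member_le_sum) auto
  finally show ?thesis by (simp add: mult_left_mono)
qed

text \<open>The premise covers only positive \<open>b\<close>, because the slice estimate divides by
  its parameter. The root of I, possibly 0, is therefore approached from above.\<close>

lemma real_power_le_from_root:
  assumes "v \<ge> 0" "I \<ge> 0" "c \<ge> 0" "\<And>b. b > 0 ==> I \<le> b ^ Suc m ==> v \<le> c * b"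
  shows "v ^ Suc m \<le> c ^ Suc m * (I :: real)"
proof -
  define b where "b = root (Suc m) I"
  have b: "b \<ge> 0" "b ^ Suc m = I" using assms by (auto simp: b_def real_root_pow_pos2 simp del: power_Suc)
  have "v \<le> c * (b + \<delta>)" if "\<delta> > 0" for \<delta>
    using b that by (intro assms(4)) (auto intro!: power_mono simp: b(2)[symmetric] simp del: power_Suc)
  note * = this
  have "v \<le> c * b + e" if "e > 0" for e
  proof (cases "c = 0")
    case False
    hence "c > 0" using assms by simp
    thus ?thesis using *[of "e / c"] that by (simp add: distrib_left)
  next
    case True
    thus ?thesis using *[of 1] that by simp
  qed
  hence "v \<le> c * b" by (rule field_le_epsilon)
  hence "v ^ Suc m \<le> (c * b) ^ Suc m" using assms by (intro power_mono) auto
  thus ?thesis using b by (simp only: power_mult_distrib)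
qed

lemma dist_le_cbox_enlarge:
  fixes a b :: "real^'n"
  assumes "x \<in> cbox a b" "dist x y \<le> e"
  shows "y \<in> cbox (a - vec e) (b + vec e)"
proof -
  have "\<bar>(x - y) $ j\<bar> \<le> e" for j
    using component_le_norm_cart[of "x - y" j] assms(2) by (simp add: dist_norm)
  thus ?thesis using assms(1) by (simp add: mem_box_cart abs_le_iff) (smt (verit, best))
qed

lemma cbox_enlarge_subset_open:
  fixes a b :: "real^'n"
  assumes "open U" "cbox a b \<subseteq> U" "cbox a b \<noteq> {}"
  obtains e where "e > 0" "cbox (a - vec e) (b + vec e) \<subseteq> U"
proof -
  obtain d where d: "d > 0" "(\<Union>x\<in>cbox a b. ball x d) \<subseteq> U"
    using compact_subset_open_imp_ball_epsilon_subset[OF compact_cbox assms(1,2)] .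
  \<comment> \<open>The norm is at most the sum of n coordinates, each off by at most e; the factor
    2 makes the total strictly less than d.\<close>
  define e where "e = d / (2 * real CARD('n))"
  have e: "e > 0" using d by (simp add: e_def)
  have ab: "a $ j \<le> b $ j" for j using assms(3) by (auto simp: interval_eq_empty_cart not_less)
  have "y \<in> U" if "y \<in> cbox (a - vec e) (b + vec e)" for y
  proof -
    define x where "x = (\<chi> j. min (max (y $ j) (a $ j)) (b $ j))"
    have x: "x \<in> cbox a b" using ab by (auto simp: x_def mem_box_cart)
    have "\<bar>(x - y) $ j\<bar> \<le> e" for j
    proof -
      have "a $ j - e \<le> y $ j" "y $ j \<le> b $ j + e" using that by (auto simp: mem_box_cart)
      thus ?thesis using ab[of j] e unfolding x_def by (auto simp: min_def max_def)
    qed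
    hence "norm (x - y) \<le> (\<Sum>j\<in>(UNIV :: 'n set). e)"
      by (intro order_trans[OF norm_le_l1_cart] sum_mono)
    also have "... < d" using d by (simp add: e_def)
    finally have "y \<in> ball x d" by (simp add: dist_norm)
    thus ?thesis using d x by blast
  qed
  thus ?thesis using that e by blast
qed

lemma mollify_tendsto:
  fixes u :: "real^'n => real"
  assumes cont: "continuous_on (cbox a b) u" and \<epsilon>: "\<And>k. \<epsilon> k > 0" "\<epsilon> \<longlonglongrightarrow> 0"
    and x: "\<And>k. cball x (\<epsilon> k) \<subseteq> cbox a b"
  shows "(\<lambda>k. integral (cbox a b) (\<lambda>t. u t * mollifier (\<epsilon> k) (x - t)) / mollifier_mass TYPE('n) (\<epsilon> k)) \<longlonglongrightarrow> u x"
proof (rule LIMSEQ_I)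
  fix r :: real assume r: "r > 0"
  have "x \<in> cbox a b" using x[of 0] \<epsilon>(1)[of 0] by (auto simp: less_imp_le)
  then obtain d where d: "d > 0" "\<And>t. t \<in> cbox a b ==> dist t x < d ==> dist (u t) (u x) < r / 2"
    using cont r unfolding continuous_on_iff by (meson half_gt_zero)
  have "\<forall>\<^sub>F k in sequentially. \<epsilon> k < d" using order_tendstoD(2)[OF \<epsilon>(2) d(1)] .
  then obtain N where N: "\<And>k. k \<ge> N ==> \<epsilon> k < d" unfolding eventually_sequentially by blast
  have "norm (integral (cbox a b) (\<lambda>t. u t * mollifier (\<epsilon> k) (x - t)) / mollifier_mass TYPE('n) (\<epsilon> k) - u x) < r" if "k \<ge> N" for k
  proof -
    define c where "c = mollifier_mass TYPE('n) (\<epsilon> k)"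
    have c: "c > 0" unfolding c_def by (rule mollifier_mass_pos[OF \<epsilon>(1)])
    have out: "mollifier (\<epsilon> k) (x - t) = 0" if "t \<notin> cbox a b" for t
    proof -
      have "norm (x - t) \<ge> \<epsilon> k" using that x[of k] by (force simp: dist_norm)
      thus ?thesis using \<epsilon>(1)[of k] by (simp add: mollifier_outside)
    qed
    have ione: "((\<lambda>t. mollifier (\<epsilon> k) (x - t)) has_integral c) (cbox a b)"
    proof -
      have i: "(\<lambda>t. mollifier (\<epsilon> k) (x - t)) integrable_on cbox a b"
        by (intro integrable_continuous continuous_intros)
      have "ennreal (integral (cbox a b) (\<lambda>t. mollifier (\<epsilon> k) (x - t))) = (\<integral>\<^sup>+t. ennreal (mollifier (\<epsilon> k) (x - t)) * indicator (cbox a b) t \<partial>lborel)"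
        by (rule nn_integral_has_integral_lebesgue'[symmetric]) (use i in \<open>auto simp: mollifier_nonneg integrable_integral\<close>)
      also have "... = (\<integral>\<^sup>+t. ennreal (mollifier (\<epsilon> k) (x - t)) \<partial>lborel)"
        by (intro nn_integral_cong) (use out in \<open>auto simp: indicator_def\<close>)
      also have "... = ennreal c" unfolding c_def by (rule nn_integral_mollifier[OF \<epsilon>(1)])
      finally have "integral (cbox a b) (\<lambda>t. mollifier (\<epsilon> k) (x - t)) = c"
        using c by (subst (asm) ennreal_inj) (auto intro!: integral_nonneg i mollifier_nonneg)
      thus ?thesis using i by (simp add: has_integral_iff)
    qed
    have i2: "(\<lambda>t. u t * mollifier (\<epsilon> k) (x - t)) integrable_on cbox a b"
      by (intro integrable_continuous continuous_intros cont)
    have "((\<lambda>t. u t * mollifier (\<epsilon> k) (x - t) - u x * mollifier (\<epsilon> k) (x - t)) has_integral (integral (cbox a b) (\<lambda>t. u t * mollifier (\<epsilon> k) (x - t)) - u x * c)) (cbox a b)"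
      by (intro has_integral_diff integrable_integral i2 has_integral_mult_right ione)
    moreover have "((\<lambda>t. r / 2 * mollifier (\<epsilon> k) (x - t)) has_integral (r / 2 * c)) (cbox a b)"
      by (intro has_integral_mult_right ione)
    moreover have "norm (u t * mollifier (\<epsilon> k) (x - t) - u x * mollifier (\<epsilon> k) (x - t)) \<le> r / 2 * mollifier (\<epsilon> k) (x - t)" if "t \<in> cbox a b" for t
    proof (cases "dist t x < d")
      case True
      have "norm (u t * mollifier (\<epsilon> k) (x - t) - u x * mollifier (\<epsilon> k) (x - t)) = dist (u t) (u x) * mollifier (\<epsilon> k) (x - t)"
        by (simp add: left_diff_distrib[symmetric] abs_mult dist_norm mollifier_nonneg)
      also have "... \<le> r / 2 * mollifier (\<epsilon> k) (x - t)"
        using d(2)[OF that True] by (intro mult_right_mono) (auto simp: mollifier_nonneg)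
      finally show ?thesis .
    next
      case False
      hence "norm (x - t) \<ge> \<epsilon> k" using N[OF \<open>k \<ge> N\<close>] by (simp add: dist_norm norm_minus_commute)
      thus ?thesis using \<epsilon>(1)[of k] by (simp add: mollifier_outside)
    qed
    ultimately have "norm (integral (cbox a b) (\<lambda>t. u t * mollifier (\<epsilon> k) (x - t)) - u x * c) \<le> r / 2 * c"
      by (metis (no_types, lifting) has_integral_iff integral_norm_bound_integral)
    hence "\<bar>integral (cbox a b) (\<lambda>t. u t * mollifier (\<epsilon> k) (x - t)) / c - u x\<bar> \<le> r / 2"
    proof -
      have "integral (cbox a b) (\<lambda>t. u t * mollifier (\<epsilon> k) (x - t)) / c - u x = (integral (cbox a b) (\<lambda>t. u t * mollifier (\<epsilon> k) (x - t)) - u x * c) / c"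
        using c by (simp add: field_simps)
      thus ?thesis using \<open>norm (integral (cbox a b) _ - _) \<le> _\<close> c by (simp add: abs_divide pos_divide_le_eq)
    qed
    thus ?thesis using r by (simp add: c_def)
  qed
  thus "\<exists>no. \<forall>n\<ge>no. norm (integral (cbox a b) (\<lambda>t. u t * mollifier (\<epsilon> n) (x - t)) / mollifier_mass TYPE('n) (\<epsilon> n) - u x) < r" by blast
qed

text \<open>The smooth estimate holds on every slice of every mollification, with the slice energy
  on the right. Passing to the limit inferior of these energies gives a bound for u itself on every
  slice, possibly infinite, and Fatou's lemma controls its integral. No convergence of gradients on
  individual slices enters.\<close>

lemma sobolev_slice_oscillation:
  fixes u :: "real^'n => real" and g g' :: "'n => real^'n => real"
  assumes U: "open U" "continuous_on U u" and Q: "cbox a (a + vec s) \<subseteq> U" and s: "s > 0"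
    and m: "CARD('n) = Suc m" and wp: "\<And>j. weak_partial U j u (g j)"
    and g'[measurable]: "\<And>j. g' j \<in> borel_measurable borel"
    and ae: "\<And>j. AE y in lebesgue. y \<in> U \<longrightarrow> g j y = g' j y"
    and loc: "\<And>j K. compact K ==> K \<subseteq> U ==> (\<integral>\<^sup>+y. ennreal (\<bar>g' j y\<bar> ^ Suc m) * indicator K y \<partial>lborel) < \<infinity>"
  obtains \<omega> :: "real => ennreal" where "\<omega> \<in> borel_measurable borel"
    "\<And>x x'. x \<in> cbox a (a + vec s) ==> x' \<in> cbox a (a + vec s) ==> x $ i = x' $ i ==> ennreal (\<bar>u x - u x'\<bar> ^ Suc m) \<le> \<omega> (x $ i)"
    "(\<integral>\<^sup>+r. \<omega> r * indicator {a $ i <..< a $ i + s} r \<partial>lborel)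
       \<le> ennreal ((8 * real (Suc m) * real (Suc m)) ^ Suc m * s) * (\<integral>\<^sup>+y. (\<Sum>j\<in>UNIV. ennreal (\<bar>g' j y\<bar> ^ Suc m)) * indicator (cbox a (a + vec s)) y \<partial>lborel)"
proof -
  let ?Q = "cbox a (a + vec s)" and ?B = "box a (a + vec s)"
  have ne: "?Q \<noteq> {}" using s by (auto simp: interval_eq_empty_cart not_less)
  obtain e0 where e0: "e0 > 0" "cbox (a - vec e0) (a + vec s + vec e0) \<subseteq> U"
    using cbox_enlarge_subset_open[OF U(1) Q ne] .
  define A b where "A = a - vec e0" and "b = a + vec s + vec e0"
  have AbU: "cbox A b \<subseteq> U" using e0 by (simp add: A_def b_def)
  have contA: "continuous_on (cbox A b) u" using U(2) AbU by (rule continuous_on_subset)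
  define \<epsilon> where "\<epsilon> k = e0 / real (Suc k)" for k
  have \<epsilon>: "\<epsilon> k > 0" "\<epsilon> k \<le> e0" for k using e0 by (auto simp: \<epsilon>_def field_simps)
  have \<epsilon>0: "\<epsilon> \<longlonglongrightarrow> 0" unfolding \<epsilon>_def by (rule lim_const_over_n[of e0, THEN LIMSEQ_Suc])
  define c where "c k = mollifier_mass TYPE('n) (\<epsilon> k)" for k
  have c: "c k > 0" for k unfolding c_def by (rule mollifier_mass_pos[OF \<epsilon>(1)])
  have cb: "cball x (\<epsilon> k) \<subseteq> cbox A b" if "x \<in> ?Q" for x k
    using dist_le_cbox_enlarge[OF that, of _ e0] \<epsilon>(2)[of k] by (auto simp: A_def b_def)
  define v where "v k x = integral (cbox A b) (\<lambda>t. u t * mollifier (\<epsilon> k) (x - t)) / c k" for k x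
  define D where "D k j x = integral (cbox A b) (\<lambda>t. u t * (dmollifier (\<epsilon> k) (x - t) * (x - t) $ j)) / c k" for k j x
  have dv: "(v k has_derivative (\<lambda>h. \<Sum>j\<in>UNIV. h $ j * D k j x)) (at x)" for k x
    using has_derivative_mult_right[OF mollify_has_derivative[OF contA, of "\<epsilon> k" x], of "1 / c k"]
    unfolding v_def D_def by (simp add: sum_distrib_left mult_ac)
  have cD: "continuous_on UNIV (D k j)" for k j
    unfolding D_def using c[of k] by (intro continuous_intros mollify_derivative_continuous contA) auto
  have [measurable]: "D k j \<in> borel_measurable borel" for k j
    by (rule borel_measurable_continuous_onI[OF cD])
  define \<phi> where "\<phi> k y = ennreal ((\<Sum>j\<in>UNIV. \<bar>D k j y\<bar>) ^ Suc m)" for k y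
  have [measurable]: "\<phi> k \<in> borel_measurable borel" for k unfolding \<phi>_def by measurable
  define I where "I k r = (\<integral>\<^sup>+y. \<phi> k (upd i r y) * indicator ?B y \<partial>lborel)" for k r
  have [measurable]: "I k \<in> borel_measurable borel" for k
  proof -
    have "(\<lambda>(r, y). \<phi> k (upd i r y) * indicator ?B y) \<in> borel_measurable (lborel \<Otimes>\<^sub>M lborel)" by measurable
    from lborel.borel_measurable_nn_integral_fst[OF this] show ?thesis by (simp add: I_def[abs_def])
  qed
  have osc: "ennreal (\<bar>v k x - v k x'\<bar> ^ Suc m) \<le> ennreal ((4 * Suc m) ^ Suc m) * I k (x $ i)"
    if "x \<in> ?Q" "x' \<in> ?Q" "x $ i = x' $ i" for k x x'
  proof (cases "I k (x $ i) = \<infinity>")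
    case False
    then obtain J where J: "I k (x $ i) = ennreal J" "J \<ge> 0" by (cases "I k (x $ i)" rule: ennreal_cases) auto
    have "\<bar>v k x - v k x'\<bar> ^ Suc m \<le> (4 * real (Suc m)) ^ Suc m * J"
    proof (rule real_power_le_from_root)
      fix b :: real assume b: "b > 0" "J \<le> b ^ Suc m"
      have "\<bar>v k x - v k x'\<bar> \<le> real (4 * Suc m) * s * (b / s)"
      proof (rule slice_oscillation[OF s _ m dv cD])
        show "(\<integral>\<^sup>+y. ennreal ((\<Sum>j\<in>UNIV. \<bar>D k j (upd i (x $ i) y)\<bar>) ^ Suc m) * indicator ?B y \<partial>lborel) \<le> ennreal ((b / s * s) ^ Suc m)"
          using J b s unfolding I_def \<phi>_def by (simp add: ennreal_leI del: power_Suc)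
      qed (use b s that in auto)
      thus "\<bar>v k x - v k x'\<bar> \<le> 4 * real (Suc m) * b" using s by simp
    qed (use J in auto)
    thus ?thesis using J by (simp add: ennreal_mult[symmetric] ennreal_leI del: power_Suc)
  qed (simp add: ennreal_mult_top)
  \<comment> \<open>Pointwise convergence of the mollifications makes the left side converge, so
    only the right side has to be a limit inferior.\<close>
  define \<omega> where "\<omega> r = liminf (\<lambda>k. ennreal ((4 * Suc m) ^ Suc m) * I k r)" for r
  have \<omega>m: "\<omega> \<in> borel_measurable borel" unfolding \<omega>_def by measurable
  have \<omega>1: "ennreal (\<bar>u x - u x'\<bar> ^ Suc m) \<le> \<omega> (x $ i)" if "x \<in> ?Q" "x' \<in> ?Q" "x $ i = x' $ i" for x x'
  proof -
    have "(\<lambda>k. v k y) \<longlonglongrightarrow> u y" if "y \<in> ?Q" for y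
      unfolding v_def c_def by (rule mollify_tendsto[OF contA \<epsilon>(1) \<epsilon>0 cb[OF that]])
    hence "(\<lambda>k. ennreal (\<bar>v k x - v k x'\<bar> ^ Suc m)) \<longlonglongrightarrow> ennreal (\<bar>u x - u x'\<bar> ^ Suc m)"
      using that by (intro tendsto_ennrealI tendsto_power tendsto_rabs tendsto_diff) auto
    hence "ennreal (\<bar>u x - u x'\<bar> ^ Suc m) = liminf (\<lambda>k. ennreal (\<bar>v k x - v k x'\<bar> ^ Suc m))"
      by (intro lim_imp_Liminf[symmetric]) auto
    also have "... \<le> \<omega> (x $ i)" unfolding \<omega>_def by (intro Liminf_mono always_eventually allI osc that)
    finally show ?thesis .
  qed
  define h where "h y = (\<Sum>j\<in>UNIV. ennreal (\<bar>g' j y\<bar> ^ Suc m))" for y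
  have [measurable]: "h \<in> borel_measurable borel" unfolding h_def by measurable
  \<comment> \<open>Averages at points of the box see the gradient at distance up to
    \<open>\<epsilon> k\<close>, hence on a slightly larger cube.\<close>
  define Qk where "Qk k = cbox (a - vec (\<epsilon> k)) (a + vec s + vec (\<epsilon> k))" for k
  have [measurable]: "Qk k \<in> sets borel" for k by (simp add: Qk_def)
  have int_\<phi>: "(\<integral>\<^sup>+y. \<phi> k y * indicator ?B y \<partial>lborel) \<le> ennreal ((2 * Suc m) ^ Suc m) * (\<integral>\<^sup>+y. h y * indicator (Qk k) y \<partial>lborel)" for k
  proof -
    have Dk: "ennreal (\<bar>D k j y\<bar> ^ Suc m) \<le> ennreal (2 ^ Suc m / c k) * (\<integral>\<^sup>+t. ennreal (\<bar>g' j t\<bar> ^ Suc m) * ennreal (mollifier (\<epsilon> k) (y - t)) \<partial>lborel)"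
      if "y \<in> ?B" for j y
    proof -
      have "y \<in> ?Q" using that box_subset_cbox by blast
      have "D k j y = (LINT t|lebesgue. g j t * mollifier (\<epsilon> k) (y - t)) / c k"
        unfolding D_def by (subst mollify_derivative_eq[OF contA AbU wp \<epsilon>(1) cb[OF \<open>y \<in> ?Q\<close>]]) simp
      thus ?thesis unfolding c_def
        using mollified_power_le[OF \<epsilon>(1) g' ae, of y k j m] cb[OF \<open>y \<in> ?Q\<close>, of k] AbU by (simp del: power_Suc)
    qed
    have "(\<integral>\<^sup>+y. \<phi> k y * indicator ?B y \<partial>lborel)
       \<le> (\<integral>\<^sup>+y. ennreal (Suc m ^ Suc m) * (\<Sum>j\<in>UNIV. ennreal (2 ^ Suc m / c k) * ((\<integral>\<^sup>+t. ennreal (\<bar>g' j t\<bar> ^ Suc m) * ennreal (mollifier (\<epsilon> k) (y - t)) \<partial>lborel) * indicator ?B y)) \<partial>lborel)"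
    proof (rule nn_integral_mono)
      fix y
      show "\<phi> k y * indicator ?B y \<le> ennreal (Suc m ^ Suc m) * (\<Sum>j\<in>UNIV. ennreal (2 ^ Suc m / c k) * ((\<integral>\<^sup>+t. ennreal (\<bar>g' j t\<bar> ^ Suc m) * ennreal (mollifier (\<epsilon> k) (y - t)) \<partial>lborel) * indicator ?B y))"
      proof (cases "y \<in> ?B")
        case True
        have "\<phi> k y \<le> ennreal (real CARD('n) ^ Suc m * (\<Sum>j\<in>UNIV. \<bar>D k j y\<bar> ^ Suc m))"
          unfolding \<phi>_def by (intro ennreal_leI sum_power_le) auto
        also have "... = ennreal (Suc m ^ Suc m) * (\<Sum>j\<in>UNIV. ennreal (\<bar>D k j y\<bar> ^ Suc m))"
          by (simp add: m ennreal_mult sum_nonneg sum_ennreal del: power_Suc)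
        also have "... \<le> ennreal (Suc m ^ Suc m) * (\<Sum>j\<in>UNIV. ennreal (2 ^ Suc m / c k) * (\<integral>\<^sup>+t. ennreal (\<bar>g' j t\<bar> ^ Suc m) * ennreal (mollifier (\<epsilon> k) (y - t)) \<partial>lborel))"
          by (intro mult_left_mono sum_mono Dk True) auto
        finally show ?thesis using True by simp
      qed simp
    qed
    also have "... = ennreal (Suc m ^ Suc m) * (\<Sum>j\<in>UNIV. ennreal (2 ^ Suc m / c k) * (\<integral>\<^sup>+y. (\<integral>\<^sup>+t. ennreal (\<bar>g' j t\<bar> ^ Suc m) * ennreal (mollifier (\<epsilon> k) (y - t)) \<partial>lborel) * indicator ?B y \<partial>lborel))"
    proof -
      have [measurable]: "(\<lambda>(x, y). mollifier (\<epsilon> k) (x - y)) \<in> borel_measurable (borel \<Otimes>\<^sub>M (borel :: (real^'n) measure))"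
        unfolding borel_prod
        by (intro borel_measurable_continuous_onI) (auto simp: case_prod_beta intro!: continuous_intros)
      have [measurable]: "(\<lambda>y. \<integral>\<^sup>+t. ennreal (\<bar>g' j t\<bar> ^ Suc m) * ennreal (mollifier (\<epsilon> k) (y - t)) \<partial>lborel) \<in> borel_measurable borel" for j
      proof -
        have "(\<lambda>(y, t). ennreal (\<bar>g' j t\<bar> ^ Suc m) * ennreal (mollifier (\<epsilon> k) (y - t))) \<in> borel_measurable (lborel \<Otimes>\<^sub>M lborel)" by measurable
        from lborel.borel_measurable_nn_integral_fst[OF this] show ?thesis by simp
      qed
      show ?thesis by (simp add: nn_integral_cmult nn_integral_sum del: power_Suc)
    qed
    also have "... \<le> ennreal (Suc m ^ Suc m) * (\<Sum>j\<in>UNIV. ennreal (2 ^ Suc m / c k) * (ennreal (c k) * (\<integral>\<^sup>+t. ennreal (\<bar>g' j t\<bar> ^ Suc m) * indicator (Qk k) t \<partial>lborel)))"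
    proof (intro mult_left_mono sum_mono)
      fix j
      show "(\<integral>\<^sup>+y. (\<integral>\<^sup>+t. ennreal (\<bar>g' j t\<bar> ^ Suc m) * ennreal (mollifier (\<epsilon> k) (y - t)) \<partial>lborel) * indicator ?B y \<partial>lborel)
          \<le> ennreal (c k) * (\<integral>\<^sup>+t. ennreal (\<bar>g' j t\<bar> ^ Suc m) * indicator (Qk k) t \<partial>lborel)"
        unfolding c_def
      proof (rule nn_integral_mollified_power_le[OF \<epsilon>(1)])
        fix x y assume "x \<in> ?B" "dist x y \<le> \<epsilon> k"
        thus "y \<in> Qk k" unfolding Qk_def using box_subset_cbox by (intro dist_le_cbox_enlarge[of x]) auto
      qed auto
    qed auto
    also have "... = ennreal (Suc m ^ Suc m) * (ennreal (2 ^ Suc m) * (\<integral>\<^sup>+y. h y * indicator (Qk k) y \<partial>lborel))"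
    proof -
      have "ennreal (2 ^ Suc m / c k) * (ennreal (c k) * z) = ennreal (2 ^ Suc m) * z" for z
        using c[of k] by (simp add: mult.assoc[symmetric] ennreal_mult[symmetric] del: power_Suc)
      moreover have "(\<integral>\<^sup>+y. h y * indicator (Qk k) y \<partial>lborel) = (\<Sum>j\<in>UNIV. (\<integral>\<^sup>+t. ennreal (\<bar>g' j t\<bar> ^ Suc m) * indicator (Qk k) t \<partial>lborel))"
        unfolding h_def sum_distrib_right by (rule nn_integral_sum) measurable
      ultimately show ?thesis by (simp add: sum_distrib_left del: power_Suc)
    qed
    also have "... = ennreal ((2 * Suc m) ^ Suc m) * (\<integral>\<^sup>+y. h y * indicator (Qk k) y \<partial>lborel)"
    proof -
      have "real (Suc m ^ Suc m) * 2 ^ Suc m = real ((2 * Suc m) ^ Suc m)"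
        by (simp only: of_nat_power of_nat_mult of_nat_numeral power_mult_distrib mult.commute)
      thus ?thesis by (simp only: mult.assoc[symmetric]) (subst ennreal_mult[symmetric]; simp del: power_Suc of_nat_Suc)
    qed
    finally show ?thesis .
  qed
  have int_I: "(\<integral>\<^sup>+r. I k r * indicator {a $ i <..< a $ i + s} r \<partial>lborel) = ennreal s * (\<integral>\<^sup>+y. \<phi> k y * indicator ?B y \<partial>lborel)" for k
  proof -
    have "(\<integral>\<^sup>+r. I k r * indicator {a $ i <..< a $ i + s} r \<partial>lborel)
       = (\<integral>\<^sup>+r. (\<integral>\<^sup>+y. (\<phi> k (upd i r y) * indicator ?B (upd i r y)) * indicator {y. a $ i < y $ i \<and> y $ i < a $ i + s} y \<partial>lborel) \<partial>lborel)"
    proof (rule nn_integral_cong)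
      fix r
      have iff: "(r \<in> {a $ i <..< a $ i + s} \<and> y \<in> ?B) \<longleftrightarrow> (upd i r y \<in> ?B \<and> a $ i < y $ i \<and> y $ i < a $ i + s)" for y
        by (auto simp: mem_box_cart split: if_splits)
      have [measurable]: "(\<lambda>y. upd i r y) \<in> borel_measurable (borel :: (real^'n) measure)"
        by (intro borel_measurable_continuous_onI continuous_intros)
      have "I k r * indicator {a $ i <..< a $ i + s} r = (\<integral>\<^sup>+y. \<phi> k (upd i r y) * indicator ?B y * indicator {a $ i <..< a $ i + s} r \<partial>lborel)"
        unfolding I_def by (rule nn_integral_multc[symmetric]) measurable
      also have "... = (\<integral>\<^sup>+y. (\<phi> k (upd i r y) * indicator ?B (upd i r y)) * indicator {y. a $ i < y $ i \<and> y $ i < a $ i + s} y \<partial>lborel)"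
        using iff by (intro nn_integral_cong) (auto simp: indicator_def)
      finally show "I k r * indicator {a $ i <..< a $ i + s} r = (\<integral>\<^sup>+y. (\<phi> k (upd i r y) * indicator ?B (upd i r y)) * indicator {y. a $ i < y $ i \<and> y $ i < a $ i + s} y \<partial>lborel)" .
    qed
    also have "... = ennreal (a $ i + s - a $ i) * (\<integral>\<^sup>+y. \<phi> k y * indicator ?B y \<partial>lborel)"
      by (rule nn_integral_upd) (use s in auto)
    finally show ?thesis by simp
  qed
  \<comment> \<open>The constant is (4(m+1))^(m+1) from \<open>slice_oscillation\<close>, times
    2^(m+1) from averaging, times (m+1)^(m+1) from the power of a sum. The factor s is the length of
    the dummy interval in \<open>nn_integral_upd\<close>.\<close>
  let ?K = "ennreal ((8 * real (Suc m) * real (Suc m)) ^ Suc m * s)"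
  have "(\<integral>\<^sup>+r. \<omega> r * indicator {a $ i <..< a $ i + s} r \<partial>lborel)
      \<le> (\<integral>\<^sup>+r. liminf (\<lambda>k. ennreal ((4 * Suc m) ^ Suc m) * I k r * indicator {a $ i <..< a $ i + s} r) \<partial>lborel)"
    by (rule nn_integral_mono) (auto simp: \<omega>_def indicator_def)
  also have "... \<le> liminf (\<lambda>k. \<integral>\<^sup>+r. ennreal ((4 * Suc m) ^ Suc m) * I k r * indicator {a $ i <..< a $ i + s} r \<partial>lborel)"
    by (rule nn_integral_liminf) measurable
  also have "... \<le> liminf (\<lambda>k. ?K * (\<integral>\<^sup>+y. h y * indicator (Qk k) y \<partial>lborel))"
  proof (intro Liminf_mono always_eventually allI)
    fix k
    have "(\<integral>\<^sup>+r. ennreal ((4 * Suc m) ^ Suc m) * I k r * indicator {a $ i <..< a $ i + s} r \<partial>lborel)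
        = ennreal ((4 * Suc m) ^ Suc m) * (ennreal s * (\<integral>\<^sup>+y. \<phi> k y * indicator ?B y \<partial>lborel))"
      unfolding int_I[symmetric] mult.assoc by (rule nn_integral_cmult) measurable
    also have "... \<le> ennreal ((4 * Suc m) ^ Suc m) * (ennreal s * (ennreal ((2 * Suc m) ^ Suc m) * (\<integral>\<^sup>+y. h y * indicator (Qk k) y \<partial>lborel)))"
      by (intro mult_left_mono int_\<phi>) auto
    also have "... = ?K * (\<integral>\<^sup>+y. h y * indicator (Qk k) y \<partial>lborel)"
    proof -
      have k: "real ((4 * Suc m) ^ Suc m) * s * real ((2 * Suc m) ^ Suc m) = (8 * real (Suc m) * real (Suc m)) ^ Suc m * s"
      proof -
        have "(8 * real (Suc m) * real (Suc m)) ^ Suc m = ((4 * real (Suc m)) * (2 * real (Suc m))) ^ Suc m"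
          by (rule arg_cong[where f = "\<lambda>x. x ^ Suc m"]) (simp add: algebra_simps)
        also have "... = real ((4 * Suc m) ^ Suc m) * real ((2 * Suc m) ^ Suc m)"
          by (simp only: power_mult_distrib of_nat_power of_nat_mult of_nat_numeral)
        finally show ?thesis by (simp only: mult_ac)
      qed
      have mul: "ennreal x * (ennreal s * (ennreal y * z)) = ennreal (x * s * y) * z" if "x \<ge> 0" "y \<ge> 0" for x y z
        using s that by (simp add: ennreal_mult mult.assoc)
      show ?thesis unfolding k[symmetric] by (rule mul; rule of_nat_0_le_iff)
    qed
    finally show "(\<integral>\<^sup>+r. ennreal ((4 * Suc m) ^ Suc m) * I k r * indicator {a $ i <..< a $ i + s} r \<partial>lborel) \<le> ?K * (\<integral>\<^sup>+y. h y * indicator (Qk k) y \<partial>lborel)" .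
  qed
  \<comment> \<open>The enlarged cubes decrease to the closed cube. Monotone convergence from above
    starts from a finite integral, which local integrability on the first enlarged cube
    provides.\<close>
  also have "... = ?K * (\<integral>\<^sup>+y. h y * indicator ?Q y \<partial>lborel)"
  proof (rule lim_imp_Liminf)
    have le: "h y * indicator (Qk (Suc k)) y \<le> h y * indicator (Qk k) y" for k y
    proof -
      have "\<epsilon> (Suc k) \<le> \<epsilon> k" using e0 by (auto simp: \<epsilon>_def field_simps)
      hence "Qk (Suc k) \<subseteq> Qk k" by (auto simp: Qk_def mem_box_cart) (smt (verit))+
      thus ?thesis by (auto simp: indicator_def)
    qed
    hence dec: "decseq (\<lambda>k y. h y * indicator (Qk k) y)" by (intro decseq_SucI le_funI)
    have fin: "(\<integral>\<^sup>+y. h y * indicator (Qk 0) y \<partial>lborel) < \<infinity>"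
    proof -
      have "(\<integral>\<^sup>+y. h y * indicator (Qk 0) y \<partial>lborel) = (\<Sum>j\<in>UNIV. (\<integral>\<^sup>+t. ennreal (\<bar>g' j t\<bar> ^ Suc m) * indicator (Qk 0) t \<partial>lborel))"
        unfolding h_def sum_distrib_right by (rule nn_integral_sum) measurable
      also have "... < \<infinity>"
        using loc[of "Qk 0"] e0 by (auto simp: Qk_def \<epsilon>_def less_top[symmetric])
      finally show ?thesis .
    qed
    have "(INF k. \<integral>\<^sup>+y. h y * indicator (Qk k) y \<partial>lborel) = (\<integral>\<^sup>+y. (INF k. h y * indicator (Qk k) y) \<partial>lborel)"
      by (rule nn_integral_monotone_convergence_INF_decseq[OF dec, symmetric]) (use fin in auto)
    also have "... = (\<integral>\<^sup>+y. h y * indicator ?Q y \<partial>lborel)"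
    proof (rule nn_integral_cong)
      fix y
      show "(INF k. h y * indicator (Qk k) y) = h y * indicator ?Q y"
      proof (cases "y \<in> ?Q")
        case True
        have "y \<in> Qk k" for k
          using True \<epsilon>(1)[of k] by (auto simp: Qk_def mem_box_cart) (smt (verit, best))+
        thus ?thesis using True by simp
      next
        case False
        have "\<exists>k. y \<notin> Qk k"
        proof (rule ccontr)
          assume "\<not> ?thesis"
          hence *: "a $ j - \<epsilon> k \<le> y $ j" "y $ j \<le> a $ j + s + \<epsilon> k" for j k by (auto simp: Qk_def mem_box_cart)
          have "a $ j - 0 \<le> y $ j" "y $ j \<le> a $ j + s + 0" for j
            by (rule LIMSEQ_le_const2[OF tendsto_diff[OF tendsto_const \<epsilon>0]], use * in blast)
               (rule LIMSEQ_le_const[OF tendsto_add[OF tendsto_const \<epsilon>0]], use * in blast)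
          thus False using False by (auto simp: mem_box_cart)
        qed
        then obtain k where "y \<notin> Qk k" by blast
        hence "(INF k. h y * indicator (Qk k) y) \<le> 0" by (intro INF_lower2[of k]) auto
        thus ?thesis using False by simp
      qed
    qed
    finally have INF: "(INF k. \<integral>\<^sup>+y. h y * indicator (Qk k) y \<partial>lborel) = (\<integral>\<^sup>+y. h y * indicator ?Q y \<partial>lborel)" .
    have "decseq (\<lambda>k. \<integral>\<^sup>+y. h y * indicator (Qk k) y \<partial>lborel)"
      using le by (intro decseq_SucI nn_integral_mono)
    from LIMSEQ_INF[OF this] have "(\<lambda>k. \<integral>\<^sup>+y. h y * indicator (Qk k) y \<partial>lborel) \<longlonglongrightarrow> (\<integral>\<^sup>+y. h y * indicator ?Q y \<partial>lborel)"
      by (simp only: INF)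
    thus "(\<lambda>k. ?K * (\<integral>\<^sup>+y. h y * indicator (Qk k) y \<partial>lborel)) \<longlonglongrightarrow> ?K * (\<integral>\<^sup>+y. h y * indicator ?Q y \<partial>lborel)"
      by (intro ennreal_tendsto_cmult) auto
  qed auto
  finally have "(\<integral>\<^sup>+r. \<omega> r * indicator {a $ i <..< a $ i + s} r \<partial>lborel) \<le> ?K * (\<integral>\<^sup>+y. h y * indicator ?Q y \<partial>lborel)" .
  with \<omega>m \<omega>1 show ?thesis unfolding h_def by (rule that)
qed

section \<open>Slices of Sobolev maps\<close>

lemma AE_cbox_iff_box: "AE y in lborel. y \<in> cbox a (b :: real^'n) \<longleftrightarrow> y \<in> box a b"
proof -
  have "negligible (cbox a b - box a b)" by (rule negligible_frontier_interval)
  hence "cbox a b - box a b \<in> null_sets lebesgue" by (simp add: negligible_iff_null_sets)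
  hence "cbox a b - box a b \<in> null_sets lborel" by (auto simp: null_sets_def)
  from AE_not_in[OF this] show ?thesis
    by eventually_elim (use box_subset_cbox[of a b] in blast)
qed

text \<open>Tonelli is used on products of Borel spaces, so a function measurable for the completed
  measure is exchanged for a Borel one that agrees with it almost everywhere on U.\<close>

lemma Lq_loc_borel:
  assumes "Lq_loc U q g"
  obtains g' :: "real^'n => real" where "g' \<in> borel_measurable borel"
    "AE y in lebesgue. y \<in> U \<longrightarrow> g y = g' y"
    "\<And>K. compact K ==> K \<subseteq> U ==> (\<integral>\<^sup>+y. ennreal (\<bar>g' y\<bar> ^ q) * indicator K y \<partial>lborel) < \<infinity>"
proof -
  have "(\<lambda>x. indicator U x *\<^sub>R g x) \<in> borel_measurable lebesgue"
    using assms unfolding Lq_loc_def set_borel_measurable_def by blast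
  then obtain g' where g': "g' \<in> borel_measurable lborel" "AE x in lborel. indicator U x *\<^sub>R g x = g' x"
    using completion_ex_borel_measurable_real by blast
  have ae: "AE y in lebesgue. y \<in> U \<longrightarrow> g y = g' y"
    using AE_completion[OF g'(2)] by eventually_elim (auto simp: indicator_def)
  have fin: "(\<integral>\<^sup>+y. ennreal (\<bar>g' y\<bar> ^ q) * indicator K y \<partial>lborel) < \<infinity>" if K: "compact K" "K \<subseteq> U" for K
  proof -
    have "integrable lebesgue (\<lambda>x. indicator K x *\<^sub>R (\<bar>g x\<bar> ^ q))"
      using assms K unfolding Lq_loc_def set_integrable_def by blast
    hence "(\<integral>\<^sup>+x. ennreal (norm (indicator K x *\<^sub>R (\<bar>g x\<bar> ^ q))) \<partial>lebesgue) < \<infinity>"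
      by (simp add: integrable_iff_bounded)
    also have "(\<integral>\<^sup>+x. ennreal (norm (indicator K x *\<^sub>R (\<bar>g x\<bar> ^ q))) \<partial>lebesgue) = (\<integral>\<^sup>+y. ennreal (\<bar>g' y\<bar> ^ q) * indicator K y \<partial>lebesgue)"
      by (rule nn_integral_cong_AE, use ae in eventually_elim) (use K in \<open>auto simp: indicator_def\<close>)
    finally show ?thesis by (simp add: nn_integral_completion)
  qed
  show ?thesis using that[of g'] g'(1) ae fin by simp
qed

lemma W1_loc_gradient:
  fixes f :: "real^'n => real^'l"
  assumes "W1_loc U q f"
  obtains g g' :: "'l => 'n => real^'n => real" where
    "\<And>l j. weak_partial U j (\<lambda>x. f x $ l) (g l j)" "\<And>l j. g' l j \<in> borel_measurable borel"
    "\<And>l j. AE y in lebesgue. y \<in> U \<longrightarrow> g l j y = g' l j y"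
    "\<And>l j K. compact K ==> K \<subseteq> U ==> (\<integral>\<^sup>+y. ennreal (\<bar>g' l j y\<bar> ^ q) * indicator K y \<partial>lborel) < \<infinity>"
proof -
  define P where "P l j g g' \<longleftrightarrow> weak_partial U j (\<lambda>x. f x $ l) g \<and> g' \<in> borel_measurable borel \<and> (AE y in lebesgue. y \<in> U \<longrightarrow> g y = g' y)
     \<and> (\<forall>K. compact K \<longrightarrow> K \<subseteq> U \<longrightarrow> (\<integral>\<^sup>+y. ennreal (\<bar>g' y\<bar> ^ q) * indicator K y \<partial>lborel) < \<infinity>)" for l j g g'
  have "\<exists>g g'. P l j g g'" for l j
  proof -
    obtain g where g: "Lq_loc U q g" "weak_partial U j (\<lambda>x. f x $ l) g" using assms unfolding W1_loc_def by blast
    obtain g' where "g' \<in> borel_measurable borel" "AE y in lebesgue. y \<in> U \<longrightarrow> g y = g' y"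
      "\<And>K. compact K ==> K \<subseteq> U ==> (\<integral>\<^sup>+y. ennreal (\<bar>g' y\<bar> ^ q) * indicator K y \<partial>lborel) < \<infinity>"
      by (rule Lq_loc_borel[OF g(1)]) (rule that; assumption)
    hence "P l j g g'" using g(2) unfolding P_def by simp
    thus ?thesis by blast
  qed
  then obtain g g' where gg: "\<And>l j. P l j (g l j) (g' l j)" by metis
  show ?thesis by (rule that[of g g']) (use gg in \<open>simp_all add: P_def\<close>)
qed

text \<open>Again a linear form of Hoelder's inequality, now between exponents m and m + 1. The free
  \<open>k\<close> weighs volume against energy: a small k makes the energy term small, at the price
  of a large volume term.\<close>

lemma power_le_scaled:
  fixes b s k :: real
  assumes "b \<ge> 0" "s > 0" "k > 0"
  shows "b ^ m \<le> s ^ m / k ^ m + k / s * b ^ Suc m"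
proof (cases "b \<le> s / k")
  case True
  hence "b ^ m \<le> (s / k) ^ m" using assms by (intro power_mono) auto
  thus ?thesis using assms by (simp add: power_divide add_increasing2)
next
  case False
  hence "k / s * b \<ge> 1" using assms by (simp add: field_simps)
  hence "1 * b ^ m \<le> (k / s * b) * b ^ m" using assms by (intro mult_right_mono) auto
  thus ?thesis using assms by (simp add: add_increasing mult_ac)
qed

section \<open>Lusin's condition (N) for slices of projected Sobolev maps\<close>

context
  fixes U :: "(real^'n) set" and F Pf :: "real^'n => real^'n" and a0 :: "real^'n" and s0 L :: real
    and m :: nat and g g' :: "'n => 'n => real^'n => real"
  assumes U: "open U" "continuous_on U F" and m: "CARD('n) = Suc m"
    and Q0: "cbox a0 (a0 + vec s0) \<subseteq> U" and s0: "s0 > 0" and L: "L \<ge> 0"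
    and contP: "continuous_on (cbox a0 (a0 + vec s0)) Pf"
    and lip: "\<And>x x' j. x \<in> cbox a0 (a0 + vec s0) ==> x' \<in> cbox a0 (a0 + vec s0) ==>
        \<bar>Pf x $ j - Pf x' $ j\<bar> \<le> L * (\<Sum>l\<in>UNIV. \<bar>F x $ l - F x' $ l\<bar>)"
    and wp: "\<And>l j. weak_partial U j (\<lambda>x. F x $ l) (g l j)"
    and g'[measurable]: "\<And>l j. g' l j \<in> borel_measurable borel"
    and ae: "\<And>l j. AE y in lebesgue. y \<in> U \<longrightarrow> g l j y = g' l j y"
    and loc: "\<And>l j K. compact K ==> K \<subseteq> U ==> (\<integral>\<^sup>+y. ennreal (\<bar>g' l j y\<bar> ^ Suc m) * indicator K y \<partial>lborel) < \<infinity>"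
begin

private definition "HH y = (\<Sum>l\<in>UNIV. \<Sum>j\<in>UNIV. ennreal (\<bar>g' l j y\<bar> ^ Suc m))"
private definition "C1 = (L * real (Suc m)) ^ Suc m * (8 * real (Suc m) * real (Suc m)) ^ Suc m"

private lemma C1: "C1 \<ge> 0" using L by (simp add: C1_def)

private lemma HH_measurable [measurable]: "HH \<in> borel_measurable borel"
  unfolding HH_def by measurable

text \<open>The slice x_i = r goes into the slice y_q = r and stays within sup-distance b of one
  point there, where b^(m+1) is the oscillation bound. Its m-dimensional area is thus at most
  (2b)^m, which \<open>power_le_scaled\<close> makes linear in that bound, and integration over r
  yields the energy of the cube. The final integral is over the open box, so that such bounds add up
  over non-overlapping cubes.\<close>

private lemma cube_image:
  assumes Q: "cbox a (a + vec s) \<subseteq> cbox a0 (a0 + vec s0)" and s: "s > 0" and k: "k > 0"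
  shows "\<exists>T \<in> sets borel. (\<lambda>x. upd q (x $ i) (Pf x)) ` cbox a (a + vec s) \<subseteq> T \<and>
     emeasure lborel T \<le> (\<integral>\<^sup>+y. (ennreal (2 ^ m / k ^ m) + ennreal (2 ^ m * k * C1) * HH y) * indicator (box a (a + vec s)) y \<partial>lborel)"
proof -
  let ?Q = "cbox a (a + vec s)"
  have QU: "?Q \<subseteq> U" using Q Q0 by blast
  define R where "R l \<omega> \<longleftrightarrow> \<omega> \<in> borel_measurable borel \<and>
    (\<forall>x x'. x \<in> ?Q \<longrightarrow> x' \<in> ?Q \<longrightarrow> x $ i = x' $ i \<longrightarrow> ennreal (\<bar>F x $ l - F x' $ l\<bar> ^ Suc m) \<le> \<omega> (x $ i)) \<and>
    (\<integral>\<^sup>+r. \<omega> r * indicator {a $ i <..< a $ i + s} r \<partial>lborel)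
       \<le> ennreal ((8 * real (Suc m) * real (Suc m)) ^ Suc m * s) * (\<integral>\<^sup>+y. (\<Sum>j\<in>UNIV. ennreal (\<bar>g' l j y\<bar> ^ Suc m)) * indicator ?Q y \<partial>lborel)"
    for l and \<omega> :: "real => ennreal"
  have "\<exists>\<omega>. R l \<omega>" for l
  proof -
    have cF: "continuous_on U (\<lambda>x. F x $ l)" using U(2) by (intro continuous_intros)
    obtain \<omega> :: "real => ennreal" where "\<omega> \<in> borel_measurable borel"
      "\<And>x x'. x \<in> ?Q ==> x' \<in> ?Q ==> x $ i = x' $ i ==> ennreal (\<bar>F x $ l - F x' $ l\<bar> ^ Suc m) \<le> \<omega> (x $ i)"
      "(\<integral>\<^sup>+r. \<omega> r * indicator {a $ i <..< a $ i + s} r \<partial>lborel)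
       \<le> ennreal ((8 * real (Suc m) * real (Suc m)) ^ Suc m * s) * (\<integral>\<^sup>+y. (\<Sum>j\<in>UNIV. ennreal (\<bar>g' l j y\<bar> ^ Suc m)) * indicator ?Q y \<partial>lborel)"
      by (rule sobolev_slice_oscillation[where u = "\<lambda>x. F x $ l" and g = "g l" and g' = "g' l" and i = i, OF U(1) cF QU s m wp g' ae loc])
         (assumption | (rule that; assumption))+
    hence "R l \<omega>" unfolding R_def by (intro conjI allI impI)
    thus ?thesis by blast
  qed
  then obtain \<omega> where "\<And>l. R l (\<omega> l)" by metis
  hence \<omega>[measurable]: "\<And>l. \<omega> l \<in> borel_measurable borel"
    and \<omega>1: "\<And>l x x'. x \<in> ?Q ==> x' \<in> ?Q ==> x $ i = x' $ i ==> ennreal (\<bar>F x $ l - F x' $ l\<bar> ^ Suc m) \<le> \<omega> l (x $ i)"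
    and \<omega>2: "\<And>l. (\<integral>\<^sup>+r. \<omega> l r * indicator {a $ i <..< a $ i + s} r \<partial>lborel)
       \<le> ennreal ((8 * real (Suc m) * real (Suc m)) ^ Suc m * s) * (\<integral>\<^sup>+y. (\<Sum>j\<in>UNIV. ennreal (\<bar>g' l j y\<bar> ^ Suc m)) * indicator ?Q y \<partial>lborel)"
    unfolding R_def by blast+
  define \<Omega> where "\<Omega> r = ennreal ((L * real (Suc m)) ^ Suc m) * (\<Sum>l\<in>UNIV. \<omega> l r)" for r
  have [measurable]: "\<Omega> \<in> borel_measurable borel" unfolding \<Omega>_def by measurable
  have \<Omega>1: "ennreal (\<bar>Pf x $ j - Pf x' $ j\<bar> ^ Suc m) \<le> \<Omega> (x $ i)" if "x \<in> ?Q" "x' \<in> ?Q" "x $ i = x' $ i" for x x' j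
  proof -
    have "\<bar>Pf x $ j - Pf x' $ j\<bar> ^ Suc m \<le> (L * (\<Sum>l\<in>UNIV. \<bar>F x $ l - F x' $ l\<bar>)) ^ Suc m"
      using that Q by (intro power_mono lip) auto
    also have "... \<le> L ^ Suc m * (real CARD('n) ^ Suc m * (\<Sum>l\<in>UNIV. \<bar>F x $ l - F x' $ l\<bar> ^ Suc m))"
      unfolding power_mult_distrib using L by (intro mult_left_mono sum_power_le) auto
    also have "... = (L * real (Suc m)) ^ Suc m * (\<Sum>l\<in>UNIV. \<bar>F x $ l - F x' $ l\<bar> ^ Suc m)"
      by (simp only: m power_mult_distrib mult.assoc)
    finally have "ennreal (\<bar>Pf x $ j - Pf x' $ j\<bar> ^ Suc m) \<le> ennreal ((L * real (Suc m)) ^ Suc m * (\<Sum>l\<in>UNIV. \<bar>F x $ l - F x' $ l\<bar> ^ Suc m))"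
      by (rule ennreal_leI)
    also have "... = ennreal ((L * real (Suc m)) ^ Suc m) * (\<Sum>l\<in>UNIV. ennreal (\<bar>F x $ l - F x' $ l\<bar> ^ Suc m))"
      using L by (subst ennreal_mult) (auto simp: sum_nonneg sum_ennreal simp del: power_Suc)
    also have "... \<le> \<Omega> (x $ i)" unfolding \<Omega>_def using that by (intro mult_left_mono sum_mono \<omega>1) auto
    finally show ?thesis .
  qed
  \<comment> \<open>Clamping r keeps the reference point in the cube for every real r, so the curve
    \<open>c\<close> is continuous on the whole line and Borel.\<close>
  define cl where "cl r = max (a $ i) (min r (a $ i + s))" for r
  define c where "c r = Pf (upd i (cl r) a)" for r
  have p: "upd i (cl r) a \<in> ?Q" for r using s by (auto simp: cl_def mem_box_cart)
  have cc: "continuous_on UNIV c" unfolding c_def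
    by (rule continuous_on_compose2[OF contP]) (use p Q in \<open>auto intro!: continuous_intros simp: cl_def\<close>)
  have [measurable]: "c \<in> borel_measurable borel" by (rule borel_measurable_continuous_onI[OF cc])
  \<comment> \<open>A Borel tube around the curve \<open>c\<close> takes the place of the image; its
    width in the slice r is the oscillation bound for that slice.\<close>
  define T where "T = {y :: real^'n. a $ i \<le> y $ q \<and> y $ q \<le> a $ i + s \<and> (\<forall>j\<in>-{q}. ennreal (\<bar>y $ j - c (y $ q) $ j\<bar> ^ Suc m) \<le> \<Omega> (y $ q))}"
  have Tm[measurable]: "T \<in> sets borel" unfolding T_def by measurable
  have "(\<lambda>x. upd q (x $ i) (Pf x)) ` ?Q \<subseteq> T"
  proof safe
    fix x assume x: "x \<in> ?Q"
    have "cl (x $ i) = x $ i" using x by (auto simp: cl_def mem_box_cart)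
    hence "ennreal (\<bar>Pf x $ j - c (x $ i) $ j\<bar> ^ Suc m) \<le> \<Omega> (x $ i)" for j
      unfolding c_def using p[of "x $ i"] by (intro \<Omega>1 x) auto
    thus "upd q (x $ i) (Pf x) \<in> T" using x by (auto simp: T_def mem_box_cart)
  qed
  moreover have "emeasure lborel T \<le> (\<integral>\<^sup>+y. (ennreal (2 ^ m / k ^ m) + ennreal (2 ^ m * k * C1) * HH y) * indicator (box a (a + vec s)) y \<partial>lborel)"
  proof -
    have "emeasure lborel T = ennreal (1 - 0) * (\<integral>\<^sup>+y. indicator T y \<partial>lborel)" by simp
    also have "... = (\<integral>\<^sup>+r. (\<integral>\<^sup>+y. indicator T (upd q r y) * indicator {y. 0 < y $ q \<and> y $ q < 1} y \<partial>lborel) \<partial>lborel)"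
      by (rule nn_integral_upd[symmetric]) auto
    also have "... \<le> (\<integral>\<^sup>+r. (ennreal (2 ^ m * (s ^ m / k ^ m)) + ennreal (2 ^ m * (k / s)) * \<Omega> r) * indicator {a $ i <..< a $ i + s} r \<partial>lborel)"
    proof (rule nn_integral_mono_AE)
      have "AE r in lborel. r \<noteq> a $ i" "AE r in lborel. r \<noteq> a $ i + s" by (rule AE_lborel_singleton)+
      thus "AE r in lborel. (\<integral>\<^sup>+y. indicator T (upd q r y) * indicator {y. 0 < y $ q \<and> y $ q < 1} y \<partial>lborel)
        \<le> (ennreal (2 ^ m * (s ^ m / k ^ m)) + ennreal (2 ^ m * (k / s)) * \<Omega> r) * indicator {a $ i <..< a $ i + s} r"
      proof eventually_elim
        case (elim r)
        show ?case
        proof (cases "r \<in> {a $ i <..< a $ i + s}")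
          case False
          hence "upd q r y \<notin> T" for y using elim by (auto simp: T_def)
          thus ?thesis by simp
        next
          case True
          show ?thesis
          \<comment> \<open>On a slice with infinite oscillation bound the right-hand side is
            infinite because the factor 2^m k / s is positive.\<close>
          proof (cases "\<Omega> r = \<infinity>")
            case True' : True
            have "ennreal (2 ^ m * (k / s)) * \<Omega> r = \<infinity>" using s k by (simp add: True' ennreal_mult_top)
            thus ?thesis using True by simp
          next
            case False
            then obtain w where w: "\<Omega> r = ennreal w" "w \<ge> 0" by (cases "\<Omega> r" rule: ennreal_cases) auto
            define b where "b = root (Suc m) w"
            have b: "b \<ge> 0" "b ^ Suc m = w" using w by (auto simp: b_def real_root_pow_pos2 simp del: power_Suc)
            define lo hi where "lo = upd q 0 (c r - vec b)" and "hi = upd q 1 (c r + vec b)"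
            have "(\<integral>\<^sup>+y. indicator T (upd q r y) * indicator {y. 0 < y $ q \<and> y $ q < 1} y \<partial>lborel) \<le> (\<integral>\<^sup>+y. indicator (cbox lo hi) y \<partial>lborel)"
            proof (rule nn_integral_mono)
              fix y
              have "y \<in> cbox lo hi" if y: "upd q r y \<in> T" "0 < y $ q" "y $ q < 1"
              proof -
                have "lo $ j \<le> y $ j \<and> y $ j \<le> hi $ j" for j
                proof (cases "j = q")
                  case False
                  have "ennreal (\<bar>y $ j - c r $ j\<bar> ^ Suc m) \<le> ennreal w"
                    using y(1) False unfolding w(1)[symmetric] by (simp add: T_def)
                  hence "\<bar>y $ j - c r $ j\<bar> ^ Suc m \<le> b ^ Suc m"
                    unfolding b(2) by (subst (asm) ennreal_le_iff[OF w(2)])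
                  from power_le_imp_le_base[OF this b(1)] have "\<bar>y $ j - c r $ j\<bar> \<le> b" .
                  thus ?thesis using False by (auto simp: lo_def hi_def abs_le_iff)
                qed (use y in \<open>auto simp: lo_def hi_def\<close>)
                thus ?thesis by (simp add: mem_box_cart)
              qed
              thus "indicator T (upd q r y) * indicator {y. 0 < y $ q \<and> y $ q < 1} y \<le> (indicator (cbox lo hi) y :: ennreal)"
                by (auto simp: indicator_def)
            qed
            also have "... = emeasure lborel (cbox lo hi)" by simp
            also have "... = ennreal (\<Prod>j\<in>UNIV. (hi - lo) $ j)"
              by (rule emeasure_lborel_cbox_cart) (use b in \<open>simp add: lo_def hi_def\<close>)
            also have "(\<Prod>j\<in>UNIV. (hi - lo) $ j) = (\<Prod>j\<in>UNIV - {q}. 2 * b)"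
            proof -
              have "(\<Prod>j\<in>UNIV. (hi - lo) $ j) = (hi - lo) $ q * (\<Prod>j\<in>UNIV - {q}. (hi - lo) $ j)"
                by (rule prod.remove) auto
              also have "(\<Prod>j\<in>UNIV - {q}. (hi - lo) $ j) = (\<Prod>j\<in>UNIV - {q}. 2 * b)"
                by (rule prod.cong) (auto simp: lo_def hi_def)
              finally show ?thesis by (simp add: lo_def hi_def)
            qed
            also have "... = 2 ^ m * b ^ m" by (simp add: card_Diff_singleton m power_mult_distrib)
            also have "ennreal (2 ^ m * b ^ m) \<le> ennreal (2 ^ m * (s ^ m / k ^ m + k / s * b ^ Suc m))"
              by (intro ennreal_leI mult_left_mono power_le_scaled b s k) auto
            also have "... = ennreal (2 ^ m * (s ^ m / k ^ m) + 2 ^ m * (k / s) * w)"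
              by (simp only: b distrib_left mult.assoc)
            also have "... = ennreal (2 ^ m * (s ^ m / k ^ m)) + ennreal (2 ^ m * (k / s) * w)"
              by (rule ennreal_plus) (use s k w(2) in auto)
            also have "ennreal (2 ^ m * (k / s) * w) = ennreal (2 ^ m * (k / s)) * \<Omega> r"
              unfolding w(1) by (rule ennreal_mult) (use s k w(2) in auto)
            finally show ?thesis using True by simp
          qed
        qed
      qed
    qed
    also have "... = (\<integral>\<^sup>+r. ennreal (2 ^ m * (s ^ m / k ^ m)) * indicator {a $ i <..< a $ i + s} r + ennreal (2 ^ m * (k / s)) * (\<Omega> r * indicator {a $ i <..< a $ i + s} r) \<partial>lborel)"
      by (intro nn_integral_cong) (auto simp: indicator_def)
    also have "... = ennreal (2 ^ m * (s ^ m / k ^ m)) * ennreal s + ennreal (2 ^ m * (k / s)) * (\<integral>\<^sup>+r. \<Omega> r * indicator {a $ i <..< a $ i + s} r \<partial>lborel)"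
      using s by (simp add: nn_integral_add nn_integral_cmult nn_integral_cmult_indicator)
    also have "(\<integral>\<^sup>+r. \<Omega> r * indicator {a $ i <..< a $ i + s} r \<partial>lborel)
       = ennreal ((L * real (Suc m)) ^ Suc m) * (\<Sum>l\<in>UNIV. \<integral>\<^sup>+r. \<omega> l r * indicator {a $ i <..< a $ i + s} r \<partial>lborel)"
    proof -
      have "(\<integral>\<^sup>+r. \<Omega> r * indicator {a $ i <..< a $ i + s} r \<partial>lborel)
          = (\<integral>\<^sup>+r. ennreal ((L * real (Suc m)) ^ Suc m) * (\<Sum>l\<in>UNIV. \<omega> l r * indicator {a $ i <..< a $ i + s} r) \<partial>lborel)"
        by (intro nn_integral_cong) (simp only: \<Omega>_def sum_distrib_right mult.assoc)
      also have "... = ennreal ((L * real (Suc m)) ^ Suc m) * (\<integral>\<^sup>+r. (\<Sum>l\<in>UNIV. \<omega> l r * indicator {a $ i <..< a $ i + s} r) \<partial>lborel)"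
        by (rule nn_integral_cmult) measurable
      also have "(\<integral>\<^sup>+r. (\<Sum>l\<in>UNIV. \<omega> l r * indicator {a $ i <..< a $ i + s} r) \<partial>lborel)
          = (\<Sum>l\<in>UNIV. \<integral>\<^sup>+r. \<omega> l r * indicator {a $ i <..< a $ i + s} r \<partial>lborel)"
        by (rule nn_integral_sum) measurable
      finally show ?thesis .
    qed
    also have "... \<le> ennreal ((L * real (Suc m)) ^ Suc m) * (\<Sum>l\<in>UNIV. ennreal ((8 * real (Suc m) * real (Suc m)) ^ Suc m * s) * (\<integral>\<^sup>+y. (\<Sum>j\<in>UNIV. ennreal (\<bar>g' l j y\<bar> ^ Suc m)) * indicator ?Q y \<partial>lborel))"
      by (intro mult_left_mono sum_mono \<omega>2) auto
    also have "... = ennreal (C1 * s) * (\<integral>\<^sup>+y. HH y * indicator ?Q y \<partial>lborel)"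
    proof -
      have "(\<integral>\<^sup>+y. HH y * indicator ?Q y \<partial>lborel) = (\<Sum>l\<in>UNIV. \<integral>\<^sup>+y. (\<Sum>j\<in>UNIV. ennreal (\<bar>g' l j y\<bar> ^ Suc m)) * indicator ?Q y \<partial>lborel)"
      proof -
        have "(\<integral>\<^sup>+y. HH y * indicator ?Q y \<partial>lborel) = (\<integral>\<^sup>+y. (\<Sum>l\<in>UNIV. (\<Sum>j\<in>UNIV. ennreal (\<bar>g' l j y\<bar> ^ Suc m)) * indicator ?Q y) \<partial>lborel)"
          by (intro nn_integral_cong) (simp only: HH_def sum_distrib_right)
        also have "... = (\<Sum>l\<in>UNIV. \<integral>\<^sup>+y. (\<Sum>j\<in>UNIV. ennreal (\<bar>g' l j y\<bar> ^ Suc m)) * indicator ?Q y \<partial>lborel)"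
          by (rule nn_integral_sum) measurable
        finally show ?thesis .
      qed
      moreover have "ennreal (C1 * s) = ennreal ((L * real (Suc m)) ^ Suc m) * ennreal ((8 * real (Suc m) * real (Suc m)) ^ Suc m * s)"
        using L s by (subst ennreal_mult[symmetric]) (auto simp: C1_def mult.assoc simp del: power_Suc)
      ultimately show ?thesis by (simp only: sum_distrib_left mult.assoc)
    qed
    finally have "emeasure lborel T \<le> ennreal (2 ^ m * (s ^ m / k ^ m)) * ennreal s + ennreal (2 ^ m * (k / s)) * (ennreal (C1 * s) * (\<integral>\<^sup>+y. HH y * indicator ?Q y \<partial>lborel))"
      by (simp add: mult_left_mono)
    also have "... = ennreal (2 ^ m / k ^ m) * ennreal (s ^ Suc m) + ennreal (2 ^ m * k * C1) * (\<integral>\<^sup>+y. HH y * indicator ?Q y \<partial>lborel)"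
    proof -
      have "ennreal (2 ^ m * (s ^ m / k ^ m)) * ennreal s = ennreal (2 ^ m / k ^ m) * ennreal (s ^ Suc m)"
        using s k by (subst (1 2) ennreal_mult[symmetric]) auto
      moreover have "ennreal (2 ^ m * (k / s)) * (ennreal (C1 * s) * z) = ennreal (2 ^ m * k * C1) * z" for z
        using s k C1 by (simp add: mult.assoc[symmetric] ennreal_mult[symmetric])
      ultimately show ?thesis by simp
    qed
    also have "... = (\<integral>\<^sup>+y. (ennreal (2 ^ m / k ^ m) + ennreal (2 ^ m * k * C1) * HH y) * indicator ?Q y \<partial>lborel)"
    proof -
      have "emeasure lborel ?Q = ennreal (s ^ Suc m)"
        using s by (subst emeasure_lborel_cbox_cart) (auto simp: m)
      hence "ennreal (2 ^ m / k ^ m) * ennreal (s ^ Suc m) = (\<integral>\<^sup>+y. ennreal (2 ^ m / k ^ m) * indicator ?Q y \<partial>lborel)"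
        by (simp add: nn_integral_cmult_indicator)
      moreover have "(\<integral>\<^sup>+y. (ennreal (2 ^ m / k ^ m) + ennreal (2 ^ m * k * C1) * HH y) * indicator ?Q y \<partial>lborel)
          = (\<integral>\<^sup>+y. ennreal (2 ^ m / k ^ m) * indicator ?Q y \<partial>lborel) + (\<integral>\<^sup>+y. ennreal (2 ^ m * k * C1) * (HH y * indicator ?Q y) \<partial>lborel)"
        unfolding distrib_right mult.assoc by (rule nn_integral_add) measurable
      moreover have "(\<integral>\<^sup>+y. ennreal (2 ^ m * k * C1) * (HH y * indicator ?Q y) \<partial>lborel) = ennreal (2 ^ m * k * C1) * (\<integral>\<^sup>+y. HH y * indicator ?Q y \<partial>lborel)"
        by (rule nn_integral_cmult) measurable
      ultimately show ?thesis by simp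
    qed
    also have "... = (\<integral>\<^sup>+y. (ennreal (2 ^ m / k ^ m) + ennreal (2 ^ m * k * C1) * HH y) * indicator (box a (a + vec s)) y \<partial>lborel)"
      by (rule nn_integral_cong_AE, use AE_cbox_iff_box[of a "a + vec s"] in eventually_elim) (auto simp: indicator_def)
    finally show ?thesis .
  qed
  ultimately show ?thesis using Tm by blast
qed

text \<open>The order of choices matters. First \<open>k\<close> is taken so small that the energy
  of the whole cube contributes at most e / 2; then the open set V around N so small that its
  volume, multiplied by the now large constant, contributes the other e / 2.\<close>

lemma sobolev_slice_lusin_cube:
  assumes N: "N \<subseteq> cbox a0 (a0 + vec s0)" "negligible N"
  shows "negligible ((\<lambda>x. upd q (x $ i) (Pf x)) ` N)"
  unfolding negligible_outer_le
proof (intro allI impI)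
  fix e :: real assume e: "e > 0"
  let ?Q0 = "cbox a0 (a0 + vec s0)" and ?G = "\<lambda>x. upd q (x $ i) (Pf x)"
  have "(\<integral>\<^sup>+y. HH y * indicator ?Q0 y \<partial>lborel) < \<infinity>"
  proof -
    have "(\<integral>\<^sup>+y. HH y * indicator ?Q0 y \<partial>lborel) = (\<Sum>l\<in>UNIV. \<Sum>j\<in>UNIV. \<integral>\<^sup>+y. ennreal (\<bar>g' l j y\<bar> ^ Suc m) * indicator ?Q0 y \<partial>lborel)"
    proof -
      have "(\<integral>\<^sup>+y. HH y * indicator ?Q0 y \<partial>lborel) = (\<Sum>l\<in>UNIV. \<integral>\<^sup>+y. (\<Sum>j\<in>UNIV. ennreal (\<bar>g' l j y\<bar> ^ Suc m) * indicator ?Q0 y) \<partial>lborel)"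
        unfolding HH_def sum_distrib_right by (rule nn_integral_sum) measurable
      also have "... = (\<Sum>l\<in>UNIV. \<Sum>j\<in>UNIV. \<integral>\<^sup>+y. ennreal (\<bar>g' l j y\<bar> ^ Suc m) * indicator ?Q0 y \<partial>lborel)"
        by (intro sum.cong refl nn_integral_sum) measurable
      finally show ?thesis .
    qed
    also have "... < \<infinity>" using loc[OF compact_cbox Q0] by (auto simp: less_top[symmetric])
    finally show ?thesis .
  qed
  then obtain h0 where h0: "(\<integral>\<^sup>+y. HH y * indicator ?Q0 y \<partial>lborel) = ennreal h0" "h0 \<ge> 0"
    by (cases "\<integral>\<^sup>+y. HH y * indicator ?Q0 y \<partial>lborel" rule: ennreal_cases) auto
  define k where "k = e / (2 * (2 ^ m * (C1 + 1) * (h0 + 1)))"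
  have k: "k > 0" using e C1 h0 by (simp add: k_def)
  have kb: "2 ^ m * k * C1 * h0 \<le> e / 2"
  proof -
    have "2 ^ m * k * C1 * h0 \<le> 2 ^ m * k * (C1 + 1) * (h0 + 1)"
      using k C1 h0 by (intro mult_mono) auto
    also have "... = e / 2"
    proof -
      have "2 ^ m * (C1 + 1) * (h0 + 1) \<noteq> 0" using C1 h0 by auto
      thus ?thesis by (simp add: k_def field_simps)
    qed
    finally show ?thesis .
  qed
  define v where "v = e / 2 * k ^ m / 2 ^ m"
  have v: "v > 0" using e k by (simp add: v_def)
  have "N \<in> sets lebesgue" using N(2) by (simp add: negligible_imp_sets)
  from sets_lebesgue_outer_open[OF this v] obtain V where V: "open V" "N \<subseteq> V" "emeasure lebesgue (V - N) < ennreal v"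
    by blast
  have eV: "emeasure lborel V \<le> ennreal v"
  proof -
    have "emeasure lebesgue V = emeasure lebesgue (V - N)"
      by (rule emeasure_Diff_null_set[symmetric]) (use N(2) V in \<open>auto simp: negligible_iff_null_sets\<close>)
    thus ?thesis using V by simp
  qed
  \<comment> \<open>With V as the gauge at its own points, every covering cube lies in V.\<close>
  have ga: "gauge (\<lambda>x. if x \<in> V then V else UNIV)" using V(1) by (auto simp: gauge_def)
  have bne: "box a0 (a0 + vec s0) \<noteq> {}" using s0 by (auto simp: interval_eq_empty_cart not_le)
  obtain \<D> where D: "countable \<D>" "\<Union>\<D> \<subseteq> ?Q0"
    "\<And>K. K \<in> \<D> ==> interior K \<noteq> {} \<and> (\<exists>c d. K = cbox c d)"
    "pairwise (\<lambda>A B. interior A \<inter> interior B = {}) \<D>"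
    "\<And>K. K \<in> \<D> ==> \<exists>x \<in> N \<inter> K. K \<subseteq> (if x \<in> V then V else UNIV)"
    "\<And>u v. cbox u v \<in> \<D> ==> \<exists>n. \<forall>i \<in> Basis. v \<bullet> i - u \<bullet> i = ((a0 + vec s0) \<bullet> i - a0 \<bullet> i) / 2^n"
    "N \<subseteq> \<Union>\<D>"
    by (rule covering_lemma[OF N(1) bne ga]) (rule that; assumption)
  define w where "w y = ennreal (2 ^ m / k ^ m) + ennreal (2 ^ m * k * C1) * HH y" for y
  have [measurable]: "w \<in> borel_measurable borel" unfolding w_def by measurable
  have "\<exists>T \<in> sets borel. ?G ` K \<subseteq> T \<and> emeasure lborel T \<le> (\<integral>\<^sup>+y. w y * indicator (interior K) y \<partial>lborel)" if KD: "K \<in> \<D>" for K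
  proof -
    obtain c d where K: "K = cbox c d" "interior K \<noteq> {}" using D(3)[OF KD] by blast
    \<comment> \<open>All sides carry the same power of 2 and the big box is a cube, so the pieces
      are cubes as well and \<open>cube_image\<close> applies.\<close>
    obtain n where n: "\<And>j. d $ j - c $ j = s0 / 2 ^ n"
      using D(6)[of c d] KD K by (auto simp: Basis_vec_def cart_eq_inner_axis[symmetric])
    have d: "d = c + vec (s0 / 2 ^ n)" using n by (simp add: vec_eq_iff algebra_simps)
    have "cbox c (c + vec (s0 / 2 ^ n)) \<subseteq> ?Q0" using D(2) KD K d by blast
    from cube_image[OF this _ k, of q i] s0 show ?thesis unfolding K(1) d interior_cbox w_def by simp
  qed
  hence "\<forall>K\<in>\<D>. \<exists>T. T \<in> sets borel \<and> ?G ` K \<subseteq> T \<and> emeasure lborel T \<le> (\<integral>\<^sup>+y. w y * indicator (interior K) y \<partial>lborel)"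
    by (simp add: Bex_def)
  from bchoice[OF this] obtain T where T: "\<And>K. K \<in> \<D> ==> T K \<in> sets borel \<and> ?G ` K \<subseteq> T K \<and> emeasure lborel (T K) \<le> (\<integral>\<^sup>+y. w y * indicator (interior K) y \<partial>lborel)"
    by blast
  \<comment> \<open>Numbering the countably many cubes turns their union into a series over nat;
    numbers that are not taken give empty sets.\<close>
  define f where "f = to_nat_on \<D>"
  have finj: "inj_on f \<D>" unfolding f_def using D(1) by (rule inj_on_to_nat_on)
  define A where "A n = (\<Union>K\<in>{K\<in>\<D>. f K = n}. T K)" for n
  define I where "I n = (\<Union>K\<in>{K\<in>\<D>. f K = n}. interior K)" for n
  have single: "{K\<in>\<D>. f K = n} = {} \<or> (\<exists>K\<in>\<D>. {K\<in>\<D>. f K = n} = {K})" for n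
  proof (cases "\<exists>K\<in>\<D>. f K = n")
    case True
    then obtain K where K: "K \<in> \<D>" "f K = n" by blast
    have "K' = K" if "K' \<in> \<D>" "f K' = n" for K'
      by (rule inj_onD[OF finj]) (use that K in simp_all)
    with K have "{K\<in>\<D>. f K = n} = {K}" by blast
    thus ?thesis using K(1) by blast
  qed auto
  have [measurable]: "A n \<in> sets borel" "I n \<in> sets borel" for n
  proof -
    show "A n \<in> sets borel"
      using single[of n]
    proof
      assume "\<exists>K\<in>\<D>. {K\<in>\<D>. f K = n} = {K}"
      then obtain K where "K \<in> \<D>" "{K\<in>\<D>. f K = n} = {K}" by blast
      thus ?thesis using T unfolding A_def by simp
    next
      assume e: "{K\<in>\<D>. f K = n} = {}"
      show ?thesis unfolding A_def e by simp
    qed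
    show "I n \<in> sets borel" unfolding I_def by (intro borel_open open_UN) auto
  qed
  have An: "emeasure lborel (A n) \<le> (\<integral>\<^sup>+y. w y * indicator (I n) y \<partial>lborel)" for n
    using single[of n]
  proof
    assume "\<exists>K\<in>\<D>. {K\<in>\<D>. f K = n} = {K}"
    then obtain K where "K \<in> \<D>" "{K\<in>\<D>. f K = n} = {K}" by blast
    thus ?thesis using T unfolding A_def I_def by simp
  next
    assume e: "{K\<in>\<D>. f K = n} = {}"
    show ?thesis unfolding A_def e by simp
  qed
  have disj: "disjoint_family I"
    unfolding disjoint_family_on_def
  proof (intro ballI impI)
    fix i j :: nat assume "i \<noteq> j"
    have "interior K \<inter> interior K' = {}" if "K \<in> \<D>" "K' \<in> \<D>" "f K = i" "f K' = j" for K K'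
    proof -
      have "K \<noteq> K'" using that \<open>i \<noteq> j\<close> by (intro notI) simp
      thus ?thesis using pairwiseD[OF D(4) that(1,2)] by simp
    qed
    note * = this
    show "I i \<inter> I j = {}"
    proof (rule equals0I)
      fix x assume "x \<in> I i \<inter> I j"
      hence "x \<in> I i" "x \<in> I j" by simp_all
      then obtain K K' where "K \<in> \<D>" "f K = i" "x \<in> interior K" "K' \<in> \<D>" "f K' = j" "x \<in> interior K'"
        unfolding I_def by (elim UN_E CollectE conjE) (rule that)
      with *[of K K'] show False by (metis IntI empty_iff)
    qed
  qed
  have sub: "(\<Union>n. I n) \<subseteq> V \<inter> ?Q0"
  proof -
    have "interior K \<subseteq> V \<inter> ?Q0" if KD: "K \<in> \<D>" for K
    proof -
      obtain x where x: "x \<in> N" "K \<subseteq> (if x \<in> V then V else UNIV)" using D(5)[OF KD] by blast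
      have "x \<in> V" using V(2) x(1) by (rule subsetD)
      hence "K \<subseteq> V" using x(2) by simp
      moreover have "K \<subseteq> ?Q0" using order_trans[OF Union_upper[OF KD] D(2)] .
      ultimately have "K \<subseteq> V \<inter> ?Q0" by simp
      thus ?thesis using interior_subset by (rule order_trans[rotated])
    qed
    thus ?thesis unfolding I_def by (simp add: UN_subset_iff)
  qed
  have GN: "?G ` N \<subseteq> (\<Union>n. A n)"
  proof
    fix y assume "y \<in> ?G ` N"
    then obtain x where x: "x \<in> N" "y = ?G x" by (rule imageE)
    obtain K where K: "K \<in> \<D>" "x \<in> K" using x(1) D(7) by (meson UnionE subsetD)
    have "?G x \<in> T K" using T[OF K(1)] imageI[OF K(2), of ?G] by (meson subsetD)
    hence "y \<in> A (f K)" unfolding A_def x(2) using K(1) by (intro UN_I[of K]) simp_all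
    thus "y \<in> (\<Union>n. A n)" by (rule UN_I[OF UNIV_I])
  qed
  have "emeasure lborel (\<Union>n. A n) \<le> (\<Sum>n. emeasure lborel (A n))"
    by (rule emeasure_subadditive_countably) auto
  also have "... \<le> (\<Sum>n. \<integral>\<^sup>+y. w y * indicator (I n) y \<partial>lborel)"
    by (intro suminf_le An) auto
  also have "... = (\<integral>\<^sup>+y. (\<Sum>n. w y * indicator (I n) y) \<partial>lborel)"
    by (rule nn_integral_suminf[symmetric]) auto
  also have "... = (\<integral>\<^sup>+y. w y * indicator (\<Union>n. I n) y \<partial>lborel)"
    by (intro nn_integral_cong) (simp add: ennreal_suminf_cmult suminf_indicator[OF disj])
  also have "... \<le> (\<integral>\<^sup>+y. ennreal (2 ^ m / k ^ m) * indicator V y + ennreal (2 ^ m * k * C1) * (HH y * indicator ?Q0 y) \<partial>lborel)"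
    by (intro nn_integral_mono) (use sub in \<open>auto simp: w_def indicator_def\<close>)
  also have "... = ennreal (2 ^ m / k ^ m) * emeasure lborel V + ennreal (2 ^ m * k * C1) * ennreal h0"
    using V(1) by (simp add: nn_integral_add nn_integral_cmult nn_integral_cmult_indicator h0)
  also have "... \<le> ennreal (2 ^ m / k ^ m) * ennreal v + ennreal (2 ^ m * k * C1) * ennreal h0"
    by (intro add_right_mono mult_left_mono eV) auto
  also have "ennreal (2 ^ m / k ^ m) * ennreal v = ennreal (2 ^ m / k ^ m * v)"
    by (rule ennreal_mult[symmetric]) (use k v in auto)
  also have "ennreal (2 ^ m * k * C1) * ennreal h0 = ennreal (2 ^ m * k * C1 * h0)"
    by (rule ennreal_mult[symmetric]) (use k C1 h0(2) in auto)
  also have "ennreal (2 ^ m / k ^ m * v) + ennreal (2 ^ m * k * C1 * h0) = ennreal (2 ^ m / k ^ m * v + 2 ^ m * k * C1 * h0)"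
    by (rule ennreal_plus[symmetric]) (use k v C1 h0(2) in auto)
  also have "... \<le> ennreal e"
  proof (rule ennreal_leI)
    have "2 ^ m / k ^ m * v = e / 2" using k by (simp add: v_def)
    thus "2 ^ m / k ^ m * v + 2 ^ m * k * C1 * h0 \<le> e" using kb by linarith
  qed
  finally have le: "emeasure lborel (\<Union>n. A n) \<le> ennreal e" .
  hence fin: "emeasure lborel (\<Union>n. A n) < \<infinity>" by (rule order_le_less_trans) simp
  show "\<exists>T. ?G ` N \<subseteq> T \<and> T \<in> lmeasurable \<and> measure lebesgue T \<le> e"
  proof (intro exI conjI)
    show "(\<Union>n. A n) \<in> lmeasurable" using fin by (intro fmeasurableI) auto
    show "measure lebesgue (\<Union>n. A n) \<le> e"
      using le e by (simp add: measure_def enn2real_leI)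
  qed (rule GN)
qed

end

text \<open>The projection is Lipschitz only locally. Around each point of N, continuity of F gives
  a cube whose image lies in a ball with one Lipschitz constant, and by Lindeloef countably many of
  these cubes cover N.\<close>

lemma sobolev_slice_lusin:
  fixes F :: "real^'n => real^'n" and P :: "real^'n => real^'n"
  assumes U: "open U" "continuous_on U F" "W1_loc U CARD('n) F"
    and V: "open V" and contP: "continuous_on V P"
    and lip: "\<And>y0. y0 \<in> V ==> \<exists>d>0. \<exists>L\<ge>0. \<forall>y\<in>ball y0 d. \<forall>y'\<in>ball y0 d. \<forall>j. \<bar>P y $ j - P y' $ j\<bar> \<le> L * (\<Sum>l\<in>UNIV. \<bar>y $ l - y' $ l\<bar>)"
    and N: "N \<subseteq> U" "F ` N \<subseteq> V" "negligible N"
  shows "negligible ((\<lambda>x. upd q (x $ i) (P (F x))) ` N)"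
proof -
  obtain m where m: "CARD('n) = Suc m" by (metis not0_implies_Suc zero_less_card_finite less_irrefl)
  obtain g g' :: "'n => 'n => real^'n => real" where
    G: "\<And>l j. weak_partial U j (\<lambda>x. F x $ l) (g l j)" "\<And>l j. g' l j \<in> borel_measurable borel"
    "\<And>l j. AE y in lebesgue. y \<in> U \<longrightarrow> g l j y = g' l j y"
    "\<And>l j K. compact K ==> K \<subseteq> U ==> (\<integral>\<^sup>+y. ennreal (\<bar>g' l j y\<bar> ^ Suc m) * indicator K y \<partial>lborel) < \<infinity>"
    by (rule W1_loc_gradient[OF U(3), unfolded m]) (rule that; assumption)
  let ?G = "\<lambda>x. upd q (x $ i) (P (F x))"
  have nbhd: "\<exists>T. openin (top_of_set N) T \<and> x \<in> T \<and> negligible (?G ` T)" if x: "x \<in> N" for x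
  proof -
    obtain d L where d: "d > 0" "L \<ge> 0" "\<And>y y' j. y \<in> ball (F x) d ==> y' \<in> ball (F x) d ==> \<bar>P y $ j - P y' $ j\<bar> \<le> L * (\<Sum>l\<in>UNIV. \<bar>y $ l - y' $ l\<bar>)"
    proof -
      have "F x \<in> V" using N(2) imageI[OF x] by (rule subsetD)
      from lip[OF this] obtain d L where "d > 0" "L \<ge> 0"
        and *: "\<forall>y\<in>ball (F x) d. \<forall>y'\<in>ball (F x) d. \<forall>j. \<bar>P y $ j - P y' $ j\<bar> \<le> L * (\<Sum>l\<in>UNIV. \<bar>y $ l - y' $ l\<bar>)"
        by (elim exE conjE)
      thus ?thesis by (intro that[of d L]) (assumption, assumption, rule *[rule_format], assumption+)
    qed
    have "F x \<in> V" using N(2) imageI[OF x] by (rule subsetD)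
    then obtain d' where d': "d' > 0" "ball (F x) d' \<subseteq> V" using V openE by blast
    define W where "W = U \<inter> F -` (ball (F x) (min d d'))"
    have "open W" unfolding W_def using continuous_open_preimage[OF U(2,1) open_ball] .
    moreover have "x \<in> W" using x N(1) d d' by (auto simp: W_def)
    ultimately obtain r where r: "r > 0" "cball x r \<subseteq> W" by (meson open_contains_cball)
    define s0 where "s0 = r / real CARD('n)"
    have s0: "s0 > 0" using r by (simp add: s0_def)
    define a0 where "a0 = x - vec (s0 / 2)"
    have cube: "cbox a0 (a0 + vec s0) \<subseteq> W"
    proof
      fix y assume y: "y \<in> cbox a0 (a0 + vec s0)"
      have "norm (x - y) \<le> (\<Sum>j\<in>(UNIV :: 'n set). s0)"
      proof (intro order_trans[OF norm_le_l1_cart] sum_mono)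
        fix j
        have "x $ j - s0 / 2 \<le> y $ j" "y $ j \<le> x $ j - s0 / 2 + s0" using y by (auto simp: a0_def mem_box_cart)
        thus "\<bar>(x - y) $ j\<bar> \<le> s0" using s0 by (simp add: abs_le_iff)
      qed
      also have "... = r" by (simp add: s0_def)
      finally show "y \<in> W" using r(2) by (auto simp: dist_norm)
    qed
    have WU: "W \<subseteq> U" by (auto simp: W_def)
    have FW: "F y \<in> ball (F x) d \<and> F y \<in> V" if "y \<in> W" for y using that d'(2) by (auto simp: W_def)
    have neg: "negligible (?G ` (N \<inter> box a0 (a0 + vec s0)))"
    proof (rule sobolev_slice_lusin_cube[OF U(1,2) m _ s0 d(2) _ _ G])
      show "cbox a0 (a0 + vec s0) \<subseteq> U" using cube WU by blast
      show "continuous_on (cbox a0 (a0 + vec s0)) (\<lambda>x. P (F x))"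
        by (rule continuous_on_compose2[OF contP continuous_on_subset[OF U(2)]]) (use cube WU FW in blast)+
      show "\<bar>P (F y) $ j - P (F y') $ j\<bar> \<le> L * (\<Sum>l\<in>UNIV. \<bar>F y $ l - F y' $ l\<bar>)"
        if "y \<in> cbox a0 (a0 + vec s0)" "y' \<in> cbox a0 (a0 + vec s0)" for y y' j
        using that cube FW by (intro d(3)) blast+
      show "N \<inter> box a0 (a0 + vec s0) \<subseteq> cbox a0 (a0 + vec s0)" using box_subset_cbox by blast
      show "negligible (N \<inter> box a0 (a0 + vec s0))" using N(3) by (rule negligible_subset) auto
    qed
    moreover have "x \<in> box a0 (a0 + vec s0)" using s0 by (auto simp: a0_def mem_box_cart)
    ultimately show ?thesis using x by (intro exI[of _ "N \<inter> box a0 (a0 + vec s0)"]) (auto simp: openin_open_Int)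
  qed
  hence "\<forall>x\<in>N. \<exists>T. openin (top_of_set N) T \<and> x \<in> T \<and> negligible (?G ` T)" by simp
  from bchoice[OF this] obtain T where T: "\<And>x. x \<in> N ==> openin (top_of_set N) (T x) \<and> x \<in> T x \<and> negligible (?G ` T x)" by blast
  obtain \<F> where F: "\<F> \<subseteq> T ` N" "countable \<F>" "\<Union>\<F> = \<Union>(T ` N)"
    using Lindelof_openin[of "T ` N" N] T by auto
  have "N \<subseteq> \<Union>\<F>" using F(3) T by blast
  hence "?G ` N \<subseteq> (\<Union>S\<in>\<F>. ?G ` S)" by blast
  moreover have "negligible (\<Union>S\<in>\<F>. ?G ` S)"
    by (rule negligible_countable_Union) (use F T in auto)
  ultimately show ?thesis using negligible_subset by blast
qed

section \<open>Central projections\<close>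

lemma upd_alt: "upd k r v = v + (r - v $ k) *\<^sub>R axis k 1"
  by (auto simp: vec_eq_iff axis_def)

lemma abs_det_le:
  fixes M :: "real^'n^'n"
  assumes "\<And>j l. \<bar>M $ j $ l\<bar> \<le> B j"
  shows "\<bar>det M\<bar> \<le> fact CARD('n) * (\<Prod>j\<in>UNIV. B j)"
proof -
  have "\<bar>det M\<bar> \<le> (\<Sum>p | p permutes (UNIV :: 'n set). \<bar>of_int (sign p) * (\<Prod>j\<in>UNIV. M $ j $ p j)\<bar>)"
    unfolding det_def by (rule sum_abs)
  also have "... \<le> (\<Sum>p | p permutes (UNIV :: 'n set). (\<Prod>j\<in>UNIV. B j))"
  proof (rule sum_mono)
    fix p :: "'n => 'n"
    have "\<bar>of_int (sign p) * (\<Prod>j\<in>UNIV. M $ j $ p j)\<bar> = (\<Prod>j\<in>UNIV. \<bar>M $ j $ p j\<bar>)"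
      by (simp add: abs_mult sign_def abs_prod)
    also have "... \<le> (\<Prod>j\<in>UNIV. B j)" using assms by (intro prod_mono) auto
    finally show "\<bar>of_int (sign p) * (\<Prod>j\<in>UNIV. M $ j $ p j)\<bar> \<le> (\<Prod>j\<in>UNIV. B j)" .
  qed
  also have "... = fact CARD('n) * (\<Prod>j\<in>UNIV. B j)" by (simp add: card_permutations)
  finally show ?thesis .
qed

lemma min_stretch_pos:
  fixes A :: "real^'n => real^'n"
  assumes A: "linear A" "det (matrix A) \<noteq> 0"
  shows "min_stretch A > 0" "min_stretch A * norm v \<le> norm (A v)"
proof -
  have bdd: "bdd_below ((\<lambda>v. norm (A v) / norm v) ` (- {0}))" by (rule bdd_belowI[of _ 0]) auto
  have "inj A" using A det_nz_iff_inj by blast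
  then obtain B where B: "B > 0" "\<And>x. B * norm x \<le> norm (A x)"
    using linear_inj_bounded_below_pos[OF A(1)] by blast
  have "(- {0 :: real^'n}) \<noteq> {}" using axis_eq_0_iff[of undefined "1::real"] by blast
  hence "B \<le> min_stretch A" unfolding min_stretch_def
    by (rule cINF_greatest) (use B in \<open>auto simp: field_simps\<close>)
  thus "min_stretch A > 0" using B by simp
  show "min_stretch A * norm v \<le> norm (A v)"
  proof (cases "v = 0")
    case False
    hence "min_stretch A \<le> norm (A v) / norm v" unfolding min_stretch_def using bdd by (intro cINF_lower) auto
    thus ?thesis using False by (simp add: field_simps)
  qed (simp add: linear_0[OF A(1)])
qed

text \<open>The central projection from z onto the hyperplane \<open>y $ k = h\<close>.\<close>

definition cproj :: "'n => real => real^'n => real^'n => real^'n" where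
  "cproj k h z y = z + ((h - z $ k) / (y $ k - z $ k)) *\<^sub>R (y - z)"

text \<open>The cone with apex z over the cube of half-side 1 in that hyperplane; the strict
  inequality in coordinate k removes the apex.\<close>

definition ray_cone :: "'n => real => real^'n => (real^'n) set" where
  "ray_cone k h z = {y. z $ k < y $ k \<and> y $ k \<le> h \<and> (\<forall>j. j \<noteq> k \<longrightarrow> \<bar>cproj k h z y $ j\<bar> \<le> 1)}"

lemma cproj_nth: "cproj k h z y $ j = z $ j + (h - z $ k) * ((y $ j - z $ j) / (y $ k - z $ k))"
  by (simp add: cproj_def)

lemma continuous_on_cproj: "continuous_on {y. z $ k < y $ k} (cproj k h z)"
  unfolding cproj_def by (intro continuous_intros) auto

lemma cproj_segment:
  assumes "y \<in> closed_segment z p" "y \<noteq> z" "p $ k = h" "z $ k < h" "\<And>j. j \<noteq> k ==> \<bar>p $ j\<bar> \<le> 1"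
  shows "y \<in> ray_cone k h z" "cproj k h z y = p"
proof -
  obtain u where u: "0 \<le> u" "u \<le> 1" "y = (1 - u) *\<^sub>R z + u *\<^sub>R p" using assms(1) by (auto simp: closed_segment_def)
  have "u \<noteq> 0" using assms(2) u by auto
  hence u0: "u > 0" using u by simp
  have d: "y $ j - z $ j = u * (p $ j - z $ j)" for j unfolding u(3) by (simp add: algebra_simps)
  have yk: "y $ k - z $ k = u * (h - z $ k)" using d[of k] assms(3) by simp
  show *: "cproj k h z y = p"
    using u0 assms(4) by (simp add: vec_eq_iff cproj_nth d yk assms(3))
  have "0 < u * (h - z $ k)" using u0 assms(4) by simp
  moreover have "u * (h - z $ k) \<le> h - z $ k" using u assms(4) mult_right_mono[of u 1 "h - z $ k"] by simp
  ultimately have "z $ k < y $ k" "y $ k \<le> h" using yk by linarith+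
  thus "y \<in> ray_cone k h z" using assms(5) unfolding ray_cone_def mem_Collect_eq * by blast
qed

text \<open>The apex is at height at least 1 below the hyperplane, so the slope of every ray is at
  most 1 + R. Hence the distance to the apex is comparable with the single coordinate difference by
  which the projection divides.\<close>

lemma cone_geometry:
  fixes z :: "real^'n"
  assumes y: "y \<in> ray_cone k h z" and z: "z $ k \<le> h - 1" "norm z \<le> R"
  shows "0 < y $ k - z $ k" "\<bar>y $ j - z $ j\<bar> \<le> (1 + R) * (y $ k - z $ k)"
    "norm (y - z) \<le> real CARD('n) * (1 + R) * (y $ k - z $ k)" "0 < norm (y - z)"
proof -
  show b: "0 < y $ k - z $ k" using y by (simp add: ray_cone_def)
  have zj: "\<bar>z $ j\<bar> \<le> R" for j using component_le_norm_cart[of z j] z by linarith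
  have R: "R \<ge> 0" using z(2) norm_ge_zero order_trans by blast
  show j: "\<bar>y $ j - z $ j\<bar> \<le> (1 + R) * (y $ k - z $ k)" for j
  proof (cases "j = k")
    case True
    thus ?thesis using b R by simp
  next
    case False
    have "\<bar>cproj k h z y $ j\<bar> \<le> 1" using y False by (simp add: ray_cone_def)
    hence "\<bar>(h - z $ k) * ((y $ j - z $ j) / (y $ k - z $ k))\<bar> \<le> 1 + R"
      using zj[of j] unfolding cproj_nth by linarith
    moreover have "1 * \<bar>(y $ j - z $ j) / (y $ k - z $ k)\<bar> \<le> \<bar>(h - z $ k) * ((y $ j - z $ j) / (y $ k - z $ k))\<bar>"
      unfolding abs_mult using z by (intro mult_right_mono) auto
    ultimately have "\<bar>(y $ j - z $ j) / (y $ k - z $ k)\<bar> \<le> 1 + R" by linarith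
    thus ?thesis using b by (simp add: abs_divide pos_divide_le_eq)
  qed
  have "norm (y - z) \<le> (\<Sum>j\<in>UNIV. \<bar>(y - z) $ j\<bar>)" by (rule norm_le_l1_cart)
  also have "... \<le> (\<Sum>j\<in>(UNIV::'n set). (1 + R) * (y $ k - z $ k))" using j by (intro sum_mono) simp
  finally show "norm (y - z) \<le> real CARD('n) * (1 + R) * (y $ k - z $ k)" by simp
  show "0 < norm (y - z)" using b by auto
qed

lemma cproj_locally_lipschitz:
  fixes z :: "real^'n"
  assumes y0: "z $ k < y0 $ k"
  shows "\<exists>d>0. \<exists>L\<ge>0. \<forall>y\<in>ball y0 d. \<forall>y'\<in>ball y0 d. \<forall>j. \<bar>cproj k h z y $ j - cproj k h z y' $ j\<bar> \<le> L * (\<Sum>l\<in>UNIV. \<bar>y $ l - y' $ l\<bar>)"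
proof -
  define b where "b = (y0 $ k - z $ k) / 2"
  have b: "b > 0" using y0 by (simp add: b_def)
  define R where "R = norm (y0 - z) + b"
  have R: "R > 0" using b by (simp add: R_def add_nonneg_pos)
  define L where "L = \<bar>h - z $ k\<bar> * (1 / b + R / b\<^sup>2)"
  have L: "L \<ge> 0" using b R by (simp add: L_def)
  have near: "y $ k - z $ k \<ge> b \<and> \<bar>y $ j - z $ j\<bar> \<le> R" if "y \<in> ball y0 b" for y j
  proof -
    have n: "norm (y - y0) < b" using that by (simp add: dist_norm norm_minus_commute)
    have "\<bar>(y - y0) $ k\<bar> < b" using component_le_norm_cart[of "y - y0" k] n by linarith
    moreover have "y0 $ k - z $ k = 2 * b" by (simp add: b_def)
    moreover have "\<bar>(y - z) $ j\<bar> \<le> norm (y - y0) + norm (y0 - z)"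
      using component_le_norm_cart[of "y - z" j] norm_triangle_ineq[of "y - y0" "y0 - z"] by simp
    ultimately show ?thesis using n by (auto simp: R_def)
  qed
  have "\<bar>cproj k h z y $ j - cproj k h z y' $ j\<bar> \<le> L * (\<Sum>l\<in>UNIV. \<bar>y $ l - y' $ l\<bar>)"
    if "y \<in> ball y0 b" "y' \<in> ball y0 b" for y y' j
  proof -
    define S where "S = (\<Sum>l\<in>UNIV. \<bar>y $ l - y' $ l\<bar>)"
    have Sl: "\<bar>y $ l - y' $ l\<bar> \<le> S" for l unfolding S_def by (rule member_le_sum) auto
    define p p' q q' where "p = y $ j - z $ j" and "p' = y' $ j - z $ j" and "q = y $ k - z $ k" and "q' = y' $ k - z $ k"
    have q: "q \<ge> b" "q' \<ge> b" "\<bar>p'\<bar> \<le> R" using near[OF that(1)] near[OF that(2)] by (auto simp: p'_def q_def q'_def)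
    have "p / q - p' / q' = (p - p') / q + p' * (q' - q) / (q * q')" using q b by (simp add: field_simps)
    hence "\<bar>p / q - p' / q'\<bar> \<le> \<bar>(p - p') / q\<bar> + \<bar>p' * (q' - q) / (q * q')\<bar>"
      by (simp only: abs_triangle_ineq)
    also have "\<bar>(p - p') / q\<bar> \<le> S / b"
      unfolding abs_divide using Sl[of j] q b by (intro frac_le) (auto simp: p_def p'_def)
    also have "\<bar>p' * (q' - q) / (q * q')\<bar> \<le> R * S / b\<^sup>2"
      unfolding abs_divide abs_mult using Sl[of k] q b R
      by (intro frac_le mult_mono) (auto simp: q_def q'_def power2_eq_square intro!: mult_mono)
    finally have "\<bar>p / q - p' / q'\<bar> \<le> (1 / b + R / b\<^sup>2) * S" by (simp add: algebra_simps)
    hence "\<bar>h - z $ k\<bar> * \<bar>p / q - p' / q'\<bar> \<le> \<bar>h - z $ k\<bar> * ((1 / b + R / b\<^sup>2) * S)" by (intro mult_left_mono) auto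
    moreover have "cproj k h z y $ j - cproj k h z y' $ j = (h - z $ k) * (p / q - p' / q')"
      by (simp add: cproj_nth p_def p'_def q_def q'_def right_diff_distrib)
    ultimately show ?thesis by (simp add: L_def S_def abs_mult mult.assoc)
  qed
  thus ?thesis using b L by blast
qed

text \<open>The two cases compare \<rho>^(-m) with a^m \<rho>^(-1/2). At equality a is \<rho>^(-1 +
  1/(2m)), which is the origin of the exponent. It is larger than -(m+1), so the kernel is
  integrable near the centre in dimension m + 1.\<close>

lemma young_kernel:
  fixes a \<rho> :: real
  assumes a: "a \<ge> 0" and \<rho>: "\<rho> > 0" and m: "m \<ge> 1"
  shows "a / \<rho> ^ m \<le> a ^ Suc m / sqrt \<rho> + \<rho> powr (- real (Suc m) + 1 / (2 * real m))"
proof (cases "1 / \<rho> ^ m \<le> a ^ m / sqrt \<rho>")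
  case True
  have "a * (1 / \<rho> ^ m) \<le> a * (a ^ m / sqrt \<rho>)" using True a by (rule mult_left_mono)
  thus ?thesis by (simp add: add_increasing2)
next
  case False
  have "a ^ m < sqrt \<rho> / \<rho> ^ m" using False \<rho> by (simp add: field_simps)
  also have "... = \<rho> powr (1 / 2 - real m)" using \<rho> by (simp add: powr_diff powr_realpow powr_half_sqrt)
  also have "... = (\<rho> powr (- 1 + 1 / (2 * real m))) ^ m"
    using m \<rho> by (subst powr_realpow[symmetric]) (auto simp: powr_powr algebra_simps)
  finally have "a < \<rho> powr (- 1 + 1 / (2 * real m))" using a by (intro power_less_imp_less_base[of a m]) auto
  hence "a / \<rho> ^ m \<le> \<rho> powr (- 1 + 1 / (2 * real m)) / \<rho> ^ m" using \<rho> by (intro divide_right_mono) auto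
  also have "... = \<rho> powr (- real (Suc m) + 1 / (2 * real m))"
  proof -
    have "\<rho> powr (- 1 + 1 / (2 * real m)) / \<rho> ^ m = \<rho> powr ((- 1 + 1 / (2 * real m)) - real m)"
      using \<rho> by (simp add: powr_diff powr_realpow)
    thus ?thesis by (simp add: algebra_simps)
  qed
  finally show ?thesis using a \<rho> by (simp add: add_increasing)
qed

text \<open>Each term is at most 3 times the increment over a unit interval of the increasing
  function sgn x sqrt |x|. The increments telescope, and over an interval of length N the total is
  at most 2 sqrt N wherever u lies.\<close>

lemma sum_inverse_sqrt_le:
  fixes u :: real
  shows "(\<Sum>l=1..N. 1 / sqrt (max 1 \<bar>u - real l\<bar>)) \<le> 6 * sqrt (real N)"
proof -
  define \<psi> where "\<psi> x = sgn x * sqrt \<bar>x\<bar>" for x :: real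
  have step: "1 / sqrt (max 1 \<bar>x\<bar>) \<le> 3 * (\<psi> x - \<psi> (x - 1))" for x
  proof -
    consider "x \<ge> 1" | "x \<le> 0" | "0 < x" "x < 1" by linarith
    thus ?thesis
    proof cases
      case 1
      have "1 = (sqrt x - sqrt (x - 1)) * (sqrt x + sqrt (x - 1))" using 1 by (simp add: algebra_simps)
      also have "... \<le> (sqrt x - sqrt (x - 1)) * (sqrt x + sqrt x)" using 1 by (intro mult_left_mono) auto
      finally have "1 / sqrt x \<le> 2 * (sqrt x - sqrt (x - 1))" using 1 by (simp add: field_simps)
      moreover have "sqrt x - sqrt (x - 1) \<ge> 0" using 1 by simp
      ultimately have "1 / sqrt x \<le> 3 * (sqrt x - sqrt (x - 1))"
        using order_trans[OF _ mult_right_mono[of 2 3 "sqrt x - sqrt (x - 1)"]] by auto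
      moreover have "\<psi> x = sqrt x" "\<psi> (x - 1) = sqrt (x - 1)" using 1 by (auto simp: \<psi>_def sgn_if)
      moreover have "max 1 \<bar>x\<bar> = x" using 1 by simp
      ultimately show ?thesis by (simp only:)
    next
      case 2
      define y where "y = - x"
      have y: "y \<ge> 0" using 2 by (simp add: y_def)
      have p: "\<psi> x = - sqrt y" "\<psi> (x - 1) = - sqrt (y + 1)" using y by (auto simp: \<psi>_def sgn_if y_def abs_if)
      have "1 = (sqrt (y + 1) - sqrt y) * (sqrt (y + 1) + sqrt y)" using y by (simp add: algebra_simps)
      also have "... \<le> (sqrt (y + 1) - sqrt y) * (3 * sqrt (max 1 y))"
      proof (intro mult_left_mono)
        have "y + 1 \<le> 2 * max 1 y" by auto
        hence "sqrt (y + 1) \<le> sqrt 2 * sqrt (max 1 y)" by (simp only: real_sqrt_mult[symmetric] real_sqrt_le_iff)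
        also have "... \<le> 2 * sqrt (max 1 y)" using sqrt2_less_2 by (intro mult_right_mono) auto
        finally have "sqrt (y + 1) \<le> 2 * sqrt (max 1 y)" .
        moreover have "sqrt y \<le> sqrt (max 1 y)" by simp
        ultimately show "sqrt (y + 1) + sqrt y \<le> 3 * sqrt (max 1 y)" by linarith
      qed (use y in auto)
      finally have "1 / sqrt (max 1 y) \<le> 3 * (sqrt (y + 1) - sqrt y)"
        by (simp add: divide_le_eq mult_ac max_def split: if_splits)
      moreover have "\<bar>x\<bar> = y" using 2 by (simp add: y_def)
      ultimately show ?thesis by (simp add: p)
    next
      case 3
      have "x \<le> sqrt x" using 3 by (intro real_le_rsqrt) (simp add: power2_eq_square mult_left_le)
      moreover have "1 - x \<le> sqrt (1 - x)" using 3 by (intro real_le_rsqrt) (simp add: power2_eq_square mult_left_le)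
      moreover have "\<psi> x = sqrt x" "\<psi> (x - 1) = - sqrt (1 - x)" using 3 by (auto simp: \<psi>_def sgn_if abs_if)
      ultimately show ?thesis using 3 by (simp add: max_def abs_if)
    qed
  qed
  have "(\<Sum>l=1..N. 1 / sqrt (max 1 \<bar>u - real l\<bar>)) \<le> (\<Sum>l=1..N. 3 * (\<psi> (real l - u) - \<psi> (real (l - 1) - u)))"
  proof (rule sum_mono)
    fix l assume "l \<in> {1..N}"
    hence "real (l - 1) - u = (real l - u) - 1" by (simp add: of_nat_diff)
    thus "1 / sqrt (max 1 \<bar>u - real l\<bar>) \<le> 3 * (\<psi> (real l - u) - \<psi> (real (l - 1) - u))"
      using step[of "real l - u"] by (simp only: abs_minus_commute)
  qed
  also have "... = 3 * (\<psi> (real N - u) - \<psi> (- u))"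
  proof -
    have "(\<Sum>l=1..N. \<psi> (real l - u) - \<psi> (real (l - 1) - u)) = \<psi> (real N - u) - \<psi> (- u)"
      by (induction N) auto
    thus ?thesis by (simp only: sum_distrib_left[symmetric])
  qed
  also have "\<psi> (real N - u) - \<psi> (- u) \<le> 2 * sqrt (real N)"
  proof -
    have sub: "sqrt (x + y) \<le> sqrt x + sqrt y" if "x \<ge> 0" "y \<ge> 0" for x y by (rule sqrt_add_le_add_sqrt[OF that])
    consider "u \<le> 0" | "u \<ge> real N" | "0 < u" "u < real N" by linarith
    thus ?thesis
    proof cases
      case 1
      hence "\<psi> (real N - u) = sqrt (real N + - u)" "\<psi> (- u) = sqrt (- u)" by (auto simp: \<psi>_def sgn_if)
      moreover have "sqrt (real N) \<ge> 0" by simp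
      moreover have "sqrt (real N + - u) \<le> sqrt (real N) + sqrt (- u)" using 1 by (intro sub) auto
      ultimately show ?thesis by linarith
    next
      case 2
      have "\<psi> (real N - u) = - sqrt (u - real N)" "\<psi> (- u) = - sqrt (real N + (u - real N))" using 2 by (auto simp: \<psi>_def sgn_if abs_if)
      moreover have "sqrt (real N) \<ge> 0" by simp
      moreover have "sqrt (real N + (u - real N)) \<le> sqrt (real N) + sqrt (u - real N)" using 2 by (intro sub) auto
      ultimately show ?thesis by linarith
    next
      case 3
      have "\<psi> (real N - u) = sqrt (real N - u)" "\<psi> (- u) = - sqrt u" using 3 by (auto simp: \<psi>_def sgn_if abs_if)
      moreover have "sqrt (real N - u) \<le> sqrt (real N)" "sqrt u \<le> sqrt (real N)" using 3 by auto
      ultimately show ?thesis by linarith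
    qed
  qed
  finally show ?thesis by simp
qed

text \<open>On the dyadic ring between the radii \<open>r (Suc q)\<close> and \<open>r q\<close> the
  kernel is at most \<open>a q\<close>. Enlarging the ring to its ball gives a term of order
  2^(-\<gamma> q), hence a geometric series that does not depend on z.\<close>

lemma nn_integral_kernel_finite:
  fixes R \<gamma> :: real
  assumes \<gamma>: "\<gamma> > 0" and R: "R > 0"
  shows "\<exists>C\<ge>0. \<forall>z :: real^'n. (\<integral>\<^sup>+y. ennreal (norm (y - z) powr (- real CARD('n) + \<gamma>)) * indicator (cball z R) y \<partial>lborel) \<le> ennreal C"
proof -
  define n where "n = CARD('n)"
  define \<alpha> where "\<alpha> = real n"
  define r where "r q = R / 2 ^ q" for q :: nat
  have r: "r q > 0" "r (Suc q) = r q / 2" for q using R by (auto simp: r_def)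
  define v where "v = unit_ball_vol (real n)"
  have v: "v \<ge> 0" by (simp add: v_def unit_ball_vol_nonneg)
  \<comment> \<open>The maximum of the two end values covers both signs of the exponent.\<close>
  define a where "a q = max (r (Suc q) powr (- \<alpha> + \<gamma>)) (r q powr (- \<alpha> + \<gamma>))" for q
  define x where "x = 2 powr (- \<gamma>)"
  have x: "0 < x" "x < 1" using \<gamma> by (auto simp: x_def powr_less_one)
  define B where "B = (2 powr \<alpha> + 1) * v * R powr \<gamma>"
  have B: "B \<ge> 0" using v by (simp add: B_def)
  have rq: "r q powr \<gamma> = R powr \<gamma> * x ^ q" for q
  proof -
    have "r q = R * 2 powr (- real q)" by (simp add: r_def powr_minus powr_realpow divide_inverse)
    hence "r q powr \<gamma> = R powr \<gamma> * (2 powr (- real q)) powr \<gamma>" using R by (simp add: powr_mult)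
    also have "(2 powr (- real q)) powr \<gamma> = (2 powr (- \<gamma>)) powr real q" by (simp add: powr_powr mult.commute)
    also have "... = x ^ q" unfolding x_def[symmetric] using x by (simp add: powr_realpow)
    finally show ?thesis .
  qed
  have aq: "a q * (v * r q ^ n) \<le> B * x ^ q" for q
  proof -
    have "r (Suc q) powr (- \<alpha> + \<gamma>) = r q powr (- \<alpha> + \<gamma>) * 2 powr (\<alpha> - \<gamma>)"
    proof -
      have "(r q / 2) powr (- \<alpha> + \<gamma>) = r q powr (- \<alpha> + \<gamma>) / 2 powr (- \<alpha> + \<gamma>)" using r by (intro powr_divide)
      also have "... = r q powr (- \<alpha> + \<gamma>) * 2 powr (- (- \<alpha> + \<gamma>))" by (simp only: powr_minus divide_inverse)
      finally show ?thesis by (simp add: r)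
    qed
    also have "... \<le> r q powr (- \<alpha> + \<gamma>) * (2 powr \<alpha> + 1)"
    proof (intro mult_left_mono)
      have "2 powr (\<alpha> - \<gamma>) \<le> 2 powr \<alpha>" using \<gamma> by (intro powr_mono) auto
      thus "2 powr (\<alpha> - \<gamma>) \<le> 2 powr \<alpha> + 1" by linarith
    qed simp
    finally have "a q \<le> r q powr (- \<alpha> + \<gamma>) * (2 powr \<alpha> + 1)"
      using mult_left_mono[of 1 "2 powr \<alpha> + 1" "r q powr (- \<alpha> + \<gamma>)"] by (simp add: a_def)
    hence "a q * (v * r q ^ n) \<le> (r q powr (- \<alpha> + \<gamma>) * (2 powr \<alpha> + 1)) * (v * r q ^ n)"
      using v r(1)[of q] by (intro mult_right_mono) auto
    also have "... = (2 powr \<alpha> + 1) * v * (r q powr (- \<alpha> + \<gamma>) * r q powr \<alpha>)"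
      using r(1)[of q] by (simp add: \<alpha>_def powr_realpow mult_ac)
    also have "r q powr (- \<alpha> + \<gamma>) * r q powr \<alpha> = r q powr \<gamma>" by (simp add: powr_add[symmetric])
    finally show ?thesis by (simp add: rq B_def mult_ac)
  qed
  have sx: "summable (\<lambda>q. B * x ^ q)" using x by (intro summable_mult summable_geometric) auto
  have "(\<integral>\<^sup>+y. ennreal (norm (y - z) powr (- real CARD('n) + \<gamma>)) * indicator (cball z R) y \<partial>lborel) \<le> ennreal (\<Sum>q. B * x ^ q)" for z :: "real^'n"
  proof -
    have "(\<integral>\<^sup>+y. ennreal (norm (y - z) powr (- real CARD('n) + \<gamma>)) * indicator (cball z R) y \<partial>lborel)
       \<le> (\<integral>\<^sup>+y. (\<Sum>q. ennreal (a q) * indicator (cball z (r q)) y) \<partial>lborel)"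
    proof (rule nn_integral_mono)
      fix y
      show "ennreal (norm (y - z) powr (- real CARD('n) + \<gamma>)) * indicator (cball z R) y \<le> (\<Sum>q. ennreal (a q) * indicator (cball z (r q)) y)"
      proof (cases "y \<in> cball z R \<and> y \<noteq> z")
        case True
        define d where "d = norm (y - z)"
        have d: "0 < d" "d \<le> R" using True by (auto simp: d_def dist_norm norm_minus_commute)
        obtain N where N: "R / d < 2 ^ N" using real_arch_pow[of 2 "R / d"] by auto
        have "\<exists>k. r k < d" using N d by (intro exI[of _ N]) (simp add: r_def field_simps)
        define k where "k = (LEAST k. r k < d)"
        have k: "r k < d" unfolding k_def by (rule LeastI_ex[of "\<lambda>k. r k < d"]) fact
        have "k \<noteq> 0" using k d by (intro notI) (simp add: r_def)
        then obtain j where j: "k = Suc j" by (cases k) auto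
        have dj: "d \<le> r j" using not_less_Least[of j "\<lambda>k. r k < d"] j by (simp add: k_def)
        have dk: "r (Suc j) < d" using k j by simp
        define t where "t q = ennreal (a q) * indicator (cball z (r q)) y" for q
        have "d powr (- real CARD('n) + \<gamma>) \<le> a j"
        proof (cases "- real CARD('n) + \<gamma> \<le> 0")
          case True
          hence "d powr (- real CARD('n) + \<gamma>) \<le> r (Suc j) powr (- real CARD('n) + \<gamma>)"
            using dk r(1)[of "Suc j"] by (intro powr_mono2') auto
          thus ?thesis by (simp add: a_def \<alpha>_def n_def)
        next
          case False
          hence "d powr (- real CARD('n) + \<gamma>) \<le> r j powr (- real CARD('n) + \<gamma>)"
            using dj d by (intro powr_mono2) auto
          thus ?thesis by (simp add: a_def \<alpha>_def n_def)
        qed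
        hence "ennreal (d powr (- real CARD('n) + \<gamma>)) \<le> t j"
          using dj by (auto simp: t_def d_def dist_norm norm_minus_commute intro!: ennreal_leI)
        also have "... = (\<Sum>q\<in>{j}. t q)" by simp
        also have "... \<le> (\<Sum>q. t q)" by (rule sum_le_suminf) auto
        finally show ?thesis using True by (simp add: t_def d_def)
      qed auto
    qed
    also have "... = (\<Sum>q. \<integral>\<^sup>+y. ennreal (a q) * indicator (cball z (r q)) y \<partial>lborel)"
      by (intro nn_integral_suminf borel_measurable_times_ennreal borel_measurable_const borel_measurable_indicator) simp
    also have "... = (\<Sum>q. ennreal (a q) * emeasure lborel (cball z (r q)))"
      by (intro suminf_cong nn_integral_cmult_indicator) simp
    also have "... \<le> (\<Sum>q. ennreal (B * x ^ q))"
    proof (intro suminf_le)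
      fix q
      have "emeasure lborel (cball z (r q)) = ennreal (v * r q ^ n)"
        using r(1)[of q] by (simp add: emeasure_cball v_def n_def)
      hence "ennreal (a q) * emeasure lborel (cball z (r q)) = ennreal (a q * (v * r q ^ n))"
        using v r(1)[of q] by (subst ennreal_mult) (auto simp: a_def max_def)
      also have "... \<le> ennreal (B * x ^ q)" by (rule ennreal_leI[OF aq])
      finally show "ennreal (a q) * emeasure lborel (cball z (r q)) \<le> ennreal (B * x ^ q)" .
    qed auto
    also have "... = ennreal (\<Sum>q. B * x ^ q)" by (rule suminf_ennreal2) (use B x sx in auto)
    finally show ?thesis .
  qed
  moreover have "(\<Sum>q. B * x ^ q) \<ge> 0" using B x by (intro suminf_nonneg sx) auto
  ultimately show ?thesis by blast
qed

section \<open>The ring inequality\<close>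

text \<open>The projected point has coordinate k equal to h, so this slot is free to hold the signed
  distance of x from the centre in direction i.\<close>

definition ray_map :: "'n => real => (real^'n => real^'n) => 'n => real => real => real^'n => real^'n => real^'n" where
  "ray_map k h F i \<sigma> c z x = upd k (\<sigma> * (x $ i - c)) (cproj k h z (F x))"

definition ray_deriv :: "'n => real => 'n => real => real^'n => real^'n => (real^'n => real^'n) => real^'n => real^'n" where
  "ray_deriv k h i \<sigma> z y A v = (\<chi> j. if j = k then \<sigma> * v $ i
     else (h - z $ k) / (y $ k - z $ k) * (A v $ j - (y $ j - z $ j) / (y $ k - z $ k) * A v $ k))"

lemma ray_map_has_derivative:
  fixes F :: "real^'n => real^'n"
  assumes F: "(F has_derivative A) (at x within S)" and b: "z $ k < F x $ k"
  shows "(ray_map k h F i \<sigma> c z has_derivative ray_deriv k h i \<sigma> z (F x) A) (at x within S)"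
proof (subst has_derivative_componentwise_within, rule ballI)
  fix u :: "real^'n" assume "u \<in> Basis"
  then obtain j where u: "u = axis j 1" by (auto simp: Basis_vec_def)
  have fj: "((\<lambda>x. F x $ j) has_derivative (\<lambda>v. A v $ j)) (at x within S)" for j
    by (rule bounded_linear.has_derivative[OF bounded_linear_vec_nth F])
  have xi: "((\<lambda>x. x $ i) has_derivative (\<lambda>v. v $ i)) (at x within S)"
    by (rule bounded_linear_imp_has_derivative[OF bounded_linear_vec_nth])
  have "((\<lambda>x. ray_map k h F i \<sigma> c z x $ j) has_derivative (\<lambda>v. ray_deriv k h i \<sigma> z (F x) A v $ j)) (at x within S)"
  proof (cases "j = k")
    case True
    have "((\<lambda>x. \<sigma> * (x $ i - c)) has_derivative (\<lambda>v. \<sigma> * (v $ i - 0))) (at x within S)"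
      by (intro has_derivative_mult_right has_derivative_diff xi has_derivative_const)
    thus ?thesis using True by (simp add: ray_map_def ray_deriv_def)
  next
    case False
    define b where "b = F x $ k - z $ k"
    have b0: "b \<noteq> 0" using b by (simp add: b_def)
    have "((\<lambda>x. (F x $ j - z $ j) / (F x $ k - z $ k)) has_derivative
       (\<lambda>v. - (F x $ j - z $ j) * (inverse (F x $ k - z $ k) * (A v $ k - 0) * inverse (F x $ k - z $ k)) + (A v $ j - 0) / (F x $ k - z $ k))) (at x within S)"
      using b by (intro has_derivative_divide has_derivative_diff fj has_derivative_const) auto
    hence "((\<lambda>x. z $ j + (h - z $ k) * ((F x $ j - z $ j) / (F x $ k - z $ k))) has_derivative
       (\<lambda>v. 0 + (h - z $ k) * (- (F x $ j - z $ j) * (inverse (F x $ k - z $ k) * (A v $ k - 0) * inverse (F x $ k - z $ k)) + (A v $ j - 0) / (F x $ k - z $ k)))) (at x within S)"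
      by (intro has_derivative_add has_derivative_const has_derivative_mult_right)
    moreover have "0 + (h - z $ k) * (- (F x $ j - z $ j) * (inverse (F x $ k - z $ k) * (A v $ k - 0) * inverse (F x $ k - z $ k)) + (A v $ j - 0) / (F x $ k - z $ k))
       = ray_deriv k h i \<sigma> z (F x) A v $ j" for v
      using False b0 unfolding b_def[symmetric] by (simp add: ray_deriv_def b_def[symmetric] field_simps)
    ultimately show ?thesis using False by (simp add: ray_map_def cproj_nth)
  qed
  thus "((\<lambda>x. ray_map k h F i \<sigma> c z x \<bullet> u) has_derivative (\<lambda>x'. ray_deriv k h i \<sigma> z (F x) A x' \<bullet> u)) (at x within S)"
    unfolding u inner_axis by simp
qed

text \<open>The matrix factors as N times that of A. Row k of N is, up to sign, a row of the inverse
  of A and thus bounded by 1 / \<open>min_stretch A\<close>; the other m rows come from the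
  derivative of the projection and are bounded by a multiple of 1 / |y - z|. This yields |J| / l
  times |y - z|^(-m).\<close>

lemma det_ray_deriv_le:
  fixes A :: "real^'n => real^'n"
  assumes A: "linear A" "det (matrix A) \<noteq> 0" and \<sigma>: "\<bar>\<sigma>\<bar> = 1"
    and y: "y \<in> ray_cone k h z" and z: "z $ k \<le> h - 1" "norm z \<le> R" "h - z $ k \<le> H" and m: "CARD('n) = Suc m"
  shows "\<bar>det (matrix (ray_deriv k h i \<sigma> z y A))\<bar>
     \<le> fact (Suc m) * (H * real (Suc m) * (1 + R)\<^sup>2) ^ m * (\<bar>det (matrix A)\<bar> * (1 / min_stretch A / norm (y - z) ^ m))"
proof -
  define M where "M = matrix A"
  define l where "l = min_stretch A"
  define b where "b = y $ k - z $ k"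
  define Q where "Q = (h - z $ k) / b"
  note geo = cone_geometry[OF y z(1,2), folded b_def]
  have R: "R \<ge> 0" using z(2) norm_ge_zero order_trans by blast
  have Q: "Q \<ge> 0" using geo(1) z(1) by (simp add: Q_def)
  have l: "l > 0" "l * norm v \<le> norm (A v)" for v using min_stretch_pos[OF A] by (auto simp: l_def)
  have invM: "invertible M" using A(2) invertible_det_nz[of M] by (simp add: M_def)
  then obtain Mi where inv: "M ** Mi = mat 1" "Mi ** M = mat 1" unfolding invertible_def by blast
  define N where "N = (\<chi> j q. if j = k then \<sigma> * Mi $ i $ q
      else Q * ((if q = j then 1 else 0) - (y $ j - z $ j) / b * (if q = k then 1 else 0)))"
  have Mnth: "M $ p $ q = A (axis q 1) $ p" for p q by (simp add: M_def matrix_def)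
  have "matrix (ray_deriv k h i \<sigma> z y A) = N ** M"
  proof -
    have "ray_deriv k h i \<sigma> z y A (axis q 1) $ j = (N ** M) $ j $ q" for j q
    proof (cases "j = k")
      case True
      have "(N ** M) $ k $ q = \<sigma> * (Mi ** M) $ i $ q"
        by (simp add: N_def matrix_matrix_mult_def sum_distrib_left mult.assoc)
      thus ?thesis using True inv by (simp add: ray_deriv_def mat_def axis_def)
    next
      case False
      have "(N ** M) $ j $ q = (\<Sum>p\<in>UNIV. Q * ((if p = j then M $ p $ q else 0) - (y $ j - z $ j) / b * (if p = k then M $ p $ q else 0)))"
        using False by (auto simp: N_def matrix_matrix_mult_def algebra_simps intro!: sum.cong)
      also have "... = Q * (M $ j $ q - (y $ j - z $ j) / b * M $ k $ q)"
        by (simp only: sum_distrib_left[symmetric] sum_subtractf sum.delta) simp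
      finally show ?thesis using False by (simp add: ray_deriv_def Mnth Q_def b_def)
    qed
    thus ?thesis by (simp add: vec_eq_iff matrix_def)
  qed
  hence detG: "\<bar>det (matrix (ray_deriv k h i \<sigma> z y A))\<bar> = \<bar>det N\<bar> * \<bar>det M\<bar>" by (simp add: det_mul abs_mult)
  have "\<bar>det N\<bar> \<le> fact CARD('n) * (\<Prod>j\<in>UNIV. if j = k then 1 / l else Q * (1 + R))"
  proof (rule abs_det_le)
    fix j q
    show "\<bar>N $ j $ q\<bar> \<le> (if j = k then 1 / l else Q * (1 + R))"
    proof (cases "j = k")
      case True
      define v where "v = Mi *v axis q 1"
      have "A v = M *v v" using matrix_vector_mul(2)[OF A(1)] by (simp add: M_def)
      also have "... = axis q 1" using inv by (simp add: v_def matrix_vector_mul_assoc)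
      finally have "l * norm v \<le> 1" using l(2)[of v] by simp
      hence "norm v \<le> 1 / l" using l(1) by (simp add: field_simps)
      moreover have "\<bar>v $ i\<bar> \<le> norm v" by (rule component_le_norm_cart)
      moreover have "v $ i = Mi $ i $ q" by (simp add: v_def matrix_vector_mul_component inner_axis)
      ultimately show ?thesis using True \<sigma> by (simp add: N_def abs_mult)
    next
      case False
      have "\<bar>(if q = j then 1 else 0) - (y $ j - z $ j) / b * (if q = k then 1 else 0)\<bar> \<le> 1 + R"
      proof -
        have "\<bar>(y $ j - z $ j) / b\<bar> \<le> 1 + R" using geo(1) geo(2)[of j] by (simp add: abs_divide pos_divide_le_eq)
        thus ?thesis using False R by auto
      qed
      thus ?thesis using False Q by (simp add: N_def abs_mult mult_left_mono)
    qed
  qed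
  also have "(\<Prod>j\<in>(UNIV::'n set). if j = k then 1 / l else Q * (1 + R)) = 1 / l * (Q * (1 + R)) ^ m"
    using m by (subst prod.remove[of _ k]) (auto simp: card_Diff_singleton)
  also have "... \<le> 1 / l * (H * real (Suc m) * (1 + R)\<^sup>2 / norm (y - z)) ^ m"
  proof (intro mult_left_mono power_mono)
    have "Q \<le> H / b" using z(3) geo(1) by (simp add: Q_def divide_right_mono)
    moreover have "1 / b \<le> real (Suc m) * (1 + R) / norm (y - z)"
      using geo(1,3,4) m by (simp add: field_simps)
    hence "H * (1 / b) \<le> H * (real (Suc m) * (1 + R) / norm (y - z))" using z by (intro mult_left_mono) auto
    ultimately have "Q \<le> H * (real (Suc m) * (1 + R) / norm (y - z))" by simp
    hence "Q * (1 + R) \<le> H * (real (Suc m) * (1 + R) / norm (y - z)) * (1 + R)" using R by (intro mult_right_mono) auto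
    thus "Q * (1 + R) \<le> H * real (Suc m) * (1 + R)\<^sup>2 / norm (y - z)" by (simp add: power2_eq_square mult_ac)
  qed (use l Q R in auto)
  finally have "\<bar>det N\<bar> \<le> fact (Suc m) * (1 / l * (H * real (Suc m) * (1 + R)\<^sup>2 / norm (y - z)) ^ m)"
    unfolding m by (simp add: mult_left_mono)
  hence "\<bar>det N\<bar> * \<bar>det M\<bar> \<le> fact (Suc m) * (1 / l * (H * real (Suc m) * (1 + R)\<^sup>2 / norm (y - z)) ^ m) * \<bar>det M\<bar>"
    by (rule mult_right_mono) simp
  also have "... = fact (Suc m) * (H * real (Suc m) * (1 + R)\<^sup>2) ^ m * (\<bar>det M\<bar> * (1 / l / norm (y - z) ^ m))"
    by (simp only: power_divide) simp
  finally show ?thesis unfolding detG M_def l_def .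
qed

text \<open>Covers the points with vanishing derivative, where \<open>K_I\<close> is 1 by
  definition. As n \<ge> 2, there is a row other than k, and it is 0.\<close>

lemma det_ray_deriv_zero:
  assumes "CARD('n::finite) \<ge> 2"
  shows "det (matrix (ray_deriv (k::'n::finite) h i \<sigma> z y (\<lambda>v. 0))) = 0"
proof -
  have "card (UNIV - {k}) > 0" using assms by (simp add: card_Diff_singleton)
  then obtain j where j: "j \<noteq> k" unfolding card_gt_0_iff by blast
  have "row j (matrix (ray_deriv k h i \<sigma> z y (\<lambda>v. 0))) = 0"
    using j by (simp add: vec_eq_iff row_def matrix_def ray_deriv_def)
  thus ?thesis by (rule det_zero_row)
qed

text \<open>The second term of \<open>young_kernel\<close> for m = n - 1, cut off to a ball because
  the cones lie in one; its integral is bounded uniformly in z.\<close>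

definition riesz :: "real => real^'n => real^'n => real" where
  "riesz R z y = norm (y - z) powr (- real CARD('n) + 1 / (2 * real (CARD('n) - 1))) * indicator (cball z R) y"

lemma riesz_nonneg: "0 \<le> riesz R z y"
  by (simp add: riesz_def)

lemma measurable_riesz [measurable]: "riesz R z \<in> borel_measurable borel"
proof -
  have [measurable]: "cball z R \<in> sets borel" by simp
  show ?thesis unfolding riesz_def by measurable
qed

definition distortion_const :: "nat => real => real => real" where
  "distortion_const n R H = fact n * (H * real n * (1 + R)\<^sup>2) ^ (n - 1)"

text \<open>With a = \<mu> / l the first Young term contains \<mu>^n |J| / l^n, which is \<mu>^n
  \<open>K_I\<close>. The second contains |J| without dilatation, so injectivity of F can turn it
  into an integral in the image.\<close>

lemma det_ray_deriv_young:
  fixes F :: "real^'n => real^'n"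
  assumes card: "CARD('n) \<ge> 2" and K: "K_I F x \<noteq> \<infinity>" and \<sigma>: "\<bar>\<sigma>\<bar> = 1" and \<mu>: "\<mu> \<ge> 0"
    and y: "F x \<in> ray_cone k h z" and z: "z $ k \<le> h - 1" "norm z \<le> R" "h - z $ k \<le> H"
  shows "ennreal \<mu> * ennreal \<bar>det (matrix (ray_deriv k h i \<sigma> z (F x) (frechet_derivative F (at x))))\<bar>
    \<le> ennreal (distortion_const CARD('n) R H) * (ennreal (\<mu> ^ CARD('n)) * K_I F x * ennreal (1 / sqrt (norm (F x - z)))
       + ennreal (riesz (real CARD('n) * (1 + R) * H) z (F x) * \<bar>det (matrix (frechet_derivative F (at x)))\<bar>))"
proof -
  define A where "A = frechet_derivative F (at x)"
  have dF: "F differentiable at x" using K by (auto simp: K_I_def Let_def split: if_splits)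
  have linA: "linear A" unfolding A_def using dF by (rule linear_frechet_derivative)
  obtain m where m: "CARD('n) = Suc m" "m \<ge> 1" using card by (cases "CARD('n)") auto
  define B where "B = distortion_const CARD('n) R H"
  have R: "R \<ge> 0" using z(2) norm_ge_zero order_trans by blast
  have H: "H \<ge> 1" using z by linarith
  have B: "B \<ge> 0" using R H by (simp add: B_def distortion_const_def)
  show ?thesis
  proof (cases "det (matrix A) = 0")
    case True
    hence "A = (\<lambda>v. 0)" using K dF by (auto simp: K_I_def Let_def A_def split: if_splits)
    hence "det (matrix (ray_deriv k h i \<sigma> z (F x) A)) = 0" using det_ray_deriv_zero[OF card] by simp
    thus ?thesis unfolding A_def by simp
  next
    case False
    define J l \<rho> where "J = \<bar>det (matrix A)\<bar>" and "l = min_stretch A" and "\<rho> = norm (F x - z)"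
    have J: "J \<ge> 0" by (simp add: J_def)
    have l: "l > 0" using min_stretch_pos[OF linA False] by (simp add: l_def)
    note geo = cone_geometry[OF y z(1,2)]
    have \<rho>: "\<rho> > 0" using geo(4) by (simp add: \<rho>_def)
    have KI: "K_I F x = ennreal (J / l ^ Suc m)"
      using dF False m(1) by (simp add: K_I_def Let_def A_def[symmetric] J_def l_def)
    have "F x $ k \<le> h" using y by (simp add: ray_cone_def)
    hence "F x $ k - z $ k \<le> H" using z by linarith
    hence "real CARD('n) * (1 + R) * (F x $ k - z $ k) \<le> real CARD('n) * (1 + R) * H"
      using R by (intro mult_left_mono) auto
    hence "F x \<in> cball z (real CARD('n) * (1 + R) * H)" using order_trans[OF geo(3)] by (simp add: dist_norm norm_minus_commute)
    hence ker: "riesz (real CARD('n) * (1 + R) * H) z (F x) = \<rho> powr (- real (Suc m) + 1 / (2 * real m))"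
      using m by (simp add: riesz_def \<rho>_def)
    have "\<mu> * \<bar>det (matrix (ray_deriv k h i \<sigma> z (F x) A))\<bar> \<le> \<mu> * (B * (J * (1 / l / \<rho> ^ m)))"
      using det_ray_deriv_le[OF linA False \<sigma> y z m(1), of i] \<mu> m
      by (intro mult_left_mono) (auto simp: B_def distortion_const_def J_def l_def \<rho>_def)
    also have "... = B * (J * (\<mu> / l / \<rho> ^ m))" by simp
    also have "... \<le> B * (J * ((\<mu> / l) ^ Suc m / sqrt \<rho> + \<rho> powr (- real (Suc m) + 1 / (2 * real m))))"
      using B J l \<mu> by (intro mult_left_mono young_kernel \<rho> m(2)) auto
    also have "... = B * (\<mu> ^ Suc m * (J / l ^ Suc m) * (1 / sqrt \<rho>) + \<rho> powr (- real (Suc m) + 1 / (2 * real m)) * J)"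
      by (simp add: power_divide algebra_simps)
    finally have "ennreal (\<mu> * \<bar>det (matrix (ray_deriv k h i \<sigma> z (F x) A))\<bar>)
        \<le> ennreal (B * (\<mu> ^ Suc m * (J / l ^ Suc m) * (1 / sqrt \<rho>) + \<rho> powr (- real (Suc m) + 1 / (2 * real m)) * J))"
      by (rule ennreal_leI)
    also have "... = ennreal B * (ennreal (\<mu> ^ Suc m * (J / l ^ Suc m) * (1 / sqrt \<rho>)) + ennreal (\<rho> powr (- real (Suc m) + 1 / (2 * real m)) * J))"
      using B J l \<mu> \<rho> by (subst ennreal_mult, simp, simp, subst ennreal_plus) auto
    also have "ennreal (\<mu> ^ Suc m * (J / l ^ Suc m) * (1 / sqrt \<rho>)) = ennreal (\<mu> ^ Suc m) * ennreal (J / l ^ Suc m) * ennreal (1 / sqrt \<rho>)"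
      using J l \<mu> \<rho> by (subst ennreal_mult, simp, simp, subst ennreal_mult) auto
    finally show ?thesis
      using \<mu> unfolding ker KI A_def[symmetric] J_def[symmetric] \<rho>_def[symmetric] B_def[symmetric]
      unfolding m(1) by (simp add: ennreal_mult)
  qed
qed

text \<open>In units of s / N the centres have distances 1, ..., N from e. The reverse triangle
  inequality bounds the distance of y from the l-th centre below by |u - l|, and the separation
  hypothesis bounds it below by 1. Divided by N, the resulting bound 6 N / sqrt s is free of
  N.\<close>

lemma sum_inverse_sqrt_norm_le:
  fixes y e :: "'a::real_normed_vector"
  assumes s: "s > 0" and N: "N \<ge> 1" and z: "\<And>l. l \<in> {1..N} ==> norm (z l - e) = real l * (s / real N)"
    and sep: "\<And>l. l \<in> {1..N} ==> s / real N \<le> norm (y - z l)"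
  shows "(\<Sum>l=1..N. 1 / sqrt (norm (y - z l))) \<le> 6 * real N / sqrt s"
proof -
  define \<delta> where "\<delta> = s / real N"
  have \<delta>: "\<delta> > 0" using s N by (simp add: \<delta>_def)
  define u where "u = norm (y - e) / \<delta>"
  have "(\<Sum>l=1..N. 1 / sqrt (norm (y - z l))) \<le> (\<Sum>l=1..N. 1 / sqrt \<delta> * (1 / sqrt (max 1 \<bar>u - real l\<bar>)))"
  proof (rule sum_mono)
    fix l assume l: "l \<in> {1..N}"
    have "\<bar>norm (y - e) - norm (z l - e)\<bar> \<le> norm ((y - e) - (z l - e))" by (rule norm_triangle_ineq3)
    moreover have "norm (y - e) - norm (z l - e) = \<delta> * (u - real l)" using z[OF l] \<delta> by (simp add: u_def \<delta>_def[symmetric] algebra_simps)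
    ultimately have "\<delta> * \<bar>u - real l\<bar> \<le> norm (y - z l)" using \<delta> by (simp add: abs_mult)
    hence "\<delta> * max 1 \<bar>u - real l\<bar> \<le> norm (y - z l)" using sep[OF l] by (simp add: max_def \<delta>_def)
    hence "sqrt \<delta> * sqrt (max 1 \<bar>u - real l\<bar>) \<le> sqrt (norm (y - z l))" by (simp only: real_sqrt_mult[symmetric] real_sqrt_le_iff)
    moreover have "sqrt \<delta> * sqrt (max 1 \<bar>u - real l\<bar>) > 0" using \<delta> by (intro mult_pos_pos) auto
    ultimately have "1 / sqrt (norm (y - z l)) \<le> 1 / (sqrt \<delta> * sqrt (max 1 \<bar>u - real l\<bar>))"
      by (intro frac_le) (assumption | simp)+
    thus "1 / sqrt (norm (y - z l)) \<le> 1 / sqrt \<delta> * (1 / sqrt (max 1 \<bar>u - real l\<bar>))" by simp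
  qed
  also have "... \<le> 1 / sqrt \<delta> * (6 * sqrt (real N))"
    unfolding sum_distrib_left[symmetric] using \<delta> by (intro mult_left_mono sum_inverse_sqrt_le) auto
  also have "... = 6 * real N / sqrt s" using s N by (simp add: \<delta>_def real_sqrt_divide)
  finally show ?thesis .
qed

text \<open>\<open>K_I\<close> is infinite wherever the derivative does not exist, so
  \<open>fin\<close> includes differentiability almost everywhere.\<close>

locale sobolev_embedding =
  fixes U :: "(real^'n) set" and F :: "real^'n => real^'n"
  assumes card: "CARD('n) \<ge> 2" and U: "open U" and cont: "continuous_on U F" and inj: "inj_on F U"
    and sob: "W1_loc U CARD('n) F"
    and meas: "(\<lambda>x. K_I F x * indicator U x) \<in> borel_measurable lebesgue"
    and fin: "negligible {x \<in> U. K_I F x = \<infinity>}"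
begin

definition "Dset = {x \<in> U. K_I F x \<noteq> \<infinity>}"

lemma U_sets [measurable]: "U \<in> sets lebesgue"
  using U by (simp add: borel_open)

lemma Dset_sets [measurable]: "Dset \<in> sets lebesgue"
proof -
  have "{x \<in> U. K_I F x = \<infinity>} \<in> sets lebesgue" using fin by (rule negligible_imp_sets)
  moreover have "Dset = U - {x \<in> U. K_I F x = \<infinity>}" by (auto simp: Dset_def)
  ultimately show ?thesis using U_sets by (simp only: sets.Diff)
qed

lemma has_derivative_Dset:
  assumes "x \<in> Dset" shows "(F has_derivative frechet_derivative F (at x)) (at x within S)"
proof -
  have "F differentiable at x" using assms by (auto simp: Dset_def K_I_def Let_def split: if_splits)
  thus ?thesis using frechet_derivative_works has_derivative_at_withinI by blast
qed

lemma F_measurable [measurable]: "(\<lambda>x. indicator U x *\<^sub>R F x) \<in> borel_measurable lebesgue"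
proof -
  have "U \<in> sets borel" using U by (rule borel_open)
  from borel_measurable_continuous_on_indicator[OF this cont]
  have "(\<lambda>x. indicator U x *\<^sub>R F x) \<in> borel_measurable lborel" by simp
  thus ?thesis by (rule measurable_completion)
qed

lemma cone_sets [measurable]: "ray_cone k h z \<in> sets borel"
proof -
  have [measurable]: "(\<lambda>y :: real^'n. y $ j) \<in> borel_measurable borel" for j by (rule measurable_vec_nth')
  have "{y. z $ k < y $ k \<and> y $ k \<le> h \<and> (\<forall>j. j \<noteq> k \<longrightarrow> \<bar>z $ j + (h - z $ k) * ((y $ j - z $ j) / (y $ k - z $ k))\<bar> \<le> 1)} \<in> sets borel"
    by measurable
  thus ?thesis by (simp add: ray_cone_def cproj_nth)
qed

definition "jac x = \<bar>det (matrix (frechet_derivative F (at x)))\<bar>"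

lemma jac_measurable: "T \<in> sets lebesgue ==> T \<subseteq> Dset ==> (\<lambda>x. jac x * indicator T x) \<in> borel_measurable lebesgue"
proof -
  assume T: "T \<in> sets lebesgue" "T \<subseteq> Dset"
  have "(\<lambda>x. det (matrix (frechet_derivative F (at x))) * indicator T x) \<in> borel_measurable lebesgue"
    using T by (intro borel_measurable_det_derivative[where f = F] has_derivative_Dset) auto
  hence "(\<lambda>x. \<bar>det (matrix (frechet_derivative F (at x))) * indicator T x\<bar>) \<in> borel_measurable lebesgue"
    by (rule borel_measurable_abs)
  thus ?thesis by (simp add: jac_def abs_mult)
qed

lemma weighted_K_measurable:
  assumes T: "T \<in> sets lebesgue" "T \<subseteq> U" and g: "g \<in> borel_measurable borel"
  shows "(\<lambda>x. K_I F x * ennreal (g (F x)) * indicator T x) \<in> borel_measurable lebesgue"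
proof -
  have "(\<lambda>x. (K_I F x * indicator U x) * ennreal (g (indicator U x *\<^sub>R F x)) * indicator T x) \<in> borel_measurable lebesgue"
    using T(1) g by (intro borel_measurable_times_ennreal meas borel_measurable_indicator measurable_compose[OF measurable_compose[OF F_measurable g] measurable_ennreal])
  moreover have "(K_I F x * indicator U x) * ennreal (g (indicator U x *\<^sub>R F x)) * indicator T x = K_I F x * ennreal (g (F x)) * indicator T x" for x
    using T(2) by (auto simp: indicator_def)
  ultimately show ?thesis by simp
qed

lemma jac_weight_measurable:
  assumes T: "T \<in> sets lebesgue" "T \<subseteq> Dset" and g: "g \<in> borel_measurable borel"
  shows "(\<lambda>x. ennreal (g (F x) * jac x) * indicator T x) \<in> borel_measurable lebesgue"
proof -
  have "(\<lambda>x. ennreal (g (indicator U x *\<^sub>R F x) * (jac x * indicator T x))) \<in> borel_measurable lebesgue"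
    by (intro measurable_compose[OF _ measurable_ennreal] borel_measurable_times measurable_compose[OF F_measurable g] jac_measurable T)
  moreover have "ennreal (g (indicator U x *\<^sub>R F x) * (jac x * indicator T x)) = ennreal (g (F x) * jac x) * indicator T x" for x
    using T(2) by (auto simp: indicator_def Dset_def)
  ultimately show ?thesis by simp
qed

text \<open>\<open>sobolev_slice_lusin\<close> with q = k treats the plain coordinate
  \<open>x $ i\<close>. The polynomial change of coordinate k that inserts the sign and the shift is
  differentiable and keeps null sets.\<close>

lemma ray_map_null:
  assumes N: "N \<subseteq> U" "negligible N" "F ` N \<subseteq> ray_cone k h z"
  shows "negligible (ray_map k h F i \<sigma> c z ` N)"
proof -
  have "negligible ((\<lambda>x. upd k (x $ i) (cproj k h z (F x))) ` N)"
  proof (rule sobolev_slice_lusin[OF U cont sob _ continuous_on_cproj])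
    show "open {y. z $ k < y $ k}" by (rule open_halfspace_component_gt_cart)
  qed (use N in \<open>auto simp: ray_cone_def intro: cproj_locally_lipschitz\<close>)
  hence "negligible ((\<lambda>w. upd k (\<sigma> * (w $ k - c)) w) ` ((\<lambda>x. upd k (x $ i) (cproj k h z (F x))) ` N))"
  proof (rule negligible_differentiable_image_negligible[rotated])
    show "(\<lambda>w. upd k (\<sigma> * (w $ k - c)) w) differentiable_on (\<lambda>x. upd k (x $ i) (cproj k h z (F x))) ` N"
      unfolding upd_alt
      by (intro differentiable_on_add differentiable_on_scaleR differentiable_on_diff differentiable_on_mult differentiable_on_const differentiable_on_ident
          linear_imp_differentiable_on bounded_linear.linear[OF bounded_linear_vec_nth])
  qed simp
  moreover have "(\<lambda>w. upd k (\<sigma> * (w $ k - c)) w) ` ((\<lambda>x. upd k (x $ i) (cproj k h z (F x))) ` N) = ray_map k h F i \<sigma> c z ` N"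
    by (auto simp: image_image ray_map_def vec_eq_iff intro!: image_cong)
  ultimately show ?thesis by simp
qed

text \<open>Outside \<open>Dset\<close> the set is null and so is its image, hence the area
  inequality on \<open>Dset\<close> accounts for the whole image; the pointwise split is
  \<open>det_ray_deriv_young\<close>.\<close>

lemma ray_map_image_le:
  assumes S: "S \<in> sets lebesgue" "S \<subseteq> U" "F ` S \<subseteq> ray_cone k h z"
    and z: "z $ k \<le> h - 1" "norm z \<le> R" "h - z $ k \<le> H" and \<sigma>: "\<bar>\<sigma>\<bar> = 1" and \<mu>: "\<mu> \<ge> 0"
  shows "ray_map k h F i \<sigma> c z ` S \<in> sets lebesgue"
    "ennreal \<mu> * emeasure lebesgue (ray_map k h F i \<sigma> c z ` S)
      \<le> ennreal (distortion_const CARD('n) R H) * (ennreal (\<mu> ^ CARD('n)) * (\<integral>\<^sup>+x\<in>S. K_I F x * ennreal (1 / sqrt (norm (F x - z))) \<partial>lebesgue)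
        + (\<integral>\<^sup>+x\<in>S \<inter> Dset. ennreal (riesz (real CARD('n) * (1 + R) * H) z (F x) * jac x) \<partial>lebesgue))"
proof -
  let ?G = "ray_map k h F i \<sigma> c z" and ?B = "ennreal (distortion_const CARD('n) R H)" and ?T = "S \<inter> Dset"
  let ?D = "\<lambda>x. ray_deriv k h i \<sigma> z (F x) (frechet_derivative F (at x))"
  let ?V = "riesz (real CARD('n) * (1 + R) * H) z"
  let ?\<theta> = "\<lambda>y. 1 / sqrt (norm (y - z))"
  have T: "?T \<in> sets lebesgue" using S(1) Dset_sets by blast
  have der: "(?G has_derivative ?D x) (at x within ?T)" if "x \<in> ?T" for x
    using that S(3) by (intro ray_map_has_derivative has_derivative_Dset) (auto simp: ray_cone_def)
  have "negligible (S - Dset)" by (rule negligible_subset[OF fin]) (use S(2) in \<open>auto simp: Dset_def\<close>)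
  hence null: "negligible (?G ` (S - Dset))" by (rule ray_map_null[rotated]) (use S in auto)
  note im = emeasure_differentiable_image_le[OF T der]
  have un: "?G ` S = ?G ` ?T \<union> ?G ` (S - Dset)" by blast
  show "?G ` S \<in> sets lebesgue" unfolding un using im(1) negligible_imp_sets[OF null] by (intro sets.Un)
  have "emeasure lebesgue (?G ` S) \<le> emeasure lebesgue (?G ` ?T) + emeasure lebesgue (?G ` (S - Dset))"
    unfolding un by (rule emeasure_subadditive[OF im(1) negligible_imp_sets[OF null]])
  also have "emeasure lebesgue (?G ` (S - Dset)) = 0" using null by (simp add: negligible_iff_null_sets null_sets_def)
  finally have "emeasure lebesgue (?G ` S) \<le> (\<integral>\<^sup>+x\<in>?T. ennreal \<bar>det (matrix (?D x))\<bar> \<partial>lebesgue)" using im(2) by simp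
  hence "ennreal \<mu> * emeasure lebesgue (?G ` S) \<le> ennreal \<mu> * (\<integral>\<^sup>+x\<in>?T. ennreal \<bar>det (matrix (?D x))\<bar> \<partial>lebesgue)"
    by (rule mult_left_mono) simp
  also have "... = (\<integral>\<^sup>+x. ennreal \<mu> * (ennreal \<bar>det (matrix (?D x))\<bar> * indicator ?T x) \<partial>lebesgue)"
  proof (rule nn_integral_cmult[symmetric])
    have "(\<lambda>x. ennreal \<bar>det (matrix (?D x)) * indicator ?T x\<bar>) \<in> borel_measurable lebesgue"
      by (intro measurable_compose[OF _ measurable_ennreal] borel_measurable_abs borel_measurable_det_derivative[OF T der])
    moreover have "ennreal \<bar>det (matrix (?D x)) * indicator ?T x\<bar> = ennreal \<bar>det (matrix (?D x))\<bar> * indicator ?T x" for x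
      by (auto simp: indicator_def)
    ultimately show "(\<lambda>x. ennreal \<bar>det (matrix (?D x))\<bar> * indicator ?T x) \<in> borel_measurable lebesgue" by simp
  qed
  also have "... \<le> (\<integral>\<^sup>+x. ?B * (ennreal (\<mu> ^ CARD('n)) * (K_I F x * ennreal (?\<theta> (F x)) * indicator S x) + ennreal (?V (F x) * jac x) * indicator ?T x) \<partial>lebesgue)"
  proof (rule nn_integral_mono)
    fix x
    show "ennreal \<mu> * (ennreal \<bar>det (matrix (?D x))\<bar> * indicator ?T x) \<le> ?B * (ennreal (\<mu> ^ CARD('n)) * (K_I F x * ennreal (?\<theta> (F x)) * indicator S x) + ennreal (?V (F x) * jac x) * indicator ?T x)"
    proof (cases "x \<in> ?T")
      case True
      hence "ennreal \<mu> * ennreal \<bar>det (matrix (?D x))\<bar> \<le> ?B * (ennreal (\<mu> ^ CARD('n)) * K_I F x * ennreal (?\<theta> (F x)) + ennreal (?V (F x) * jac x))"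
        unfolding jac_def using S(3) by (intro det_ray_deriv_young card \<sigma> \<mu> z) (auto simp: Dset_def)
      thus ?thesis using True by (simp add: mult.assoc)
    qed simp
  qed
  also have "... = ?B * (ennreal (\<mu> ^ CARD('n)) * (\<integral>\<^sup>+x. K_I F x * ennreal (?\<theta> (F x)) * indicator S x \<partial>lebesgue) + (\<integral>\<^sup>+x. ennreal (?V (F x) * jac x) * indicator ?T x \<partial>lebesgue))"
  proof -
    have m1: "(\<lambda>x. K_I F x * ennreal (?\<theta> (F x)) * indicator S x) \<in> borel_measurable lebesgue"
      by (rule weighted_K_measurable[OF S(1,2)]) measurable
    have m2: "(\<lambda>x. ennreal (?V (F x) * jac x) * indicator ?T x) \<in> borel_measurable lebesgue"
      by (rule jac_weight_measurable[OF T]) auto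
    have m1': "(\<lambda>x. ennreal (\<mu> ^ CARD('n)) * (K_I F x * ennreal (?\<theta> (F x)) * indicator S x)) \<in> borel_measurable lebesgue"
      by (intro borel_measurable_times_ennreal borel_measurable_const m1)
    show ?thesis
      unfolding nn_integral_cmult[OF borel_measurable_add[OF m1' m2]] nn_integral_add[OF m1' m2] nn_integral_cmult[OF m1] ..
  qed
  finally show "ennreal \<mu> * emeasure lebesgue (?G ` S) \<le> ?B * (ennreal (\<mu> ^ CARD('n)) * (\<integral>\<^sup>+x\<in>S. K_I F x * ennreal (?\<theta> (F x)) \<partial>lebesgue) + (\<integral>\<^sup>+x\<in>?T. ennreal (?V (F x) * jac x) \<partial>lebesgue))" .
qed

definition "shell x0 a b = {x \<in> U. a < infnorm (x - x0) \<and> infnorm (x - x0) < b}"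

lemma shell_sets: "shell x0 a b \<in> sets lebesgue"
proof -
  have c: "continuous_on UNIV (\<lambda>x. infnorm (x - x0))" by (intro continuous_intros)
  have "open {x. a < infnorm (x - x0)}" "open {x. infnorm (x - x0) < b}"
    by (rule open_Collect_less[OF continuous_on_const c], rule open_Collect_less[OF c continuous_on_const])
  hence "open (U \<inter> {x. a < infnorm (x - x0)} \<inter> {x. infnorm (x - x0) < b})" using U by (intro open_Int)
  moreover have "shell x0 a b = U \<inter> {x. a < infnorm (x - x0)} \<inter> {x. infnorm (x - x0) < b}" by (auto simp: shell_def)
  ultimately show ?thesis by (simp add: borel_open)
qed

text \<open>A volume count. For each radius r in a shell and each q in the cube of the hyperplane, a
  crossing point x is sent by one of finitely many ray maps to the point with coordinate k equal to
  r and the others taken from q. The images therefore cover a box at least as large as the shell is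
  thick.\<close>

lemma ring_inequality_single:
  fixes z w :: "real^'n" and a b \<mu> :: "nat => real"
  assumes zw: "\<And>p. p \<in> {z, w} ==> norm p \<le> R"
    and ab: "\<And>j. j < J ==> a j < b j" "\<And>j. j < J ==> 0 \<le> \<mu> j" and disj: "disjoint_family_on (\<lambda>j. {a j<..<b j}) {..<J}"
    and cross: "\<And>j r q. j < J ==> a j < r ==> r < b j ==> q $ k = R + 1 ==> (\<And>i. i \<noteq> k ==> \<bar>q $ i\<bar> \<le> 1) ==>
       \<exists>x\<in>U. infnorm (x - x0) = r \<and> F x \<in> closed_segment z q \<union> closed_segment q w \<and> F x \<noteq> z \<and> F x \<noteq> w"
    and CV: "\<And>z :: real^'n. (\<integral>\<^sup>+y. ennreal (riesz (real CARD('n) * (1 + R) * (2 * R + 1)) z y) \<partial>lborel) \<le> ennreal CV" and CV0: "CV \<ge> 0"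
  shows "ennreal (\<Sum>j<J. \<mu> j * (b j - a j)) \<le> ennreal (2 * real CARD('n) * distortion_const CARD('n) R (2 * R + 1)) *
     ((\<Sum>j<J. ennreal (\<mu> j ^ CARD('n)) * (\<integral>\<^sup>+x\<in>shell x0 (a j) (b j). K_I F x * ennreal (1 / sqrt (norm (F x - z)) + 1 / sqrt (norm (F x - w))) \<partial>lebesgue)) + ennreal (2 * CV))"
proof -
  let ?h = "R + 1" and ?H = "2 * R + 1"
  define B where "B = distortion_const CARD('n) R ?H"
  define sh where "sh j = shell x0 (a j) (b j)" for j
  define S where "S j p = {x \<in> sh j. F x \<in> ray_cone k ?h p}" for j p
  define \<theta> where "\<theta> p y = 1 / sqrt (norm (y - p))" for p y :: "real^'n"
  define V where "V p = riesz (real CARD('n) * (1 + R) * ?H) p" for p :: "real^'n"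
  have R: "R \<ge> 0" using zw[of z] norm_ge_zero[of z] by (simp del: norm_ge_zero)
  have B: "B \<ge> 0" using R by (simp add: B_def distortion_const_def)
  have zk: "p $ k \<le> ?h - 1" "norm p \<le> R" "?h - p $ k \<le> ?H" if "p \<in> {z, w}" for p
    using zw[OF that] component_le_norm_cart[of p k] by auto
  have sh: "sh j \<in> sets lebesgue" "sh j \<subseteq> U" for j using shell_sets by (auto simp: sh_def shell_def)
  have S: "S j p \<in> sets lebesgue" "S j p \<subseteq> sh j" "S j p \<subseteq> U" "F ` S j p \<subseteq> ray_cone k ?h p" for j p
  proof -
    have "(\<lambda>x. indicator U x *\<^sub>R F x) -` ray_cone k ?h p \<inter> space lebesgue \<in> sets lebesgue"
      by (rule measurable_sets[OF F_measurable cone_sets])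
    moreover have "S j p = ((\<lambda>x. indicator U x *\<^sub>R F x) -` ray_cone k ?h p \<inter> space lebesgue) \<inter> sh j"
      using sh(2)[of j] by (auto simp: S_def)
    ultimately show "S j p \<in> sets lebesgue" using sh(1) by auto
  qed (use sh(2)[of j] in \<open>auto simp: S_def\<close>)
  have Sdisj: "disjoint_family_on (\<lambda>j. S j p) {..<J}" for p
    unfolding disjoint_family_on_def
  proof (intro ballI impI)
    fix i j assume "i \<in> {..<J}" "j \<in> {..<J}" "i \<noteq> j"
    hence "{a i<..<b i} \<inter> {a j<..<b j} = {}" using disj unfolding disjoint_family_on_def by blast
    thus "S i p \<inter> S j p = {}" by (auto simp: S_def sh_def shell_def)
  qed
  define G where "G i \<sigma> p = ray_map k ?h F i \<sigma> (x0 $ i) p" for i \<sigma> p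
  \<comment> \<open>The 2n faces of the cubes times the two centres. For z = w the set of centres is
    a singleton, which only lowers the sum; hence the inequality in \<open>sumIx\<close>.\<close>
  define Ix where "Ix = (UNIV :: 'n set) \<times> {1, -1 :: real} \<times> {z, w}"
  have finIx: "finite Ix" by (simp add: Ix_def)
  define Y where "Y j p = ennreal (\<mu> j ^ CARD('n)) * (\<integral>\<^sup>+x\<in>sh j. K_I F x * ennreal (\<theta> p (F x)) \<partial>lebesgue)" for j p
  define W where "W j p = (\<integral>\<^sup>+x\<in>S j p \<inter> Dset. ennreal (V p (F x) * jac x) \<partial>lebesgue)" for j p
  have img: "G i \<sigma> p ` S j p \<in> sets lebesgue" "ennreal (\<mu> j) * emeasure lebesgue (G i \<sigma> p ` S j p) \<le> ennreal B * (Y j p + W j p)"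
    if "(i, \<sigma>, p) \<in> Ix" "j < J" for i \<sigma> p j
  proof -
    have p: "p \<in> {z, w}" and \<sigma>: "\<bar>\<sigma>\<bar> = 1" using that by (auto simp: Ix_def)
    note l = ray_map_image_le[OF S(1)[of j p] S(3)[of j p] S(4)[of j p] zk[OF p] \<sigma> ab(2)[OF that(2)], where i = i and c = "x0 $ i"]
    show "G i \<sigma> p ` S j p \<in> sets lebesgue" using l(1) by (simp add: G_def)
    have "ennreal (\<mu> j) * emeasure lebesgue (G i \<sigma> p ` S j p)
       \<le> ennreal B * (ennreal (\<mu> j ^ CARD('n)) * (\<integral>\<^sup>+x\<in>S j p. K_I F x * ennreal (\<theta> p (F x)) \<partial>lebesgue) + W j p)"
      using l(2) by (simp only: G_def B_def \<theta>_def W_def V_def)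
    also have "... \<le> ennreal B * (Y j p + W j p)"
      unfolding Y_def using S(2)[of j p]
      by (intro mult_left_mono add_right_mono nn_integral_mono) (auto simp: indicator_def)
    finally show "ennreal (\<mu> j) * emeasure lebesgue (G i \<sigma> p ` S j p) \<le> ennreal B * (Y j p + W j p)" .
  qed
  \<comment> \<open>Coordinate k carries the radius, the others the point q; the volume is (b_j -
    a_j) 2^(n-1).\<close>
  define T where "T j = box (\<chi> i. if i = k then a j else -1) (\<chi> i. if i = k then b j else (1::real))" for j
  have Tm: "ennreal (b j - a j) \<le> emeasure lebesgue (T j)" if "j < J" for j
  proof -
    have "emeasure lebesgue (T j) = ennreal (\<Prod>i\<in>(UNIV::'n set). if i = k then b j - a j else 2)"
    proof -
      have "emeasure lborel (T j) = ennreal (\<Prod>i\<in>(UNIV::'n set). (if i = k then b j else 1) - (if i = k then a j else -1))"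
        unfolding T_def using ab(1)[OF that] by (subst emeasure_lborel_box_cart) auto
      also have "(\<Prod>i\<in>(UNIV::'n set). (if i = k then b j else 1) - (if i = k then a j else -1)) = (\<Prod>i\<in>(UNIV::'n set). if i = k then b j - a j else 2)"
        by (rule prod.cong) auto
      finally show ?thesis by (simp add: T_def)
    qed
    also have "(\<Prod>i\<in>(UNIV::'n set). if i = k then b j - a j else 2) = (b j - a j) * 2 ^ (CARD('n) - 1)"
      by (subst prod.remove[of _ k]) (auto simp: card_Diff_singleton)
    finally show ?thesis using ab(1)[OF that] by (simp add: ennreal_leI)
  qed
  have cover: "T j \<subseteq> (\<Union>t\<in>Ix. case t of (i, \<sigma>, p) => G i \<sigma> p ` S j p)" if j: "j < J" for j
  proof
    fix y assume y: "y \<in> T j"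
    define q where "q = upd k ?h y"
    have yk: "a j < y $ k" "y $ k < b j" and yi: "\<And>i. i \<noteq> k ==> -1 < y $ i \<and> y $ i < 1"
      using y by (auto simp: T_def mem_box_cart split: if_splits)
    have q: "q $ k = ?h" "\<And>i. i \<noteq> k ==> \<bar>q $ i\<bar> \<le> 1" using yi by (auto simp: q_def abs_le_iff less_imp_le)
    obtain x where x: "x \<in> U" "infnorm (x - x0) = y $ k" "F x \<in> closed_segment z q \<union> closed_segment q w" "F x \<noteq> z" "F x \<noteq> w"
      using cross[OF j yk q] by blast
    obtain p where p: "p \<in> {z, w}" "F x \<in> closed_segment p q" "F x \<noteq> p" using x closed_segment_commute[of q w] by auto
    have pk: "p $ k < ?h" using zk(1)[OF p(1)] by simp
    have cp: "F x \<in> ray_cone k ?h p" "cproj k ?h p (F x) = q"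
      using cproj_segment[OF p(2,3) q(1) pk] q(2) by blast+
    \<comment> \<open>The sup norm is attained in some coordinate i, and with the sign \<sigma> that
      coordinate of x - x0 equals the radius.\<close>
    have "infnorm (x - x0) \<in> (\<lambda>u. \<bar>(x - x0) \<bullet> u\<bar>) ` Basis" unfolding infnorm_Max by (rule Max_in) auto
    then obtain i where i: "infnorm (x - x0) = \<bar>(x - x0) $ i\<bar>" by (auto simp: Basis_vec_def inner_axis)
    define \<sigma> where "\<sigma> = (if (x - x0) $ i \<ge> 0 then 1 else -1 :: real)"
    have \<sigma>: "\<sigma> * (x $ i - x0 $ i) = y $ k" using i x(2) by (auto simp: \<sigma>_def)
    have "G i \<sigma> p x = y" by (simp add: G_def ray_map_def cp(2) \<sigma>) (simp add: q_def vec_eq_iff)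
    moreover have "x \<in> S j p" using x yk cp(1) by (auto simp: S_def sh_def shell_def)
    moreover have "(i, \<sigma>, p) \<in> Ix" using p by (auto simp: Ix_def \<sigma>_def)
    ultimately show "y \<in> (\<Union>t\<in>Ix. case t of (i, \<sigma>, p) => G i \<sigma> p ` S j p)" by force
  qed
  have one: "ennreal (\<mu> j * (b j - a j)) \<le> (\<Sum>(i, \<sigma>, p)\<in>Ix. ennreal B * (Y j p + W j p))" if j: "j < J" for j
  proof -
    have "ennreal (\<mu> j * (b j - a j)) = ennreal (\<mu> j) * ennreal (b j - a j)" using ab[OF j] by (intro ennreal_mult) auto
    also have "... \<le> ennreal (\<mu> j) * emeasure lebesgue (T j)" using Tm[OF j] by (rule mult_left_mono) simp
    also have "emeasure lebesgue (T j) \<le> emeasure lebesgue (\<Union>t\<in>Ix. case t of (i, \<sigma>, p) => G i \<sigma> p ` S j p)"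
      using img(1)[OF _ j] by (intro emeasure_mono cover[OF j] sets.finite_UN finIx) auto
    also have "... \<le> (\<Sum>t\<in>Ix. emeasure lebesgue (case t of (i, \<sigma>, p) => G i \<sigma> p ` S j p))"
      using img(1)[OF _ j] by (intro emeasure_subadditive_finite finIx) auto
    also have "ennreal (\<mu> j) * (\<Sum>t\<in>Ix. emeasure lebesgue (case t of (i, \<sigma>, p) => G i \<sigma> p ` S j p))
       = (\<Sum>t\<in>Ix. ennreal (\<mu> j) * emeasure lebesgue (case t of (i, \<sigma>, p) => G i \<sigma> p ` S j p))" by (rule sum_distrib_left)
    also have "... \<le> (\<Sum>(i, \<sigma>, p)\<in>Ix. ennreal B * (Y j p + W j p))"
      using img(2)[OF _ j] by (intro sum_mono) auto
    finally show ?thesis by (simp add: mult_left_mono)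
  qed
  \<comment> \<open>The disjoint shells are united before the change of variables, so all of them
    together cost one kernel integral, whatever J is.\<close>
  have Wsum: "(\<Sum>j<J. W j p) \<le> ennreal CV" for p
  proof -
    let ?g = "\<lambda>x. ennreal (V p (F x) * jac x)"
    let ?T = "(\<Union>j<J. S j p \<inter> Dset)"
    have T: "?T \<in> sets lebesgue" "?T \<subseteq> Dset" using S(1) Dset_sets by auto
    have "(\<Sum>j<J. W j p) = (\<integral>\<^sup>+x. (\<Sum>j<J. ?g x * indicator (S j p \<inter> Dset) x) \<partial>lebesgue)"
      unfolding W_def
    proof (rule nn_integral_sum[symmetric])
      fix j show "(\<lambda>x. ?g x * indicator (S j p \<inter> Dset) x) \<in> borel_measurable lebesgue"
        by (rule jac_weight_measurable) (use S(1) Dset_sets in \<open>auto simp: V_def\<close>)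
    qed
    also have "... = (\<integral>\<^sup>+x. ?g x * indicator ?T x \<partial>lebesgue)"
    proof (rule nn_integral_cong)
      fix x
      have "disjoint_family_on (\<lambda>j. S j p \<inter> Dset) {..<J}" using Sdisj[of p] unfolding disjoint_family_on_def by blast
      hence "(\<Sum>j<J. indicator (S j p \<inter> Dset) x :: ennreal) = indicator ?T x" by (intro indicator_UN_disjoint[symmetric]) auto
      thus "(\<Sum>j<J. ?g x * indicator (S j p \<inter> Dset) x) = ?g x * indicator ?T x" by (simp only: sum_distrib_left[symmetric])
    qed
    also have "... = (\<integral>\<^sup>+x\<in>?T. ennreal (V p (F x) * \<bar>det (matrix (frechet_derivative F (at x)))\<bar>) \<partial>lebesgue)" by (simp add: jac_def)
    also have "... \<le> (\<integral>\<^sup>+y. ennreal (V p y) \<partial>lborel)"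
    proof (rule nn_integral_injective_change_of_variables_le[OF T(1)])
      show "(F has_derivative frechet_derivative F (at x)) (at x within ?T)" if "x \<in> ?T" for x
        using that T(2) by (intro has_derivative_Dset) blast
      show "inj_on F ?T" using inj by (rule inj_on_subset) (use T(2) in \<open>auto simp: Dset_def\<close>)
      show "(\<integral>\<^sup>+y. ennreal (V p y) \<partial>lborel) < \<infinity>" unfolding V_def using CV[of p] by (rule le_less_trans) simp
    qed (auto simp: V_def riesz_nonneg)
    also have "... \<le> ennreal CV" unfolding V_def by (rule CV)
    finally show ?thesis .
  qed
  have sumIx: "(\<Sum>(i, \<sigma>, p)\<in>Ix. g p) \<le> ennreal (2 * real CARD('n)) * (g z + g w)" for g :: "real^'n => ennreal"
  proof -
    have "(\<Sum>(i, \<sigma>, p)\<in>Ix. g p) = of_nat (CARD('n) * 2) * (\<Sum>p\<in>{z, w}. g p)"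
      unfolding Ix_def sum.cartesian_product[symmetric] by (simp add: card_insert_if mult.assoc)
    also have "(\<Sum>p\<in>{z, w}. g p) \<le> g z + g w" by (cases "z = w") (auto simp: add_increasing2)
    also have "(of_nat (CARD('n) * 2) :: ennreal) = ennreal (2 * real CARD('n))"
      by (simp add: ennreal_of_nat_eq_real_of_nat mult.commute)
    finally show ?thesis by (simp add: mult_left_mono)
  qed
  have "ennreal (\<Sum>j<J. \<mu> j * (b j - a j)) = (\<Sum>j<J. ennreal (\<mu> j * (b j - a j)))"
    using ab by (subst sum_ennreal[symmetric]) (auto simp: less_imp_le)
  also have "... \<le> (\<Sum>j<J. ennreal (2 * real CARD('n)) * (ennreal B * (Y j z + W j z) + ennreal B * (Y j w + W j w)))"
    using order_trans[OF one sumIx] by (intro sum_mono) auto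
  also have "... = ennreal (2 * real CARD('n)) * ennreal B * ((\<Sum>j<J. Y j z + Y j w) + ((\<Sum>j<J. W j z) + (\<Sum>j<J. W j w)))"
    by (simp add: sum_distrib_left[symmetric] sum.distrib distrib_left[symmetric] mult.assoc add_ac)
  also have "... \<le> ennreal (2 * real CARD('n)) * ennreal B * ((\<Sum>j<J. Y j z + Y j w) + (ennreal CV + ennreal CV))"
    using Wsum by (intro mult_left_mono add_mono) auto
  also have "(\<Sum>j<J. Y j z + Y j w) = (\<Sum>j<J. ennreal (\<mu> j ^ CARD('n)) * (\<integral>\<^sup>+x\<in>sh j. K_I F x * ennreal (\<theta> z (F x) + \<theta> w (F x)) \<partial>lebesgue))"
  proof (rule sum.cong[OF refl])
    fix j
    have m: "(\<lambda>x. K_I F x * ennreal (\<theta> p (F x)) * indicator (sh j) x) \<in> borel_measurable lebesgue" for p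
      by (rule weighted_K_measurable[OF sh]) (simp add: \<theta>_def)
    have "(\<integral>\<^sup>+x\<in>sh j. K_I F x * ennreal (\<theta> z (F x) + \<theta> w (F x)) \<partial>lebesgue)
      = (\<integral>\<^sup>+x. K_I F x * ennreal (\<theta> z (F x)) * indicator (sh j) x + K_I F x * ennreal (\<theta> w (F x)) * indicator (sh j) x \<partial>lebesgue)"
      by (intro nn_integral_cong) (simp add: \<theta>_def distrib_left distrib_right)
    thus "Y j z + Y j w = ennreal (\<mu> j ^ CARD('n)) * (\<integral>\<^sup>+x\<in>sh j. K_I F x * ennreal (\<theta> z (F x) + \<theta> w (F x)) \<partial>lebesgue)"
      unfolding Y_def by (simp add: nn_integral_add[OF m m] distrib_left)
  qed
  also have "ennreal CV + ennreal CV = ennreal (2 * CV)" using CV0 by (subst ennreal_plus[symmetric]) auto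
  also have "ennreal (2 * real CARD('n)) * ennreal B = ennreal (2 * real CARD('n) * B)" using B by (intro ennreal_mult[symmetric]) auto
  finally show ?thesis by (simp add: B_def \<theta>_def sh_def)
qed

text \<open>The sum of \<open>ring_inequality_single\<close> over N pairs of centres, divided by N.
  The hypothesis \<open>sep\<close> couples N to the map, while the constant contains only s, R, n
  and CV.\<close>

theorem ring_inequality:
  fixes z w :: "nat => real^'n" and a b \<mu> :: "nat => real"
  assumes s: "s > 0" and N: "N \<ge> 1"
    and zw: "\<And>l. l \<in> {1..N} ==> norm (z l) \<le> R \<and> norm (w l) \<le> R"
    and sph: "\<And>l. l \<in> {1..N} ==> norm (z l - e) = real l * (s / real N) \<and> norm (w l - e') = real l * (s / real N)"
    and sep: "\<And>l j x. l \<in> {1..N} ==> j < J ==> x \<in> shell x0 (a j) (b j) ==> s / real N \<le> norm (F x - z l) \<and> s / real N \<le> norm (F x - w l)"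
    and ab: "\<And>j. j < J ==> a j < b j" "\<And>j. j < J ==> 0 \<le> \<mu> j" and disj: "disjoint_family_on (\<lambda>j. {a j<..<b j}) {..<J}"
    and cross: "\<And>l j r q. l \<in> {1..N} ==> j < J ==> a j < r ==> r < b j ==> q $ k = R + 1 ==>
       \<exists>x\<in>U. infnorm (x - x0) = r \<and> F x \<in> closed_segment (z l) q \<union> closed_segment q (w l)"
    and CV: "\<And>z :: real^'n. (\<integral>\<^sup>+y. ennreal (riesz (real CARD('n) * (1 + R) * (2 * R + 1)) z y) \<partial>lborel) \<le> ennreal CV" and CV0: "CV \<ge> 0"
  shows "ennreal (\<Sum>j<J. \<mu> j * (b j - a j)) \<le> ennreal (2 * real CARD('n) * distortion_const CARD('n) R (2 * R + 1) * (12 / sqrt s + 2 * CV)) *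
     ((\<Sum>j<J. ennreal (\<mu> j ^ CARD('n)) * (\<integral>\<^sup>+x\<in>shell x0 (a j) (b j). K_I F x \<partial>lebesgue)) + 1)"
proof -
  define P where "P = 2 * real CARD('n) * distortion_const CARD('n) R (2 * R + 1)"
  define sh where "sh j = shell x0 (a j) (b j)" for j
  define \<theta> where "\<theta> l y = 1 / sqrt (norm (y - z l)) + 1 / sqrt (norm (y - w l))" for l y
  define X where "X = ennreal (\<Sum>j<J. \<mu> j * (b j - a j))"
  define I where "I j = (\<integral>\<^sup>+x\<in>sh j. K_I F x \<partial>lebesgue)" for j
  define Q where "Q = (\<Sum>j<J. ennreal (\<mu> j ^ CARD('n)) * I j)"
  have \<delta>: "s / real N > 0" using s N by simp
  have one: "1 \<in> {1..N}" using N by simp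
  have R: "R \<ge> 0" using zw[OF one] norm_ge_zero[of "z 1"] by linarith
  have P: "P \<ge> 0" using R by (simp add: P_def distortion_const_def)
  have sh: "sh j \<in> sets lebesgue" "sh j \<subseteq> U" for j using shell_sets by (auto simp: sh_def shell_def)
  have single: "X \<le> ennreal P * ((\<Sum>j<J. ennreal (\<mu> j ^ CARD('n)) * (\<integral>\<^sup>+x\<in>sh j. K_I F x * ennreal (\<theta> l (F x)) \<partial>lebesgue)) + ennreal (2 * CV))"
    if l: "l \<in> {1..N}" for l
    unfolding X_def P_def sh_def \<theta>_def
  proof (rule ring_inequality_single[where k = k])
    fix j r and q :: "real^'n" assume jr: "j < J" "a j < r" "r < b j" "q $ k = R + 1"
    obtain x where x: "x \<in> U" "infnorm (x - x0) = r" "F x \<in> closed_segment (z l) q \<union> closed_segment q (w l)"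
      using cross[OF l jr] by blast
    hence "x \<in> shell x0 (a j) (b j)" using jr by (simp add: shell_def)
    from sep[OF l jr(1) this] \<delta> have "F x \<noteq> z l" "F x \<noteq> w l" by auto
    thus "\<exists>x\<in>U. infnorm (x - x0) = r \<and> F x \<in> closed_segment (z l) q \<union> closed_segment q (w l) \<and> F x \<noteq> z l \<and> F x \<noteq> w l"
      using x by blast
  qed (use zw[OF l] ab disj CV CV0 in auto)
  have int: "(\<Sum>l=1..N. \<integral>\<^sup>+x\<in>sh j. K_I F x * ennreal (\<theta> l (F x)) \<partial>lebesgue) \<le> ennreal (real N * (12 / sqrt s)) * I j" if j: "j < J" for j
  proof -
    have "(\<Sum>l=1..N. \<integral>\<^sup>+x\<in>sh j. K_I F x * ennreal (\<theta> l (F x)) \<partial>lebesgue) = (\<integral>\<^sup>+x. (\<Sum>l=1..N. K_I F x * ennreal (\<theta> l (F x)) * indicator (sh j) x) \<partial>lebesgue)"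
    proof (rule nn_integral_sum[symmetric])
      fix l show "(\<lambda>x. K_I F x * ennreal (\<theta> l (F x)) * indicator (sh j) x) \<in> borel_measurable lebesgue"
        by (rule weighted_K_measurable[OF sh]) (simp add: \<theta>_def)
    qed
    also have "... \<le> (\<integral>\<^sup>+x. ennreal (real N * (12 / sqrt s)) * (K_I F x * indicator (sh j) x) \<partial>lebesgue)"
    proof (rule nn_integral_mono)
      fix x
      show "(\<Sum>l=1..N. K_I F x * ennreal (\<theta> l (F x)) * indicator (sh j) x) \<le> ennreal (real N * (12 / sqrt s)) * (K_I F x * indicator (sh j) x)"
      proof (cases "x \<in> sh j")
        case True
        have "(\<Sum>l=1..N. 1 / sqrt (norm (F x - z l))) \<le> 6 * real N / sqrt s"
          using sph sep[OF _ j] True by (intro sum_inverse_sqrt_norm_le[OF s N]) (auto simp: sh_def)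
        moreover have "(\<Sum>l=1..N. 1 / sqrt (norm (F x - w l))) \<le> 6 * real N / sqrt s"
          using sph sep[OF _ j] True by (intro sum_inverse_sqrt_norm_le[OF s N]) (auto simp: sh_def)
        moreover have "real N * (12 / sqrt s) = 6 * real N / sqrt s + 6 * real N / sqrt s"
          by (simp only: add_divide_distrib[symmetric]) simp
        ultimately have "(\<Sum>l=1..N. \<theta> l (F x)) \<le> real N * (12 / sqrt s)"
          unfolding \<theta>_def sum.distrib by (simp only: add_mono)
        hence "ennreal (\<Sum>l=1..N. \<theta> l (F x)) \<le> ennreal (real N * (12 / sqrt s))" by (rule ennreal_leI)
        moreover have "ennreal (\<Sum>l=1..N. \<theta> l (F x)) = (\<Sum>l=1..N. ennreal (\<theta> l (F x)))" by (rule sum_ennreal[symmetric]) (simp add: \<theta>_def)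
        ultimately have "K_I F x * (\<Sum>l=1..N. ennreal (\<theta> l (F x))) \<le> K_I F x * ennreal (real N * (12 / sqrt s))"
          by (intro mult_left_mono) simp_all
        thus ?thesis using True by (simp add: sum_distrib_left mult.commute)
      qed simp
    qed
    also have "... = ennreal (real N * (12 / sqrt s)) * I j"
    proof -
      have "(\<lambda>x. K_I F x * ennreal 1 * indicator (sh j) x) \<in> borel_measurable lebesgue" by (rule weighted_K_measurable[OF sh]) simp
      thus ?thesis unfolding I_def by (intro nn_integral_cmult) simp
    qed
    finally show ?thesis .
  qed
  have "of_nat N * X = (\<Sum>l=1..N. X)" by simp
  also have "... \<le> (\<Sum>l=1..N. ennreal P * ((\<Sum>j<J. ennreal (\<mu> j ^ CARD('n)) * (\<integral>\<^sup>+x\<in>sh j. K_I F x * ennreal (\<theta> l (F x)) \<partial>lebesgue)) + ennreal (2 * CV)))"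
    by (intro sum_mono single)
  also have "... = ennreal P * ((\<Sum>j<J. ennreal (\<mu> j ^ CARD('n)) * (\<Sum>l=1..N. \<integral>\<^sup>+x\<in>sh j. K_I F x * ennreal (\<theta> l (F x)) \<partial>lebesgue)) + of_nat N * ennreal (2 * CV))"
  proof -
    have sw: "(\<Sum>l=1..N. ennreal P * ((\<Sum>j<J. m j * q l j) + c)) = ennreal P * ((\<Sum>j<J. m j * (\<Sum>l=1..N. q l j)) + of_nat N * c)"
      for m :: "nat => ennreal" and q c
    proof -
      have "(\<Sum>l=1..N. \<Sum>j<J. m j * q l j) = (\<Sum>j<J. \<Sum>l=1..N. m j * q l j)" by (rule sum.swap)
      also have "... = (\<Sum>j<J. m j * (\<Sum>l=1..N. q l j))" by (simp only: sum_distrib_left)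
      finally have "(\<Sum>l=1..N. (\<Sum>j<J. m j * q l j) + c) = (\<Sum>j<J. m j * (\<Sum>l=1..N. q l j)) + of_nat N * c"
        by (simp add: sum.distrib)
      thus ?thesis by (simp only: sum_distrib_left[symmetric])
    qed
    show ?thesis by (rule sw)
  qed
  also have "... \<le> ennreal P * ((\<Sum>j<J. ennreal (\<mu> j ^ CARD('n)) * (ennreal (real N * (12 / sqrt s)) * I j)) + of_nat N * ennreal (2 * CV))"
    using int by (intro mult_left_mono add_right_mono sum_mono) auto
  also have "... = of_nat N * (ennreal P * (ennreal (12 / sqrt s) * Q + ennreal (2 * CV)))"
  proof -
    have "ennreal (real N * (12 / sqrt s)) = of_nat N * ennreal (12 / sqrt s)"
      using s by (subst ennreal_mult) (auto simp: ennreal_of_nat_eq_real_of_nat)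
    hence "(\<Sum>j<J. ennreal (\<mu> j ^ CARD('n)) * (ennreal (real N * (12 / sqrt s)) * I j)) = of_nat N * (ennreal (12 / sqrt s) * Q)"
      by (simp add: Q_def sum_distrib_left mult_ac)
    thus ?thesis by (simp add: distrib_left mult_ac)
  qed
  finally have le: "of_nat N * X \<le> of_nat N * (ennreal P * (ennreal (12 / sqrt s) * Q + ennreal (2 * CV)))" .
  have "X \<le> ennreal P * (ennreal (12 / sqrt s) * Q + ennreal (2 * CV))"
    by (rule ennreal_mult_le_mult_iff[THEN iffD1, OF _ _ le]) (use N in auto)
  \<comment> \<open>Both terms are enlarged by the factor Q + 1, which leaves one constant in
    front.\<close>
  also have "... \<le> ennreal P * (ennreal (12 / sqrt s) * (Q + 1) + ennreal (2 * CV) * (Q + 1))"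
  proof (rule mult_left_mono, rule add_mono)
    show "ennreal (12 / sqrt s) * Q \<le> ennreal (12 / sqrt s) * (Q + 1)" by (intro mult_left_mono) auto
    have "ennreal (2 * CV) * 1 \<le> ennreal (2 * CV) * (Q + 1)" by (rule mult_left_mono) auto
    thus "ennreal (2 * CV) \<le> ennreal (2 * CV) * (Q + 1)" by simp
  qed simp
  also have "... = ennreal P * ennreal (12 / sqrt s + 2 * CV) * (Q + 1)"
    using s CV0 by (simp add: distrib_right[symmetric] mult.assoc)
  also have "ennreal P * ennreal (12 / sqrt s + 2 * CV) = ennreal (P * (12 / sqrt s + 2 * CV))"
    using s CV0 P by (intro ennreal_mult[symmetric]) auto
  finally show ?thesis unfolding X_def P_def Q_def I_def sh_def .
qed

end

section \<open>Topology of the one-point compactification\<close>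

lemma dist_Fin_le: "dist (Fin x) (Fin y) \<le> norm (x - y)"
proof -
  have "1 * 1 \<le> sqrt (1 + (norm x)\<^sup>2) * sqrt (1 + (norm y)\<^sup>2)" by (intro mult_mono) auto
  hence "norm (x - y) / (sqrt (1 + (norm x)\<^sup>2) * sqrt (1 + (norm y)\<^sup>2)) \<le> norm (x - y) / 1"
    by (intro divide_left_mono) auto
  thus ?thesis by (simp add: dist_cpt_def)
qed

lemma continuous_on_Fin [continuous_intros]:
  fixes g :: "'b::topological_space => 'a::real_inner"
  shows "continuous_on S g ==> continuous_on S (\<lambda>x. Fin (g x))"
proof -
  have "continuous_on UNIV (Fin :: 'a => 'a cpt)"
    unfolding continuous_on_iff
  proof (intro ballI allI impI)
    fix x :: 'a and e :: real assume "e > 0"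
    moreover have "dist (Fin y) (Fin x) < e" if "dist y x < e" for y
      using dist_Fin_le[of y x] that by (simp add: dist_norm)
    ultimately show "\<exists>d>0. \<forall>x'\<in>UNIV. dist x' x < d \<longrightarrow> dist (Fin x') (Fin x) < e" by blast
  qed
  thus "continuous_on S g ==> continuous_on S (\<lambda>x. Fin (g x))"
    by (rule continuous_on_compose2) auto
qed

lemma sqrt_one_plus_le: "sqrt (1 + (norm x)\<^sup>2) \<le> 1 + norm x"
  by (rule real_le_lsqrt) (auto simp: power2_eq_square algebra_simps)

lemma near_Fin:
  fixes x :: "'a::real_inner"
  assumes r: "r > 0"
  shows "\<exists>e>0. \<forall>q. dist (Fin x) q < e \<longrightarrow> (\<exists>y. q = Fin y \<and> norm (x - y) < r)"
proof -
  define s where "s = 1 + norm x"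
  have s: "s \<ge> 1" by (simp add: s_def)
  \<comment> \<open>The first bound excludes \<open>Infty\<close> and makes the term linear in d at
    most d / 2, which is absorbed; the second then gives d < r.\<close>
  define e where "e = min (1 / (2 * s)) (r / (2 * s\<^sup>2))"
  have e: "e > 0" "e \<le> 1 / (2 * s)" "e \<le> r / (2 * s\<^sup>2)" using r s by (auto simp: e_def)
  have "\<exists>y. q = Fin y \<and> norm (x - y) < r" if q: "dist (Fin x) q < e" for q
  proof (cases q)
    case Infty
    have "1 / s \<le> 1 / sqrt (1 + (norm x)\<^sup>2)"
      using sqrt_one_plus_le[of x] one_plus_norm_pos[of x] by (intro divide_left_mono) (auto simp: s_def intro!: mult_pos_pos add_pos_nonneg)
    also have "... < e" using q Infty by (simp add: dist_cpt_def)
    finally have "1 / s < 1 / (2 * s)" using e(2) by linarith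
    thus ?thesis using s by (simp add: field_simps)
  next
    case (Fin y)
    define d where "d = norm (x - y)"
    have pos: "sqrt (1 + (norm x)\<^sup>2) * sqrt (1 + (norm y)\<^sup>2) > 0"
      using one_plus_norm_pos[of x] one_plus_norm_pos[of y] by (intro mult_pos_pos) auto
    have "d < e * (sqrt (1 + (norm x)\<^sup>2) * sqrt (1 + (norm y)\<^sup>2))"
      using q Fin pos by (simp add: dist_cpt_def d_def pos_divide_less_eq)
    also have "... \<le> e * (s * (s + d))"
    proof (intro mult_left_mono mult_mono)
      have "norm y \<le> norm x + d" using norm_triangle_ineq4[of x "x - y"] by (simp add: d_def)
      thus "sqrt (1 + (norm y)\<^sup>2) \<le> s + d" using sqrt_one_plus_le[of y] by (simp add: s_def)
    qed (use e s sqrt_one_plus_le[of x] in \<open>auto simp: s_def\<close>)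
    also have "... = e * s\<^sup>2 + (e * s) * d" by (simp add: power2_eq_square algebra_simps)
    also have "(e * s) * d \<le> 1 / 2 * d" using e(2) s by (intro mult_right_mono) (auto simp: field_simps d_def)
    finally have "d < 2 * (e * s\<^sup>2)" by linarith
    also have "... \<le> r" using e(3) s by (simp add: field_simps)
    finally show ?thesis using Fin by (auto simp: d_def)
  qed
  thus ?thesis using e(1) by blast
qed

lemma open_Fin_image: "open V ==> open (Fin ` V)"
  unfolding open_dist
proof safe
  fix x assume V: "\<forall>x\<in>V. \<exists>e>0. \<forall>y. dist y x < e \<longrightarrow> y \<in> V" "x \<in> V"
  then obtain r where r: "r > 0" "\<And>y. dist y x < r ==> y \<in> V" by blast
  obtain e where e: "e > 0" "\<And>q. dist (Fin x) q < e ==> \<exists>y. q = Fin y \<and> norm (x - y) < r" using near_Fin[OF r(1), of x] by blast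
  show "\<exists>e>0. \<forall>y. dist y (Fin x) < e \<longrightarrow> y \<in> Fin ` V"
  proof (intro exI[of _ e] conjI allI impI)
    fix q assume "dist q (Fin x) < e"
    then obtain y where "q = Fin y" "norm (x - y) < r" using e(2)[of q] by (auto simp: dist_commute)
    thus "q \<in> Fin ` V" using r(2)[of y] by (auto simp: dist_norm norm_minus_commute)
  qed (rule e(1))
qed

lemma continuous_on_the_fin: "continuous_on (- {Infty}) (the_fin :: 'a::real_inner cpt => 'a)"
  unfolding continuous_on_iff
proof (intro ballI allI impI)
  fix q :: "'a cpt" and r :: real assume q: "q \<in> - {Infty}" and r: "r > 0"
  then obtain x where x: "q = Fin x" by (cases q) auto
  obtain e where e: "e > 0" "\<And>q. dist (Fin x) q < e ==> \<exists>y. q = Fin y \<and> norm (x - y) < r" using near_Fin[OF r, of x] by blast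
  show "\<exists>d>0. \<forall>q'\<in>- {Infty}. dist q' q < d \<longrightarrow> dist (the_fin q') (the_fin q) < r"
  proof (intro exI[of _ e] conjI ballI impI)
    fix q' assume "dist q' q < e"
    then obtain y where "q' = Fin y" "norm (x - y) < r" using e(2)[of q'] x by (auto simp: dist_commute)
    thus "dist (the_fin q') (the_fin q) < r" using x by (simp add: dist_norm norm_minus_commute)
  qed (rule e(1))
qed

lemma Infty_in_closure:
  assumes "\<not> bounded S" shows "Infty \<in> closure (Fin ` S)"
  unfolding closure_approachable
proof (intro allI impI)
  fix e :: real assume e: "e > 0"
  obtain y where y: "y \<in> S" "norm y > 1 / e" using assms unfolding bounded_iff by (meson not_le)
  have "1 / e < sqrt (1 + (norm y)\<^sup>2)" using y(2) e by (intro real_less_rsqrt) (smt (verit) power2_less_imp_less power_mono zero_le_divide_iff)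
  hence "1 < e * sqrt (1 + (norm y)\<^sup>2)" using e by (simp add: pos_divide_less_eq mult.commute)
  moreover have "sqrt (1 + (norm y)\<^sup>2) > 0" using one_plus_norm_pos[of y] by simp
  ultimately have "1 / sqrt (1 + (norm y)\<^sup>2) < e" by (simp only: pos_divide_less_eq)
  thus "\<exists>q\<in>Fin ` S. dist q Infty < e" using y(1) by (auto simp: dist_cpt_def)
qed

lemma inversion_inversion [simp]: "inversion (inversion q) = q"
proof (cases q)
  case (Fin x)
  show ?thesis
  proof (cases "x = 0")
    case False
    define y where "y = x /\<^sub>R (norm x)\<^sup>2"
    have y0: "y \<noteq> 0" using False by (simp add: y_def)
    have "norm y = 1 / norm x" using False by (simp add: y_def power2_eq_square field_simps)
    hence "y /\<^sub>R (norm y)\<^sup>2 = (norm x)\<^sup>2 *\<^sub>R y" by (simp add: power_divide)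
    also have "... = x" using False by (simp add: y_def)
    finally show ?thesis using False Fin y0 by (simp add: y_def[symmetric])
  qed (simp add: Fin)
qed simp

text \<open>Under the stereographic projection, inversion is the reflection of the sphere in its
  equator, hence an isometry; here it is computed from the chordal formula.\<close>

lemma dist_inversion: "dist (inversion p) (inversion q) = dist p q"
proof -
  have sq: "sqrt (1 + (norm (x /\<^sub>R (norm x)\<^sup>2))\<^sup>2) = sqrt (1 + (norm x)\<^sup>2) / norm x" if "x \<noteq> 0" for x :: 'a
  proof -
    have "1 + (norm (x /\<^sub>R (norm x)\<^sup>2))\<^sup>2 = (1 + (norm x)\<^sup>2) / (norm x)\<^sup>2"
      using that by (simp add: power2_eq_square field_simps)
    thus ?thesis using that by (simp add: real_sqrt_divide)
  qed
  have fin: "chordal (inversion (Fin x)) (inversion (Fin y)) = chordal (Fin x) (Fin y)" if xy: "x \<noteq> 0" "y \<noteq> 0" for x y :: 'a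
  proof -
    have "(norm (x /\<^sub>R (norm x)\<^sup>2 - y /\<^sub>R (norm y)\<^sup>2))\<^sup>2 = (norm (x - y) / (norm x * norm y))\<^sup>2"
    proof -
      define a b where "a = (norm x)\<^sup>2" and "b = (norm y)\<^sup>2"
      have ab: "a > 0" "b > 0" "x \<bullet> x = a" "y \<bullet> y = b" using xy by (auto simp: a_def b_def dot_square_norm)
      have "(norm (x /\<^sub>R a - y /\<^sub>R b))\<^sup>2 = (x \<bullet> x) / a\<^sup>2 - 2 * (x \<bullet> y) / (a * b) + (y \<bullet> y) / b\<^sup>2"
        unfolding power2_norm_eq_inner
        by (simp add: inner_diff_left inner_diff_right inner_commute divide_inverse power2_eq_square algebra_simps)
      also have "... = (a + b - 2 * (x \<bullet> y)) / (a * b)" using ab by (simp add: field_simps power2_eq_square)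
      also have "a + b - 2 * (x \<bullet> y) = (norm (x - y))\<^sup>2"
        unfolding power2_norm_eq_inner by (simp add: inner_diff_left inner_diff_right inner_commute ab)
      finally show ?thesis by (simp add: a_def b_def power_divide power_mult_distrib)
    qed
    hence "norm (x /\<^sub>R (norm x)\<^sup>2 - y /\<^sub>R (norm y)\<^sup>2) = norm (x - y) / (norm x * norm y)"
      by (rule power2_eq_imp_eq) auto
    moreover have "inversion (Fin x) = Fin (x /\<^sub>R (norm x)\<^sup>2)" "inversion (Fin y) = Fin (y /\<^sub>R (norm y)\<^sup>2)"
      using xy by simp_all
    ultimately show ?thesis using xy by (simp only: chordal.simps sq[OF xy(1)] sq[OF xy(2)]) (simp add: field_simps)
  qed
  have zero: "chordal (inversion (Fin 0)) (inversion (Fin y)) = chordal (Fin 0) (Fin y)" if "y \<noteq> 0" for y :: 'a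
  proof -
    have "norm y / sqrt (1 + (norm y)\<^sup>2) = 1 / (sqrt (1 + (norm y)\<^sup>2) / norm y)" by simp
    moreover have "inversion (Fin y) = Fin (y /\<^sub>R (norm y)\<^sup>2)" "inversion (Fin 0) = (Infty :: 'a cpt)" using that by simp_all
    ultimately show ?thesis using that by (simp only: chordal.simps sq[OF that]) simp
  qed
  have inf: "chordal (inversion Infty) (inversion (Fin y)) = chordal Infty (Fin y)" for y :: 'a
  proof (cases "y = 0")
    case False
    have "inversion (Fin y) = Fin (y /\<^sub>R (norm y)\<^sup>2)" "inversion Infty = Fin (0 :: 'a)" using False by simp_all
    moreover have n: "norm (y /\<^sub>R (norm y)\<^sup>2) = 1 / norm y" using False by (simp add: power2_eq_square field_simps)
    moreover have "sqrt (1 + (1 / norm y)\<^sup>2) = sqrt (1 + (norm y)\<^sup>2) / norm y" using sq[OF False] by (simp only: n)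
    moreover have "(1 / norm y) / (sqrt (1 + (norm (0::'a))\<^sup>2) * (sqrt (1 + (norm y)\<^sup>2) / norm y)) = 1 / sqrt (1 + (norm y)\<^sup>2)"
      using False by simp
    ultimately show ?thesis by (simp only: chordal.simps diff_0 norm_minus_cancel)
  qed simp
  have sym: "chordal p q = chordal q p" for p q :: "'a cpt"
    by (cases p; cases q) (auto simp: norm_minus_commute mult.commute)
  show ?thesis unfolding dist_cpt_def
  proof (cases p; cases q)
    fix x y assume pq: "p = Fin x" "q = Fin y"
    show "chordal (inversion p) (inversion q) = chordal p q"
      unfolding pq using fin[of x y] zero[of y] zero[of x] sym by (cases "x = 0"; cases "y = 0") (metis chordal.simps(4) chordal_eq_0_iff)+
  next
    assume "p = Infty" "q = Infty"
    thus "chordal (inversion p) (inversion q) = chordal p q" by simp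
  qed (use inf sym in metis)+
qed

lemma continuous_on_inversion: "continuous_on S inversion"
  unfolding continuous_on_iff dist_inversion by blast

text \<open>Invariance of domain in each of the two source charts, which together cover D. The
  finite values are collected because the separation arguments take place in
  \<open>real^'n\<close>.\<close>

lemma homeomorphism_open_values:
  fixes f :: "(real^'n) cpt => (real^'n) cpt"
  assumes f: "continuous_on D f" "inj_on f D" and V: "open V" "V \<subseteq> D"
  shows "open {y. Fin y \<in> f ` V}"
proof -
  define W where "W a = {x. a (Fin x) \<in> V \<and> f (a (Fin x)) \<noteq> Infty}" for a :: "(real^'n) cpt => (real^'n) cpt"
  have op: "open ((\<lambda>x. the_fin (f (a (Fin x)))) ` W a)" if a: "continuous_on UNIV a" "inj a" for a
  proof (rule invariance_of_domain)
    have c1: "continuous_on UNIV (\<lambda>x. a (Fin x))"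
      by (rule continuous_on_compose2[OF a(1)]) (auto intro!: continuous_intros)
    have oV: "open ((\<lambda>x. a (Fin x)) -` V)" by (rule open_vimage[OF V(1) c1])
    have c2: "continuous_on ((\<lambda>x. a (Fin x)) -` V) (\<lambda>x. f (a (Fin x)))"
      by (rule continuous_on_compose2[OF f(1) continuous_on_subset[OF c1]]) (use V(2) in auto)
    have "W a = ((\<lambda>x. f (a (Fin x))) -` (- {Infty})) \<inter> ((\<lambda>x. a (Fin x)) -` V)" by (auto simp: W_def)
    moreover have "open (((\<lambda>x. f (a (Fin x))) -` (- {Infty})) \<inter> ((\<lambda>x. a (Fin x)) -` V))"
      by (rule continuous_on_open_vimage[OF oV, THEN iffD1, rule_format, OF c2]) auto
    ultimately show "open (W a)" by simp
    show "continuous_on (W a) (\<lambda>x. the_fin (f (a (Fin x))))"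
    proof (rule continuous_on_compose2[OF continuous_on_the_fin])
      show "continuous_on (W a) (\<lambda>x. f (a (Fin x)))" by (rule continuous_on_subset[OF c2]) (auto simp: W_def)
    qed (auto simp: W_def)
    show "inj_on (\<lambda>x. the_fin (f (a (Fin x)))) (W a)"
    proof (rule inj_onI)
      fix x y assume xy: "x \<in> W a" "y \<in> W a" "the_fin (f (a (Fin x))) = the_fin (f (a (Fin y)))"
      hence "f (a (Fin x)) = f (a (Fin y))" by (cases "f (a (Fin x))"; cases "f (a (Fin y))") (auto simp: W_def)
      moreover have "a (Fin x) \<in> D" "a (Fin y) \<in> D" using xy V(2) by (auto simp: W_def)
      ultimately have "a (Fin x) = a (Fin y)" by (rule inj_onD[OF f(2)])
      thus "x = y" using injD[OF a(2)] by auto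
    qed
  qed
  have inv: "inj (inversion :: (real^'n) cpt => _)" by (metis injI inversion_inversion)
  have "{y. Fin y \<in> f ` V} = (\<lambda>x. the_fin (f (id (Fin x)))) ` W id \<union> (\<lambda>x. the_fin (f (inversion (Fin x)))) ` W inversion"
  proof (intro set_eqI iffI)
    fix y assume "y \<in> {y. Fin y \<in> f ` V}"
    then obtain v where v: "v \<in> V" "f v = Fin y" by (auto simp: image_iff)
    show "y \<in> (\<lambda>x. the_fin (f (id (Fin x)))) ` W id \<union> (\<lambda>x. the_fin (f (inversion (Fin x)))) ` W inversion"
    proof (cases v)
      case (Fin x)
      hence "x \<in> W id" "y = the_fin (f (id (Fin x)))" using v by (auto simp: W_def)
      thus ?thesis by blast
    next
      case Infty
      hence "0 \<in> W inversion" "y = the_fin (f (inversion (Fin 0)))" using v by (auto simp: W_def)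
      thus ?thesis by blast
    qed
  next
    fix y assume "y \<in> (\<lambda>x. the_fin (f (id (Fin x)))) ` W id \<union> (\<lambda>x. the_fin (f (inversion (Fin x)))) ` W inversion"
    then obtain a x where a: "x \<in> W a" "y = the_fin (f (a (Fin x)))" by auto
    hence "Fin y = f (a (Fin x))" by (auto simp: W_def intro: cpt.collapse(1))
    thus "y \<in> {y. Fin y \<in> f ` V}" using a by (auto simp: W_def)
  qed
  thus ?thesis using op[OF continuous_on_id'[of UNIV, folded id_def] inj_on_id] op[OF continuous_on_inversion inv] by auto
qed

section \<open>Separation by images of cubes and balls\<close>

lemma closed_Fin_vimage: "closed C ==> closed {y. Fin y \<in> C}"
  using continuous_closed_vimage[of C Fin] continuous_on_Fin[of UNIV "\<lambda>x. x"]
  by (auto simp: vimage_def continuous_on_eq_continuous_within intro!: continuous_closed_vimage)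

text \<open>Off the image of \<Sigma>, the set \<Gamma> is covered by two disjoint open sets: the
  image of I, open by invariance of domain, and the complement of the compact image of C. It meets
  both of them.\<close>

lemma image_separates:
  fixes f :: "(real^'n) cpt => (real^'n) cpt"
  assumes f: "continuous_on D f" "inj_on f D" and I: "open I" "I \<subseteq> D"
    and C: "compact C" "C \<subseteq> D" "C \<subseteq> I \<union> \<Sigma>" "I \<subseteq> C"
    and \<Gamma>: "connected \<Gamma>" "z \<in> \<Gamma>" "w \<in> \<Gamma>" "Fin z \<in> f ` I" "Fin w \<notin> f ` C"
  shows "\<exists>y\<in>\<Gamma>. Fin y \<in> f ` \<Sigma>"
proof (rule ccontr)
  assume no: "\<not> ?thesis"
  have "compact (f ` C)" using compact_continuous_image[OF continuous_on_subset[OF f(1) C(2)] C(1)] .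
  hence "closed {y. Fin y \<in> f ` C}" by (intro closed_Fin_vimage compact_imp_closed)
  hence o2: "open (- {y. Fin y \<in> f ` C})" by auto
  have o1: "open {y. Fin y \<in> f ` I}" by (rule homeomorphism_open_values[OF f I])
  have "\<Gamma> \<subseteq> {y. Fin y \<in> f ` I} \<union> - {y. Fin y \<in> f ` C}" using no C(3) by blast
  moreover have "{y. Fin y \<in> f ` I} \<inter> - {y. Fin y \<in> f ` C} \<inter> \<Gamma> = {}" using C(4) by blast
  ultimately show False using connectedD[OF \<Gamma>(1) o1 o2] \<Gamma> by blast
qed

lemma connected_meets_sphere:
  fixes E :: "'a::euclidean_space cpt set"
  assumes E: "connected E" "Fin e \<in> E" "q \<in> E" "q = Infty \<or> norm (the_fin q - e) \<ge> s" and t: "0 < t" "t < s"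
  shows "\<exists>z. Fin z \<in> E \<and> norm (z - e) = t"
proof (rule ccontr)
  assume no: "\<not> ?thesis"
  have o1: "open (Fin ` ball e t)" by (rule open_Fin_image) simp
  have "compact (Fin ` cball e t)" by (rule compact_continuous_image) (auto intro!: continuous_intros)
  hence o2: "open (- Fin ` cball e t)" by (simp add: compact_imp_closed open_Compl)
  have "E \<subseteq> Fin ` ball e t \<union> - Fin ` cball e t"
  proof
    fix p assume p: "p \<in> E"
    show "p \<in> Fin ` ball e t \<union> - Fin ` cball e t"
    proof (cases p)
      case (Fin y)
      hence "norm (y - e) \<noteq> t" using no p by blast
      thus ?thesis using Fin by (auto simp: dist_norm norm_minus_commute)
    qed auto
  qed
  moreover have "Fin ` ball e t \<inter> - Fin ` cball e t \<inter> E = {}" by auto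
  moreover have "Fin e \<in> Fin ` ball e t" using t by auto
  moreover have "q \<in> - Fin ` cball e t" using E(4) t by (auto simp: dist_norm norm_minus_commute)
  ultimately show False using connectedD[OF E(1) o1 o2] E(2,3) by blast
qed

text \<open>If the whole sphere were covered, its preimage would be a topological sphere inside the
  ball, bounding a component Q there. The image of Q would be open and closed off the sphere, hence
  contain the whole inside or the whole outside. The inside contains the omitted point c; the
  outside contains the omitted point q or has it in its closure.\<close>

lemma sphere_not_in_ball_image:
  fixes \<phi> :: "'a::euclidean_space => 'a cpt"
  assumes dim: "2 \<le> DIM('a)" and \<phi>: "continuous_on (cball x1 \<rho>) \<phi>" "inj_on \<phi> (cball x1 \<rho>)"
    and c: "Fin c \<notin> \<phi> ` cball x1 \<rho>" and q: "q \<notin> \<phi> ` cball x1 \<rho>" "q = Infty \<or> norm (the_fin q - c) > t" and t: "t > 0"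
  shows "\<exists>w. norm (w - c) = t \<and> Fin w \<notin> \<phi> ` cball x1 \<rho>"
proof (rule ccontr)
  assume "\<not> ?thesis"
  hence sub: "Fin w \<in> \<phi> ` cball x1 \<rho>" if "norm (w - c) = t" for w using that by blast
  let ?B = "cball x1 \<rho>"
  define \<Sigma> where "\<Sigma> = {x \<in> ?B. \<phi> x \<in> Fin ` sphere c t}"
  have cS: "compact (Fin ` sphere c t)" by (rule compact_continuous_image) (auto intro!: continuous_intros)
  have "closed \<Sigma>"
  proof -
    have "closed (?B \<inter> \<phi> -` (Fin ` sphere c t))"
      by (rule continuous_closed_preimage[OF \<phi>(1)]) (auto intro: compact_imp_closed cS)
    thus ?thesis by (simp add: \<Sigma>_def Int_def vimage_def)
  qed
  moreover have SB: "\<Sigma> \<subseteq> ?B" by (auto simp: \<Sigma>_def)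
  ultimately have comp: "compact \<Sigma>" using compact_eq_bounded_closed bounded_subset bounded_cball by blast
  have hom: "\<Sigma> homeomorphic sphere c t"
  proof (rule homeomorphic_compact[OF comp])
    have "\<phi> ` \<Sigma> \<subseteq> - {Infty}" by (auto simp: \<Sigma>_def)
    thus "continuous_on \<Sigma> (\<lambda>x. the_fin (\<phi> x))"
      by (intro continuous_on_compose2[OF continuous_on_the_fin continuous_on_subset[OF \<phi>(1) SB]]) auto
    show "(\<lambda>x. the_fin (\<phi> x)) ` \<Sigma> = sphere c t"
    proof (intro set_eqI iffI)
      fix w assume w: "w \<in> sphere c t"
      hence "Fin w \<in> \<phi> ` ?B" by (intro sub) (simp add: dist_norm norm_minus_commute)
      then obtain x where "x \<in> ?B" "\<phi> x = Fin w" by (metis imageE)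
      hence "x \<in> \<Sigma>" "w = the_fin (\<phi> x)" using w by (auto simp: \<Sigma>_def)
      thus "w \<in> (\<lambda>x. the_fin (\<phi> x)) ` \<Sigma>" by blast
    qed (auto simp: \<Sigma>_def)
    show "inj_on (\<lambda>x. the_fin (\<phi> x)) \<Sigma>"
    proof (rule inj_onI)
      fix x y assume "x \<in> \<Sigma>" "y \<in> \<Sigma>" "the_fin (\<phi> x) = the_fin (\<phi> y)"
      hence "\<phi> x = \<phi> y" "x \<in> ?B" "y \<in> ?B" by (auto simp: \<Sigma>_def)
      thus "x = y" using inj_onD[OF \<phi>(2)] by blast
    qed
  qed
  have nc: "\<not> connected (- \<Sigma>)" by (rule Jordan_Brouwer_separation[OF hom t])
  have "bounded (- (- \<Sigma>))" using comp compact_imp_bounded by simp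
  from cobounded_has_bounded_component[OF this nc dim] obtain Q where Q: "Q \<in> components (- \<Sigma>)" "bounded Q" by blast
  have cB: "connected (- ?B)" by (rule connected_complement_bounded_convex) (auto simp: dim)
  \<comment> \<open>The complement of the ball is connected, misses \<Sigma> and is unbounded, so it
    cannot lie in the bounded component.\<close>
  have QB: "Q \<subseteq> ?B"
  proof (rule ccontr)
    assume "\<not> Q \<subseteq> ?B"
    hence "- ?B \<subseteq> Q" using components_maximal[OF Q(1) cB] SB by blast
    hence "bounded (- ?B)" using Q(2) bounded_subset by blast
    thus False using cobounded_imp_unbounded[of "- ?B"] by simp
  qed
  have oQ: "open Q" using open_components[of "- \<Sigma>" Q] Q(1) comp compact_imp_closed by blast
  have Qne: "Q \<noteq> {}" using Q(1) in_components_nonempty by blast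
  have Q\<Sigma>: "Q \<inter> \<Sigma> = {}" using in_components_subset[OF Q(1)] by blast
  have clQ: "closure Q \<subseteq> Q \<union> \<Sigma>"
    using frontier_of_components_closed_complement[OF compact_imp_closed[OF comp] Q(1)]
    unfolding frontier_def using interior_open[OF oQ] by blast
  have clB: "closure Q \<subseteq> ?B" using QB by (rule closure_minimal) simp
  define Wd where "Wd = {x \<in> Q. \<phi> x \<noteq> Infty}"
  define Y where "Y = (\<lambda>x. the_fin (\<phi> x)) ` Wd"
  define Yc where "Yc = {y. Fin y \<in> \<phi> ` closure Q}"
  have cQ: "continuous_on Q \<phi>" using \<phi>(1) QB continuous_on_subset by blast
  have oY: "open Y" unfolding Y_def
  proof (rule invariance_of_domain)
    have "Wd = \<phi> -` (- {Infty}) \<inter> Q" by (auto simp: Wd_def)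
    moreover have "open (\<phi> -` (- {Infty}) \<inter> Q)" by (rule continuous_on_open_vimage[OF oQ, THEN iffD1, rule_format, OF cQ]) auto
    ultimately show "open Wd" by simp
    show "continuous_on Wd (\<lambda>x. the_fin (\<phi> x))"
    proof (rule continuous_on_compose2[OF continuous_on_the_fin])
      show "continuous_on Wd \<phi>" by (rule continuous_on_subset[OF cQ]) (auto simp: Wd_def)
    qed (auto simp: Wd_def)
    show "inj_on (\<lambda>x. the_fin (\<phi> x)) Wd"
    proof (rule inj_onI)
      fix x y assume xy: "x \<in> Wd" "y \<in> Wd" "the_fin (\<phi> x) = the_fin (\<phi> y)"
      hence "\<phi> x = \<phi> y" by (cases "\<phi> x"; cases "\<phi> y") (auto simp: Wd_def)
      moreover have "x \<in> ?B" "y \<in> ?B" using QB xy by (auto simp: Wd_def)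
      ultimately show "x = y" by (rule inj_onD[OF \<phi>(2)])
    qed
  qed
  have YYc: "Y \<subseteq> Yc"
  proof
    fix y assume "y \<in> Y"
    then obtain x where x: "x \<in> Wd" "y = the_fin (\<phi> x)" by (auto simp: Y_def)
    hence "Fin y = \<phi> x" by (auto simp: Wd_def intro: cpt.collapse(1))
    thus "y \<in> Yc" using x closure_subset[of Q] by (auto simp: Yc_def Wd_def)
  qed
  have "compact (\<phi> ` closure Q)"
    by (rule compact_continuous_image[OF continuous_on_subset[OF \<phi>(1) clB]]) (use Q(2) in \<open>simp add: compact_closure\<close>)
  hence cl\<phi>: "closed (\<phi> ` closure Q)" by (rule compact_imp_closed)
  hence oYc: "open (- Yc)" unfolding Yc_def by (intro open_Compl closed_Fin_vimage)
  have Yc_sub: "y \<in> Y \<or> norm (y - c) = t" if y: "y \<in> Yc" for y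
  proof -
    obtain x where x: "x \<in> closure Q" "\<phi> x = Fin y" using y by (auto simp: Yc_def image_iff)
    show ?thesis
    proof (cases "x \<in> Q")
      case True
      hence "x \<in> Wd" "y = the_fin (\<phi> x)" using x by (auto simp: Wd_def)
      thus ?thesis unfolding Y_def by blast
    next
      case False
      hence "x \<in> \<Sigma>" using x clQ by blast
      thus ?thesis using x by (auto simp: \<Sigma>_def dist_norm norm_minus_commute)
    qed
  qed
  have Y_sphere: "norm (y - c) \<noteq> t" if yY: "y \<in> Y" for y
  proof
    assume n: "norm (y - c) = t"
    obtain x where x: "x \<in> Wd" "y = the_fin (\<phi> x)" using yY by (auto simp: Y_def)
    hence "\<phi> x = Fin y" by (auto simp: Wd_def intro: cpt.collapse(1)[symmetric])
    moreover have "y \<in> sphere c t" using n by (simp add: dist_norm norm_minus_commute)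
    moreover have "x \<in> ?B" using x(1) QB by (auto simp: Wd_def)
    ultimately have "x \<in> \<Sigma>" unfolding \<Sigma>_def by simp
    thus False using x Q\<Sigma> by (auto simp: Wd_def)
  qed
  \<comment> \<open>Off the sphere the open set Y and the closed set Yc coincide, so a connected set
    that avoids the sphere and meets Y lies in Y.\<close>
  have clopen: "T \<subseteq> Y" if T: "connected T" "T \<inter> Y \<noteq> {}" "\<And>y. y \<in> T ==> norm (y - c) \<noteq> t" for T
  proof -
    have "T \<subseteq> Y \<union> - Yc" using Yc_sub T(3) by blast
    moreover have "Y \<inter> - Yc \<inter> T = {}" using YYc by blast
    ultimately have "- Yc \<inter> T = {}" using connectedD[OF T(1) oY oYc] T(2) by blast
    thus ?thesis using \<open>T \<subseteq> Y \<union> - Yc\<close> by blast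
  qed
  \<comment> \<open>By injectivity only one point can have the value \<open>Infty\<close>, and a
    nonempty open set is infinite.\<close>
  have "\<exists>x\<in>Q. \<phi> x \<noteq> Infty"
  proof (rule ccontr)
    assume all: "\<not> ?thesis"
    obtain x where x: "x \<in> Q" using Qne by blast
    have "Q \<subseteq> {x}" using all x inj_onD[OF \<phi>(2)] QB by (metis insertI1 subsetD subsetI)
    hence "finite Q" using finite_subset by blast
    thus False using oQ Qne finite_imp_not_open by blast
  qed
  then obtain y where y: "y \<in> Y" by (auto simp: Y_def Wd_def)
  consider "norm (y - c) < t" | "norm (y - c) > t" using Y_sphere[OF y] by linarith
  thus False
  proof cases
    case 1
    have "ball c t \<subseteq> Y" by (rule clopen) (use 1 y in \<open>auto simp: dist_norm norm_minus_commute\<close>)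
    hence "c \<in> Yc" using YYc t by (auto simp: subset_iff)
    thus False using c clB by (auto simp: Yc_def)
  next
    case 2
    have "connected (- cball c t)" by (rule connected_complement_bounded_convex) (auto simp: dim)
    moreover have "y \<in> - cball c t \<inter> Y" using 2 y by (simp add: dist_norm norm_minus_commute)
    ultimately have "- cball c t \<subseteq> Y" by (intro clopen) (auto simp: dist_norm norm_minus_commute)
    hence ext: "Fin ` (- cball c t) \<subseteq> \<phi> ` closure Q" using YYc by (auto simp: Yc_def subset_iff)
    show False
    proof (cases q)
      case (Fin q')
      hence "norm (q' - c) > t" using q(2) by simp
      hence "q \<in> Fin ` (- cball c t)" using Fin by (auto simp: dist_norm norm_minus_commute)
      thus False using ext q(1) clB by blast
    next
      case Infty
      \<comment> \<open>\<open>Infty\<close> is not in the exterior itself but in its closure, and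
        the image of the compact closure of Q is closed.\<close>
      have "\<not> bounded (- cball c t)" using cobounded_imp_unbounded[of "- cball c t"] by simp
      hence "Infty \<in> closure (Fin ` (- cball c t))" by (rule Infty_in_closure)
      also have "... \<subseteq> \<phi> ` closure Q" using ext cl\<phi> by (rule closure_minimal)
      finally show False using Infty q(1) clB by blast
    qed
  qed
qed

text \<open>By the triangle inequality one of the points has chordal distance at least s / 2 from
  \<open>Infty\<close>, so it is finite with norm at most 2 / s. Euclidean distances are no smaller
  than chordal ones, which keeps the other point away.\<close>

lemma far_points_normalise:
  fixes p q :: "'a::real_inner cpt"
  assumes "dist p q \<ge> s" "s > 0"
  obtains c r where "{p, q} = {Fin c, r}" "norm c \<le> 2 / s" "r = Infty \<or> norm (the_fin r - c) \<ge> s"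
proof -
  have key: "\<exists>c. p = Fin c \<and> norm c \<le> 2 / s \<and> (q = Infty \<or> norm (the_fin q - c) \<ge> s)"
    if pq: "dist p q \<ge> s" "dist p Infty \<ge> s / 2" for p q :: "'a cpt"
  proof (cases p)
    case (Fin c)
    have "s / 2 \<le> 1 / sqrt (1 + (norm c)\<^sup>2)" using pq(2) Fin by (simp add: dist_cpt_def)
    moreover have "sqrt (1 + (norm c)\<^sup>2) > 0" using one_plus_norm_pos[of c] by simp
    ultimately have "sqrt (1 + (norm c)\<^sup>2) \<le> 2 / s" using assms(2) by (simp add: field_simps)
    moreover have "norm c \<le> sqrt (1 + (norm c)\<^sup>2)" by (rule real_le_rsqrt) simp
    ultimately have "norm c \<le> 2 / s" by linarith
    moreover have "q = Infty \<or> norm (the_fin q - c) \<ge> s"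
    proof (cases q)
      case (Fin y)
      have "dist p q \<le> norm (c - y)" unfolding Fin \<open>p = Fin c\<close> by (rule dist_Fin_le)
      thus ?thesis using pq(1) Fin by (simp add: norm_minus_commute)
    qed simp
    ultimately show ?thesis using Fin by blast
  next
    case Infty
    thus ?thesis using pq(2) assms(2) by simp
  qed
  have "dist p q \<le> dist p Infty + dist q Infty" by (rule dist_triangle2)
  hence "dist p Infty \<ge> s / 2 \<or> dist q Infty \<ge> s / 2" using assms(1) by linarith
  thus thesis
  proof
    assume "dist p Infty \<ge> s / 2"
    from key[OF assms(1) this] obtain c where c: "p = Fin c" "norm c \<le> 2 / s" "q = Infty \<or> norm (the_fin q - c) \<ge> s" by blast
    show thesis by (rule that[of c q]) (use c in auto)
  next
    assume "dist q Infty \<ge> s / 2"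
    from key[OF _ this, of p] assms(1) obtain c where c: "q = Fin c" "norm c \<le> 2 / s" "p = Infty \<or> norm (the_fin p - c) \<ge> s" by (auto simp: dist_commute)
    show thesis by (rule that[of c p]) (use c in auto)
  qed
qed

section \<open>The divergence conditions\<close>

lemma ennreal_one_divide_antimono: "x \<le> y ==> 1 / y \<le> 1 / (x :: ennreal)"
proof (cases x rule: ennreal_cases; cases y rule: ennreal_cases)
  fix r t assume *: "x \<le> y" "0 \<le> r" "x = ennreal r" "0 \<le> t" "y = ennreal t"
  show ?thesis
  proof (cases "r = 0")
    case False
    hence "0 < r" "r \<le> t" using * by auto
    thus ?thesis using * by (auto simp: divide_ennreal_def inverse_ennreal intro!: ennreal_leI le_imp_inverse_le)
  qed (use * in \<open>simp add: divide_ennreal_def\<close>)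
qed (auto simp: divide_ennreal_def top_unique)

lemma ennreal_log_ge_iff: "ereal \<eta> \<le> ennreal_log x \<longleftrightarrow> ennreal (exp \<eta>) \<le> x"
proof (cases x rule: ennreal_cases)
  case (real r)
  show ?thesis
  proof (cases "r = 0")
    case False
    hence "r > 0" using real by simp
    thus ?thesis using real by (simp add: ennreal_log_def ln_ge_iff)
  qed (use real in \<open>auto simp: ennreal_log_def not_le ennreal_eq_0_iff\<close>)
qed (simp add: ennreal_log_def)

lemma ennreal_log_less_iff: "ennreal_log x < ereal \<eta> \<longleftrightarrow> x < ennreal (exp \<eta>)"
  using ennreal_log_ge_iff[of \<eta> x] by (simp add: not_le[symmetric])

lemma mono_ennreal_log: "mono ennreal_log"
proof (rule monoI)
  fix x y :: ennreal assume "x \<le> y"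
  thus "ennreal_log x \<le> ennreal_log y"
    by (cases x rule: ennreal_cases; cases y rule: ennreal_cases)
       (auto simp: ennreal_log_def top_unique)
qed

lemma ennreal_pow_mono: "0 < p ==> s \<le> t ==> ennreal_pow s p \<le> ennreal_pow t p"
  by (cases s rule: ennreal_cases; cases t rule: ennreal_cases)
     (auto simp: ennreal_pow_def top_unique intro!: ennreal_leI powr_mono2)

text \<open>For monotone F the right limit is an infimum, from which a witness can be extracted. The
  filter has to be shown nontrivial, since limits would otherwise not be unique and
  \<open>Lim\<close> not determined.\<close>

lemma tendsto_right_limit_0:
  fixes F :: "ennreal => 'b::{complete_linorder, linorder_topology}"
  assumes "mono F"
  shows "right_limit_0 F = (INF t\<in>{0<..}. F t)"
proof -
  have nb: "at_right (0::ennreal) \<noteq> bot"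
  proof
    assume "at_right (0::ennreal) = bot"
    hence "eventually (\<lambda>_. False) (at_right (0::ennreal))" by simp
    then obtain b where "b > (0::ennreal)" "\<And>y. y > 0 ==> y < b ==> False"
      using eventually_at_right[of 0 "1::ennreal"] by auto
    thus False using dense by blast
  qed
  have "(F \<longlongrightarrow> (INF t\<in>{0<..}. F t)) (at_right 0)"
  proof (rule order_tendstoI)
    fix a assume a: "a < (INF t\<in>{0<..}. F t)"
    have "\<forall>\<^sub>F x in at_right (0::ennreal). 0 < x"
      using eventually_at_right[of 0 "1::ennreal"] by (auto intro!: exI[of _ 1])
    thus "\<forall>\<^sub>F x in at_right 0. a < F x"
      by eventually_elim (use a in \<open>auto intro: less_le_trans INF_lower\<close>)
  next
    fix a assume "(INF t\<in>{0<..}. F t) < a"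
    then obtain t where t: "t > 0" "F t < a" by (auto simp: INF_less_iff)
    have "\<forall>\<^sub>F x in at_right (0::ennreal). x < t"
      using eventually_at_right[of 0 t] t(1) by blast
    thus "\<forall>\<^sub>F x in at_right 0. F x < a"
    proof eventually_elim
      case (elim x)
      hence "F x \<le> F t" by (intro monoD[OF assms]) simp
      thus ?case using t(2) by (rule le_less_trans)
    qed
  qed
  thus ?thesis unfolding right_limit_0_def by (rule tendsto_Lim[OF nb])
qed

lemma right_limit_0_lessD:
  fixes F :: "ennreal => 'b::{complete_linorder, linorder_topology}"
  assumes "mono F" "right_limit_0 F < d"
  obtains t where "t > 0" "F (ennreal t) < d"
proof -
  obtain s where s: "s > 0" "F s < d"
    using assms(2) unfolding tendsto_right_limit_0[OF assms(1)] by (auto simp: INF_less_iff)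
  have "min s 1 > 0" "min s 1 \<noteq> \<infinity>" using s by (auto simp: min_def top_unique)
  then obtain t where t: "min s 1 = ennreal t" "t > 0"
    by (cases "min s 1" rule: ennreal_cases) auto
  have "F (ennreal t) \<le> F s" unfolding t(1)[symmetric] using assms(1) by (simp add: monoD)
  thus ?thesis using that[OF t(2)] s(2) by simp
qed

section \<open>From the integral conditions to a divergent series of weights\<close>

context
  fixes \<Phi> :: "ennreal => ennreal" and p :: real and n :: nat
  assumes mono: "mono \<Phi>" and convex: "convex_ennreal \<Phi>" and p: "0 < p" "p \<le> real n - 1" and n: "n \<ge> 2"
begin

private lemma mono_Phi_p: "mono (Phi_p \<Phi> p)"
  by (intro monoI) (auto simp: Phi_p_def intro!: monoD[OF mono] ennreal_pow_mono p)

private lemma mono_H_p: "mono (H_p \<Phi> p)"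
  by (intro monoI) (auto simp: H_p_def intro!: monoD[OF mono_ennreal_log] monoD[OF mono_Phi_p])

private definition "G \<eta> = gen_inverse (H_p \<Phi> p) (ereal \<eta>)"

private lemma G_eq: "G \<eta> = gen_inverse (Phi_p \<Phi> p) (ennreal (exp \<eta>))"
  by (simp add: G_def gen_inverse_def H_p_def ennreal_log_ge_iff)

private lemma G_le: "ereal \<eta> \<le> H_p \<Phi> p t ==> G \<eta> \<le> t"
  unfolding G_def gen_inverse_def by (rule Inf_lower) simp

private lemma mono_G: "\<eta> \<le> \<eta>' ==> G \<eta> \<le> G \<eta>'"
  unfolding G_def gen_inverse_def by (intro Inf_superset_mono) (auto intro: order_trans[of "ereal \<eta>" "ereal \<eta>'"])

private lemma G_ge: "H_p \<Phi> p t < ereal \<eta> ==> t \<le> G \<eta>"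
  unfolding G_def gen_inverse_def
proof (rule Inf_greatest)
  fix s assume *: "H_p \<Phi> p t < ereal \<eta>" "s \<in> {t. ereal \<eta> \<le> H_p \<Phi> p t}"
  show "t \<le> s"
  proof (rule ccontr)
    assume "\<not> t \<le> s"
    hence "H_p \<Phi> p s \<le> H_p \<Phi> p t" by (intro monoD[OF mono_H_p]) simp
    thus False using * by (auto dest: order_trans leD)
  qed
qed

private lemma Phi_ge_of_G_less:
  assumes "G \<eta> < t" shows "ennreal (exp \<eta>) \<le> Phi_p \<Phi> p t"
proof -
  obtain s where s: "ereal \<eta> \<le> H_p \<Phi> p s" "s < t"
    using assms unfolding G_def gen_inverse_def by (auto simp: Inf_less_iff)
  hence "ereal \<eta> \<le> H_p \<Phi> p t" using monoD[OF mono_H_p, of s t] by (auto intro: order_trans)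
  thus ?thesis by (simp add: H_p_def ennreal_log_ge_iff)
qed

text \<open>With T of order L^(-p): for K \<le> T the left side is bounded because L \<le> 1 and p
  \<le> n - 1. For K > T the hypothesis on \<open>G\<close> gives \<Phi>(T) \<ge> \<tau>, and
  convexity on [0, K] together with \<Phi>(0) \<le> \<tau> / 2 lets \<Phi> grow at least linearly,
  with \<Phi>(K) \<ge> \<tau> K / (2 T).\<close>

private lemma dilatation_bound:
  fixes L K \<tau> :: real
  assumes L: "0 \<le> L" "L \<le> 1" "L > 0 ==> G (ln \<tau>) \<le> ennreal (1 / L)"
    and \<tau>: "\<tau> > 0" "\<Phi> 0 \<le> ennreal (\<tau> / 2)" and K: "K \<ge> 0"
  shows "ennreal (L ^ (n - 1)) * ennreal K \<le> 4 * (1 + ennreal (1 / \<tau>) * \<Phi> (ennreal K))"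
proof (cases "L = 0")
  case True thus ?thesis using n by (auto simp: power_0_left)
next
  case False
  hence L0: "L > 0" using L by simp
  \<comment> \<open>The factor 2 makes 1 / L strictly less than T^(1/p), as
    \<open>Phi_ge_of_G_less\<close> demands.\<close>
  define T where "T = 2 * L powr (- p)"
  have T: "T > 0" using L0 by (simp add: T_def)
  have LT: "L ^ (n - 1) * T \<le> 2"
  proof -
    have "L ^ (n - 1) * T = 2 * L powr (real (n - 1) - p)"
      using L0 by (simp add: T_def powr_realpow[symmetric] powr_diff powr_minus divide_inverse mult_ac)
    also have "L powr (real (n - 1) - p) \<le> 1" using L L0 p n by (intro powr_le1) auto
    finally show ?thesis by simp
  qed
  show ?thesis
  proof (cases "K \<le> T")
    case True
    have "L ^ (n - 1) * K \<le> L ^ (n - 1) * T" using True L by (intro mult_left_mono) auto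
    also note LT
    finally have "ennreal (L ^ (n - 1) * K) \<le> ennreal 4" by (intro ennreal_leI) auto
    also have "... \<le> 4 * (1 + ennreal (1 / \<tau>) * \<Phi> (ennreal K))"
      using mult_left_mono[of 1 "1 + ennreal (1 / \<tau>) * \<Phi> (ennreal K)" "4 :: ennreal"] by simp
    finally show ?thesis using L K by (simp add: ennreal_mult)
  next
    case False
    hence KT: "K > T" by simp
    have "1 / L < T powr (1 / p)"
    proof -
      have "(L powr (- p)) powr (1 / p) = L powr (- 1)" by (subst powr_powr) (use p in simp)
      hence "1 / L = (L powr (- p)) powr (1 / p)" using L0 by (simp add: powr_minus_divide)
      also have "... < T powr (1 / p)" using L0 p by (intro powr_less_mono2) (auto simp: T_def)
      finally show ?thesis .
    qed
    hence "G (ln \<tau>) < ennreal (T powr (1 / p))"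
      using L(3)[OF L0] L0 by (auto intro!: order_le_less_trans[of _ "ennreal (1 / L)"] ennreal_lessI)
    from Phi_ge_of_G_less[OF this] have "ennreal \<tau> \<le> \<Phi> (ennreal T)"
      using T p \<tau> by (simp add: Phi_p_def ennreal_pow_def powr_powr)
    also have "\<Phi> (ennreal T) = \<Phi> (ennreal (T / K) * ennreal K + ennreal (1 - T / K) * 0)"
      using T KT by (simp add: ennreal_mult[symmetric])
    also have "... \<le> ennreal (T / K) * \<Phi> (ennreal K) + ennreal (1 - T / K) * \<Phi> 0"
      by (rule bspec[OF spec[OF spec[OF convex[unfolded convex_ennreal_def]]]]) (use T KT in auto)
    also have "ennreal (1 - T / K) * \<Phi> 0 \<le> 1 * ennreal (\<tau> / 2)"
      using \<tau> T KT by (intro mult_mono) (auto simp: ennreal_le_1 field_simps)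
    finally have main: "ennreal \<tau> \<le> ennreal (T / K) * \<Phi> (ennreal K) + ennreal (\<tau> / 2)"
      by (simp add: add_left_mono)
    show ?thesis
    proof (cases "\<Phi> (ennreal K)" rule: ennreal_cases)
      case (real v)
      have "ennreal (T / K * v + \<tau> / 2) = ennreal (T / K) * ennreal v + ennreal (\<tau> / 2)"
        using real T KT \<tau> by (subst ennreal_plus, simp_all del: times_divide_eq_left, subst ennreal_mult, simp_all)
      hence "ennreal \<tau> \<le> ennreal (T / K * v + \<tau> / 2)" using main real by simp
      hence "\<tau> \<le> T / K * v + \<tau> / 2" using real T KT \<tau> by (subst (asm) ennreal_le_iff) auto
      hence "K * \<tau> \<le> 2 * T * v" using KT T by (simp add: field_simps)
      hence "K \<le> 2 * T * v / \<tau>" using \<tau> by (simp add: field_simps)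
      hence "L ^ (n - 1) * K \<le> L ^ (n - 1) * (2 * T * v / \<tau>)" using L by (intro mult_left_mono) auto
      also have "... = (L ^ (n - 1) * T) * (2 * v / \<tau>)" by simp
      also have "... \<le> 2 * (2 * v / \<tau>)" using LT real \<tau> by (intro mult_right_mono) auto
      finally have "ennreal (L ^ (n - 1) * K) \<le> ennreal (4 * (1 + 1 / \<tau> * v))" by (intro ennreal_leI) auto
      also have "... = 4 * (1 + ennreal (1 / \<tau>) * \<Phi> (ennreal K))"
      proof -
        have "ennreal (1 / \<tau> * v) = ennreal (1 / \<tau>) * ennreal v" using real \<tau> by (intro ennreal_mult) auto
        moreover have "ennreal (4 * (1 + 1 / \<tau> * v)) = 4 * (1 + ennreal (1 / \<tau> * v))"
          using real \<tau> by (subst ennreal_mult) (simp_all del: times_divide_eq_left)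
        ultimately show ?thesis using real by simp
      qed
      finally show ?thesis using L K by (simp add: ennreal_mult)
    next
      case top
      thus ?thesis using \<tau> by (simp add: ennreal_mult_top)
    qed
  qed
qed

text \<open>Steps of n ln 2 on the logarithmic scale are factors 2^n for \<Phi>, the volume ratio of
  consecutive dyadic cubes.\<close>

private definition "h = real n * ln 2"
private definition "lev j = real j * h"

private lemma h: "h > 0" using n by (simp add: h_def)

private lemma exp_lev: "exp (lev j) = 2 ^ (n * j)"
proof -
  have "exp (lev j) = exp (ln 2) ^ (n * j)" unfolding exp_of_nat_mult[symmetric] by (simp add: lev_def h_def mult_ac)
  thus ?thesis by simp
qed

text \<open>A discrete layer-cake formula: the positive part of x is at most the base level plus h
  for each level that x reaches.\<close>

private lemma level_bound:
  "e2ennreal x \<le> ennreal (lev j0) + (\<Sum>j. ennreal h * (if ereal (lev (j0 + j)) \<le> x then 1 else 0))"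
proof (cases x)
  case (real r)
  show ?thesis
  proof (cases "r \<le> lev j0")
    case True
    thus ?thesis using real by (simp add: add_increasing2 ennreal_leI)
  next
    case False
    define N where "N = nat \<lceil>(r - lev j0) / h\<rceil>"
    have N: "(r - lev j0) / h \<le> real N" unfolding N_def by linarith
    have j: "lev (j0 + j) \<le> r" if "j < N" for j
    proof -
      have "real j < (r - lev j0) / h" using that unfolding N_def by linarith
      hence "real j * h < r - lev j0" using h by (simp add: field_simps)
      thus ?thesis by (simp add: lev_def distrib_right)
    qed
    have "r - lev j0 \<le> real N * h" using N h by (simp add: field_simps)
    hence "ennreal (r - lev j0) \<le> ennreal (real N * h)" by (rule ennreal_leI)
    also have "... = (\<Sum>j<N. ennreal h * (if ereal (lev (j0 + j)) \<le> x then 1 else 0))"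
      using j real h by (simp add: ennreal_mult ennreal_of_nat_eq_real_of_nat)
    also have "... \<le> (\<Sum>j. ennreal h * (if ereal (lev (j0 + j)) \<le> x then 1 else 0))"
      by (rule sum_le_suminf) auto
    finally have "ennreal (lev j0) + ennreal (r - lev j0) \<le> ennreal (lev j0) + (\<Sum>j. ennreal h * (if ereal (lev (j0 + j)) \<le> x then 1 else 0))"
      by (rule add_left_mono)
    also have "ennreal (lev j0) + ennreal (r - lev j0) = ennreal r"
      using False h by (subst ennreal_plus[symmetric]) (auto simp: lev_def)
    finally show ?thesis using real by simp
  qed
next
  case PInf
  have "(\<Sum>j. ennreal h * (if ereal (lev (j0 + j)) \<le> x then 1 else 0)) = (\<Sum>j::nat. ennreal h)"
    using PInf by simp
  also have "... = \<infinity>"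
  proof -
    have "(\<Sum>j::nat. ennreal h) = (\<integral>\<^sup>+j. ennreal h \<partial>count_space (UNIV :: nat set))"
      by (rule nn_integral_count_space_nat[symmetric])
    also have "... = \<infinity>" using h by (simp add: ennreal_mult_top)
    finally show ?thesis .
  qed
  finally show ?thesis by simp
qed (simp add: e2ennreal_neg)

text \<open>The pair cuts off the low levels. From \<open>j0\<close> on, monotonicity keeps
  \<open>G\<close> at least \<open>t1 > 0\<close>, so every \<open>a j\<close> is finite, and
  \<Phi>(0) is at most half of each value 2^(nj), as \<open>dilatation_bound\<close> asks.\<close>

context
  fixes j0 :: nat and t1 :: real
  assumes t1: "t1 > 0" "Phi_p \<Phi> p (ennreal t1) < ennreal (2 ^ (n * j0) / 2)"
begin

private lemma G_pos: "ennreal t1 \<le> G (lev (j0 + j))"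
proof (rule G_ge)
  have "Phi_p \<Phi> p (ennreal t1) < ennreal (2 ^ (n * j0) / 2)" by (rule t1)
  also have "... \<le> ennreal (exp (lev (j0 + j)))"
  proof -
    have "(2::real) ^ (n * j0) / 2 \<le> 2 ^ (n * j0)" by simp
    also have "... \<le> 2 ^ (n * (j0 + j))" by (intro power_increasing) auto
    finally show ?thesis unfolding exp_lev by (rule ennreal_leI)
  qed
  finally show "H_p \<Phi> p (ennreal t1) < ereal (lev (j0 + j))" by (simp add: H_p_def ennreal_log_less_iff)
qed

text \<open>Up to the factor h these are Riemann sums of the integral in (v); all conditions are
  reduced to the divergence of this series.\<close>

private definition "a j = 1 / G (lev (j0 + j))"

text \<open>One estimate for the integrals in (iii) and (iv) and for the dyadic sums from (i) and
  (ii). The level lev j is reached only where X is at least \<open>G\<close> of it, and the weighted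
  measure of that set is at most c times 1 / \<open>G\<close>.\<close>

private lemma level_integral:
  fixes M :: "'x measure" and X w :: "'x => ennreal" and c :: real
  assumes [measurable]: "X \<in> borel_measurable M" "w \<in> borel_measurable M"
    and Xfin: "\<And>x. w x \<noteq> 0 ==> X x < \<infinity>" and c: "c \<ge> 0"
    and w: "(\<integral>\<^sup>+x. w x \<partial>M) < \<infinity>"
    and tail: "\<And>g. g > 0 ==> (\<integral>\<^sup>+x. w x * indicator {x. ennreal g \<le> X x} x \<partial>M) \<le> ennreal (c / g)"
  shows "(\<integral>\<^sup>+x. e2ennreal (H_p \<Phi> p (X x)) * w x \<partial>M) \<le> ennreal (lev j0) * (\<integral>\<^sup>+x. w x \<partial>M) + ennreal (h * c) * (\<Sum>j. a j)"
proof -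
  have "(\<integral>\<^sup>+x. e2ennreal (H_p \<Phi> p (X x)) * w x \<partial>M)
     \<le> (\<integral>\<^sup>+x. ennreal (lev j0) * w x + (\<Sum>j. ennreal h * (w x * indicator {x \<in> space M. G (lev (j0 + j)) \<le> X x} x)) \<partial>M)"
  proof (rule nn_integral_mono)
    fix x assume x: "x \<in> space M"
    have "e2ennreal (H_p \<Phi> p (X x)) * w x \<le> (ennreal (lev j0) + (\<Sum>j. ennreal h * (if ereal (lev (j0 + j)) \<le> H_p \<Phi> p (X x) then 1 else 0))) * w x"
      by (intro mult_right_mono level_bound) auto
    also have "... = ennreal (lev j0) * w x + (\<Sum>j. ennreal h * (w x * (if ereal (lev (j0 + j)) \<le> H_p \<Phi> p (X x) then 1 else 0)))"
      by (simp only: distrib_right ennreal_suminf_multc[symmetric]) (simp only: mult_ac)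
    also have "... \<le> ennreal (lev j0) * w x + (\<Sum>j. ennreal h * (w x * indicator {x \<in> space M. G (lev (j0 + j)) \<le> X x} x))"
      by (intro add_left_mono suminf_le mult_left_mono) (auto simp: indicator_def x dest: G_le)
    finally show "e2ennreal (H_p \<Phi> p (X x)) * w x \<le> ennreal (lev j0) * w x + (\<Sum>j. ennreal h * (w x * indicator {x \<in> space M. G (lev (j0 + j)) \<le> X x} x))" .
  qed
  also have "... = (\<integral>\<^sup>+x. ennreal (lev j0) * w x \<partial>M) + (\<integral>\<^sup>+x. (\<Sum>j. ennreal h * (w x * indicator {x \<in> space M. G (lev (j0 + j)) \<le> X x} x)) \<partial>M)"
    by (rule nn_integral_add) measurable
  also have "(\<integral>\<^sup>+x. ennreal (lev j0) * w x \<partial>M) = ennreal (lev j0) * (\<integral>\<^sup>+x. w x \<partial>M)"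
    by (rule nn_integral_cmult) measurable
  also have "(\<integral>\<^sup>+x. (\<Sum>j. ennreal h * (w x * indicator {x \<in> space M. G (lev (j0 + j)) \<le> X x} x)) \<partial>M)
      = (\<Sum>j. \<integral>\<^sup>+x. ennreal h * (w x * indicator {x \<in> space M. G (lev (j0 + j)) \<le> X x} x) \<partial>M)"
    by (rule nn_integral_suminf) measurable
  also have "... = (\<Sum>j. ennreal h * (\<integral>\<^sup>+x. w x * indicator {x \<in> space M. G (lev (j0 + j)) \<le> X x} x \<partial>M))"
    by (intro suminf_cong nn_integral_cmult) measurable
  also have "ennreal (lev j0) * (\<integral>\<^sup>+x. w x \<partial>M) + (\<Sum>j. ennreal h * (\<integral>\<^sup>+x. w x * indicator {x \<in> space M. G (lev (j0 + j)) \<le> X x} x \<partial>M))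
     \<le> ennreal (lev j0) * (\<integral>\<^sup>+x. w x \<partial>M) + (\<Sum>j. ennreal h * (ennreal c * a j))"
  proof (intro add_left_mono suminf_le mult_left_mono)
    fix j
    show "(\<integral>\<^sup>+x. w x * indicator {x \<in> space M. G (lev (j0 + j)) \<le> X x} x \<partial>M) \<le> ennreal c * a j"
    proof (cases "G (lev (j0 + j))" rule: ennreal_cases)
      case (real g)
      have g: "g > 0" using G_pos[of j] t1 real by (simp add: less_le_trans)
      have "(\<integral>\<^sup>+x. w x * indicator {x \<in> space M. G (lev (j0 + j)) \<le> X x} x \<partial>M) = (\<integral>\<^sup>+x. w x * indicator {x. ennreal g \<le> X x} x \<partial>M)"
        by (intro nn_integral_cong) (auto simp: real indicator_def)
      also have "... \<le> ennreal (c / g)" by (rule tail[OF g])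
      also have "... = ennreal c * a j"
        using g c unfolding a_def real(2) by (simp add: divide_ennreal[symmetric] ennreal_1[symmetric] divide_ennreal_def ennreal_mult[symmetric] inverse_ennreal divide_inverse del: ennreal_1)
      finally show ?thesis .
    next
      case top
      \<comment> \<open>If the level is never reached at a finite argument, the set is empty where w
        is positive.\<close>
      have "(\<integral>\<^sup>+x. w x * indicator {x \<in> space M. G (lev (j0 + j)) \<le> X x} x \<partial>M) = (\<integral>\<^sup>+x. 0 \<partial>M)"
        by (intro nn_integral_cong) (use Xfin in \<open>force simp: top indicator_def top_unique\<close>)
      thus ?thesis by simp
    qed
  qed auto
  also have "(\<Sum>j. ennreal h * (ennreal c * a j)) = ennreal (h * c) * (\<Sum>j. a j)"
    using h c by (simp add: ennreal_mult mult.assoc ennreal_suminf_cmult)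
  finally show ?thesis .
qed

private lemma nn_integral_inverse_square:
  assumes "g > 0"
  shows "(\<integral>\<^sup>+t. ennreal (1 / t\<^sup>2) * indicator {g..} t \<partial>lborel) = ennreal (1 / g)"
proof -
  have "(\<integral>\<^sup>+t. ennreal (1 / t\<^sup>2) * indicator {g..} t \<partial>lborel) = ennreal (0 - (- 1 / g))"
  proof (rule nn_integral_FTC_atLeast[where F = "\<lambda>t. - 1 / t"])
    fix x assume "g \<le> x"
    thus "((\<lambda>t. - 1 / t) has_real_derivative 1 / x\<^sup>2) (at x)"
      using assms by (auto intro!: derivative_eq_intros simp: power2_eq_square field_simps)
  next
    show "((\<lambda>t::real. - 1 / t) \<longlongrightarrow> 0) at_top"
      by (rule tendsto_divide_0[OF tendsto_const filterlim_at_top_imp_at_infinity[OF filterlim_ident]])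
  qed auto
  thus ?thesis by simp
qed

text \<open>The weight t^(-2) has tail exactly 1 / g. Only the positive part of the logarithm
  enters, since \<open>e2ennreal\<close> sends negative values to 0.\<close>

private lemma suminf_from_cond_iii:
  assumes "cond_iii \<Phi> p" shows "(\<Sum>j. a j) = \<infinity>"
proof (rule ccontr)
  assume fin: "(\<Sum>j. a j) \<noteq> \<infinity>"
  obtain \<delta> where d: "\<delta> > 0" "(\<integral>\<^sup>+t\<in>{\<delta><..}. e2ennreal (H_p \<Phi> p (ennreal t) / ereal (t\<^sup>2)) \<partial>lebesgue) = \<infinity>"
    using assms unfolding cond_iii_def integral_eq_PInf_def by blast
  define w where "w t = ennreal (1 / t\<^sup>2) * indicator {\<delta><..} t" for t
  have w: "(\<integral>\<^sup>+t. w t \<partial>lborel) \<le> ennreal (1 / \<delta>)"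
    unfolding w_def nn_integral_inverse_square[OF d(1), symmetric]
    by (intro nn_integral_mono) (auto simp: indicator_def)
  have le: "(\<integral>\<^sup>+t. e2ennreal (H_p \<Phi> p (ennreal t)) * w t \<partial>lborel) \<le> ennreal (lev j0) * (\<integral>\<^sup>+t. w t \<partial>lborel) + ennreal (h * 1) * (\<Sum>j. a j)"
  proof (rule level_integral)
    show "(\<integral>\<^sup>+t. w t \<partial>lborel) < \<infinity>" by (rule order_le_less_trans[OF w]) simp
    fix g :: real assume g: "g > 0"
    show "(\<integral>\<^sup>+t. w t * indicator {t. ennreal g \<le> ennreal t} t \<partial>lborel) \<le> ennreal (1 / g)"
      unfolding nn_integral_inverse_square[OF g, symmetric] w_def
      by (intro nn_integral_mono) (use g d(1) in \<open>auto simp: indicator_def ennreal_le_iff2\<close>)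
  qed (auto simp: w_def)
  have "(\<integral>\<^sup>+t\<in>{\<delta><..}. e2ennreal (H_p \<Phi> p (ennreal t) / ereal (t\<^sup>2)) \<partial>lebesgue) = (\<integral>\<^sup>+t. e2ennreal (H_p \<Phi> p (ennreal t)) * w t \<partial>lborel)"
    unfolding nn_integral_completion
  proof (rule nn_integral_cong)
    fix t :: real
    show "e2ennreal (H_p \<Phi> p (ennreal t) / ereal (t\<^sup>2)) * indicator {\<delta><..} t = e2ennreal (H_p \<Phi> p (ennreal t)) * w t"
    proof (cases "t > \<delta>")
      case True
      hence t: "t > 0" using d(1) by simp
      have "e2ennreal (x / ereal (t\<^sup>2)) = e2ennreal x * ennreal (1 / t\<^sup>2)" for x
      proof (cases x)
        case (real r)
        thus ?thesis using ennreal_mult''[of "1 / t\<^sup>2" r] t by simp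
      qed (use t in \<open>auto simp: ennreal_top_mult e2ennreal_neg\<close>)
      thus ?thesis using True by (simp add: w_def)
    qed (simp add: w_def)
  qed
  hence "\<infinity> \<le> ennreal (lev j0) * (\<integral>\<^sup>+t. w t \<partial>lborel) + ennreal (h * 1) * (\<Sum>j. a j)"
    using le d(2) by simp
  moreover have "(\<integral>\<^sup>+t. w t \<partial>lborel) < top" using order_le_less_trans[OF w ennreal_less_top] by simp
  hence "ennreal (lev j0) * (\<integral>\<^sup>+t. w t \<partial>lborel) + ennreal (h * 1) * (\<Sum>j. a j) < top"
    using fin by (auto simp: ennreal_mult_less_top less_top[symmetric] ennreal_mult_eq_top_iff)
  ultimately show False by (metis infinity_ennreal_def leD)
qed

text \<open>The same argument after t -> 1 / t: the set where 1 / t \<ge> g has length at most 1 /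
  g.\<close>

private lemma suminf_from_cond_iv:
  assumes "cond_iv \<Phi> p" shows "(\<Sum>j. a j) = \<infinity>"
proof (rule ccontr)
  assume fin: "(\<Sum>j. a j) \<noteq> \<infinity>"
  obtain d where d: "d > 0" "(\<integral>\<^sup>+t\<in>{0<..<d}. e2ennreal (H_p \<Phi> p (ennreal (1 / t))) \<partial>lebesgue) = \<infinity>"
    using assms unfolding cond_iv_def integral_eq_PInf_def by blast
  define w where "w t = (indicator {0<..<d} t :: ennreal)" for t :: real
  have w: "(\<integral>\<^sup>+t. w t \<partial>lborel) = ennreal d" using d(1) by (simp add: w_def)
  have le: "(\<integral>\<^sup>+t. e2ennreal (H_p \<Phi> p (ennreal (1 / t))) * w t \<partial>lborel) \<le> ennreal (lev j0) * (\<integral>\<^sup>+t. w t \<partial>lborel) + ennreal (h * 1) * (\<Sum>j. a j)"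
  proof (rule level_integral)
    fix g :: real assume g: "g > 0"
    have "(\<integral>\<^sup>+t. w t * indicator {t. ennreal g \<le> ennreal (1 / t)} t \<partial>lborel) \<le> (\<integral>\<^sup>+t. indicator {0..1 / g} t \<partial>lborel)"
      by (intro nn_integral_mono) (use g in \<open>auto simp: w_def indicator_def ennreal_le_iff2 field_simps split: if_splits\<close>)
    also have "... = ennreal (1 / g)" using g by simp
    finally show "(\<integral>\<^sup>+t. w t * indicator {t. ennreal g \<le> ennreal (1 / t)} t \<partial>lborel) \<le> ennreal (1 / g)" .
  qed (auto simp: w_def w[unfolded w_def])
  hence "\<infinity> \<le> ennreal (lev j0) * ennreal d + ennreal (h * 1) * (\<Sum>j. a j)"
    using d by (simp add: nn_integral_completion w w_def)
  moreover have "ennreal (lev j0) * ennreal d + ennreal (h * 1) * (\<Sum>j. a j) < top"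
    using fin by (auto simp: ennreal_mult_less_top less_top[symmetric] ennreal_mult_eq_top_iff)
  ultimately show False by (metis infinity_ennreal_def leD)
qed

text \<open>All levels are reached at the finite point T, so the terms are bounded below by 1 / T >
  0.\<close>

private lemma suminf_from_eventually_infinite:
  assumes "eventually_infinite (Phi_p \<Phi> p)" shows "(\<Sum>j. a j) = \<infinity>"
proof -
  obtain T where T: "T < \<infinity>" "\<And>t. t \<ge> T ==> Phi_p \<Phi> p t = \<infinity>" using assms unfolding eventually_infinite_def by blast
  have "G \<eta> \<le> T" for \<eta> by (rule G_le) (simp add: H_p_def T ennreal_log_def)
  hence "1 / T \<le> a j" for j unfolding a_def by (intro ennreal_one_divide_antimono) auto
  hence "(\<Sum>j::nat. 1 / T) \<le> (\<Sum>j. a j)" by (intro suminf_le) auto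
  moreover have "(\<Sum>j::nat. 1 / T) = \<infinity>"
  proof -
    have "(\<Sum>j::nat. 1 / T) = (\<integral>\<^sup>+j. 1 / T \<partial>count_space (UNIV :: nat set))"
      by (rule nn_integral_count_space_nat[symmetric])
    also have "... = \<infinity>" using T(1) by (auto simp: ennreal_mult_top ennreal_divide_eq_0_iff)
    finally show ?thesis .
  qed
  ultimately show ?thesis by (simp add: top_unique)
qed

text \<open>An upper sum over the intervals between consecutive nodes. The nodes are the levels
  themselves for (v) and their exponentials for (vi); the part before the first node is
  finite.\<close>

private lemma dyadic_integral:
  fixes f :: "real => ennreal" and b :: "nat => real" and C :: real
  assumes b: "mono b" "filterlim b at_top sequentially" and B: "B < \<infinity>" "\<And>x. \<delta> < x ==> x < b 0 ==> f x \<le> B"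
    and c: "\<And>j x. b j \<le> x ==> x < b (Suc j) ==> f x \<le> c j" "\<And>j. c j * ennreal (b (Suc j) - b j) \<le> ennreal C * a j"
    and inf: "(\<integral>\<^sup>+x\<in>{\<delta><..}. f x \<partial>lebesgue) = \<infinity>"
  shows "(\<Sum>j. a j) = \<infinity>"
proof (rule ccontr)
  assume fin: "(\<Sum>j. a j) \<noteq> \<infinity>"
  have "(\<integral>\<^sup>+x\<in>{\<delta><..}. f x \<partial>lebesgue) \<le> (\<integral>\<^sup>+x. B * indicator {\<delta>..b 0} x + (\<Sum>j. c j * indicator {b j..<b (Suc j)} x) \<partial>lborel)"
    unfolding nn_integral_completion
  proof (rule nn_integral_mono)
    fix x :: real
    show "f x * indicator {\<delta><..} x \<le> B * indicator {\<delta>..b 0} x + (\<Sum>j. c j * indicator {b j..<b (Suc j)} x)"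
    proof (cases "\<delta> < x")
      case True
      show ?thesis
      proof (cases "x < b 0")
        case True': True
        thus ?thesis using True B(2) by (auto simp: add_increasing2)
      next
        case False
        obtain N where N: "\<And>k. k \<ge> N ==> x < b k"
          using b(2) unfolding filterlim_at_top_dense eventually_sequentially by blast
        define k where "k = (LEAST k. x < b k)"
        have k: "x < b k" unfolding k_def by (rule LeastI[of _ N]) (simp add: N)
        have "k \<noteq> 0" using False k by metis
        then obtain j where j: "k = Suc j" by (cases k) auto
        have "\<not> x < b j" using not_less_Least[of j "\<lambda>k. x < b k"] j by (simp add: k_def)
        define q where "q i = c i * indicator {b i..<b (Suc i)} x" for i
        have "f x \<le> q j" using k j c(1)[of j x] \<open>\<not> x < b j\<close> by (simp add: q_def)
        also have "... = (\<Sum>i\<in>{j}. q i)" by simp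
        also have "... \<le> (\<Sum>j. q j)" by (rule sum_le_suminf) auto
        also have "... = (\<Sum>j. c j * indicator {b j..<b (Suc j)} x)" by (simp only: q_def)
        finally show ?thesis using True by (simp add: add_increasing)
      qed
    qed simp
  qed
  also have "... = B * emeasure lborel {\<delta>..b 0} + (\<Sum>j. c j * emeasure lborel {b j..<b (Suc j)})"
    by (simp add: nn_integral_add nn_integral_suminf nn_integral_cmult_indicator)
  also have "... \<le> B * emeasure lborel {\<delta>..b 0} + (\<Sum>j. ennreal C * a j)"
    using c(2) monoD[OF b(1)] by (intro add_left_mono suminf_le) auto
  also have "... < top"
    using fin B(1) by (auto simp: ennreal_suminf_cmult ennreal_mult_less_top less_top[symmetric] ennreal_mult_eq_top_iff emeasure_lborel_Icc_eq)
  finally show False using inf by simp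
qed

private lemma G_pos_of_less: "H_p \<Phi> p (ennreal t) < ereal \<eta> ==> t > 0 ==> 1 / G \<eta> < \<infinity>"
  using G_ge[of "ennreal t" \<eta>] by (auto simp: ennreal_divide_eq_top_iff less_top[symmetric] ennreal_mult_eq_top_iff top_unique)

private lemma filterlim_lev: "filterlim (\<lambda>j. lev (j0 + j)) at_top sequentially"
proof -
  have "filterlim (\<lambda>j. h * real (j + j0)) at_top sequentially"
    by (rule filterlim_tendsto_pos_mult_at_top[OF tendsto_const h])
       (rule filterlim_compose[OF filterlim_real_sequentially filterlim_add_const_nat_at_top])
  thus ?thesis by (simp add: lev_def mult_ac add_ac)
qed

private lemma suminf_from_cond_v:
  assumes "cond_v \<Phi> p" shows "(\<Sum>j. a j) = \<infinity>"
proof -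
  obtain \<delta> where d: "ereal \<delta> > right_limit_0 (H_p \<Phi> p)" "(\<integral>\<^sup>+\<eta>\<in>{\<delta><..}. 1 / G \<eta> \<partial>lebesgue) = \<infinity>"
    using assms unfolding cond_v_def G_def by blast
  obtain t where t: "t > 0" "H_p \<Phi> p (ennreal t) < ereal \<delta>" by (rule right_limit_0_lessD[OF mono_H_p d(1)])
  show ?thesis
  proof (rule dyadic_integral[OF _ filterlim_lev G_pos_of_less[OF t(2,1)] _ _ _ d(2)])
    show "mono (\<lambda>j. lev (j0 + j))" using h by (auto simp: mono_def lev_def)
    show "1 / G x \<le> 1 / G \<delta>" if "\<delta> < x" for x using that by (intro ennreal_one_divide_antimono mono_G) auto
    show "1 / G x \<le> a j" if "lev (j0 + j) \<le> x" for j x using that unfolding a_def by (intro ennreal_one_divide_antimono mono_G)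
    show "a j * ennreal (lev (j0 + Suc j) - lev (j0 + j)) \<le> ennreal h * a j" for j
      by (simp add: lev_def algebra_simps mult.commute)
  qed
qed

text \<open>The substitution \<tau> = exp \<eta> done on the discrete level: an interval from 2^(nj)
  to 2^(n(j+1)) times 1 / 2^(nj) costs only the constant 2^n - 1. The limit in the condition is that
  of \<Phi>, so a point t for \<Phi> becomes t^(1/p) for \<open>Phi_p\<close>.\<close>

private lemma suminf_from_cond_vi:
  assumes "cond_vi \<Phi> p" shows "(\<Sum>j. a j) = \<infinity>"
proof -
  obtain \<delta> where d: "\<delta> \<ge> 0" "ennreal \<delta> > right_limit_0 \<Phi>" "(\<integral>\<^sup>+\<tau>\<in>{\<delta><..}. 1 / (ennreal \<tau> * gen_inverse (Phi_p \<Phi> p) (ennreal \<tau>)) \<partial>lebesgue) = \<infinity>"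
    using assms unfolding cond_vi_def by blast
  have d0: "\<delta> > 0" using d(2) by (metis ennreal_less_zero_iff gr_zeroI not_less_zero)
  obtain t where t: "t > 0" "\<Phi> (ennreal t) < ennreal \<delta>" by (rule right_limit_0_lessD[OF mono d(2)])
  have "Phi_p \<Phi> p (ennreal (t powr (1 / p))) < ennreal \<delta>"
    using t p by (simp add: Phi_p_def ennreal_pow_def powr_powr)
  hence "H_p \<Phi> p (ennreal (t powr (1 / p))) < ereal (ln \<delta>)"
    using d0 by (simp add: H_p_def ennreal_log_less_iff)
  hence fin: "1 / G (ln \<delta>) < \<infinity>" by (rule G_pos_of_less) (use t in simp)
  have Geq: "gen_inverse (Phi_p \<Phi> p) (ennreal \<tau>) = G (ln \<tau>)" if "\<tau> > 0" for \<tau> using that by (simp add: G_eq)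
  have quot: "1 / (ennreal \<tau> * gen_inverse (Phi_p \<Phi> p) (ennreal \<tau>)) \<le> ennreal (1 / \<sigma>) * (1 / G (ln \<sigma>))" if "0 < \<sigma>" "\<sigma> \<le> \<tau>" for \<sigma> \<tau>
  proof -
    have g: "G (ln \<sigma>) \<le> G (ln \<tau>)" using that by (intro mono_G) simp
    have e: "ennreal (1 / \<sigma>) * (1 / G (ln \<sigma>)) = 1 / (ennreal \<sigma> * G (ln \<sigma>))"
    proof (cases "G (ln \<sigma>)" rule: ennreal_cases)
      case (real r)
      show ?thesis
      proof (cases "r = 0")
        case True
        thus ?thesis using real that by (simp add: divide_ennreal_def ennreal_mult_top)
      next
        case False
        thus ?thesis using real that
          by (simp add: ennreal_mult[symmetric] divide_ennreal_def inverse_ennreal divide_inverse)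
      qed
    qed (use that in \<open>simp add: divide_ennreal_def ennreal_mult_top\<close>)
    show ?thesis unfolding e using that Geq[of \<tau>] g by (auto intro!: ennreal_one_divide_antimono mult_mono ennreal_leI)
  qed
  show ?thesis
  proof (rule dyadic_integral[OF _ _ _ _ _ _ d(3)])
    show "mono (\<lambda>j. (2::real) ^ (n * (j0 + j)))" by (auto simp: mono_def intro!: power_increasing)
    show "filterlim (\<lambda>j. (2::real) ^ (n * (j0 + j))) at_top sequentially"
    proof -
      have "filterlim (\<lambda>j. exp (lev (j0 + j))) at_top sequentially" by (rule filterlim_compose[OF exp_at_top filterlim_lev])
      thus ?thesis by (simp add: exp_lev)
    qed
    show "ennreal (1 / \<delta>) * (1 / G (ln \<delta>)) < \<infinity>" using fin by (auto simp: ennreal_mult_less_top)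
    show "1 / (ennreal \<tau> * gen_inverse (Phi_p \<Phi> p) (ennreal \<tau>)) \<le> ennreal (1 / \<delta>) * (1 / G (ln \<delta>))" if "\<delta> < \<tau>" for \<tau>
      using that d0 by (intro quot) auto
    have ln2: "ln ((2::real) ^ (n * (j0 + j))) = lev (j0 + j)" for j by (simp add: ln_realpow lev_def h_def)
    show "1 / (ennreal \<tau> * gen_inverse (Phi_p \<Phi> p) (ennreal \<tau>)) \<le> ennreal (1 / 2 ^ (n * (j0 + j))) * a j" if "2 ^ (n * (j0 + j)) \<le> \<tau>" for j \<tau>
      using quot[of "2 ^ (n * (j0 + j))" \<tau>] that by (simp only: ln2 a_def) simp
    show "ennreal (1 / 2 ^ (n * (j0 + j))) * a j * ennreal (2 ^ (n * (j0 + Suc j)) - 2 ^ (n * (j0 + j))) \<le> ennreal (2 ^ n) * a j" for j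
    proof -
      have "(1 / 2 ^ (n * (j0 + j))) * ((2::real) ^ (n * (j0 + Suc j)) - 2 ^ (n * (j0 + j))) = 2 ^ n - 1"
        by (simp add: power_add field_simps)
      hence "ennreal (1 / 2 ^ (n * (j0 + j))) * ennreal (2 ^ (n * (j0 + Suc j)) - 2 ^ (n * (j0 + j))) = ennreal (2 ^ n - 1)"
        by (subst ennreal_mult'[symmetric]) auto
      moreover have "ennreal (2 ^ n - 1) \<le> ennreal (2 ^ n)" by (intro ennreal_leI) simp
      ultimately show ?thesis by (metis mult.assoc mult.commute mult_right_mono zero_le)
    qed
  qed
qed

text \<open>A geometric tail whose first term is at most 4 / g. Bounding the terms by increments of
  a truncated 1 / y makes the sum telescope without locating the first index.\<close>

private lemma dyadic_tail:
  fixes \<delta> g :: real assumes "\<delta> > 0" "g > 0"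
  shows "(\<Sum>i. ennreal (1 / (2 ^ i * \<delta>)) * indicator {i. g \<le> 4 * (2 ^ i * \<delta>)} i) \<le> ennreal (8 / g)"
proof -
  define x where "x i = 2 ^ i * \<delta>" for i :: nat
  have x: "x i > 0" "x (Suc i) = 2 * x i" for i using assms by (auto simp: x_def)
  define \<psi> where "\<psi> y = min (4 / g) (1 / y)" for y :: real
  have step: "1 / x i * indicator {i. g \<le> 4 * x i} i \<le> 2 * (\<psi> (x i) - \<psi> (x (Suc i)))" for i
  proof (cases "g \<le> 4 * x i")
    case True
    hence "1 / x i \<le> 4 / g" "1 / (2 * x i) \<le> 4 / g" using x(1)[of i] assms by (auto simp: field_simps)
    thus ?thesis using True by (simp add: \<psi>_def x(2) min_def)
  next
    case False
    have "1 / (2 * x i) \<le> 1 / x i" using x(1)[of i] by (simp add: field_simps)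
    thus ?thesis using False by (simp add: \<psi>_def x(2) min_def)
  qed
  have part: "(\<Sum>i<N. 1 / x i * indicator {i. g \<le> 4 * x i} i) \<le> 8 / g" for N
  proof -
    have "(\<Sum>i<N. 1 / x i * indicator {i. g \<le> 4 * x i} i) \<le> (\<Sum>i<N. 2 * (\<psi> (x i) - \<psi> (x (Suc i))))"
      by (intro sum_mono step)
    also have "... = 2 * (\<psi> (x 0) - \<psi> (x N))"
      by (simp only: sum_distrib_left[symmetric] sum_lessThan_telescope'[of "\<lambda>i. \<psi> (x i)" N])
    also have "... \<le> 8 / g"
    proof -
      have "\<psi> (x 0) \<le> 4 / g" by (simp add: \<psi>_def)
      moreover have "\<psi> (x N) \<ge> 0" using assms x(1)[of N] by (simp add: \<psi>_def)
      ultimately show ?thesis by simp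
    qed
    finally show ?thesis .
  qed
  have "(\<Sum>i. ennreal (1 / x i * indicator {i. g \<le> 4 * x i} i)) \<le> ennreal (8 / g)"
    unfolding suminf_eq_SUP
  proof (rule SUP_least)
    fix N :: nat
    have "(\<Sum>i<N. ennreal (1 / x i * indicator {i. g \<le> 4 * x i} i)) = ennreal (\<Sum>i<N. 1 / x i * indicator {i. g \<le> 4 * x i} i)"
      by (rule sum_ennreal) (use x(1) in \<open>auto simp: less_imp_le\<close>)
    also have "... \<le> ennreal (8 / g)" by (rule ennreal_leI[OF part])
    finally show "(\<Sum>i<N. ennreal (1 / x i * indicator {i. g \<le> 4 * x i} i)) \<le> ennreal (8 / g)" .
  qed
  also have "(\<Sum>i. ennreal (1 / x i * indicator {i. g \<le> 4 * x i} i)) = (\<Sum>i. ennreal (1 / (2 ^ i * \<delta>)) * indicator {i. g \<le> 4 * (2 ^ i * \<delta>)} i)"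
    by (intro suminf_cong) (auto simp: x_def indicator_def)
  finally show ?thesis .
qed

text \<open>The common target of (i) and (ii). Increments over a dyadic interval are replaced by the
  increment from \<delta>; because of the geometric weights this costs no more than
  \<open>level_integral\<close> allows. The factor 4 leaves room for the doubled right end in the
  proof for (i).\<close>

private lemma suminf_from_dyadic:
  fixes \<delta> :: real
  assumes d: "\<delta> > 0" "ennreal \<delta> > t_zero \<Phi> p" and ni: "\<not> eventually_infinite (Phi_p \<Phi> p)"
    and inf: "(\<Sum>i. ennreal ((H_p_real \<Phi> p (4 * (2 ^ i * \<delta>)) - H_p_real \<Phi> p \<delta>) / (2 ^ i * \<delta>))) = \<infinity>"
  shows "(\<Sum>j. a j) = \<infinity>"
proof (rule ccontr)
  assume fin: "(\<Sum>j. a j) \<noteq> \<infinity>"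
  have H: "H_p \<Phi> p (ennreal t) = ereal (H_p_real \<Phi> p t)" if "t \<ge> \<delta>" for t
  proof -
    have "Phi_p \<Phi> p (ennreal t) \<noteq> \<infinity>"
    proof
      assume "Phi_p \<Phi> p (ennreal t) = \<infinity>"
      hence "\<forall>s\<ge>ennreal t. Phi_p \<Phi> p s = \<infinity>"
        using monoD[OF mono_Phi_p] by (metis infinity_ennreal_def top_unique)
      thus False using ni unfolding eventually_infinite_def by (metis ennreal_less_top infinity_ennreal_def)
    qed
    moreover have "Phi_p \<Phi> p (ennreal t) \<noteq> 0"
    proof
      assume "Phi_p \<Phi> p (ennreal t) = 0"
      hence "ennreal t \<le> t_zero \<Phi> p" unfolding t_zero_def by (intro Sup_upper) simp
      moreover have "ennreal \<delta> \<le> ennreal t" using that by (rule ennreal_leI)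
      ultimately show False using d(2) by (meson leD order_trans)
    qed
    ultimately show ?thesis by (simp add: H_p_real_def H_p_def ennreal_log_def)
  qed
  define w where "w i = ennreal (1 / (2 ^ i * \<delta>))" for i :: nat
  define X where "X i = ennreal (4 * (2 ^ i * \<delta>))" for i :: nat
  have wsum: "(\<Sum>i. w i) \<le> ennreal (8 / (4 * \<delta>))"
  proof -
    have mem: "i \<in> {i. 4 * \<delta> \<le> 4 * (2 ^ i * \<delta>)}" for i :: nat
      using mult_right_mono[of 1 "2 ^ i" \<delta>] d(1) by simp
    have "(\<Sum>i. w i) = (\<Sum>i. ennreal (1 / (2 ^ i * \<delta>)) * indicator {i. 4 * \<delta> \<le> 4 * (2 ^ i * \<delta>)} i)"
      by (rule suminf_cong) (simp only: w_def indicator_simps(1)[OF mem] mult.right_neutral)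
    also have "... \<le> ennreal (8 / (4 * \<delta>))" by (rule dyadic_tail) (use d(1) in auto)
    finally show ?thesis .
  qed
  have "(\<integral>\<^sup>+i. e2ennreal (H_p \<Phi> p (X i)) * w i \<partial>count_space UNIV) \<le> ennreal (lev j0) * (\<integral>\<^sup>+i. w i \<partial>count_space UNIV) + ennreal (h * 8) * (\<Sum>j. a j)"
  proof (rule level_integral)
    show "(\<integral>\<^sup>+i. w i \<partial>count_space UNIV) < \<infinity>"
      unfolding nn_integral_count_space_nat by (rule order_le_less_trans[OF wsum]) simp
    show "(\<integral>\<^sup>+i. w i * indicator {i. ennreal g \<le> X i} i \<partial>count_space UNIV) \<le> ennreal (8 / g)" if "g > 0" for g
    proof -
      have "{i. ennreal g \<le> X i} = {i. g \<le> 4 * (2 ^ i * \<delta>)}"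
        using that d(1) by (auto simp: X_def ennreal_le_iff2)
      thus ?thesis unfolding nn_integral_count_space_nat using dyadic_tail[OF d(1) that] by (simp only: w_def)
    qed
  qed (auto simp: X_def)
  hence le: "(\<Sum>i. e2ennreal (H_p \<Phi> p (X i)) * w i) \<le> ennreal (lev j0) * (\<Sum>i. w i) + ennreal (h * 8) * (\<Sum>j. a j)"
    unfolding nn_integral_count_space_nat .
  have "(\<Sum>i. ennreal ((H_p_real \<Phi> p (4 * (2 ^ i * \<delta>)) - H_p_real \<Phi> p \<delta>) / (2 ^ i * \<delta>)))
      \<le> (\<Sum>i. e2ennreal (H_p \<Phi> p (X i)) * w i + ennreal \<bar>H_p_real \<Phi> p \<delta>\<bar> * w i)"
  proof (intro suminf_le)
    fix i :: nat
    define x where "x = 2 ^ i * \<delta>"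
    have x: "x \<ge> \<delta>" "x > 0" using d(1) by (auto simp: x_def)
    define r where "r = H_p_real \<Phi> p (4 * x)"
    have "ennreal ((r - H_p_real \<Phi> p \<delta>) / x) \<le> ennreal ((max 0 r + \<bar>H_p_real \<Phi> p \<delta>\<bar>) * (1 / x))"
      using x by (intro ennreal_leI) (auto simp: divide_right_mono)
    also have "... = (ennreal (max 0 r) + ennreal \<bar>H_p_real \<Phi> p \<delta>\<bar>) * ennreal (1 / x)"
      using x by (subst ennreal_mult) auto
    also have "ennreal (max 0 r) = e2ennreal (H_p \<Phi> p (X i))"
    proof -
      have "H_p \<Phi> p (X i) = ereal r" using H[of "4 * x"] x by (simp add: X_def x_def r_def)
      thus ?thesis by (simp add: ennreal_max_0)
    qed
    finally show "ennreal ((H_p_real \<Phi> p (4 * (2 ^ i * \<delta>)) - H_p_real \<Phi> p \<delta>) / (2 ^ i * \<delta>)) \<le> e2ennreal (H_p \<Phi> p (X i)) * w i + ennreal \<bar>H_p_real \<Phi> p \<delta>\<bar> * w i"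
      by (simp add: r_def x_def w_def distrib_right)
  qed auto
  also have "... = (\<Sum>i. e2ennreal (H_p \<Phi> p (X i)) * w i) + ennreal \<bar>H_p_real \<Phi> p \<delta>\<bar> * (\<Sum>i. w i)"
    by (simp add: suminf_add[symmetric] ennreal_suminf_cmult)
  also have "... \<le> (ennreal (lev j0) * (\<Sum>i. w i) + ennreal (h * 8) * (\<Sum>j. a j)) + ennreal \<bar>H_p_real \<Phi> p \<delta>\<bar> * (\<Sum>i. w i)"
    by (intro add_right_mono le)
  also have "... < top"
  proof -
    have "(\<Sum>i. w i) < top" using wsum by (rule order_le_less_trans) simp
    thus ?thesis using fin by (auto simp: ennreal_mult_less_top less_top[symmetric] ennreal_mult_eq_top_iff)
  qed
  finally show False using inf by simp
qed

text \<open>\<open>real_of_ereal\<close> sends both infinities to 0, so monotonicity passes to real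
  values only after finiteness beyond \<delta> is known. That is where \<open>t_zero\<close> and the
  absence of infinite values enter.\<close>

private lemma H_p_real_mono:
  assumes d: "\<delta> > 0" "ennreal \<delta> > t_zero \<Phi> p" and ni: "\<not> eventually_infinite (Phi_p \<Phi> p)"
    and st: "\<delta> \<le> s" "s \<le> t"
  shows "H_p_real \<Phi> p s \<le> H_p_real \<Phi> p t"
proof -
  have H: "H_p \<Phi> p (ennreal t) \<noteq> \<infinity> \<and> H_p \<Phi> p (ennreal t) \<noteq> - \<infinity>" if "t \<ge> \<delta>" for t
  proof -
    have "Phi_p \<Phi> p (ennreal t) \<noteq> \<infinity>"
    proof
      assume "Phi_p \<Phi> p (ennreal t) = \<infinity>"
      hence "\<forall>s\<ge>ennreal t. Phi_p \<Phi> p s = \<infinity>"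
        using monoD[OF mono_Phi_p] by (metis infinity_ennreal_def top_unique)
      thus False using ni unfolding eventually_infinite_def by (metis ennreal_less_top infinity_ennreal_def)
    qed
    moreover have "Phi_p \<Phi> p (ennreal t) \<noteq> 0"
    proof
      assume "Phi_p \<Phi> p (ennreal t) = 0"
      hence "ennreal t \<le> t_zero \<Phi> p" unfolding t_zero_def by (intro Sup_upper) simp
      moreover have "ennreal \<delta> \<le> ennreal t" using that by (rule ennreal_leI)
      ultimately show False using d(2) by (meson leD order_trans)
    qed
    ultimately show ?thesis by (simp add: H_p_def ennreal_log_def)
  qed
  have "H_p \<Phi> p (ennreal s) \<le> H_p \<Phi> p (ennreal t)" using st by (intro monoD[OF mono_H_p] ennreal_leI)
  thus ?thesis unfolding H_p_real_def using H[of s] H[of t] st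
    by (cases "H_p \<Phi> p (ennreal s)"; cases "H_p \<Phi> p (ennreal t)") auto
qed

private lemma suminf_from_cond_ii:
  assumes "cond_ii \<Phi> p" shows "(\<Sum>j. a j) = \<infinity>"
proof -
  obtain \<delta> where d: "\<delta> > 0" "ennreal \<delta> > t_zero \<Phi> p" "eventually_infinite (Phi_p \<Phi> p) \<or> (\<integral>\<^sup>+t\<in>{\<delta><..}. ennreal (1 / t) \<partial>H_p_measure \<Phi> p \<delta>) = \<infinity>"
    using assms unfolding cond_ii_def by blast
  show ?thesis
  proof (cases "eventually_infinite (Phi_p \<Phi> p)")
    case True thus ?thesis by (rule suminf_from_eventually_infinite)
  next
    case ni: False
    define F where "F t = H_p_real \<Phi> p (max \<delta> t)" for t
    define x where "x i = 2 ^ i * \<delta>" for i :: nat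
    have x: "x i > 0" "x i \<ge> \<delta>" "x (Suc i) = 2 * x i" for i using d(1) by (auto simp: x_def)
    have [simp]: "sets (interval_measure F) = sets borel" by (rule sets_interval_measure)
    \<comment> \<open>Only an upper bound is used. If no measure extends the interval function,
      \<open>interval_measure\<close> is the zero measure by default and the bound still
      holds.\<close>
    have Ioc: "emeasure (interval_measure F) {u<..v} \<le> ennreal (F v - F u)" if "u \<le> v" for u v
    proof (cases "(\<exists>\<mu>'. (\<forall>i\<in>{(a, b). a \<le> b}. \<mu>' ((\<lambda>(a, b). {a<..b}) i) = (\<lambda>(a, b). ennreal (F b - F a)) i) \<and>
          measure_space UNIV (sigma_sets UNIV ((\<lambda>(a, b). {a<..b}) ` {(a, b). a \<le> b})) \<mu>') \<and> \<not> (\<forall>i\<in>{(a, b). a \<le> b}. (\<lambda>(a, b). ennreal (F b - F a)) i = 0)")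
      case True
      then obtain \<mu>' where m: "\<forall>i\<in>{(a, b). a \<le> b}. \<mu>' ((\<lambda>(a, b). {a<..b}) i) = (\<lambda>(a, b). ennreal (F b - F a)) i"
        "measure_space UNIV (sigma_sets UNIV ((\<lambda>(a, b). {a<..b}) ` {(a, b). a \<le> b})) \<mu>'" by blast
      have "emeasure (interval_measure F) ((\<lambda>(a, b). {a<..b}) (u, v)) = (\<lambda>(a, b). ennreal (F b - F a)) (u, v)"
      proof (rule emeasure_extend_measure[OF interval_measure_def, where \<mu>' = \<mu>'])
        show "positive (sets (interval_measure F)) \<mu>'" "countably_additive (sets (interval_measure F)) \<mu>'"
          using m(2) unfolding measure_space_def by (simp_all add: interval_measure_def extend_measure_def)
      qed (use m(1) that in auto)
      thus ?thesis by simp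
    next
      case False
      hence "interval_measure F = measure_of UNIV ((\<lambda>(a, b). {a<..b}) ` {(a, b). a \<le> b}) (\<lambda>_. 0)"
        unfolding interval_measure_def extend_measure_def by (simp only: if_False)
      thus ?thesis by (simp add: emeasure_sigma)
    qed
    have "(\<Sum>i. ennreal ((H_p_real \<Phi> p (4 * (2 ^ i * \<delta>)) - H_p_real \<Phi> p \<delta>) / (2 ^ i * \<delta>))) = \<infinity>"
    proof -
      have "(\<integral>\<^sup>+t\<in>{\<delta><..}. ennreal (1 / t) \<partial>interval_measure F)
         \<le> (\<integral>\<^sup>+t. (\<Sum>i. ennreal (1 / x i) * indicator {x i<..x (Suc i)} t) \<partial>interval_measure F)"
      proof (rule nn_integral_mono)
        fix t :: real
        show "ennreal (1 / t) * indicator {\<delta><..} t \<le> (\<Sum>i. ennreal (1 / x i) * indicator {x i<..x (Suc i)} t)"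
        proof (cases "t > \<delta>")
          case True
          have "\<exists>k. t \<le> x k"
          proof -
            obtain k where "t / \<delta> < 2 ^ k" using real_arch_pow[of 2 "t / \<delta>"] by auto
            thus ?thesis using d(1) by (intro exI[of _ k]) (simp add: x_def field_simps)
          qed
          then obtain N where N: "t \<le> x N" ..
          define k where "k = (LEAST k. t \<le> x k)"
          have k: "t \<le> x k" unfolding k_def by (rule LeastI[where P = "\<lambda>k. t \<le> x k", OF N])
          have "k \<noteq> 0" using True k by (intro notI) (simp add: x_def)
          then obtain j where j: "k = Suc j" by (cases k) auto
          have tj: "x j < t" using not_less_Least[of j "\<lambda>k. t \<le> x k"] j by (simp add: k_def)
          define q where "q i = ennreal (1 / x i) * indicator {x i<..x (Suc i)} t" for i
          have "ennreal (1 / t) \<le> q j"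
            using k j tj x(1)[of j] by (auto simp: q_def intro!: ennreal_leI divide_left_mono)
          also have "... = (\<Sum>i\<in>{j}. q i)" by simp
          also have "... \<le> (\<Sum>j. q j)" by (rule sum_le_suminf) auto
          finally show ?thesis using True by (simp add: q_def)
        qed simp
      qed
      also have "... = (\<Sum>i. \<integral>\<^sup>+t. ennreal (1 / x i) * indicator {x i<..x (Suc i)} t \<partial>interval_measure F)"
        by (rule nn_integral_suminf) simp
      also have "... = (\<Sum>i. ennreal (1 / x i) * emeasure (interval_measure F) {x i<..x (Suc i)})"
        by (intro suminf_cong nn_integral_cmult_indicator) simp
      also have "... \<le> (\<Sum>i. ennreal ((H_p_real \<Phi> p (4 * x i) - H_p_real \<Phi> p \<delta>) / x i))"
      proof (intro suminf_le)
        fix i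
        have "ennreal (1 / x i) * emeasure (interval_measure F) {x i<..x (Suc i)} \<le> ennreal (1 / x i) * ennreal (F (x (Suc i)) - F (x i))"
          using x(1)[of i] by (intro mult_left_mono Ioc) (auto simp: x(3))
        also have "... = ennreal (1 / x i * (F (x (Suc i)) - F (x i)))"
          using x(1)[of i] by (subst ennreal_mult') auto
        also have "... \<le> ennreal ((H_p_real \<Phi> p (4 * x i) - H_p_real \<Phi> p \<delta>) / x i)"
        proof (rule ennreal_leI)
          have "F (x (Suc i)) \<le> H_p_real \<Phi> p (4 * x i)"
            using x[of i] d(1) unfolding F_def by (intro H_p_real_mono[OF d(1,2) ni]) auto
          moreover have "F (x i) \<ge> H_p_real \<Phi> p \<delta>"
            unfolding F_def by (intro H_p_real_mono[OF d(1,2) ni]) auto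
          ultimately show "1 / x i * (F (x (Suc i)) - F (x i)) \<le> (H_p_real \<Phi> p (4 * x i) - H_p_real \<Phi> p \<delta>) / x i"
            using x(1)[of i] by (simp add: divide_right_mono)
        qed
        finally show "ennreal (1 / x i) * emeasure (interval_measure F) {x i<..x (Suc i)} \<le> ennreal ((H_p_real \<Phi> p (4 * x i) - H_p_real \<Phi> p \<delta>) / x i)" .
      qed auto
      finally show ?thesis using d(3) ni unfolding H_p_measure_def F_def[symmetric] x_def by (simp add: top_unique)
    qed
    thus ?thesis by (rule suminf_from_dyadic[OF d(1,2) ni])
  qed
qed

text \<open>For a monotone function the integral of the derivative is at most an increment. This
  comes from Fatou's lemma for the difference quotients with the steps \<open>e k\<close>; a
  singular part of the function can only help.\<close>

private lemma suminf_from_cond_i: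
  assumes "cond_i \<Phi> p" shows "(\<Sum>j. a j) = \<infinity>"
proof -
  obtain \<delta> where d: "\<delta> > 0" "ennreal \<delta> > t_zero \<Phi> p" "eventually_infinite (Phi_p \<Phi> p) \<or> (\<integral>\<^sup>+t\<in>{\<delta><..}. ennreal (H_p_deriv \<Phi> p t / t) \<partial>lebesgue) = \<infinity>"
    using assms unfolding cond_i_def by blast
  show ?thesis
  proof (cases "eventually_infinite (Phi_p \<Phi> p)")
    case True thus ?thesis by (rule suminf_from_eventually_infinite)
  next
    case ni: False
    define F where "F t = H_p_real \<Phi> p (max \<delta> t)" for t
    have mF: "mono F" unfolding F_def by (intro monoI H_p_real_mono[OF d(1,2) ni]) auto
    have [measurable]: "F \<in> borel_measurable borel" using mF by (rule borel_measurable_mono)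
    define x where "x i = 2 ^ i * \<delta>" for i :: nat
    have x: "x i > 0" "x i \<ge> \<delta>" "x (Suc i) = 2 * x i" for i using d(1) by (auto simp: x_def)
    define e where "e k = \<delta> / real (Suc k)" for k
    have e: "e k > 0" "e k \<le> \<delta>" for k using d(1) by (auto simp: e_def field_simps)
    have e0: "e \<longlonglongrightarrow> 0" unfolding e_def by (rule lim_const_over_n[of \<delta>, THEN LIMSEQ_Suc])
    define D where "D t = liminf (\<lambda>k. ennreal ((F (t + e k) - F t) / e k))" for t
    have [measurable]: "D \<in> borel_measurable borel" unfolding D_def by measurable
    have deriv_le: "ennreal (H_p_deriv \<Phi> p t) \<le> D t" if t: "t > \<delta>" for t
    proof (cases "H_p_real \<Phi> p differentiable at t")
      case True
      hence "DERIV (H_p_real \<Phi> p) t :> deriv (H_p_real \<Phi> p) t"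
        using DERIV_deriv_iff_real_differentiable by blast
      hence "((\<lambda>h. (H_p_real \<Phi> p (t + h) - H_p_real \<Phi> p t) / h) \<longlongrightarrow> H_p_deriv \<Phi> p t) (at 0)"
        using True by (simp add: DERIV_def H_p_deriv_def)
      moreover have "filterlim e (at 0) sequentially"
        unfolding filterlim_at using e0 e(1) by (simp add: less_imp_neq[THEN not_sym])
      ultimately have "(\<lambda>k. (H_p_real \<Phi> p (t + e k) - H_p_real \<Phi> p t) / e k) \<longlonglongrightarrow> H_p_deriv \<Phi> p t"
        by (rule filterlim_compose)
      hence "(\<lambda>k. (F (t + e k) - F t) / e k) \<longlonglongrightarrow> H_p_deriv \<Phi> p t"
      proof -
        have "F (t + e k) = H_p_real \<Phi> p (t + e k)" for k using t e(1)[of k] by (simp add: F_def max_def)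
        moreover have "F t = H_p_real \<Phi> p t" using t by (simp add: F_def max_def)
        ultimately show ?thesis using \<open>(\<lambda>k. (H_p_real \<Phi> p (t + e k) - _) / e k) \<longlonglongrightarrow> _\<close> by simp
      qed
      hence "(\<lambda>k. ennreal ((F (t + e k) - F t) / e k)) \<longlonglongrightarrow> ennreal (H_p_deriv \<Phi> p t)" by (rule tendsto_ennrealI)
      thus ?thesis unfolding D_def by (simp add: lim_imp_Liminf)
    qed (simp add: H_p_deriv_def)
    \<comment> \<open>The right end is doubled because the translated interval reaches v + e k, and
      e k \<le> \<delta> \<le> v.\<close>
    have piece: "(\<integral>\<^sup>+t. D t * indicator {u<..v} t \<partial>lborel) \<le> ennreal (F (2 * v) - F u)"
      if uv: "\<delta> \<le> u" "u < v" for u v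
    proof -
      have "(\<integral>\<^sup>+t. D t * indicator {u<..v} t \<partial>lborel) \<le> (\<integral>\<^sup>+t. liminf (\<lambda>k. ennreal ((F (t + e k) - F t) / e k) * indicator {u<..v} t) \<partial>lborel)"
        by (rule nn_integral_mono) (auto simp: D_def indicator_def)
      also have "... \<le> liminf (\<lambda>k. \<integral>\<^sup>+t. ennreal ((F (t + e k) - F t) / e k) * indicator {u<..v} t \<partial>lborel)"
        by (rule nn_integral_liminf) measurable
      also have "... \<le> liminf (\<lambda>k. ennreal (F (2 * v) - F u))"
      proof (intro Liminf_mono always_eventually allI)
        fix k
        define P where "P t = ennreal (F t - F u)" for t
        have [measurable]: "P \<in> borel_measurable borel" unfolding P_def by measurable
        define I where "I = (\<integral>\<^sup>+t. P t * indicator {u<..v} t \<partial>lborel)"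
        have Fm: "F s \<le> F t" if "s \<le> t" for s t using mF that by (rule monoD)
        have "I \<le> (\<integral>\<^sup>+t. ennreal (F v - F u) * indicator {u<..v} t \<partial>lborel)"
          unfolding I_def P_def by (intro nn_integral_mono) (auto simp: indicator_def intro!: ennreal_leI Fm)
        also have "... < top" using uv by (simp add: nn_integral_cmult_indicator ennreal_mult_less_top)
        finally have Ifin: "I < top" .
        \<comment> \<open>\<open>A + I\<close> is the integral of P over the translated interval,
          which leaves the old one only in an interval of length e k. Cancelling the finite I
          replaces a subtraction of extended integrals.\<close>
        define A where "A = (\<integral>\<^sup>+t. ennreal (F (t + e k) - F t) * indicator {u<..v} t \<partial>lborel)"
        have "A + I = (\<integral>\<^sup>+t. ennreal (F (t + e k) - F t) * indicator {u<..v} t + P t * indicator {u<..v} t \<partial>lborel)"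
          unfolding A_def I_def by (rule nn_integral_add[symmetric]) measurable
        also have "... = (\<integral>\<^sup>+t. P (e k + 1 * t) * indicator {u + e k<..v + e k} (e k + 1 * t) \<partial>lborel)"
        proof (rule nn_integral_cong)
          fix t
          show "ennreal (F (t + e k) - F t) * indicator {u<..v} t + P t * indicator {u<..v} t = P (e k + 1 * t) * indicator {u + e k<..v + e k} (e k + 1 * t)"
          proof (cases "t \<in> {u<..v}")
            case True
            have "F t \<le> F (t + e k)" "F u \<le> F t" using e(1)[of k] True by (auto intro!: Fm)
            thus ?thesis using True by (simp add: P_def ennreal_plus[symmetric] add.commute del: ennreal_plus)
          qed (auto simp: indicator_def)
        qed
        also have "... = (\<integral>\<^sup>+t. P t * indicator {u + e k<..v + e k} t \<partial>lborel)"
          by (subst nn_integral_real_affine[where c = 1 and t = "e k" and f = "\<lambda>t. P t * indicator {u + e k<..v + e k} t"]) auto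
        also have "... \<le> (\<integral>\<^sup>+t. P t * indicator {u<..v} t + ennreal (F (2 * v) - F u) * indicator {v..v + e k} t \<partial>lborel)"
        proof (rule nn_integral_mono)
          fix t
          have "F t \<le> F (2 * v)" if "t \<le> v + e k" using that e(2)[of k] uv by (intro Fm) auto
          thus "P t * indicator {u + e k<..v + e k} t \<le> P t * indicator {u<..v} t + ennreal (F (2 * v) - F u) * indicator {v..v + e k} t"
            using e(1)[of k] by (auto simp: indicator_def P_def intro!: ennreal_leI)
        qed
        also have "... = I + ennreal (F (2 * v) - F u) * ennreal (e k)"
          using e(1)[of k] unfolding I_def by (simp add: nn_integral_add nn_integral_cmult_indicator)
        finally have "A \<le> ennreal (F (2 * v) - F u) * ennreal (e k)"
          using Ifin by (auto simp: add.commute[of A] ennreal_add_left_cancel_le)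
        hence "ennreal (1 / e k) * A \<le> ennreal (1 / e k) * (ennreal (F (2 * v) - F u) * ennreal (e k))"
          by (intro mult_left_mono) auto
        also have "... = ennreal (F (2 * v) - F u)"
        proof -
          have "ennreal (e k) * ennreal (1 / e k) = 1" using e(1)[of k] by (simp add: ennreal_mult[symmetric])
          thus ?thesis by (metis mult.assoc mult.commute mult.right_neutral)
        qed
        also have "ennreal (1 / e k) * A = (\<integral>\<^sup>+t. ennreal ((F (t + e k) - F t) / e k) * indicator {u<..v} t \<partial>lborel)"
          unfolding A_def
        proof (subst nn_integral_cmult[symmetric])
          show "(\<integral>\<^sup>+t. ennreal (1 / e k) * (ennreal (F (t + e k) - F t) * indicator {u<..v} t) \<partial>lborel) = (\<integral>\<^sup>+t. ennreal ((F (t + e k) - F t) / e k) * indicator {u<..v} t \<partial>lborel)"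
          proof (rule nn_integral_cong)
            fix t
            have "ennreal (1 / e k * (F (t + e k) - F t)) = ennreal (1 / e k) * ennreal (F (t + e k) - F t)"
              using e(1)[of k] by (intro ennreal_mult') simp
            thus "ennreal (1 / e k) * (ennreal (F (t + e k) - F t) * indicator {u<..v} t) = ennreal ((F (t + e k) - F t) / e k) * indicator {u<..v} t"
              by (simp add: mult.assoc[symmetric])
          qed
        qed measurable
        finally show "(\<integral>\<^sup>+t. ennreal ((F (t + e k) - F t) / e k) * indicator {u<..v} t \<partial>lborel) \<le> ennreal (F (2 * v) - F u)" .
      qed
      finally show ?thesis by (simp add: Liminf_const)
    qed
    have "(\<Sum>i. ennreal ((H_p_real \<Phi> p (4 * (2 ^ i * \<delta>)) - H_p_real \<Phi> p \<delta>) / (2 ^ i * \<delta>))) = \<infinity>"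
    proof -
      have "(\<integral>\<^sup>+t\<in>{\<delta><..}. ennreal (H_p_deriv \<Phi> p t / t) \<partial>lebesgue)
         \<le> (\<integral>\<^sup>+t. (\<Sum>i. ennreal (1 / x i) * (D t * indicator {x i<..x (Suc i)} t)) \<partial>lborel)"
        unfolding nn_integral_completion
      proof (rule nn_integral_mono)
        fix t :: real
        show "ennreal (H_p_deriv \<Phi> p t / t) * indicator {\<delta><..} t \<le> (\<Sum>i. ennreal (1 / x i) * (D t * indicator {x i<..x (Suc i)} t))"
        proof (cases "t > \<delta>")
          case True
          have "\<exists>k. t \<le> x k"
          proof -
            obtain k where "t / \<delta> < 2 ^ k" using real_arch_pow[of 2 "t / \<delta>"] by auto
            thus ?thesis using d(1) by (intro exI[of _ k]) (simp add: x_def field_simps)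
          qed
          then obtain N where N: "t \<le> x N" ..
          define k where "k = (LEAST k. t \<le> x k)"
          have k: "t \<le> x k" unfolding k_def by (rule LeastI[where P = "\<lambda>k. t \<le> x k", OF N])
          have "k \<noteq> 0" using True k by (intro notI) (simp add: x_def)
          then obtain j where j: "k = Suc j" by (cases k) auto
          have tj: "x j < t" using not_less_Least[of j "\<lambda>k. t \<le> x k"] j by (simp add: k_def)
          define q where "q i = ennreal (1 / x i) * (D t * indicator {x i<..x (Suc i)} t)" for i
          have "ennreal (H_p_deriv \<Phi> p t / t) = ennreal (1 / t) * ennreal (H_p_deriv \<Phi> p t)"
            using True d(1) by (subst ennreal_mult'[symmetric]) auto
          also have "... \<le> q j"
            using k j tj x(1)[of j] deriv_le[OF True] by (auto simp: q_def intro!: mult_mono ennreal_leI divide_left_mono)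
          also have "... = (\<Sum>i\<in>{j}. q i)" by simp
          also have "... \<le> (\<Sum>j. q j)" by (rule sum_le_suminf) auto
          finally show ?thesis using True by (simp add: q_def)
        qed simp
      qed
      also have "... = (\<Sum>i. \<integral>\<^sup>+t. ennreal (1 / x i) * (D t * indicator {x i<..x (Suc i)} t) \<partial>lborel)"
        by (rule nn_integral_suminf) measurable
      also have "... = (\<Sum>i. ennreal (1 / x i) * (\<integral>\<^sup>+t. D t * indicator {x i<..x (Suc i)} t \<partial>lborel))"
        by (intro suminf_cong nn_integral_cmult) measurable
      also have "... \<le> (\<Sum>i. ennreal ((H_p_real \<Phi> p (4 * x i) - H_p_real \<Phi> p \<delta>) / x i))"
      proof (intro suminf_le)
        fix i
        have "ennreal (1 / x i) * (\<integral>\<^sup>+t. D t * indicator {x i<..x (Suc i)} t \<partial>lborel) \<le> ennreal (1 / x i) * ennreal (F (2 * x (Suc i)) - F (x i))"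
          using x[of i] by (intro mult_left_mono piece) auto
        also have "... = ennreal (1 / x i * (F (2 * x (Suc i)) - F (x i)))"
          using x(1)[of i] by (subst ennreal_mult') auto
        also have "... \<le> ennreal ((H_p_real \<Phi> p (4 * x i) - H_p_real \<Phi> p \<delta>) / x i)"
        proof (rule ennreal_leI)
          have "F (2 * x (Suc i)) \<le> H_p_real \<Phi> p (4 * x i)"
            using x[of i] d(1) unfolding F_def by (intro H_p_real_mono[OF d(1,2) ni]) auto
          moreover have "F (x i) \<ge> H_p_real \<Phi> p \<delta>"
            unfolding F_def by (intro H_p_real_mono[OF d(1,2) ni]) auto
          ultimately show "1 / x i * (F (2 * x (Suc i)) - F (x i)) \<le> (H_p_real \<Phi> p (4 * x i) - H_p_real \<Phi> p \<delta>) / x i"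
            using x(1)[of i] by (simp add: divide_right_mono)
        qed
        finally show "ennreal (1 / x i) * (\<integral>\<^sup>+t. D t * indicator {x i<..x (Suc i)} t \<partial>lborel) \<le> ennreal ((H_p_real \<Phi> p (4 * x i) - H_p_real \<Phi> p \<delta>) / x i)" .
      qed auto
      finally show ?thesis using d(3) ni unfolding x_def by (simp add: top_unique)
    qed
    thus ?thesis by (rule suminf_from_dyadic[OF d(1,2) ni])
  qed
qed

text \<open>The weights are the reciprocals 1 / G(lev j), capped at 1 and set to 0 below
  \<open>j0\<close>. Since \<open>G\<close> is at least \<open>t1\<close> from there on, the cap
  costs at most the factor max 1 (1 / t1), so divergence survives.\<close>

private lemma weights_from_suminf:
  assumes inf: "(\<Sum>j. a j) = \<infinity>"
  shows "\<exists>L :: nat => real. (\<forall>j. 0 \<le> L j \<and> L j \<le> 1) \<and> \<not> summable L \<and>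
    (\<forall>j K. K \<ge> 0 \<longrightarrow> ennreal (L j ^ (n - 1)) * ennreal K \<le> 4 * (1 + ennreal (1 / 2 ^ (n * j)) * \<Phi> (ennreal K)))"
proof -
  define L where "L j = (if j < j0 then 0 else enn2real (min 1 (1 / G (lev j))))" for j
  have L01: "0 \<le> L j \<and> L j \<le> 1" for j
  proof -
    have "enn2real (min 1 (1 / G (lev j))) \<le> enn2real 1" by (rule enn2real_mono) auto
    thus ?thesis by (simp add: L_def)
  qed
  have LG: "G (lev j) \<le> ennreal (1 / L j)" if "L j > 0" for j
  proof (cases "G (lev j)" rule: ennreal_cases)
    case (real g)
    show ?thesis
    proof (cases "g = 0")
      case False
      hence "1 / G (lev j) = ennreal (1 / g)" using real by (simp add: divide_ennreal_def inverse_ennreal divide_inverse)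
      moreover have "min 1 (ennreal (1 / g)) = ennreal (min 1 (1 / g))" using real by (simp add: min_def ennreal_le_1 ennreal_1[symmetric] del: ennreal_1)
      ultimately have "L j \<le> 1 / g" using that real by (auto simp: L_def split: if_splits)
      hence "g \<le> 1 / L j" using that False real by (simp add: field_simps)
      thus ?thesis using real by (simp add: ennreal_leI)
    qed (use real in simp)
  next
    case top
    thus ?thesis using that by (simp add: L_def split: if_splits)
  qed
  have "\<not> summable L"
  proof
    assume sL: "summable L"
    hence "summable (\<lambda>j. L (j + j0))" by (simp add: summable_iff_shift)
    hence fin: "(\<Sum>j. ennreal (L (j0 + j))) \<noteq> top" using L01 by (intro ennreal_suminf_neq_top) (auto simp: add.commute)
    define c where "c = max 1 (1 / t1)"
    have "a j \<le> ennreal c * ennreal (L (j0 + j))" for j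
    proof (cases "G (lev (j0 + j))" rule: ennreal_cases)
      case (real g)
      have g: "t1 \<le> g" using G_pos[of j] real t1 by simp
      hence g0: "g > 0" using t1 by simp
      have aj: "a j = ennreal (1 / g)" using real g0 by (simp add: a_def divide_ennreal_def inverse_ennreal divide_inverse)
      have "L (j0 + j) = enn2real (min 1 (ennreal (1 / g)))" using aj by (simp add: L_def a_def)
      also have "min 1 (ennreal (1 / g)) = ennreal (min 1 (1 / g))" using g0 by (simp add: min_def ennreal_le_1 ennreal_1[symmetric] del: ennreal_1)
      finally have L: "L (j0 + j) = min 1 (1 / g)" using g0 by simp
      have "1 / g \<le> c * min 1 (1 / g)"
      proof (cases "1 / g \<le> 1")
        case True
        thus ?thesis using mult_right_mono[of 1 c "1 / g"] g0 by (simp add: c_def)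
      next
        case False
        have "1 / g \<le> 1 / t1" using g t1 by (simp add: frac_le)
        thus ?thesis using False by (simp add: c_def)
      qed
      thus ?thesis unfolding aj L using g0 by (subst ennreal_mult[symmetric]) (auto simp: c_def intro!: ennreal_leI)
    next
      case top
      thus ?thesis by (simp add: a_def)
    qed
    hence "(\<Sum>j. a j) \<le> (\<Sum>j. ennreal c * ennreal (L (j0 + j)))" by (intro suminf_le) auto
    also have "... = ennreal c * (\<Sum>j. ennreal (L (j0 + j)))" by (rule ennreal_suminf_cmult)
    also have "... < top" using fin by (auto simp: ennreal_mult_less_top less_top[symmetric] ennreal_mult_eq_top_iff)
    finally show False using inf by simp
  qed
  moreover have "ennreal (L j ^ (n - 1)) * ennreal K \<le> 4 * (1 + ennreal (1 / 2 ^ (n * j)) * \<Phi> (ennreal K))" if K: "K \<ge> 0" for j K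
  proof (cases "j < j0")
    case True
    thus ?thesis using n by (auto simp: L_def power_0_left)
  next
    case False
    show ?thesis
    proof (rule dilatation_bound)
      show "G (ln (2 ^ (n * j))) \<le> ennreal (1 / L j)" if "0 < L j"
        using LG[OF that] by (simp add: exp_lev[symmetric])
      have "\<Phi> 0 \<le> Phi_p \<Phi> p (ennreal t1)" unfolding Phi_p_def by (intro monoD[OF mono]) simp
      also have "... \<le> ennreal (2 ^ (n * j0) / 2)" using t1 by simp
      also have "... \<le> ennreal (2 ^ (n * j) / 2)" using False by (intro ennreal_leI divide_right_mono power_increasing) auto
      finally show "\<Phi> 0 \<le> ennreal (2 ^ (n * j) / 2)" .
    qed (use L01 K in auto)
  qed
  ultimately show ?thesis using L01 by blast
qed

lemma weights_from_conditions:
  assumes "cond_i \<Phi> p \<or> cond_ii \<Phi> p \<or> cond_iii \<Phi> p \<or> cond_iv \<Phi> p \<or> cond_v \<Phi> p \<or> cond_vi \<Phi> p"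
  shows "\<exists>L :: nat => real. (\<forall>j. 0 \<le> L j \<and> L j \<le> 1) \<and> \<not> summable L \<and>
    (\<forall>j K. K \<ge> 0 \<longrightarrow> ennreal (L j ^ (n - 1)) * ennreal K \<le> 4 * (1 + ennreal (1 / 2 ^ (n * j)) * \<Phi> (ennreal K)))"
  using assms weights_from_suminf suminf_from_cond_i suminf_from_cond_ii suminf_from_cond_iii
    suminf_from_cond_iv suminf_from_cond_v suminf_from_cond_vi by blast

end

text \<open>If \<Phi> is infinite at all positive arguments, no cut-off \<open>t1\<close> exists,
  but then constant weights satisfy the bound. Otherwise a point of finite \<Phi> gives
  \<open>t1\<close>, and \<open>j0\<close> is taken large.\<close>

lemma divergent_weights:
  assumes "cond_i \<Phi> p \<or> cond_ii \<Phi> p \<or> cond_iii \<Phi> p \<or> cond_iv \<Phi> p \<or> cond_v \<Phi> p \<or> cond_vi \<Phi> p"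
  shows "\<exists>L :: nat => real. (\<forall>j. 0 \<le> L j \<and> L j \<le> 1) \<and> \<not> summable L \<and>
    (\<forall>j K. K \<ge> 0 \<longrightarrow> ennreal (L j ^ (n - 1)) * ennreal K \<le> 4 * (1 + ennreal (1 / 2 ^ (n * j)) * \<Phi> (ennreal K)))"
proof (cases "\<forall>K>0. \<Phi> (ennreal K) = \<infinity>")
  case True
  have "ennreal (1 ^ (n - 1)) * ennreal K \<le> 4 * (1 + ennreal (1 / 2 ^ (n * j)) * \<Phi> (ennreal K))" if "K \<ge> 0" for j K
    using True that by (cases "K = 0") (auto simp: ennreal_mult_top)
  moreover have "\<not> summable (\<lambda>_::nat. 1::real)" by (simp add: summable_const_iff)
  ultimately show ?thesis by (intro exI[of _ "\<lambda>_. 1"]) auto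
next
  case False
  then obtain K where K: "K > 0" "\<Phi> (ennreal K) \<noteq> \<infinity>" by blast
  define t1 where "t1 = K powr (1 / p)"
  have P: "Phi_p \<Phi> p (ennreal t1) = \<Phi> (ennreal K)" using K p by (simp add: Phi_p_def ennreal_pow_def t1_def powr_powr)
  obtain v where v: "\<Phi> (ennreal K) = ennreal v" "v \<ge> 0" using K(2) by (cases "\<Phi> (ennreal K)" rule: ennreal_cases) auto
  obtain j0 where j0: "2 * v < 2 ^ j0" using real_arch_pow[of 2 "2 * v"] by auto
  have "(2::real) ^ j0 \<le> 2 ^ (n * j0)" using n by (intro power_increasing) auto
  hence "v < 2 ^ (n * j0) / 2" using j0 by linarith
  hence "Phi_p \<Phi> p (ennreal t1) < ennreal (2 ^ (n * j0) / 2)" unfolding P v(1) using v(2) by (intro ennreal_lessI) auto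
  from weights_from_conditions[OF _ this assms] show ?thesis using K by (simp add: t1_def)
qed

end

section \<open>Weights, the class of homeomorphisms, and compactness\<close>

lemma mono_ennreal_measurable:
  fixes \<Phi> :: "ennreal => ennreal"
  assumes "mono \<Phi>" shows "\<Phi> \<in> borel_measurable borel"
proof (rule borel_measurableI_greater)
  fix y
  define S where "S = {x. y < \<Phi> x}"
  have up: "x' \<in> S" if "x \<in> S" "x \<le> x'" for x x'
    using that monoD[OF assms that(2)] by (auto simp: S_def)
  have "S = {Inf S..} \<or> S = {Inf S<..}"
  proof (cases "Inf S \<in> S")
    case True
    have "S = {Inf S..}" using up[OF True] by (auto intro: Inf_lower)
    thus ?thesis by blast
  next
    case False
    have "x \<in> S" if x: "Inf S < x" for x
    proof -
      obtain v where "v \<in> S" "v < x" using x by (auto simp: Inf_less_iff)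
      thus ?thesis using up by (meson less_imp_le)
    qed
    moreover have "Inf S < x" if "x \<in> S" for x using that False Inf_lower[OF that] by (metis order_le_less)
    ultimately have "S = {Inf S<..}" by auto
    thus ?thesis by blast
  qed
  hence "S \<in> sets borel" by (metis borel_closed borel_open closed_atLeast open_greaterThan)
  thus "{x \<in> space borel. y < \<Phi> x} \<in> sets borel" by (simp add: S_def)
qed

text \<open>With \<mu>_j = \<theta> L_j / \<rho>_j the thickness cancels \<rho>_j on the left, and
  the volume cancels \<rho>_j^n on the right. The sum of the L_j then stands on the left with factor
  \<theta> / 2 and on the right with a multiple of \<theta>^n \<le> \<theta>^2, so a small \<theta>
  absorbs it.\<close>

lemma weight_sum_le:
  fixes K :: "real^'n => ennreal" and Sh :: "nat => (real^'n) set" and L \<rho> a b :: "nat => real"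
  assumes card: "CARD('n) \<ge> 2" and \<Phi>: "mono \<Phi>"
    and L: "\<And>j. 0 \<le> L j \<and> L j \<le> 1"
    and key: "\<And>j k. 0 \<le> k ==> ennreal (L j ^ (CARD('n) - 1)) * ennreal k \<le> 4 * (1 + ennreal (1 / 2 ^ (CARD('n) * j)) * \<Phi> (ennreal k))"
    and Sh: "\<And>j. Sh j \<in> sets lebesgue" "disjoint_family_on Sh {..<J}"
    and Km: "\<And>j. (\<lambda>x. K x * indicator (Sh j) x) \<in> borel_measurable lebesgue"
    and Kf: "\<And>j. negligible {x \<in> Sh j. K x = \<infinity>}"
    and vol: "\<And>j. j < J ==> emeasure lebesgue (Sh j) \<le> ennreal (c2 * \<rho> j ^ CARD('n))" and c2: "c2 \<ge> 0"
    and wt: "\<And>j x. j < J ==> x \<in> Sh j ==> (1 + (norm x)\<^sup>2) ^ CARD('n) \<le> c3 * (2 ^ j * \<rho> j) ^ CARD('n)" and c3: "c3 \<ge> 0"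
    and M: "(\<integral>\<^sup>+x\<in>(\<Union>j<J. Sh j). \<Phi> (K x) / ennreal ((1 + (norm x)\<^sup>2) ^ CARD('n)) \<partial>lebesgue) \<le> ennreal M" "M \<ge> 0"
    and \<rho>: "\<And>j. \<rho> j > 0" "\<And>j. j < J ==> \<rho> j / 2 \<le> b j - a j"
    and ring: "\<And>\<mu>. (\<And>j. 0 \<le> \<mu> j) ==> ennreal (\<Sum>j<J. \<mu> j * (b j - a j)) \<le> ennreal C * ((\<Sum>j<J. ennreal (\<mu> j ^ CARD('n)) * (\<integral>\<^sup>+x\<in>Sh j. K x \<partial>lebesgue)) + 1)" and C: "C \<ge> 0"
  shows "(\<Sum>j<J. L j) \<le> 4 * C * (4 * c3 * M + 1) * (16 * C * c2 + 1)"
proof -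
  let ?n = "CARD('n)"
  obtain m where m: "?n = Suc m" "m \<ge> 1" using card by (cases ?n) auto
  \<comment> \<open>Chosen so that 4 C c2 \<theta>^2 \<le> \<theta> / 4, half of the factor on the
    left; the summand 1 avoids division by 0.\<close>
  define \<theta> where "\<theta> = 1 / (16 * C * c2 + 1)"
  have q: "16 * C * c2 + 1 \<ge> 1" using C c2 by simp
  have \<theta>: "0 < \<theta>" "\<theta> \<le> 1" using q by (auto simp: \<theta>_def)
  define A where "A = \<theta> ^ ?n"
  have A: "0 < A" "A \<le> \<theta> * \<theta>" "A \<le> 1"
  proof -
    show "0 < A" using \<theta> by (simp add: A_def)
    have "\<theta> ^ ?n \<le> \<theta> ^ 2" using \<theta> card by (intro power_decreasing) auto
    thus "A \<le> \<theta> * \<theta>" by (simp add: A_def power2_eq_square)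
    show "A \<le> 1" unfolding A_def using \<theta> by (intro power_le_one) auto
  qed
  define \<mu> where "\<mu> j = \<theta> * L j / \<rho> j" for j
  have \<mu>: "0 \<le> \<mu> j" for j using \<theta> L[of j] \<rho>(1)[of j] by (simp add: \<mu>_def)
  define G where "G x = \<Phi> (K x) / ennreal ((1 + (norm x)\<^sup>2) ^ ?n)" for x
  have w1: "(1 + (norm x)\<^sup>2) ^ ?n > 0" for x :: "real^'n" using one_plus_norm_pos[of x] by simp
  have Gm: "(\<lambda>x. G x * indicator (Sh j) x) \<in> borel_measurable lebesgue" for j
  proof -
    have "(\<lambda>x. \<Phi> (K x * indicator (Sh j) x)) \<in> borel_measurable lebesgue"
      by (rule measurable_compose[OF Km mono_ennreal_measurable[OF \<Phi>]])
    moreover have "(\<lambda>x :: real^'n. ennreal ((1 + (norm x)\<^sup>2) ^ ?n)) \<in> borel_measurable lebesgue"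
      by (intro measurable_completion) measurable
    ultimately have "(\<lambda>x. \<Phi> (K x * indicator (Sh j) x) / ennreal ((1 + (norm x)\<^sup>2) ^ ?n) * indicator (Sh j) x) \<in> borel_measurable lebesgue"
      by (intro borel_measurable_times_ennreal borel_measurable_divide_ennreal borel_measurable_indicator Sh(1))
    moreover have "\<Phi> (K x * indicator (Sh j) x) / ennreal ((1 + (norm x)\<^sup>2) ^ ?n) * indicator (Sh j) x = G x * indicator (Sh j) x" for x
      by (auto simp: G_def indicator_def)
    ultimately show ?thesis by simp
  qed
  define g where "g j = (\<integral>\<^sup>+x. G x * indicator (Sh j) x \<partial>lebesgue)" for j
  have gsum: "(\<Sum>j<J. g j) \<le> ennreal M"
  proof -
    have "(\<Sum>j<J. g j) = (\<integral>\<^sup>+x. (\<Sum>j<J. G x * indicator (Sh j) x) \<partial>lebesgue)"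
      unfolding g_def by (rule nn_integral_sum[symmetric]) (rule Gm)
    also have "... = (\<integral>\<^sup>+x. G x * indicator (\<Union>j<J. Sh j) x \<partial>lebesgue)"
    proof (rule nn_integral_cong)
      fix x
      have "(\<Sum>j<J. indicator (Sh j) x :: ennreal) = indicator (\<Union>j<J. Sh j) x"
        by (rule indicator_UN_disjoint[symmetric]) (use Sh(2) in auto)
      thus "(\<Sum>j<J. G x * indicator (Sh j) x) = G x * indicator (\<Union>j<J. Sh j) x" by (simp only: sum_distrib_left[symmetric])
    qed
    also have "... \<le> ennreal M" unfolding G_def by (rule M(1))
    finally show ?thesis .
  qed
  have T: "ennreal (\<mu> j ^ ?n) * (\<integral>\<^sup>+x\<in>Sh j. K x \<partial>lebesgue) \<le> ennreal (4 * A * c2 * L j) + ennreal (4 * A * c3) * g j" if j: "j < J" for j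
  proof -
    define r where "r = \<rho> j ^ ?n"
    have r: "r > 0" using \<rho>(1)[of j] by (simp add: r_def)
    \<comment> \<open>One of the n factors L_j is kept for the sum to be absorbed; the other n - 1
      are those in \<open>key\<close>.\<close>
    have mu: "\<mu> j ^ ?n = (A * L j / r) * L j ^ (?n - 1)"
      unfolding \<mu>_def A_def r_def m by (simp add: power_mult_distrib power_divide)
    have "ennreal (\<mu> j ^ ?n) * (\<integral>\<^sup>+x\<in>Sh j. K x \<partial>lebesgue) = (\<integral>\<^sup>+x. ennreal (\<mu> j ^ ?n) * (K x * indicator (Sh j) x) \<partial>lebesgue)"
      by (rule nn_integral_cmult[symmetric]) (rule Km)
    also have "... \<le> (\<integral>\<^sup>+x. ennreal (4 * A * L j / r) * indicator (Sh j) x + ennreal (4 * A * c3) * (G x * indicator (Sh j) x) \<partial>lebesgue)"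
    proof (rule nn_integral_mono_AE)
      have "AE x in lebesgue. x \<notin> {x \<in> Sh j. K x = \<infinity>}"
        using Kf[of j] by (intro AE_not_in) (simp add: negligible_iff_null_sets)
      thus "AE x in lebesgue. ennreal (\<mu> j ^ ?n) * (K x * indicator (Sh j) x) \<le> ennreal (4 * A * L j / r) * indicator (Sh j) x + ennreal (4 * A * c3) * (G x * indicator (Sh j) x)"
      proof (rule AE_mp, intro AE_I2 impI)
        fix x assume nx: "x \<notin> {x \<in> Sh j. K x = \<infinity>}"
        show "ennreal (\<mu> j ^ ?n) * (K x * indicator (Sh j) x) \<le> ennreal (4 * A * L j / r) * indicator (Sh j) x + ennreal (4 * A * c3) * (G x * indicator (Sh j) x)"
        proof (cases "x \<in> Sh j")
          case True
          hence "K x \<noteq> \<infinity>" using nx by blast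
          then obtain k where k: "K x = ennreal k" "k \<ge> 0" by (cases "K x") auto
          define W where "W = (1 + (norm x)\<^sup>2) ^ ?n"
          have W: "W > 0" "W \<le> c3 * (2 ^ j * \<rho> j) ^ ?n" using w1[of x] wt[OF j True] by (auto simp: W_def)
          define e where "e = 1 / (2::real) ^ (?n * j)"
          have e: "e > 0" by (simp add: e_def)
          \<comment> \<open>The factor 2^(-nj) from \<open>key\<close> cancels the 2^(nj) in the
            hypothesis on the weight; what remains is \<rho>_j^n, which the denominator
            \<open>r\<close> removes.\<close>
          have W2: "W * e \<le> c3 * r"
          proof -
            have "(2 ^ j * \<rho> j) ^ ?n = 2 ^ (?n * j) * r" by (simp add: power_mult_distrib r_def power_mult[symmetric] mult.commute)
            hence "W * e \<le> c3 * (2 ^ (?n * j) * r) * e" using W(2) e by (intro mult_right_mono) auto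
            thus ?thesis by (simp add: e_def)
          qed
          have ALr: "A * L j / r \<ge> 0" using A L[of j] r by simp
          have "ennreal (\<mu> j ^ ?n) * K x = ennreal (A * L j / r) * (ennreal (L j ^ (?n - 1)) * ennreal k)"
          proof -
            have "ennreal (\<mu> j ^ ?n) = ennreal (A * L j / r) * ennreal (L j ^ (?n - 1))"
              unfolding mu using ALr L[of j] by (intro ennreal_mult) auto
            thus ?thesis by (simp only: k(1) mult.assoc)
          qed
          also have "... \<le> ennreal (A * L j / r) * (4 * (1 + ennreal e * \<Phi> (K x)))"
            unfolding e_def k(1) by (intro mult_left_mono key k) simp
          also have "... = ennreal (A * L j / r) * ennreal 4 + ennreal (A * L j / r) * ennreal 4 * ennreal e * \<Phi> (K x)"
            by (simp add: distrib_left mult_ac)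
          also have "ennreal (A * L j / r) * ennreal 4 = ennreal (4 * A * L j / r)" using ALr by (subst ennreal_mult[symmetric]) (auto simp: mult_ac)
          also have "ennreal (4 * A * L j / r) * ennreal e = ennreal (4 * A * L j / r * e)" using e A L[of j] r by (intro ennreal_mult[symmetric]) auto
          also have "ennreal (4 * A * L j / r * e) * \<Phi> (K x) \<le> ennreal (4 * A * c3) * G x"
          proof -
            have "4 * A * L j / r * e \<le> 4 * A * c3 * (1 / W)"
            proof -
              have "L j * (W * e) \<le> 1 * (c3 * r)" using W2 L[of j] W(1) e by (intro mult_mono[of "L j" 1 "W * e" "c3 * r"]) auto
              hence "L j * e / r \<le> c3 / W" using W(1) r by (simp add: field_simps)
              hence "4 * A * (L j * e / r) \<le> 4 * A * (c3 / W)" using A by (intro mult_left_mono) auto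
              thus ?thesis by simp
            qed
            hence "ennreal (4 * A * L j / r * e) * \<Phi> (K x) \<le> ennreal (4 * A * c3 * (1 / W)) * \<Phi> (K x)"
              by (intro mult_right_mono ennreal_leI) auto
            also have "... = ennreal (4 * A * c3) * (ennreal (inverse W) * \<Phi> (K x))"
              using A c3 W(1) by (subst ennreal_mult) (auto simp: mult.assoc inverse_eq_divide)
            also have "ennreal (inverse W) * \<Phi> (K x) = G x"
              using W(1) by (simp add: G_def W_def[symmetric] divide_ennreal_def inverse_ennreal mult.commute)
            finally show ?thesis .
          qed
          finally show ?thesis using True by (simp add: add_left_mono)
        qed simp
      qed
    qed
    also have "... = ennreal (4 * A * L j / r) * emeasure lebesgue (Sh j) + ennreal (4 * A * c3) * g j"
    proof -
      have m1: "(\<lambda>x. ennreal (4 * A * L j / r) * indicator (Sh j) x) \<in> borel_measurable lebesgue"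
        by (intro borel_measurable_times_ennreal borel_measurable_const borel_measurable_indicator Sh(1))
      have m2: "(\<lambda>x. ennreal (4 * A * c3) * (G x * indicator (Sh j) x)) \<in> borel_measurable lebesgue"
        by (intro borel_measurable_times_ennreal borel_measurable_const Gm)
      show ?thesis unfolding nn_integral_add[OF m1 m2] nn_integral_cmult[OF Gm] nn_integral_cmult_indicator[OF Sh(1)] g_def ..
    qed
    also have "ennreal (4 * A * L j / r) * emeasure lebesgue (Sh j) \<le> ennreal (4 * A * L j / r) * ennreal (c2 * r)"
      unfolding r_def by (intro mult_left_mono vol[OF j]) simp
    also have "... = ennreal (4 * A * c2 * L j)"
      using A L[of j] r c2 by (subst ennreal_mult[symmetric]) (auto simp: mult_ac)
    finally show ?thesis by (simp add: add_right_mono)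
  qed
  define \<Lambda> where "\<Lambda> = (\<Sum>j<J. L j)"
  have \<Lambda>: "\<Lambda> \<ge> 0" using L by (simp add: \<Lambda>_def sum_nonneg)
  have "ennreal (\<theta> / 2 * \<Lambda>) \<le> ennreal (\<Sum>j<J. \<mu> j * (b j - a j))"
  proof (rule ennreal_leI)
    have "\<theta> / 2 * \<Lambda> = (\<Sum>j<J. \<mu> j * (\<rho> j / 2))"
      unfolding \<Lambda>_def sum_distrib_left
    proof (rule sum.cong[OF refl])
      fix j show "\<theta> / 2 * L j = \<mu> j * (\<rho> j / 2)" using \<rho>(1)[of j] by (simp add: \<mu>_def)
    qed
    also have "... \<le> (\<Sum>j<J. \<mu> j * (b j - a j))" using \<mu> \<rho>(2) by (intro sum_mono mult_left_mono) auto
    finally show "\<theta> / 2 * \<Lambda> \<le> (\<Sum>j<J. \<mu> j * (b j - a j))" .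
  qed
  also have "... \<le> ennreal C * ((\<Sum>j<J. ennreal (\<mu> j ^ ?n) * (\<integral>\<^sup>+x\<in>Sh j. K x \<partial>lebesgue)) + 1)" by (rule ring[OF \<mu>])
  also have "... \<le> ennreal C * ((\<Sum>j<J. ennreal (4 * A * c2 * L j) + ennreal (4 * A * c3) * g j) + 1)"
    by (intro mult_left_mono add_right_mono sum_mono T) auto
  also have "(\<Sum>j<J. ennreal (4 * A * c2 * L j) + ennreal (4 * A * c3) * g j) = ennreal (4 * A * c2 * \<Lambda>) + ennreal (4 * A * c3) * (\<Sum>j<J. g j)"
  proof -
    have "(\<Sum>j<J. ennreal (4 * A * c2 * L j)) = ennreal (\<Sum>j<J. 4 * A * c2 * L j)" using A c2 L by (intro sum_ennreal) auto
    thus ?thesis by (simp add: sum.distrib \<Lambda>_def sum_distrib_left[symmetric])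
  qed
  also have "ennreal C * (ennreal (4 * A * c2 * \<Lambda>) + ennreal (4 * A * c3) * (\<Sum>j<J. g j) + 1) \<le> ennreal C * (ennreal (4 * A * c2 * \<Lambda>) + ennreal (4 * A * c3) * ennreal M + 1)"
    by (intro mult_left_mono add_mono gsum order_refl) auto
  also have "... = ennreal (C * (4 * A * c2 * \<Lambda> + 4 * A * c3 * M + 1))"
    using A c2 c3 M(2) \<Lambda> C by (simp add: ennreal_mult)
  finally have "\<theta> / 2 * \<Lambda> \<le> C * (4 * A * c2 * \<Lambda> + 4 * A * c3 * M + 1)"
    using A c2 c3 M(2) \<Lambda> C by (subst (asm) ennreal_le_iff) auto
  also have "... = A * (4 * C * c2 * \<Lambda>) + C * (A * (4 * c3 * M) + 1)" by (simp add: algebra_simps)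
  also have "... \<le> (\<theta> * \<theta>) * (4 * C * c2 * \<Lambda>) + C * (1 * (4 * c3 * M) + 1)"
    using A c2 c3 M(2) \<Lambda> C by (intro add_mono mult_right_mono mult_left_mono) auto
  also have "(\<theta> * \<theta>) * (4 * C * c2 * \<Lambda>) \<le> \<theta> / 4 * \<Lambda>"
  proof -
    have "\<theta> * (16 * C * c2) \<le> 1" using q by (simp add: \<theta>_def)
    hence "(\<theta> * \<Lambda> / 4) * (\<theta> * (16 * C * c2)) \<le> (\<theta> * \<Lambda> / 4) * 1" using \<theta> \<Lambda> by (intro mult_left_mono) auto
    thus ?thesis by (simp add: algebra_simps)
  qed
  finally have "\<theta> / 4 * \<Lambda> \<le> C * (4 * c3 * M + 1)" by (simp add: field_simps)
  hence "\<theta> * \<Lambda> \<le> 4 * C * (4 * c3 * M + 1)" by simp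
  hence "\<Lambda> \<le> 4 * C * (4 * c3 * M + 1) / \<theta>" using \<theta> by (simp add: pos_le_divide_eq mult.commute)
  thus ?thesis unfolding \<Lambda>_def \<theta>_def by simp
qed

section \<open>Members of the class read in the finite chart\<close>

lemma S_class_continuous: "f \<in> S_class D \<Phi> M \<Delta> ==> continuous_on D f \<and> inj_on f D"
  unfolding S_class_def homeomorphism_def by (auto intro: inj_on_inverseI)

lemma rep_dom_id: "rep_dom id id D f = {x. Fin x \<in> D \<and> f (Fin x) \<noteq> Infty}"
  by (simp add: rep_dom_def)

lemma Fin_rep_id: "x \<in> rep_dom id id D f ==> f (Fin x) = Fin (rep id id f x)"
  by (simp add: rep_dom_def rep_def)

text \<open>Points with value \<open>Infty\<close> are left out of U. The crossing points used later
  have finite values, since these lie on a broken line in \<open>real^'n\<close>.\<close>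

lemma S_class_sobolev_embedding:
  fixes f :: "(real^'n) cpt => (real^'n) cpt"
  assumes card: "CARD('n) \<ge> 2" and D: "open D" and f: "f \<in> S_class D \<Phi> M \<Delta>"
  shows "sobolev_embedding (rep_dom id id D f) (rep id id f)"
proof
  let ?U = "rep_dom id id D f" and ?F = "rep id id f"
  have cf: "continuous_on D f" and inj: "inj_on f D" using S_class_continuous[OF f] by auto
  have id: "id \<in> charts E" for E :: "(real^'n) cpt set" by (simp add: charts_def)
  have W: "W1_loc ?U CARD('n) ?F" and L1: "L1_loc_ennreal ?U (K_I ?F)" using f id by (auto simp: S_class_def)
  show "2 \<le> CARD('n)" by (rule card)
  have cF: "continuous_on UNIV (Fin :: real^'n => _)" by (intro continuous_intros)
  have oV: "open (Fin -` D)" by (rule open_vimage[OF D cF])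
  have c2: "continuous_on (Fin -` D) (\<lambda>x. f (Fin x))"
    by (rule continuous_on_compose2[OF cf continuous_on_subset[OF cF]]) auto
  have "open ((\<lambda>x. f (Fin x)) -` (- {Infty}) \<inter> Fin -` D)"
    by (rule continuous_on_open_vimage[OF oV, THEN iffD1, rule_format, OF c2]) auto
  moreover have "(\<lambda>x. f (Fin x)) -` (- {Infty}) \<inter> Fin -` D = ?U" by (auto simp: rep_dom_id)
  ultimately show oU: "open ?U" by simp
  have "continuous_on ?U (\<lambda>x. the_fin (f (Fin x)))"
  proof (rule continuous_on_compose2[OF continuous_on_the_fin])
    show "continuous_on ?U (\<lambda>x. f (Fin x))" by (rule continuous_on_subset[OF c2]) (auto simp: rep_dom_id)
  qed (auto simp: rep_dom_id)
  thus "continuous_on ?U ?F" by (simp add: rep_def[abs_def])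
  show "inj_on ?F ?U"
  proof (rule inj_onI)
    fix x y assume xy: "x \<in> ?U" "y \<in> ?U" "?F x = ?F y"
    hence "f (Fin x) = f (Fin y)" using Fin_rep_id[OF xy(1)] Fin_rep_id[OF xy(2)] by simp
    hence "Fin x = Fin y" by (rule inj_onD[OF inj]) (use xy in \<open>auto simp: rep_dom_id\<close>)
    thus "x = y" by simp
  qed
  show "W1_loc ?U CARD('n) ?F" by (rule W)
  show m: "(\<lambda>x. K_I ?F x * indicator ?U x) \<in> borel_measurable lebesgue" using L1 by (simp add: L1_loc_ennreal_def)
  show "negligible {x \<in> ?U. K_I ?F x = \<infinity>}"
  \<comment> \<open>Integrability of \<open>K_I\<close> is local, so its infinite set is shown to be
    null near each of its points.\<close>
  proof (subst locally_negligible_alt, intro ballI)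
    fix x assume x: "x \<in> {x \<in> ?U. K_I ?F x = \<infinity>}"
    then obtain e where e: "e > 0" "cball x e \<subseteq> ?U" using oU open_contains_cball by blast
    have "(\<integral>\<^sup>+y\<in>cball x e. K_I ?F y \<partial>lebesgue) < \<infinity>" using L1 e(2) by (simp add: L1_loc_ennreal_def)
    moreover have "(\<lambda>y. K_I ?F y * indicator ?U y * indicator (cball x e) y) \<in> borel_measurable lebesgue"
      by (intro borel_measurable_times_ennreal m borel_measurable_indicator) simp
    moreover have "K_I ?F y * indicator ?U y * indicator (cball x e) y = K_I ?F y * indicator (cball x e) y" for y
      using e(2) by (auto simp: indicator_def)
    ultimately have ms: "(\<lambda>y. K_I ?F y * indicator (cball x e) y) \<in> borel_measurable lebesgue"
      and fi: "(\<integral>\<^sup>+y\<in>cball x e. K_I ?F y \<partial>lebesgue) \<noteq> \<infinity>" by auto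
    have "emeasure lebesgue ((\<lambda>y. K_I ?F y * indicator (cball x e) y) -` {\<infinity>} \<inter> space lebesgue) = 0"
      by (rule nn_integral_PInf[OF ms fi])
    moreover have "(\<lambda>y. K_I ?F y * indicator (cball x e) y) -` {\<infinity>} \<inter> space lebesgue \<in> sets lebesgue"
      by (rule measurable_sets[OF ms]) simp
    ultimately have "negligible ((\<lambda>y. K_I ?F y * indicator (cball x e) y) -` {\<infinity>} \<inter> space lebesgue)"
      by (simp add: negligible_iff_null_sets null_sets_def)
    hence "negligible ({x \<in> ?U. K_I ?F x = \<infinity>} \<inter> ball x e)" by (rule negligible_subset) auto
    moreover have "openin (top_of_set {x \<in> ?U. K_I ?F x = \<infinity>}) ({x \<in> ?U. K_I ?F x = \<infinity>} \<inter> ball x e)" by (rule openin_open_Int) simp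
    ultimately show "\<exists>V. openin (top_of_set {x \<in> ?U. K_I ?F x = \<infinity>}) V \<and> x \<in> V \<and> negligible V"
      using x e(1) by (intro exI[of _ "{x \<in> ?U. K_I ?F x = \<infinity>} \<inter> ball x e"]) simp
  qed
qed

section \<open>Cubes, compactness and normal families\<close>

lemma infnorm_le_iff_cbox:
  fixes x :: "'a::euclidean_space"
  shows "infnorm (x - c) \<le> r \<longleftrightarrow> x \<in> cbox (c - r *\<^sub>R One) (c + r *\<^sub>R One)"
proof -
  have "infnorm (x - c) \<le> r \<longleftrightarrow> (\<forall>i\<in>Basis. \<bar>(x - c) \<bullet> i\<bar> \<le> r)" unfolding infnorm_Max by simp
  also have "... \<longleftrightarrow> x \<in> cbox (c - r *\<^sub>R One) (c + r *\<^sub>R One)"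
    by (auto simp: mem_box inner_diff_left inner_add_left abs_le_iff algebra_simps)
  finally show ?thesis .
qed

lemma infnorm_less_iff_box:
  fixes x :: "'a::euclidean_space"
  shows "infnorm (x - c) < r \<longleftrightarrow> x \<in> box (c - r *\<^sub>R One) (c + r *\<^sub>R One)"
proof -
  have "infnorm (x - c) < r \<longleftrightarrow> (\<forall>i\<in>Basis. \<bar>(x - c) \<bullet> i\<bar> < r)" unfolding infnorm_Max by simp
  also have "... \<longleftrightarrow> x \<in> box (c - r *\<^sub>R One) (c + r *\<^sub>R One)"
    by (auto simp: mem_box inner_diff_left inner_add_left abs_less_iff algebra_simps)
  finally show ?thesis .
qed

lemma emeasure_cube_le:
  assumes "r \<ge> 0" "S \<subseteq> {x :: real^'n. infnorm (x - c) < r}" "S \<in> sets lebesgue"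
  shows "emeasure lebesgue S \<le> ennreal ((2 * r) ^ CARD('n))"
proof -
  have "emeasure lebesgue S \<le> emeasure lebesgue (cbox (c - r *\<^sub>R One) (c + r *\<^sub>R One))"
    using assms(2) by (intro emeasure_mono) (auto simp: infnorm_le_iff_cbox[symmetric] dest!: subsetD)
  also have "... = emeasure lborel (cbox (c - r *\<^sub>R One) (c + r *\<^sub>R One))" by simp
  also have "... = ennreal (\<Prod>b\<in>(Basis :: (real^'n) set). ((c + r *\<^sub>R One) - (c - r *\<^sub>R One)) \<bullet> b)"
    using assms(1) by (intro emeasure_lborel_cbox) (auto simp: inner_diff_left inner_add_left)
  also have "(\<Prod>b\<in>(Basis :: (real^'n) set). ((c + r *\<^sub>R One) - (c - r *\<^sub>R One)) \<bullet> b) = (2 * r) ^ CARD('n)"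
  proof -
    have "((c + r *\<^sub>R One) - (c - r *\<^sub>R One)) \<bullet> b = 2 * r" if "b \<in> Basis" for b
      using that by (simp only: inner_diff_left inner_add_left inner_scaleR_left) simp
    hence "(\<Prod>b\<in>(Basis :: (real^'n) set). ((c + r *\<^sub>R One) - (c - r *\<^sub>R One)) \<bullet> b) = (\<Prod>b\<in>(Basis :: (real^'n) set). 2 * r)"
      by (intro prod.cong) auto
    thus ?thesis by simp
  qed
  finally show ?thesis .
qed

lemma inversion_ball_eq:
  fixes R :: real
  assumes "R > 0"
  shows "inversion ` (Fin ` cball 0 (1 / R)) = - Fin ` ball (0 :: 'a::real_inner) R"
    "inversion ` (Fin ` ball 0 (1 / R)) = - Fin ` cball (0 :: 'a) R"
proof -
  have mem: "q \<in> inversion ` X \<longleftrightarrow> inversion q \<in> X" for q :: "'a cpt" and X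
    by (metis image_eqI imageE inversion_inversion)
  have nrm: "norm (x /\<^sub>R (norm x)\<^sup>2) = 1 / norm x" if "x \<noteq> 0" for x :: 'a
    using that by (simp add: power2_eq_square field_simps)
  have "q \<in> inversion ` (Fin ` cball 0 (1 / R)) \<longleftrightarrow> q \<in> - Fin ` ball 0 R" for q :: "'a cpt"
  proof (cases q)
    case (Fin x)
    show ?thesis
    proof (cases "x = 0")
      case False
      hence "q \<in> inversion ` (Fin ` cball 0 (1 / R)) \<longleftrightarrow> norm (x /\<^sub>R (norm x)\<^sup>2) \<le> 1 / R"
        unfolding mem Fin by (auto simp: image_iff)
      also have "... \<longleftrightarrow> R \<le> norm x" unfolding nrm[OF False] using False assms by (simp add: field_simps)
      finally show ?thesis using Fin by auto
    qed (unfold mem, use Fin assms in auto)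
  qed (unfold mem, use assms in auto)
  thus "inversion ` (Fin ` cball 0 (1 / R)) = - Fin ` ball (0 :: 'a) R" by blast
  have "q \<in> inversion ` (Fin ` ball 0 (1 / R)) \<longleftrightarrow> q \<in> - Fin ` cball 0 R" for q :: "'a cpt"
  proof (cases q)
    case (Fin x)
    show ?thesis
    proof (cases "x = 0")
      case False
      hence "q \<in> inversion ` (Fin ` ball 0 (1 / R)) \<longleftrightarrow> norm (x /\<^sub>R (norm x)\<^sup>2) < 1 / R"
        unfolding mem Fin by (auto simp: image_iff)
      also have "... \<longleftrightarrow> R < norm x" unfolding nrm[OF False] using False assms by (simp add: field_simps)
      finally show ?thesis using Fin by auto
    qed (unfold mem, use Fin assms in auto)
  qed (unfold mem, use assms in auto)
  thus "inversion ` (Fin ` ball 0 (1 / R)) = - Fin ` cball (0 :: 'a) R" by blast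
qed

lemma compact_cpt: "compact (UNIV :: 'a::euclidean_space cpt set)"
proof -
  have c: "compact (Fin ` cball (0::'a) 1)" by (rule compact_continuous_image) (auto intro!: continuous_intros)
  hence "compact (inversion ` (Fin ` cball (0::'a) 1))" by (rule compact_continuous_image[OF continuous_on_inversion])
  hence "compact (- Fin ` ball (0::'a) 1)" using inversion_ball_eq(1)[of 1, where 'a = 'a] by simp
  from compact_Un[OF c this] have "compact (Fin ` cball (0::'a) 1 \<union> - Fin ` ball (0::'a) 1)" .
  moreover have "Fin ` cball (0::'a) 1 \<union> - Fin ` ball (0::'a) 1 = UNIV" by auto
  ultimately show ?thesis by simp
qed

text \<open>\<open>stereo\<close> moves the values into a bounded part of a normed space, where a
  diagonal subsequence exists. As it is isometric, the Cauchy property comes back, and compactness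
  provides the limits.\<close>

lemma equicontinuous_imp_normal:
  fixes F :: "('a::euclidean_space cpt => 'b::euclidean_space cpt) set"
  assumes D: "open D" and eq: "equicontinuous_family D F" and cont: "\<And>f. f \<in> F ==> continuous_on D f"
  shows "normal_family D F"
  unfolding normal_family_def
proof (intro conjI ballI allI impI)
  fix s :: "nat => 'a cpt => 'b cpt" assume sF: "\<forall>k. s k \<in> F"
  obtain T where T: "countable T" "T \<subseteq> {x. Fin x \<in> D}" "{x. Fin x \<in> D} \<subseteq> closure T" by (rule separable)
  \<comment> \<open>\<open>Infty\<close> is added because T is dense only among the finite points of
    D; if it lies outside D, it is one more harmless point for the diagonal argument.\<close>
  define S where "S = insert Infty (Fin ` T)"
  have cS: "countable S" using T(1) by (simp add: S_def)
  have bd: "bounded (range (\<lambda>q :: 'b cpt. stereo q))"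
  proof -
    have "continuous_on UNIV (stereo :: 'b cpt => _)" unfolding continuous_on_iff
      by (auto simp: dist_cpt_def chordal_eq_stereo)
    hence "compact (range (stereo :: 'b cpt => _))" by (rule compact_continuous_image[OF _ compact_cpt])
    thus ?thesis by (rule compact_imp_bounded)
  qed
  then obtain B where B: "\<And>q :: 'b cpt. norm (stereo q) \<le> B" unfolding bounded_iff by blast
  obtain r where r: "strict_mono (r :: nat => nat)" "\<And>x. x \<in> S ==> \<exists>l. (\<lambda>n. stereo (s (r n) x)) \<longlonglongrightarrow> l"
    by (rule function_convergent_subsequence[OF cS, of "\<lambda>n x. stereo (s n x)" B]) (use B in blast)+
  have CauS: "Cauchy (\<lambda>n. s (r n) x)" if "x \<in> S" for x
  proof -
    have "Cauchy (\<lambda>n. stereo (s (r n) x))" using r(2)[OF that] LIMSEQ_imp_Cauchy by blast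
    thus ?thesis unfolding Cauchy_def by (simp add: dist_cpt_def chordal_eq_stereo)
  qed
  have eqc: "\<exists>U. open U \<and> x0 \<in> U \<and> (\<forall>n. \<forall>x\<in>U \<inter> D. dist (s (r n) x) (s (r n) x0) < e)" if "x0 \<in> D" "e > 0" for x0 e
    using eq that sF unfolding equicontinuous_family_def by meson
  have Cau: "Cauchy (\<lambda>n. s (r n) x0)" if x0: "x0 \<in> D" for x0
  proof (rule metric_CauchyI)
    fix e :: real assume e: "e > 0"
    obtain U where U: "open U" "x0 \<in> U" "\<And>n x. x \<in> U \<inter> D ==> dist (s (r n) x) (s (r n) x0) < e / 3"
      using eqc[OF x0, of "e / 3"] e by auto
    have "\<exists>y\<in>S. y \<in> U \<inter> D"
    proof (cases x0)
      case Infty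
      thus ?thesis using U(2) x0 by (auto simp: S_def)
    next
      case (Fin v)
      have "continuous_on UNIV (Fin :: 'a => 'a cpt)" by (intro continuous_intros)
      hence "open (Fin -` (U \<inter> D))" using U(1) D by (intro open_vimage) auto
      moreover have "v \<in> closure T" using T(3) x0 Fin by blast
      ultimately have "Fin -` (U \<inter> D) \<inter> T \<noteq> {}" using U(2) x0 Fin
        by (metis IntI closure_iff_nhds_not_empty empty_iff vimageI subset_refl Int_commute)
      thus ?thesis by (auto simp: S_def)
    qed
    then obtain y where y: "y \<in> S" "y \<in> U \<inter> D" by blast
    obtain N where N: "\<And>m n. m \<ge> N ==> n \<ge> N ==> dist (s (r m) y) (s (r n) y) < e / 3"
      using metric_CauchyD[OF CauS[OF y(1)], of "e / 3"] e by auto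
    have "dist (s (r m) x0) (s (r n) x0) < e" if "m \<ge> N" "n \<ge> N" for m n
    proof -
      have "dist (s (r m) x0) (s (r n) x0) \<le> dist (s (r m) y) (s (r m) x0) + dist (s (r m) y) (s (r n) y) + dist (s (r n) y) (s (r n) x0)"
        using dist_triangle[of "s (r m) x0" "s (r n) x0" "s (r m) y"] dist_triangle[of "s (r m) y" "s (r n) x0" "s (r n) y"] by (simp add: dist_commute)
      thus ?thesis using U(3)[OF y(2), of m] U(3)[OF y(2), of n] N[OF that] by linarith
    qed
    thus "\<exists>M. \<forall>m\<ge>M. \<forall>n\<ge>M. dist (s (r m) x0) (s (r n) x0) < e" by blast
  qed
  have "\<exists>l. (\<lambda>n. s (r n) x) \<longlonglongrightarrow> l" if "x \<in> D" for x
    using Cau[OF that] compact_imp_complete[OF compact_cpt] unfolding complete_def by blast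
  then obtain g where g: "\<And>x. x \<in> D ==> (\<lambda>n. s (r n) x) \<longlonglongrightarrow> g x" by metis
  have gl: "\<exists>U. open U \<and> x0 \<in> U \<and> (\<forall>n. \<forall>x\<in>U \<inter> D. dist (s (r n) x) (s (r n) x0) < e) \<and> (\<forall>x\<in>U \<inter> D. dist (g x) (g x0) \<le> e)"
    if x0: "x0 \<in> D" and e: "e > 0" for x0 e
  proof -
    obtain U where U: "open U" "x0 \<in> U" "\<forall>n. \<forall>x\<in>U \<inter> D. dist (s (r n) x) (s (r n) x0) < e" using eqc[OF x0 e] by blast
    have "dist (g x) (g x0) \<le> e" if x: "x \<in> U \<inter> D" for x
    proof (rule LIMSEQ_le_const2)
      show "(\<lambda>n. dist (s (r n) x) (s (r n) x0)) \<longlonglongrightarrow> dist (g x) (g x0)" using x x0 by (intro tendsto_dist g) auto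
      show "\<exists>N. \<forall>n\<ge>N. dist (s (r n) x) (s (r n) x0) \<le> e" using U(3) x by (meson less_imp_le)
    qed
    thus ?thesis using U by blast
  qed
  have "continuous_on D g" unfolding continuous_on_topological
  proof (intro ballI allI impI)
    fix x0 V assume x0: "x0 \<in> D" and V: "open V" "g x0 \<in> V"
    then obtain e where e: "e > 0" "\<And>y. dist y (g x0) < e ==> y \<in> V" unfolding open_dist by blast
    obtain U where U: "open U" "x0 \<in> U" "\<forall>x\<in>U \<inter> D. dist (g x) (g x0) \<le> e / 2" using gl[OF x0, of "e / 2"] e(1) by auto
    have "g y \<in> V" if "y \<in> D" "y \<in> U" for y
    proof (rule e(2))
      have "dist (g y) (g x0) \<le> e / 2" using U(3) that by blast
      thus "dist (g y) (g x0) < e" using e(1) by linarith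
    qed
    thus "\<exists>A. open A \<and> x0 \<in> A \<and> (\<forall>y\<in>D. y \<in> A \<longrightarrow> g y \<in> V)" using U by blast
  qed
  moreover have "uniform_limit K (s \<circ> r) g sequentially" if K: "compact K" "K \<subseteq> D" for K
  proof (rule uniform_limitI)
    fix e :: real assume e: "e > 0"
    define P where "P x0 U \<longleftrightarrow> open U \<and> x0 \<in> U \<and> (\<forall>n. \<forall>x\<in>U \<inter> D. dist (s (r n) x) (s (r n) x0) < e / 4) \<and> (\<forall>x\<in>U \<inter> D. dist (g x) (g x0) \<le> e / 4)" for x0 U
    have "\<forall>x0\<in>K. \<exists>U. P x0 U" unfolding P_def using gl K(2) e by (metis subsetD zero_less_divide_iff zero_less_numeral)
    from bchoice[OF this] obtain U where U: "\<forall>x0\<in>K. P x0 (U x0)" by blast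
    have "\<And>T. T \<in> U ` K ==> open T" "K \<subseteq> \<Union>(U ` K)" using U by (auto simp: P_def)
    then obtain Q where Q: "Q \<subseteq> U ` K" "finite Q" "K \<subseteq> \<Union>Q" using compactE[OF K(1)] by metis
    obtain Z where Z: "Z \<subseteq> K" "finite Z" "Q = U ` Z" using finite_subset_image[OF Q(2,1)] by blast
    have "\<forall>\<^sub>F n in sequentially. \<forall>c\<in>Z. dist (s (r n) c) (g c) < e / 4"
    proof (rule eventually_ball_finite[OF Z(2)], rule ballI)
      fix c assume "c \<in> Z"
      hence "(\<lambda>n. s (r n) c) \<longlonglongrightarrow> g c" using Z(1) K(2) by (intro g) blast
      thus "\<forall>\<^sub>F n in sequentially. dist (s (r n) c) (g c) < e / 4" by (rule tendstoD) (use e in simp)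
    qed
    thus "\<forall>\<^sub>F n in sequentially. \<forall>x\<in>K. dist ((s \<circ> r) n x) (g x) < e"
    proof eventually_elim
      case (elim n)
      show ?case
      proof
        fix x assume x: "x \<in> K"
        then obtain c where c: "c \<in> Z" "x \<in> U c" using Q(3) Z(3) by blast
        have P: "P c (U c)" using U c(1) Z(1) by blast
        have xd: "x \<in> U c \<inter> D" using c x K(2) by blast
        have "dist (s (r n) x) (s (r n) c) < e / 4" "dist (g x) (g c) \<le> e / 4" using P xd unfolding P_def by blast+
        moreover have "dist (s (r n) c) (g c) < e / 4" using elim c(1) by blast
        moreover have "dist (s (r n) x) (g x) \<le> dist (s (r n) x) (s (r n) c) + dist (s (r n) c) (g c) + dist (g x) (g c)"
          using dist_triangle[of "s (r n) x" "g x" "s (r n) c"] dist_triangle[of "s (r n) c" "g x" "g c"] by (simp add: dist_commute)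
        ultimately show "dist ((s \<circ> r) n x) (g x) < e" using e by simp
      qed
    qed
  qed
  ultimately show "\<exists>r g. strict_mono r \<and> continuous_on D g \<and> (\<forall>K. compact K \<and> K \<subseteq> D \<longrightarrow> uniform_limit K (s \<circ> r) g sequentially)"
    using r(1) by blast
qed (rule cont)

section \<open>Equicontinuity\<close>

text \<open>The chart \<open>\<alpha>\<close> and the closed neighbourhoods of \<open>E0\<close>
  with boundary on a cube surface are kept abstract, so that shrinking shells at a finite point and
  growing shells at infinity share one proof. The bound contains nothing that depends on f.\<close>

lemma oscillation_weight_bound:
  fixes f :: "(real^'n) cpt => (real^'n) cpt" and x0 x1 :: "real^'n" and L \<rho> a b :: "nat => real"
  assumes card: "CARD('n) \<ge> 2" and D: "open D" and f: "f \<in> S_class D \<Phi> M \<Delta>" and \<Delta>: "\<Delta> > 0" and M: "M > 0"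
    and \<alpha>: "\<alpha> = id \<or> \<alpha> = inversion" and C: "\<alpha> ` (Fin ` cball x1 \<rho>1) \<subseteq> D"
    and E0: "compact E0" "connected E0" "E0 \<subseteq> D" "p0 \<in> E0" "p1 \<in> E0" and d: "0 < d" "d \<le> dist (f p0) (f p1)"
    and Kc: "Fin ` {x. lo \<le> infnorm (x - x0) \<and> infnorm (x - x0) \<le> hi} \<subseteq> \<alpha> ` (Fin ` ball x1 \<rho>1)"
      "compact {x. lo \<le> infnorm (x - x0) \<and> infnorm (x - x0) \<le> hi}"
      "Fin ` {x. lo \<le> infnorm (x - x0) \<and> infnorm (x - x0) \<le> hi} \<inter> E0 = {}"
    and ab: "\<And>j. j < J ==> lo \<le> a j \<and> a j < b j \<and> b j \<le> hi" and disj: "disjoint_family_on (\<lambda>j. {a j<..<b j}) {..<J}"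
    and sepset: "\<And>r. lo < r ==> r < hi ==> \<exists>I Cr. open I \<and> E0 \<subseteq> I \<and> I \<subseteq> Cr \<and> compact Cr \<and>
        Cr \<subseteq> I \<union> Fin ` {x. infnorm (x - x0) = r} \<and> Cr \<subseteq> \<alpha> ` (Fin ` cball x1 \<rho>1)"
    and s: "s = min d (\<Delta> / 2) / 2" and R: "R = 1 / s + s"
    and CV: "\<And>z :: real^'n. (\<integral>\<^sup>+y. ennreal (riesz (real CARD('n) * (1 + R) * (2 * R + 1)) z y) \<partial>lborel) \<le> ennreal CV" and CV0: "CV \<ge> 0"
    and \<Phi>: "mono \<Phi>" and L: "\<And>j. 0 \<le> L j \<and> L j \<le> 1"
    and key: "\<And>j k. 0 \<le> k ==> ennreal (L j ^ (CARD('n) - 1)) * ennreal k \<le> 4 * (1 + ennreal (1 / 2 ^ (CARD('n) * j)) * \<Phi> (ennreal k))"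
    and \<rho>: "\<And>j. \<rho> j > 0" "\<And>j. j < J ==> \<rho> j / 2 \<le> b j - a j" "\<And>j. j < J ==> b j \<le> 2 * \<rho> j"
    and wt: "\<And>j x. j < J ==> infnorm (x - x0) < b j ==> (1 + (norm x)\<^sup>2) ^ CARD('n) \<le> c3 * (2 ^ j * \<rho> j) ^ CARD('n)" and c3: "c3 \<ge> 0"
    and Cst: "Cst = 2 * real CARD('n) * distortion_const CARD('n) R (2 * R + 1) * (12 / sqrt s + 2 * CV)"
  shows "(\<Sum>j<J. L j) \<le> 4 * Cst * (4 * c3 * M + 1) * (16 * Cst * 4 ^ CARD('n) + 1)"
proof -
  define U where "U = rep_dom id id D f"
  define F where "F = rep id id f"
  interpret SE: sobolev_embedding U F unfolding U_def F_def by (rule S_class_sobolev_embedding[OF card D f])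
  have cf: "continuous_on D f" and inj: "inj_on f D" using S_class_continuous[OF f] by auto
  have UF: "x \<in> U \<longleftrightarrow> Fin x \<in> D \<and> f (Fin x) \<noteq> Infty" "x \<in> U ==> f (Fin x) = Fin (F x)" for x
    using Fin_rep_id[of x D f] by (auto simp: U_def F_def rep_dom_id)
  define Sh where "Sh j = {x \<in> U. a j < infnorm (x - x0) \<and> infnorm (x - x0) < b j}" for j
  have Sh_shell: "SE.shell x0 (a j) (b j) = Sh j" for j by (simp add: SE.shell_def Sh_def)
  have s0: "s > 0" "2 * s \<le> d" "2 * s \<le> \<Delta> / 2" using d \<Delta> by (auto simp: s)
  have R0: "R \<ge> 0" using s0 by (simp add: R)
  have Cst0: "Cst \<ge> 0" using R0 CV0 s0 by (simp add: Cst distortion_const_def)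
  let ?K = "{x. lo \<le> infnorm (x - x0) \<and> infnorm (x - x0) \<le> hi}"
  let ?C = "\<alpha> ` (Fin ` cball x1 \<rho>1)" and ?CI = "\<alpha> ` (Fin ` ball x1 \<rho>1)"
  have CIC: "?CI \<subseteq> ?C" by (intro image_mono) auto
  have "inj (inversion :: (real^'n) cpt => _)" by (rule inj_on_inverseI[of _ inversion]) simp
  hence ca: "continuous_on UNIV \<alpha>" and ia: "inj \<alpha>"
    using \<alpha> continuous_on_inversion by (auto simp: id_def)
  have oCI: "open ?CI"
  proof -
    have o: "open (Fin ` ball x1 \<rho>1)" by (rule open_Fin_image) simp
    have "?CI = \<alpha> -` (Fin ` ball x1 \<rho>1)" using \<alpha>
    proof
      assume i: "\<alpha> = inversion"
      show ?thesis unfolding i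
      proof (intro set_eqI iffI)
        fix q assume "q \<in> inversion -` (Fin ` ball x1 \<rho>1)"
        moreover have "q = inversion (inversion q)" by simp
        ultimately show "q \<in> inversion ` (Fin ` ball x1 \<rho>1)" by blast
      next
        fix q assume "q \<in> inversion ` (Fin ` ball x1 \<rho>1)"
        then obtain p where "p \<in> Fin ` ball x1 \<rho>1" "q = inversion p" by blast
        hence "inversion q \<in> Fin ` ball x1 \<rho>1" by (simp only: inversion_inversion)
        thus "q \<in> inversion -` (Fin ` ball x1 \<rho>1)" by (rule vimageI2)
      qed
    qed simp
    thus ?thesis using open_vimage[OF o ca] by simp
  qed
  \<comment> \<open>e is one of the two far values, normalised to be finite. The connected image of
    E0 reaches from e to Euclidean distance d \<ge> 2 s, so it meets every sphere of radius up to
    s.\<close>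
  have z_ex: "\<exists>e. norm e \<le> 1 / s \<and> (\<forall>t. 0 < t \<longrightarrow> t \<le> s \<longrightarrow> (\<exists>z. Fin z \<in> f ` E0 \<and> norm (z - e) = t))"
  proof -
    obtain e q where e: "{f p0, f p1} = {Fin e, q}" "norm e \<le> 2 / d" "q = Infty \<or> norm (the_fin q - e) \<ge> d"
      by (rule far_points_normalise[OF d(2,1)]) (rule that; assumption)
    have "{f p0, f p1} \<subseteq> f ` E0" using E0(4,5) by blast
    hence eE: "Fin e \<in> f ` E0" "q \<in> f ` E0" unfolding e(1) by blast+
    have con: "connected (f ` E0)" by (rule connected_continuous_image[OF continuous_on_subset[OF cf E0(3)] E0(2)])
    have "2 / d \<le> 1 / s" using s0 d(1) by (simp add: field_simps)
    moreover have "\<exists>z. Fin z \<in> f ` E0 \<and> norm (z - e) = t" if "0 < t" "t \<le> s" for t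
      using connected_meets_sphere[OF con eE e(3), of t] that s0 by simp
    ultimately show ?thesis using e(2) order_trans by blast
  qed
  have w_ex: "\<exists>e. norm e \<le> 1 / s \<and> (\<forall>t. 0 < t \<longrightarrow> t \<le> s \<longrightarrow> (\<exists>w. Fin w \<notin> f ` ?C \<and> norm (w - e) = t))"
  proof -
    have "bounded (- f ` D)" using compact_imp_bounded[OF compact_cpt] by (rule bounded_subset) simp
    \<comment> \<open>A number strictly below the diameter is exceeded by an actual pair of omitted
      points; this is the origin of \<open>\<Delta> / 2\<close> in s.\<close>
    moreover have "\<Delta> / 2 < diameter (- f ` D)" using f \<Delta> by (auto simp: S_class_def)
    ultimately obtain p q where pq: "p \<in> - f ` D" "q \<in> - f ` D" "\<Delta> / 2 < dist p q"
      using diameter_lower_bounded[of "- f ` D" "\<Delta> / 2"] \<Delta> by auto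
    have pq': "\<Delta> / 2 \<le> dist p q" "\<Delta> / 2 > 0" using pq \<Delta> by auto
    obtain e r where e: "{p, q} = {Fin e, r}" "norm e \<le> 2 / (\<Delta> / 2)" "r = Infty \<or> norm (the_fin r - e) \<ge> \<Delta> / 2"
      by (rule far_points_normalise[OF pq']) (rule that; assumption)
    have eE: "Fin e \<notin> f ` D" "r \<notin> f ` D" using e(1) pq(1,2) by (auto simp: doubleton_eq_iff)
    define \<phi> where "\<phi> x = f (\<alpha> (Fin x))" for x
    have im: "\<phi> ` cball x1 \<rho>1 = f ` ?C" by (auto simp: \<phi>_def)
    have "continuous_on (cball x1 \<rho>1) (\<lambda>x. \<alpha> (Fin x))"
      by (rule continuous_on_compose2[OF ca]) (auto intro!: continuous_intros)
    hence c: "continuous_on (cball x1 \<rho>1) \<phi>" unfolding \<phi>_def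
      by (rule continuous_on_compose2[OF cf]) (use C in auto)
    have i: "inj_on \<phi> (cball x1 \<rho>1)"
    proof (rule inj_onI)
      fix x y assume xy: "x \<in> cball x1 \<rho>1" "y \<in> cball x1 \<rho>1" "\<phi> x = \<phi> y"
      have "\<alpha> (Fin x) = \<alpha> (Fin y)" by (rule inj_onD[OF inj]) (use xy C in \<open>auto simp: \<phi>_def\<close>)
      thus "x = y" using injD[OF ia] by auto
    qed
    have "2 / (\<Delta> / 2) \<le> 1 / s" using s0 \<Delta> by (simp add: field_simps)
    moreover have "\<exists>w. Fin w \<notin> f ` ?C \<and> norm (w - e) = t" if t: "0 < t" "t \<le> s" for t
    proof -
      have n: "Fin e \<notin> \<phi> ` cball x1 \<rho>1" "r \<notin> \<phi> ` cball x1 \<rho>1" unfolding im using eE C by blast+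
      have "r = Infty \<or> norm (the_fin r - e) > t" using e(3) t s0 by auto
      from sphere_not_in_ball_image[OF _ c i n this t(1)] card show ?thesis unfolding im by auto
    qed
    ultimately show ?thesis using e(2) order_trans by blast
  qed
  obtain e where e: "norm e \<le> 1 / s" "\<And>t. 0 < t ==> t \<le> s ==> \<exists>z. Fin z \<in> f ` E0 \<and> norm (z - e) = t" using z_ex by blast
  obtain e' where e': "norm e' \<le> 1 / s" "\<And>t. 0 < t ==> t \<le> s ==> \<exists>w. Fin w \<notin> f ` ?C \<and> norm (w - e') = t" using w_ex by blast
  have KD: "Fin ` ?K \<subseteq> D" using Kc(1) CIC C by blast
  have clK: "closed {y. Fin y \<in> f ` (Fin ` ?K)}"
  proof (intro closed_Fin_vimage compact_imp_closed compact_continuous_image[OF continuous_on_subset[OF cf KD]])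
    show "compact (Fin ` ?K)" by (rule compact_continuous_image[OF _ Kc(2)]) (intro continuous_intros)
  qed
  have sep: "\<exists>\<eta>>0. \<forall>x\<in>{y. Fin y \<in> f ` (Fin ` ?K)}. \<forall>t\<in>T \<inter> cball 0 R. \<eta> \<le> dist x t"
    if "closed T" "{y. Fin y \<in> f ` (Fin ` ?K)} \<inter> T = {}" for T
    using that by (intro separate_closed_compact[OF clK]) (auto intro: closed_Int_compact)
  have "\<exists>\<eta>>0. \<forall>x\<in>{y. Fin y \<in> f ` (Fin ` ?K)}. \<forall>t\<in>{y. Fin y \<in> f ` E0} \<inter> cball 0 R. \<eta> \<le> dist x t"
  proof (rule sep)
    show "closed {y. Fin y \<in> f ` E0}"
      by (intro closed_Fin_vimage compact_imp_closed compact_continuous_image[OF continuous_on_subset[OF cf E0(3)] E0(1)])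
    have "f ` (Fin ` ?K) \<inter> f ` E0 = f ` (Fin ` ?K \<inter> E0)" by (rule inj_on_image_Int[OF inj KD E0(3), symmetric])
    thus "{y. Fin y \<in> f ` (Fin ` ?K)} \<inter> {y. Fin y \<in> f ` E0} = {}" unfolding Kc(3) by blast
  qed
  then obtain \<eta>1 where \<eta>1: "\<eta>1 > 0" "\<And>x t. Fin x \<in> f ` (Fin ` ?K) ==> Fin t \<in> f ` E0 ==> norm t \<le> R ==> \<eta>1 \<le> norm (x - t)"
    by (auto simp: dist_norm)
  have "\<exists>\<eta>>0. \<forall>x\<in>{y. Fin y \<in> f ` (Fin ` ?K)}. \<forall>t\<in>(- {y. Fin y \<in> f ` ?CI}) \<inter> cball 0 R. \<eta> \<le> dist x t"
  proof (rule sep)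
    have "open {y. Fin y \<in> f ` ?CI}" by (rule homeomorphism_open_values[OF cf inj oCI]) (use CIC C in blast)
    thus "closed (- {y. Fin y \<in> f ` ?CI})" by (rule closed_Compl)
    show "{y. Fin y \<in> f ` (Fin ` ?K)} \<inter> - {y. Fin y \<in> f ` ?CI} = {}" using image_mono[OF Kc(1), of f] by blast
  qed
  then obtain \<eta>2 where \<eta>2: "\<eta>2 > 0" "\<And>x t. Fin x \<in> f ` (Fin ` ?K) ==> Fin t \<notin> f ` ?CI ==> norm t \<le> R ==> \<eta>2 \<le> norm (x - t)"
    by (auto simp: dist_norm)
  \<comment> \<open>A compactness constant that depends on f. It enters only through the number N of
    centres, which drops out of \<open>ring_inequality\<close>.\<close>
  define \<eta> where "\<eta> = min \<eta>1 \<eta>2"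
  have \<eta>: "\<eta> > 0" "\<eta> \<le> \<eta>1" "\<eta> \<le> \<eta>2" using \<eta>1(1) \<eta>2(1) by (auto simp: \<eta>_def)
  obtain N0 where N0: "s / \<eta> \<le> real N0" using real_arch_simple by blast
  define N where "N = max 1 N0"
  have N: "N \<ge> 1" "s / real N \<le> \<eta>"
  proof -
    have "s / \<eta> \<le> real N" using N0 by (simp add: N_def)
    moreover show "N \<ge> 1" by (simp add: N_def)
    ultimately show "s / real N \<le> \<eta>" using \<eta>(1) by (simp add: field_simps)
  qed
  have tl: "0 < real l * (s / real N)" "real l * (s / real N) \<le> s" if "l \<in> {1..N}" for l
    using that s0(1) by (auto simp: field_simps)
  have "\<forall>l\<in>{1..N}. \<exists>z. Fin z \<in> f ` E0 \<and> norm (z - e) = real l * (s / real N)" using e(2) tl by blast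
  from bchoice[OF this] obtain z where z: "\<And>l. l \<in> {1..N} ==> Fin (z l) \<in> f ` E0 \<and> norm (z l - e) = real l * (s / real N)" by blast
  have "\<forall>l\<in>{1..N}. \<exists>w. Fin w \<notin> f ` ?C \<and> norm (w - e') = real l * (s / real N)" using e'(2) tl by blast
  from bchoice[OF this] obtain w where w: "\<And>l. l \<in> {1..N} ==> Fin (w l) \<notin> f ` ?C \<and> norm (w l - e') = real l * (s / real N)" by blast
  have zwR: "norm (z l) \<le> R \<and> norm (w l) \<le> R" if l: "l \<in> {1..N}" for l
    using z[OF l] w[OF l] tl[OF l] e(1) e'(1) norm_triangle_ineq[of e "z l - e"] norm_triangle_ineq[of e' "w l - e'"]
    unfolding R by auto
  have ring: "ennreal (\<Sum>j<J. \<mu> j * (b j - a j)) \<le> ennreal Cst * ((\<Sum>j<J. ennreal (\<mu> j ^ CARD('n)) * (\<integral>\<^sup>+x\<in>Sh j. K_I F x \<partial>lebesgue)) + 1)"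
    if \<mu>: "\<And>j. 0 \<le> \<mu> j" for \<mu>
    unfolding Cst Sh_shell[symmetric]
  proof (rule SE.ring_inequality[OF s0(1) N(1) zwR, where e = e and e' = e'])
    show "norm (z l - e) = real l * (s / real N) \<and> norm (w l - e') = real l * (s / real N)" if "l \<in> {1..N}" for l
      using z[OF that] w[OF that] by blast
    show "s / real N \<le> norm (F x - z l) \<and> s / real N \<le> norm (F x - w l)"
      if l: "l \<in> {1..N}" and j: "j < J" and x: "x \<in> SE.shell x0 (a j) (b j)" for l j x
    proof -
      have xU: "x \<in> U" "x \<in> ?K" using x ab[OF j] by (auto simp: Sh_shell Sh_def)
      have "f (Fin x) \<in> f ` (Fin ` ?K)" using xU(2) by blast
      hence Fx: "Fin (F x) \<in> f ` (Fin ` ?K)" by (simp only: UF(2)[OF xU(1)])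
      have "Fin (w l) \<notin> f ` ?CI" using w[OF l] CIC by blast
      hence "\<eta>2 \<le> norm (F x - w l)" using \<eta>2(2)[OF Fx] zwR[OF l] by blast
      moreover have "\<eta>1 \<le> norm (F x - z l)" using \<eta>1(2)[OF Fx] z[OF l] zwR[OF l] by blast
      ultimately show ?thesis using N(2) \<eta>(2,3) by linarith
    qed
    fix l j r and q :: "real^'n" assume lj: "l \<in> {1..N}" "j < J" "a j < r" "r < b j"
    have r: "lo < r" "r < hi" using lj(3,4) ab[OF lj(2)] by auto
    obtain I Cr where I: "open I" "E0 \<subseteq> I" "I \<subseteq> Cr" "compact Cr" "Cr \<subseteq> I \<union> Fin ` {x. infnorm (x - x0) = r}" "Cr \<subseteq> ?C"
      using sepset[OF r] by blast
    \<comment> \<open>z is in the image of the neighbourhood I of E0 and w outside the image of the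
      larger ball, so the broken line has to cross the image of the cube surface.\<close>
    let ?G = "closed_segment (z l) q \<union> closed_segment q (w l)"
    have CrD: "Cr \<subseteq> D" using I(6) C by blast
    have "\<exists>y\<in>?G. Fin y \<in> f ` (Cr \<inter> Fin ` {x. infnorm (x - x0) = r})"
    proof (rule image_separates[OF cf inj I(1) _ I(4) CrD _ I(3)])
      show "I \<subseteq> D" using I(3) CrD by blast
      show "Cr \<subseteq> I \<union> Cr \<inter> Fin ` {x. infnorm (x - x0) = r}" using I(5) by blast
      show "connected ?G" by (rule connected_Un) auto
      show "Fin (z l) \<in> f ` I" using z[OF lj(1)] I(2) by blast
      show "Fin (w l) \<notin> f ` Cr" using w[OF lj(1)] I(6) by blast
    qed auto
    then obtain y v where yv: "y \<in> ?G" "v \<in> Cr" "v \<in> Fin ` {x. infnorm (x - x0) = r}" "Fin y = f v" by blast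
    then obtain x where x: "v = Fin x" "infnorm (x - x0) = r" by blast
    have yx: "y \<in> ?G" "Fin x \<in> Cr" "infnorm (x - x0) = r" "f (Fin x) = Fin y" using yv x by simp_all
    have xU: "x \<in> U" using yx CrD by (auto simp: UF(1))
    moreover have "F x = y" using UF(2)[OF xU] yx(4) by simp
    ultimately show "\<exists>x\<in>U. infnorm (x - x0) = r \<and> F x \<in> ?G" using yx by blast
  qed (use ab \<mu> disj CV CV0 in auto)
  show ?thesis
  proof (rule weight_sum_le[OF card \<Phi> L key, where Sh = Sh and K = "K_I F" and \<rho> = \<rho> and a = a and b = b])
    show m: "Sh j \<in> sets lebesgue" for j using SE.shell_sets[of x0 "a j" "b j"] by (simp add: Sh_shell)
    show "disjoint_family_on Sh {..<J}" unfolding disjoint_family_on_def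
    proof (intro ballI impI)
      fix i j assume "i \<in> {..<J}" "j \<in> {..<J}" "i \<noteq> j"
      hence "{a i<..<b i} \<inter> {a j<..<b j} = {}" using disj unfolding disjoint_family_on_def by blast
      thus "Sh i \<inter> Sh j = {}" by (auto simp: Sh_def)
    qed
    show "(\<lambda>x. K_I F x * indicator (Sh j) x) \<in> borel_measurable lebesgue" for j
    proof -
      have "(\<lambda>x. K_I F x * ennreal 1 * indicator (Sh j) x) \<in> borel_measurable lebesgue"
        by (rule SE.weighted_K_measurable[OF m]) (auto simp: Sh_def)
      thus ?thesis by simp
    qed
    show "negligible {x \<in> Sh j. K_I F x = \<infinity>}" for j by (rule negligible_subset[OF SE.fin]) (auto simp: Sh_def)
    show "emeasure lebesgue (Sh j) \<le> ennreal (4 ^ CARD('n) * \<rho> j ^ CARD('n))" if j: "j < J" for j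
    proof -
      have "emeasure lebesgue (Sh j) \<le> ennreal ((2 * (2 * \<rho> j)) ^ CARD('n))"
        using \<rho>(1)[of j] \<rho>(3)[OF j] by (intro emeasure_cube_le[of _ _ x0] m) (auto simp: Sh_def)
      moreover have "2 * (2 * \<rho> j) = 4 * \<rho> j" by simp
      ultimately show ?thesis by (simp only: power_mult_distrib)
    qed
    show "(1 + (norm x)\<^sup>2) ^ CARD('n) \<le> c3 * (2 ^ j * \<rho> j) ^ CARD('n)" if "j < J" "x \<in> Sh j" for j x
      using that by (intro wt) (auto simp: Sh_def)
    have "(\<integral>\<^sup>+x\<in>(\<Union>j<J. Sh j). \<Phi> (K_I F x) / ennreal ((1 + (norm x)\<^sup>2) ^ CARD('n)) \<partial>lebesgue)
       \<le> (\<integral>\<^sup>+x\<in>{x. Fin x \<in> D}. \<Phi> (K_I_cpt f x) / ennreal ((1 + (norm x)\<^sup>2) ^ CARD('n)) \<partial>lebesgue)"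
    proof (rule nn_integral_mono)
      fix x
      show "\<Phi> (K_I F x) / ennreal ((1 + (norm x)\<^sup>2) ^ CARD('n)) * indicator (\<Union>j<J. Sh j) x
        \<le> \<Phi> (K_I_cpt f x) / ennreal ((1 + (norm x)\<^sup>2) ^ CARD('n)) * indicator {x. Fin x \<in> D} x"
      proof (cases "x \<in> (\<Union>j<J. Sh j)")
        case True
        hence "Fin x \<in> D" "K_I_cpt f x = K_I F x" by (auto simp: Sh_def UF(1) K_I_cpt_def F_def)
        thus ?thesis using True by simp
      qed simp
    qed
    also have "... \<le> ennreal M" using f by (simp add: S_class_def)
    finally show "(\<integral>\<^sup>+x\<in>(\<Union>j<J. Sh j). \<Phi> (K_I F x) / ennreal ((1 + (norm x)\<^sup>2) ^ CARD('n)) \<partial>lebesgue) \<le> ennreal M" .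
    show "ennreal (\<Sum>j<J. \<mu> j * (b j - a j)) \<le> ennreal Cst * ((\<Sum>j<J. ennreal (\<mu> j ^ CARD('n)) * (\<integral>\<^sup>+x\<in>Sh j. K_I F x \<partial>lebesgue)) + 1)"
      if "\<And>j. 0 \<le> \<mu> j" for \<mu> by (rule ring[OF that])
  qed (use c3 M \<rho> Cst0 in auto)
qed

section \<open>Equicontinuity at finite points and at infinity\<close>

lemma nonsummable_exceeds:
  fixes L :: "nat => real"
  assumes "\<And>j. 0 \<le> L j" "\<not> summable L"
  shows "\<exists>J. B < (\<Sum>j<J. L j)"
proof (rule ccontr)
  assume "\<not> ?thesis"
  hence "summable L" using assms(1) by (intro summableI_nonneg_bounded[of L B]) (auto simp: not_less)
  thus False using assms(2) by blast
qed

lemma disjoint_intervals: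
  fixes a b :: "nat => real"
  assumes "(\<forall>i j. i < j \<longrightarrow> b j \<le> a i) \<or> (\<forall>i j. i < j \<longrightarrow> b i \<le> a j)"
  shows "disjoint_family_on (\<lambda>j. {a j<..<b j}) S"
  unfolding disjoint_family_on_def
proof (intro ballI impI)
  fix i j :: nat assume "i \<noteq> j"
  then consider "i < j" | "j < i" by linarith
  thus "{a i<..<b i} \<inter> {a j<..<b j} = {}"
  proof cases
    case 1
    hence "b j \<le> a i \<or> b i \<le> a j" using assms by blast
    thus ?thesis by auto
  next
    case 2
    hence "b i \<le> a j \<or> b j \<le> a i" using assms by blast
    thus ?thesis by auto
  qed
qed

lemma infnorm_topology:
  fixes c :: "'a::euclidean_space"
  shows "compact {x. infnorm (x - c) \<le> r}" "open {x. infnorm (x - c) < r}"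
    "convex {x. infnorm (x - c) \<le> r}" "convex {x. infnorm (x - c) < r}" "bounded {x. infnorm (x - c) < r}"
    "compact {x. lo \<le> infnorm (x - c) \<and> infnorm (x - c) \<le> r}"
proof -
  show k: "compact {x. infnorm (x - c) \<le> r}" "open {x. infnorm (x - c) < r}"
    "convex {x. infnorm (x - c) \<le> r}" "convex {x. infnorm (x - c) < r}" "bounded {x. infnorm (x - c) < r}"
    unfolding infnorm_le_iff_cbox infnorm_less_iff_box by (simp_all add: bounded_box open_box)
  have "continuous_on UNIV (\<lambda>x. infnorm (x - c))" by (intro continuous_intros)
  hence "closed {x. lo \<le> infnorm (x - c)}" by (intro closed_Collect_le continuous_on_const)
  from closed_Int_compact[OF this k(1)]
  show "compact {x. lo \<le> infnorm (x - c) \<and> infnorm (x - c) \<le> r}" by (simp add: Collect_conj_eq)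
qed

lemma norm_le_card_infnorm: "norm (x :: real^'n) \<le> real CARD('n) * infnorm x"
proof -
  have "sqrt (real CARD('n)) \<le> real CARD('n)" by (rule real_le_lsqrt) (auto simp: power2_eq_square)
  hence "sqrt (real CARD('n)) * infnorm x \<le> real CARD('n) * infnorm x" by (intro mult_right_mono infnorm_pos_le)
  thus ?thesis using norm_le_infnorm[of x] by simp
qed

lemma riesz_bound:
  assumes "CARD('n) \<ge> 2" "R > 0"
  shows "\<exists>C\<ge>0. \<forall>z :: real^'n. (\<integral>\<^sup>+y. ennreal (riesz R z y) \<partial>lborel) \<le> ennreal C"
proof -
  have "1 / (2 * real (CARD('n) - 1)) > 0" using assms(1) by simp
  from nn_integral_kernel_finite[OF this assms(2), where 'n = 'n] obtain C where C: "C \<ge> 0"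
    "\<And>z :: real^'n. (\<integral>\<^sup>+y. ennreal (norm (y - z) powr (- real CARD('n) + 1 / (2 * real (CARD('n) - 1)))) * indicator (cball z R) y \<partial>lborel) \<le> ennreal C"
    by blast
  have "ennreal (riesz R z y) = ennreal (norm (y - z) powr (- real CARD('n) + 1 / (2 * real (CARD('n) - 1)))) * indicator (cball z R) y" for y z :: "real^'n"
    by (cases "y \<in> cball z R") (auto simp: riesz_def)
  thus ?thesis using C by auto
qed

text \<open>The bound \<open>Bd\<close> is the same for all f, while the sums of weights are
  unbounded. Fixing J with a larger sum makes an oscillation of size \<epsilon> inside J shells
  impossible, and J determines the neighbourhood.\<close>

lemma S_class_equicontinuous:
  fixes D :: "(real^'n) cpt set"
  assumes card: "CARD('n) \<ge> 2" and D: "open D" and \<Delta>: "\<Delta> > 0" and M: "M > 0" and \<Phi>: "mono \<Phi>"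
    and L: "\<And>j. 0 \<le> L j \<and> L j \<le> 1" "\<not> summable L"
    and key: "\<And>j k. 0 \<le> k ==> ennreal (L j ^ (CARD('n) - 1)) * ennreal k \<le> 4 * (1 + ennreal (1 / 2 ^ (CARD('n) * j)) * \<Phi> (ennreal k))"
  shows "equicontinuous_family D (S_class D \<Phi> M \<Delta>)"
  unfolding equicontinuous_family_def
proof (intro ballI allI impI)
  fix p0 :: "(real^'n) cpt" and \<epsilon> :: real assume p0: "p0 \<in> D" and \<epsilon>: "\<epsilon> > 0"
  let ?n = "CARD('n)"
  define s where "s = min \<epsilon> (\<Delta> / 2) / 2"
  define R where "R = 1 / s + s"
  have s: "s > 0" using \<epsilon> \<Delta> by (simp add: s_def)
  have R: "R > 0" using s by (simp add: R_def add_pos_pos)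
  have "real ?n * (1 + R) * (2 * R + 1) > 0" using R by simp
  from riesz_bound[OF card this] obtain CV where CV: "CV \<ge> 0"
    "\<And>z :: real^'n. (\<integral>\<^sup>+y. ennreal (riesz (real ?n * (1 + R) * (2 * R + 1)) z y) \<partial>lborel) \<le> ennreal CV" by blast
  define Cst where "Cst = 2 * real ?n * distortion_const ?n R (2 * R + 1) * (12 / sqrt s + 2 * CV)"
  define Bd where "Bd c3 = 4 * Cst * (4 * c3 * M + 1) * (16 * Cst * 4 ^ ?n + 1)" for c3
  have Jex: "\<exists>J. Bd c3 < (\<Sum>j<J. L j)" for c3 using L by (intro nonsummable_exceeds) auto
  have n1: "real ?n \<ge> 1" using card by simp
  show "\<exists>U. open U \<and> p0 \<in> U \<and> (\<forall>f\<in>S_class D \<Phi> M \<Delta>. \<forall>x\<in>U \<inter> D. dist (f x) (f p0) < \<epsilon>)"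
  proof (cases p0)
    case (Fin x0)
    have "open (Fin -` D)" by (rule open_vimage[OF D]) (intro continuous_intros)
    moreover have "x0 \<in> Fin -` D" using p0 Fin by simp
    ultimately obtain R0 where R0: "R0 > 0" "cball x0 R0 \<subseteq> Fin -` D" using open_contains_cball by blast
    define \<beta> where "\<beta> = R0 / (2 * real ?n)"
    have \<beta>: "\<beta> > 0" using R0 n1 by (simp add: \<beta>_def)
    have near: "norm (x - x0) \<le> R0 / 2" if "infnorm (x - x0) \<le> \<beta>" for x
    proof -
      have "norm (x - x0) \<le> real ?n * infnorm (x - x0)" by (rule norm_le_card_infnorm)
      also have "... \<le> real ?n * \<beta>" using that by (intro mult_left_mono) auto
      finally show ?thesis by (simp add: \<beta>_def)
    qed
    have nearb: "Fin x \<in> Fin ` ball x0 R0" "Fin x \<in> Fin ` cball x0 R0" if "infnorm (x - x0) \<le> \<beta>" for x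
      using near[OF that] R0(1) by (auto simp: dist_norm norm_minus_commute)
    \<comment> \<open>Here 2^j \<rho>_j = \<beta> for all j, and the weight is bounded on the ball
      of radius R0 around x0.\<close>
    define c3 where "c3 = ((1 + (norm x0 + R0)\<^sup>2) / \<beta>) ^ ?n"
    have c3: "c3 \<ge> 0" using \<beta> by (simp add: c3_def)
    obtain J where J: "Bd c3 < (\<Sum>j<J. L j)" using Jex by blast
    \<comment> \<open>Half of the inner radius of the last shell, so that E0 and the closed ring are
      disjoint compact sets.\<close>
    define \<tau> where "\<tau> = \<beta> / 2 ^ Suc J"
    have pw: "\<beta> / 2 ^ j \<le> \<beta> / 2 ^ i" if "i \<le> j" for i j :: nat
      using \<beta> that by (intro divide_left_mono power_increasing) auto
    have \<tau>: "0 < \<tau>" "\<tau> < \<beta> / 2 ^ J" "\<beta> / 2 ^ J \<le> \<beta>" using \<beta> pw[of 0 J] by (auto simp: \<tau>_def field_simps)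
    have "dist (f x) (f p0) < \<epsilon>" if f: "f \<in> S_class D \<Phi> M \<Delta>" and x: "x \<in> Fin ` {x. infnorm (x - x0) < \<tau>} \<inter> D" for f x
    proof (rule ccontr)
      assume far: "\<not> dist (f x) (f p0) < \<epsilon>"
      let ?E = "Fin ` {x. infnorm (x - x0) \<le> \<tau>}"
      have ED: "Fin ` {x. infnorm (x - x0) \<le> r} \<subseteq> Fin ` cball x0 R0" if "r \<le> \<beta>" for r
        using nearb(2) that by (auto simp del: image_eqI)
      have CD: "Fin ` cball x0 R0 \<subseteq> D" using R0(2) by auto
      have cF: "continuous_on X (Fin :: real^'n => _)" for X by (intro continuous_intros)
      have "(\<Sum>j<J. L j) \<le> 4 * Cst * (4 * c3 * M + 1) * (16 * Cst * 4 ^ ?n + 1)"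
      proof (rule oscillation_weight_bound[OF card D f \<Delta> M, where \<alpha> = id and ?x1.0 = x0 and ?\<rho>1.0 = R0 and ?E0.0 = ?E and ?p0.0 = x and ?p1.0 = p0 and d = \<epsilon>
            and lo = "\<beta> / 2 ^ J" and hi = \<beta> and ?x0.0 = x0 and a = "\<lambda>j. \<beta> / 2 ^ Suc j" and b = "\<lambda>j. \<beta> / 2 ^ j" and \<rho> = "\<lambda>j. \<beta> / 2 ^ j" and s = s and R = R and CV = CV])
        show "id ` (Fin ` cball x0 R0) \<subseteq> D" using CD by simp
        show "compact ?E" by (rule compact_continuous_image[OF cF infnorm_topology(1)])
        show "connected ?E" by (rule connected_continuous_image[OF cF convex_connected[OF infnorm_topology(3)]])
        show "?E \<subseteq> D" using ED[of \<tau>] \<tau> CD by fastforce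
        show "x \<in> ?E" using x by auto
        show "p0 \<in> ?E" using Fin \<tau> by (auto simp: infnorm_0)
        show "Fin ` {x. \<beta> / 2 ^ J \<le> infnorm (x - x0) \<and> infnorm (x - x0) \<le> \<beta>} \<subseteq> id ` (Fin ` ball x0 R0)" using nearb(1) by auto
        show "compact {x. \<beta> / 2 ^ J \<le> infnorm (x - x0) \<and> infnorm (x - x0) \<le> \<beta>}" by (rule infnorm_topology(6))
        show "Fin ` {x. \<beta> / 2 ^ J \<le> infnorm (x - x0) \<and> infnorm (x - x0) \<le> \<beta>} \<inter> ?E = {}" using \<tau>(2) by auto
        show "\<beta> / 2 ^ J \<le> \<beta> / 2 ^ Suc j \<and> \<beta> / 2 ^ Suc j < \<beta> / 2 ^ j \<and> \<beta> / 2 ^ j \<le> \<beta>" if "j < J" for j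
          using pw[of "Suc j" J] pw[of 0 j] that \<beta> by (auto simp: field_simps)
        show "disjoint_family_on (\<lambda>j. {\<beta> / 2 ^ Suc j<..<\<beta> / 2 ^ j}) {..<J}"
          by (rule disjoint_intervals) (use pw Suc_leI in blast)
        show "\<exists>I Cr. open I \<and> ?E \<subseteq> I \<and> I \<subseteq> Cr \<and> compact Cr \<and> Cr \<subseteq> I \<union> Fin ` {x. infnorm (x - x0) = r} \<and> Cr \<subseteq> id ` (Fin ` cball x0 R0)"
          if r: "\<beta> / 2 ^ J < r" "r < \<beta>" for r
        proof (rule exI[of _ "Fin ` {x. infnorm (x - x0) < r}"], rule exI[of _ "Fin ` {x. infnorm (x - x0) \<le> r}"], intro conjI)
          show "open (Fin ` {x. infnorm (x - x0) < r})" by (rule open_Fin_image[OF infnorm_topology(2)])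
          show "compact (Fin ` {x. infnorm (x - x0) \<le> r})" by (rule compact_continuous_image[OF cF infnorm_topology(1)])
          show "Fin ` {x. infnorm (x - x0) \<le> r} \<subseteq> id ` (Fin ` cball x0 R0)" using ED[of r] r by simp
        qed (use r \<tau> in \<open>auto simp: image_iff\<close>)
        show "(1 + (norm y)\<^sup>2) ^ ?n \<le> c3 * (2 ^ j * (\<beta> / 2 ^ j)) ^ ?n" if "j < J" "infnorm (y - x0) < \<beta> / 2 ^ j" for j y
        proof -
          have "infnorm (y - x0) \<le> \<beta>" using that pw[of 0 j] by simp
          hence "norm y \<le> norm x0 + R0" using near[of y] norm_triangle_ineq[of x0 "y - x0"] R0(1) by simp
          hence "(1 + (norm y)\<^sup>2) ^ ?n \<le> (1 + (norm x0 + R0)\<^sup>2) ^ ?n" by (intro power_mono add_left_mono) auto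
          also have "... = c3 * (2 ^ j * (\<beta> / 2 ^ j)) ^ ?n" using \<beta> by (simp add: c3_def power_divide)
          finally show ?thesis .
        qed
      qed (use far \<epsilon> CV \<Phi> L key \<beta> c3 in \<open>auto simp: s_def R_def Cst_def field_simps\<close>)
      thus False using J by (simp add: Bd_def)
    qed
    moreover have "open (Fin ` {x. infnorm (x - x0) < \<tau>})" by (rule open_Fin_image[OF infnorm_topology(2)])
    moreover have "p0 \<in> Fin ` {x. infnorm (x - x0) < \<tau>}" using Fin \<tau>(1) by (auto simp: infnorm_0)
    ultimately show ?thesis by blast
  next
    case Infty
    obtain e0 where e0: "e0 > 0" "\<And>q. dist q p0 < e0 ==> q \<in> D" using D p0 unfolding open_dist by blast
    define R0 where "R0 = 1 / e0"
    have R0: "R0 > 0" using e0 by (simp add: R0_def)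
    have CD: "- Fin ` ball 0 R0 \<subseteq> D"
    proof
      fix q :: "(real^'n) cpt" assume q: "q \<in> - Fin ` ball 0 R0"
      show "q \<in> D"
      proof (cases q)
        case (Fin x)
        hence "norm x \<ge> R0" using q by auto
        moreover have "norm x < sqrt (1 + (norm x)\<^sup>2)" by (rule real_less_rsqrt) simp
        ultimately have "1 / e0 < sqrt (1 + (norm x)\<^sup>2)" by (simp add: R0_def)
        hence "1 < e0 * sqrt (1 + (norm x)\<^sup>2)" using e0(1) by (simp add: pos_divide_less_eq mult.commute)
        moreover have "sqrt (1 + (norm x)\<^sup>2) > 0" using one_plus_norm_pos[of x] by simp
        ultimately have "1 / sqrt (1 + (norm x)\<^sup>2) < e0" by (simp only: pos_divide_less_eq)
        thus ?thesis using Fin Infty by (intro e0(2)) (simp add: dist_cpt_def)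
      qed (use p0 Infty in simp)
    qed
    define \<beta> where "\<beta> = 2 * R0"
    have \<beta>: "\<beta> > 0" "R0 < \<beta>" using R0 by (auto simp: \<beta>_def)
    \<comment> \<open>On the j-th shell the norm is at most n \<beta> 2^(j+1), so the weight grows
      like 4^(nj). This is matched by (2^j \<rho>_j)^n, because now \<rho>_j = \<beta> 2^j.\<close>
    define c3 where "c3 = ((1 + 4 * (real ?n)\<^sup>2 * \<beta>\<^sup>2) / \<beta>) ^ ?n"
    have c3: "c3 \<ge> 0" using \<beta> by (simp add: c3_def)
    obtain J where J: "Bd c3 < (\<Sum>j<J. L j)" using Jex by blast
    define \<tau> where "\<tau> = \<beta> * 2 ^ Suc J"
    have pw: "\<beta> * 2 ^ i \<le> \<beta> * 2 ^ j" if "i \<le> j" for i j :: nat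
      using \<beta> that by (intro mult_left_mono power_increasing) auto
    have \<tau>: "\<beta> * 2 ^ J < \<tau>" "\<beta> \<le> \<beta> * 2 ^ J" using \<beta> pw[of 0 J] by (auto simp: \<tau>_def)
    have cF: "continuous_on X (Fin :: real^'n => _)" for X by (intro continuous_intros)
    have op: "open (- Fin ` {x :: real^'n. infnorm (x - 0) \<le> r})" for r
      by (intro open_Compl compact_imp_closed compact_continuous_image[OF cF infnorm_topology(1)])
    have cpt: "compact (- Fin ` {x :: real^'n. infnorm (x - 0) < r})" for r
    proof -
      have "closed (- Fin ` {x :: real^'n. infnorm (x - 0) < r})" by (intro closed_Compl open_Fin_image infnorm_topology(2))
      from compact_Int_closed[OF compact_cpt this] show ?thesis by simp
    qed
    have sub: "- Fin ` {x :: real^'n. infnorm (x - 0) < r} \<subseteq> - Fin ` cball 0 R0" if "\<beta> \<le> r" for r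
    proof -
      have "x \<in> {x. infnorm (x - 0) < r}" if "x \<in> cball 0 R0" for x :: "real^'n"
        using that \<open>\<beta> \<le> r\<close> \<beta>(2) infnorm_le_norm[of x] by simp
      thus ?thesis by blast
    qed
    have "dist (f x) (f p0) < \<epsilon>" if f: "f \<in> S_class D \<Phi> M \<Delta>" and x: "x \<in> (- Fin ` {x. infnorm (x - 0) \<le> \<tau>}) \<inter> D" for f x
    proof (rule ccontr)
      assume far: "\<not> dist (f x) (f p0) < \<epsilon>"
      let ?E = "- Fin ` {x :: real^'n. infnorm (x - 0) < \<tau>}"
      have cb: "- Fin ` cball 0 R0 \<subseteq> - Fin ` ball (0 :: real^'n) R0" by auto
      have "(\<Sum>j<J. L j) \<le> 4 * Cst * (4 * c3 * M + 1) * (16 * Cst * 4 ^ ?n + 1)"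
      proof (rule oscillation_weight_bound[OF card D f \<Delta> M, where \<alpha> = inversion and ?x1.0 = 0 and ?\<rho>1.0 = "1 / R0" and ?E0.0 = ?E and ?p0.0 = x and ?p1.0 = p0 and d = \<epsilon>
            and lo = \<beta> and hi = "\<beta> * 2 ^ J" and ?x0.0 = 0 and a = "\<lambda>j. \<beta> * 2 ^ j" and b = "\<lambda>j. \<beta> * 2 ^ Suc j" and \<rho> = "\<lambda>j. \<beta> * 2 ^ j" and s = s and R = R and CV = CV,
            unfolded inversion_ball_eq[OF R0]])
        show "- Fin ` ball 0 R0 \<subseteq> D" by (rule CD)
        show "compact ?E" by (rule cpt)
        show "connected ?E"
        \<comment> \<open>E0 is the exterior of a cube together with \<open>Infty\<close>, which is
          a limit of the connected finite exterior.\<close>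
        proof (rule connected_intermediate_closure)
          let ?S = "- {x :: real^'n. infnorm (x - 0) < \<tau>}"
          have "connected ?S" by (rule connected_complement_bounded_convex[OF infnorm_topology(5,4)]) (use card in simp)
          thus "connected (Fin ` ?S)" by (rule connected_continuous_image[OF cF])
          show "Fin ` ?S \<subseteq> ?E" by auto
          have "\<not> bounded ?S" by (rule cobounded_imp_unbounded) (simp only: double_compl infnorm_topology(5))
          hence "Infty \<in> closure (Fin ` ?S)" by (rule Infty_in_closure)
          moreover have "?E \<subseteq> insert Infty (Fin ` ?S)"
          proof
            fix q assume "q \<in> ?E"
            thus "q \<in> insert Infty (Fin ` ?S)" by (cases q) auto
          qed
          ultimately show "?E \<subseteq> closure (Fin ` ?S)" using closure_subset[of "Fin ` ?S"] by blast
        qed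
        show "?E \<subseteq> D" by (rule order_trans[OF order_trans[OF sub cb] CD]) (use \<tau> in linarith)
        show "x \<in> ?E" using x by auto
        show "p0 \<in> ?E" using Infty by auto
        show "Fin ` {x :: real^'n. \<beta> \<le> infnorm (x - 0) \<and> infnorm (x - 0) \<le> \<beta> * 2 ^ J} \<subseteq> - Fin ` cball 0 R0"
          using sub[of \<beta>] by auto
        show "compact {x :: real^'n. \<beta> \<le> infnorm (x - 0) \<and> infnorm (x - 0) \<le> \<beta> * 2 ^ J}" by (rule infnorm_topology(6))
        show "Fin ` {x :: real^'n. \<beta> \<le> infnorm (x - 0) \<and> infnorm (x - 0) \<le> \<beta> * 2 ^ J} \<inter> ?E = {}" using \<tau>(1) by auto
        show "\<beta> \<le> \<beta> * 2 ^ j \<and> \<beta> * 2 ^ j < \<beta> * 2 ^ Suc j \<and> \<beta> * 2 ^ Suc j \<le> \<beta> * 2 ^ J" if "j < J" for j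
          using pw[of "Suc j" J] pw[of 0 j] that \<beta> by auto
        show "disjoint_family_on (\<lambda>j. {\<beta> * 2 ^ j<..<\<beta> * 2 ^ Suc j}) {..<J}"
          by (rule disjoint_intervals) (use pw Suc_leI in blast)
        show "\<exists>I Cr. open I \<and> ?E \<subseteq> I \<and> I \<subseteq> Cr \<and> compact Cr \<and> Cr \<subseteq> I \<union> Fin ` {x :: real^'n. infnorm (x - 0) = r} \<and> Cr \<subseteq> - Fin ` ball 0 R0"
          if r: "\<beta> < r" "r < \<beta> * 2 ^ J" for r
        proof (rule exI[of _ "- Fin ` {x :: real^'n. infnorm (x - 0) \<le> r}"], rule exI[of _ "- Fin ` {x :: real^'n. infnorm (x - 0) < r}"], intro conjI)
          show "- Fin ` {x :: real^'n. infnorm (x - 0) < r} \<subseteq> - Fin ` ball 0 R0" by (rule order_trans[OF sub cb]) (use r in linarith)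
          show "- Fin ` {x :: real^'n. infnorm (x - 0) < r} \<subseteq> - Fin ` {x. infnorm (x - 0) \<le> r} \<union> Fin ` {x. infnorm (x - 0) = r}"
          proof
            fix q assume q: "q \<in> - Fin ` {x :: real^'n. infnorm (x - 0) < r}"
            show "q \<in> - Fin ` {x. infnorm (x - 0) \<le> r} \<union> Fin ` {x. infnorm (x - 0) = r}"
            proof (cases q)
              case (Fin y)
              hence "\<not> infnorm y < r" using q by auto
              thus ?thesis using Fin by (cases "infnorm y = r") auto
            qed auto
          qed
        qed (use r \<tau> op cpt in auto)
        show "(1 + (norm y)\<^sup>2) ^ ?n \<le> c3 * (2 ^ j * (\<beta> * 2 ^ j)) ^ ?n" if "j < J" "infnorm (y - 0) < \<beta> * 2 ^ Suc j" for j and y :: "real^'n"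
        proof -
          have "norm y \<le> real ?n * infnorm y" by (rule norm_le_card_infnorm)
          also have "... \<le> real ?n * (\<beta> * 2 ^ Suc j)" using that by (intro mult_left_mono) auto
          finally have "(norm y)\<^sup>2 \<le> (real ?n * (\<beta> * 2 ^ Suc j))\<^sup>2" by (intro power_mono) auto
          also have "... = 4 * (real ?n)\<^sup>2 * \<beta>\<^sup>2 * (2 ^ j * 2 ^ j)" by (simp add: power2_eq_square)
          finally have "1 + (norm y)\<^sup>2 \<le> 1 * (2 ^ j * 2 ^ j) + 4 * (real ?n)\<^sup>2 * \<beta>\<^sup>2 * (2 ^ j * 2 ^ j)"
            using mult_mono[of 1 "2 ^ j" 1 "2 ^ j :: real"] by simp
          hence "1 + (norm y)\<^sup>2 \<le> (1 + 4 * (real ?n)\<^sup>2 * \<beta>\<^sup>2) * (2 ^ j * 2 ^ j)" by (simp only: distrib_right)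
          hence "(1 + (norm y)\<^sup>2) ^ ?n \<le> ((1 + 4 * (real ?n)\<^sup>2 * \<beta>\<^sup>2) * (2 ^ j * 2 ^ j)) ^ ?n" by (intro power_mono) auto
          also have "... = c3 * (2 ^ j * (\<beta> * 2 ^ j)) ^ ?n"
          proof -
            have "(1 + 4 * (real ?n)\<^sup>2 * \<beta>\<^sup>2) * (2 ^ j * 2 ^ j) = (1 + 4 * (real ?n)\<^sup>2 * \<beta>\<^sup>2) / \<beta> * (2 ^ j * (\<beta> * 2 ^ j))"
              using \<beta>(1) by simp
            thus ?thesis by (simp only: c3_def power_mult_distrib)
          qed
          finally show ?thesis .
        qed
      qed (use far \<epsilon> CV \<Phi> L key \<beta> c3 in \<open>auto simp: s_def R_def Cst_def field_simps\<close>)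
      thus False using J by (simp add: Bd_def)
    qed
    moreover have "p0 \<in> - Fin ` {x. infnorm (x - 0) \<le> \<tau>}" using Infty by auto
    ultimately show ?thesis using op[of \<tau>] by blast
  qed
qed

theorem corollary4p2:
  fixes D :: "(real^'n) cpt set" and \<Phi> :: "ennreal \<Rightarrow> ennreal" and p :: real
  assumes "CARD('n) \<ge> 2"
    and "is_domain D"
    and "mono \<Phi>"
    and "convex_ennreal \<Phi>"
    and "0 < p" and "p \<le> real CARD('n) - 1"
    and "cond_i \<Phi> p \<or> cond_ii \<Phi> p \<or> cond_iii \<Phi> p \<or> cond_iv \<Phi> p \<or> cond_v \<Phi> p \<or> cond_vi \<Phi> p"
  shows "\<forall>M>0. \<forall>\<Delta>\<in>{0<..<1}.
           equicontinuous_family D (S_class D \<Phi> M \<Delta>) \<and> normal_family D (S_class D \<Phi> M \<Delta>)"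
proof -
  obtain L :: "nat => real" where L: "\<forall>j. 0 \<le> L j \<and> L j \<le> 1" "\<not> summable L"
    "\<forall>j K. K \<ge> 0 \<longrightarrow> ennreal (L j ^ (CARD('n) - 1)) * ennreal K \<le> 4 * (1 + ennreal (1 / 2 ^ (CARD('n) * j)) * \<Phi> (ennreal K))"
    using divergent_weights[OF assms(3-6,1,7)] by blast
  have D: "open D" using assms(2) by (simp add: is_domain_def)
  have "equicontinuous_family D (S_class D \<Phi> M \<Delta>)" if "M > 0" "\<Delta> > 0" for M \<Delta>
    using L by (intro S_class_equicontinuous[OF assms(1) D that(2,1) assms(3)]) auto
  moreover have "normal_family D (S_class D \<Phi> M \<Delta>)" if "M > 0" "\<Delta> > 0" for M \<Delta>
    by (rule equicontinuous_imp_normal[OF D calculation[OF that]]) (use S_class_continuous in blast)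
  ultimately show ?thesis by auto
qed

end
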